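(* Let $\mu$ be a probability measure on $\mathbb{R}$ of the form $d\mu(t)=e^{-V(t)}dt$ with $V:\mathbb{R}\to\mathbb{R}$ of class $C^2$. Assume that there exists $\alpha\in[0,+\infty)$ such that $V''(t)\ge-\alpha$ for all $t\in\mathbb{R}$ and $\sup_{m\in\mathbb{R}}\mathrm{c_p}(\mu^{2|m})<\frac1\alpha$. Then $$\sup_{n\ge2,\,m\in\mathbb{R}}\mathrm{c_p}(\mu^{n|m})\le 2\sup_{m\in\mathbb{R}}\Big(\mathrm{c_p}(\mu^{2|m})^{-1}-\alpha\Big)^{-1}.$$
   Context: For $n\ge2$ and $m\in\mathbb{R}$, let $H^n_m=\{x\in\mathbb{R}^n:\sum_i x_i=nm\}$, an affine hyperplane with the Euclidean structure inherited from $\mathbb{R}^n$. $\mu^{n|m}$ is the product measure $\mu^{\otimes n}$ conditioned on $\sum_{i=1}^n x_i=nm$, i.e. the probability measure on $H^n_m$ with density with respect to Lebesgue measure on $H^n_m$ proportional to $\exp(-\sum_{i=1}^nV(x_i))$. The Poincar\'e constant $\mathrm{c_p}(\nu)\in(0,+\infty]$ of a Borel probability measure $\nu$ on a Euclidean space is the best constant for which $\int(g-\int g\,d\nu)^2\,d\nu\le\mathrm{c_p}(\nu)\int|\nabla g|^2\,d\nu$ for every locally Lipschitz $g\in L^2(\nu)$. Convention: $1/0=+\infty$. *)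

theory Defs
  imports "HOL-Analysis.Analysis" "HOL-Probability.Probability"
begin

text \<open>
  Euclidean spaces are affine subspaces \<open>S\<close> of an ambient \<^class>\<open>euclidean_space\<close>, with the
  inherited structure. A measure on such a space has \<open>space \<nu> = S\<close> and the Borel sets of \<open>S\<close>.
\<close>

definition direction :: "'a::euclidean_space set \<Rightarrow> 'a set" where
  "direction S = {x - y | x y. x \<in> S \<and> y \<in> S}"

definition is_onb :: "'a::euclidean_space set \<Rightarrow> 'a set \<Rightarrow> bool" where
  "is_onb T B \<longleftrightarrow> pairwise orthogonal B \<and> (\<forall>b\<in>B. norm b = 1) \<and> span B = T"

text \<open>
  Lebesgue measure on a nonempty affine subspace, built from orthonormal coordinates exactly as
  \<^const>\<open>lborel\<close> is built from the standard basis. By translation and rotation invariance of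
  Lebesgue measure the choices of origin and basis are immaterial.
\<close>

definition affine_lborel :: "'a::euclidean_space set \<Rightarrow> 'a measure" where
  "affine_lborel S =
     (let p = (SOME p. p \<in> S); B = (SOME B. is_onb (direction S) B)
      in distr (\<Pi>\<^sub>M b\<in>B. lborel) (restrict_space borel S) (\<lambda>c. p + (\<Sum>b\<in>B. c b *\<^sub>R b)))"

definition locally_lipschitz_on :: "'a::metric_space set \<Rightarrow> ('a \<Rightarrow> 'b::metric_space) \<Rightarrow> bool" where
  "locally_lipschitz_on S g \<longleftrightarrow> (\<forall>x\<in>S. \<exists>e>0. \<exists>L. L-lipschitz_on (ball x e \<inter> S) g)"

definition has_gradient_at :: "'a::euclidean_space set \<Rightarrow> ('a \<Rightarrow> real) \<Rightarrow> 'a \<Rightarrow> 'a \<Rightarrow> bool" where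
  "has_gradient_at S g x v \<longleftrightarrow>
     v \<in> direction S \<and> (g has_derivative (\<lambda>h. v \<bullet> h)) (at x within S)"

text \<open>
  A locally Lipschitz function on \<open>S\<close> is differentiable almost everywhere for Lebesgue measure on
  \<open>S\<close> (Rademacher), so the value given at the other points does not affect integrals with respect
  to absolutely continuous measures.
\<close>

definition gradient_on :: "'a::euclidean_space set \<Rightarrow> ('a \<Rightarrow> real) \<Rightarrow> 'a \<Rightarrow> 'a" where
  "gradient_on S g x =
     (if \<exists>v. has_gradient_at S g x v then THE v. has_gradient_at S g x v else 0)"

text \<open>
  The best constant in the Poincare inequality, in \<open>[0,\<infinity>]\<close>. The infimum of the empty set is
  \<open>\<infinity>\<close>; in particular the value is \<open>\<infinity>\<close> when \<open>\<nu>\<close> is not a probability measure.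
\<close>

definition poincare_const :: "'a::euclidean_space measure \<Rightarrow> ennreal" where
  "poincare_const \<nu> = Inf {C. prob_space \<nu> \<and>
     (\<forall>g :: 'a \<Rightarrow> real. locally_lipschitz_on (space \<nu>) g \<longrightarrow> integrable \<nu> (\<lambda>x. (g x)\<^sup>2) \<longrightarrow>
        (\<integral>\<^sup>+x. ennreal ((g x - (\<integral>y. g y \<partial>\<nu>))\<^sup>2) \<partial>\<nu>)
          \<le> C * (\<integral>\<^sup>+x. ennreal ((norm (gradient_on (space \<nu>) g x))\<^sup>2) \<partial>\<nu>))}"

definition mean_hyperplane :: "real \<Rightarrow> (real ^ 'n) set" where
  "mean_hyperplane m = {x. (\<Sum>i\<in>UNIV. x $ i) = real CARD('n) * m}"

text \<open>
  The measure \<open>\<mu>\<close> with density \<open>exp (- V)\<close>, raised to the power \<open>'n\<close> and conditioned on the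
  coordinates having mean \<open>m\<close>. If the normalising constant is infinite, this is the null measure,
  hence not a probability measure.
\<close>

definition cond_measure :: "(real \<Rightarrow> real) \<Rightarrow> real \<Rightarrow> (real ^ 'n) measure" where
  "cond_measure V m =
     (let L = affine_lborel (mean_hyperplane m);
          w = (\<lambda>x. ennreal (exp (- (\<Sum>i\<in>UNIV. V (x $ i)))))
      in density L (\<lambda>x. w x / (\<integral>\<^sup>+y. w y \<partial>L)))"

text \<open>Well-definedness of the choices made above.\<close>

lemma subspace_direction:
  assumes "affine S" "S \<noteq> {}"
  shows "subspace (direction S)"
proof -
  obtain a where a: "a \<in> S" using assms by blast
  have "direction S = {x - a | x. x \<in> S}"
  proof (intro equalityI subsetI)
    fix z assume "z \<in> direction S"
    then obtain x y where z: "z = x - y" "x \<in> S" "y \<in> S" by (auto simp: direction_def)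
    have "a + 1 *\<^sub>R (x - y) \<in> S"
      using mem_affine_3_minus[OF assms(1) a z(2,3)] by blast
    then show "z \<in> {x - a | x. x \<in> S}" using z by force
  qed (use a in \<open>auto simp: direction_def\<close>)
  then show ?thesis
    using affine_diffs_subspace_subtract[OF assms(1) a] by (simp add: setcompr_eq_image)
qed

lemma is_onb_some:
  assumes "affine S" "S \<noteq> {}"
  shows "is_onb (direction S) (SOME B. is_onb (direction S) B)"
  by (rule someI_ex)
     (metis is_onb_def orthonormal_basis_subspace[OF subspace_direction[OF assms]])

lemma has_gradient_at_unique:
  assumes S: "affine S" "x \<in> S" and v: "has_gradient_at S g x v" "has_gradient_at S g x w"
  shows "v = w"
proof -
  have T: "subspace (direction S)" using subspace_direction S by blast
  have vw: "v - w \<in> direction S"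
    using v subspace_diff[OF T] by (auto simp: has_gradient_at_def)
  then obtain y z where yz: "v - w = y - z" "y \<in> S" "z \<in> S" by (auto simp: direction_def)
  have line: "x + t *\<^sub>R (v - w) \<in> S" for t
    using mem_affine_3_minus[OF S yz(2,3)] yz(1) by simp
  have D: "((\<lambda>t. g (x + t *\<^sub>R (v - w))) has_derivative (\<lambda>t. u \<bullet> (t *\<^sub>R (v - w)))) (at 0)"
    if "has_gradient_at S g x u" for u
  proof -
    have 1: "((\<lambda>t. x + t *\<^sub>R (v - w)) has_derivative (\<lambda>t. t *\<^sub>R (v - w))) (at 0)"
      by (auto intro!: derivative_eq_intros)
    have "(g has_derivative (\<lambda>h. u \<bullet> h))
        (at (x + 0 *\<^sub>R (v - w)) within range (\<lambda>t. x + t *\<^sub>R (v - w)))"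
      using that line by (auto simp: has_gradient_at_def intro: has_derivative_subset)
    from has_derivative_in_compose[OF 1 this] show ?thesis .
  qed
  have "(\<lambda>t. v \<bullet> (t *\<^sub>R (v - w))) = (\<lambda>t. w \<bullet> (t *\<^sub>R (v - w)))"
    using has_derivative_unique[OF D[OF v(1)] D[OF v(2)]] .
  from fun_cong[OF this, of 1] have "(v - w) \<bullet> (v - w) = 0" by (simp add: inner_diff_left)
  then show ?thesis by simp
qed

lemma affine_mean_hyperplane: "affine (mean_hyperplane m)"
  by (auto simp: mean_hyperplane_def affine_def sum.distrib sum_distrib_left[symmetric]
      distrib_right[symmetric])

lemma mean_hyperplane_nonempty: "mean_hyperplane m \<noteq> {}"
proof -
  have "(\<chi> i. m) \<in> mean_hyperplane m" by (simp add: mean_hyperplane_def)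
  then show ?thesis by blast
qed

lemma space_cond_measure: "space (cond_measure V m) = mean_hyperplane m"
  by (simp add: cond_measure_def affine_lborel_def Let_def space_restrict_space)

lemma sets_cond_measure: "sets (cond_measure V m) = sets (restrict_space borel (mean_hyperplane m))"
  by (simp add: cond_measure_def affine_lborel_def Let_def)

end

theory Submission
 imports Defs
begin

text \<open>
  Let \<open>\<Sigma>\<close> be the supremum on the right-hand side without its factor 2. If \<open>\<Sigma> < 1 / \<kappa>\<close>, then every pair
  constant is less than \<open>1 / (\<alpha> + \<kappa>)\<close>; it suffices to bound every constant in dimension \<open>n\<close> by
  \<open>2 / \<kappa>\<close> for each such \<open>\<kappa>\<close>.

  The hyperplane is replaced by the whole space: the conditioned measure is the projection of the
  normalised density \<open>exp (- U)\<close>, where \<open>U\<close> is the sum of the \<open>V (x\<^sub>i)\<close> evaluated at the projected point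
  plus \<open>\<kappa> / 2\<close> times the squared coordinate orthogonal to the hyperplane (\<open>cond_measure_eq_distr\<close>).
  This \<open>U\<close> is invariant under permutations of the coordinates, and its Hessian is at least \<open>\<kappa>\<close> in the
  direction \<open>(1, \<dots>, 1)\<close> and at least \<open>- \<alpha>\<close> orthogonally to it. On a line parallel to \<open>e\<^sub>i - e\<^sub>j\<close> the
  weight is, up to a factor, that of a conditioned pair. A function that is odd under exchanging \<open>x\<^sub>i\<close>
  and \<open>x\<^sub>j\<close> has mean zero on each such line, so the pair inequality bounds its square by the square
  of its derivative along the line (\<open>wt_line_inequality\<close>). This fact is used three times.

  First, it makes \<open>exp (- U)\<close> integrable: applied to truncated differences of coordinates it shows that
  the mass of a tube around the diagonal is controlled by a tube of fixed radius (\<open>wt_integrable\<close>).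

  Second, let \<open>L u = \<Delta> u - \<nabla>U \<cdot> \<nabla>u\<close>. By Bochner's formula the weighted integral of \<open>(L u)\<^sup>2\<close> is that of
  the squared Hessian of \<open>u\<close> plus that of the Hessian of \<open>U\<close> applied to the gradient of \<open>u\<close>. If \<open>u\<close> is
  symmetric, \<open>\<partial>\<^sub>i u - \<partial>\<^sub>j u\<close> is odd; summing the line inequality over all pairs, the squared Hessian
  dominates \<open>\<alpha> + \<kappa>\<close> times the part of the gradient orthogonal to the diagonal. This absorbs \<open>- \<alpha>\<close> and
  leaves \<open>\<kappa>\<close> in every direction (\<open>symmetric_gap\<close>). As functions \<open>L u\<close> are dense among the functions of
  mean zero (\<open>gen_range_dense\<close>), symmetric functions satisfy the inequality with constant \<open>1 / \<kappa>\<close>.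

  Third, subtracting from \<open>f\<close> its average over permutations leaves a function \<open>g\<close> whose square is
  controlled by the odd functions \<open>g - g \<circ> \<tau>\<^sub>i\<^sub>j\<close>, by the spectral gap of the random transposition walk.
  This costs a constant \<open>2 / (\<alpha> + \<kappa>)\<close> (\<open>antisymmetric_gap\<close>). Both parts are orthogonal in the variance
  and in the energy, which gives \<open>2 / \<kappa>\<close> for smooth \<open>f\<close> (\<open>poincare_C1\<close>). Mollification and Rademacher's
  theorem extend this to locally Lipschitz functions.
\<close>

section \<open>Calculus on Euclidean spaces\<close>

abbreviation nn_lborel :: "('a::euclidean_space => ennreal) => ennreal" (binder "NNINT " 10)
 where "nn_lborel f \<equiv> integral\<^sup>N lborel f"

definition pd :: "'a::euclidean_space => ('a => real) => 'a => real" where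
 "pd v f x = frechet_derivative f (at x) v"

definition grad :: "('a::euclidean_space => real) => 'a => 'a" where
 "grad f x = (\<Sum>b\<in>Basis. pd b f x *\<^sub>R b)"

text \<open>Continuity of all iterated directional derivatives up to order \<open>k\<close>; each derivative is again a
real function, so that the notion can be defined by recursion on \<open>k\<close>.\<close>

primrec Ck :: "nat => ('a::euclidean_space => real) => bool" where
 "Ck 0 f \<longleftrightarrow> continuous_on UNIV f"
| "Ck (Suc k) f \<longleftrightarrow> (\<forall>x. f differentiable at x) \<and> (\<forall>v. Ck k (pd v f))"

text \<open>Compact support, stated through a radius so that no closure has to be computed.\<close>

definition bsupp :: "('a::real_normed_vector => 'b::zero) => bool" where
 "bsupp f \<longleftrightarrow> (\<exists>M. \<forall>x. M < norm x \<longrightarrow> f x = 0)"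

lemma pdI: "(f has_derivative D) (at x) ==> pd v f x = D v"
 unfolding pd_def using frechet_derivative_at by metis

lemma has_derivative_pd: "f differentiable at x ==> (f has_derivative (\<lambda>v. pd v f x)) (at x)"
 unfolding pd_def by (simp add: frechet_derivative_works[symmetric])

lemma linear_pd: "f differentiable at x ==> linear (\<lambda>v. pd v f x)"
 unfolding pd_def by (rule linear_frechet_derivative)

lemma pd_scaleR: "f differentiable at x ==> pd (c *\<^sub>R v) f x = c * pd v f x"
 using linear_cmul[OF linear_pd] by fastforce

lemma pd_expand:
 assumes "f differentiable at x"
 shows "pd v f x = (\<Sum>b\<in>Basis. (v \<bullet> b) * pd b f x)"
proof -
 have "pd (\<Sum>b\<in>Basis. (v \<bullet> b) *\<^sub>R b) f x = (\<Sum>b\<in>Basis. (v \<bullet> b) * pd b f x)"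
  using linear_sum[OF linear_pd[OF assms], of "\<lambda>b. (v \<bullet> b) *\<^sub>R b" Basis] linear_cmul[OF linear_pd[OF assms]]
  by simp
 then show ?thesis by (simp add: euclidean_representation)
qed

lemma inner_grad: "f differentiable at x ==> grad f x \<bullet> v = pd v f x"
 by (subst pd_expand) (auto simp: grad_def inner_sum_left inner_commute[of v] intro!: sum.cong)

lemma has_derivative_grad: "f differentiable at x ==> (f has_derivative (\<lambda>v. grad f x \<bullet> v)) (at x)"
 using has_derivative_pd inner_grad by (metis (no_types, lifting) ext)

lemma norm_grad_sq: "(norm (grad f x))^2 = (\<Sum>b\<in>Basis. (pd b f x)^2)"
 unfolding grad_def by (subst norm_sum_Pythagorean)
  (auto simp: pairwise_def orthogonal_def inner_Basis power_mult_distrib)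

lemma pd_add: "f differentiable at x ==> g differentiable at x ==>
  pd v (\<lambda>x. f x + g x) x = pd v f x + pd v g x"
 by (rule pdI) (auto intro!: derivative_eq_intros has_derivative_pd)

lemma pd_diff: "f differentiable at x ==> g differentiable at x ==>
  pd v (\<lambda>x. f x - g x) x = pd v f x - pd v g x"
 by (rule pdI) (auto intro!: derivative_eq_intros has_derivative_pd)

lemma pd_cmult: "f differentiable at x ==> pd v (\<lambda>x. c * f x) x = c * pd v f x"
 by (rule pdI) (auto intro!: derivative_eq_intros has_derivative_pd)

lemma pd_mult: "f differentiable at x ==> g differentiable at x ==>
  pd v (\<lambda>x. f x * g x) x = pd v f x * g x + f x * pd v g x"
 by (subst pdI[of _ "\<lambda>v. f x * pd v g x + pd v f x * g x"])
   (auto intro!: derivative_eq_intros has_derivative_pd)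

lemma pd_sum: "(\<And>i. i \<in> I ==> f i differentiable at x) ==>
  pd v (\<lambda>x. \<Sum>i\<in>I. f i x) x = (\<Sum>i\<in>I. pd v (f i) x)"
 by (rule pdI) (auto intro!: derivative_eq_intros has_derivative_pd)

lemma pd_const [simp]: "pd v (\<lambda>x. c) x = 0"
 unfolding pd_def by simp

lemma Ck_SucD: "Ck (Suc k) f ==> Ck k f"
proof (induction k arbitrary: f)
 case 0
 then show ?case
  by (auto intro!: continuous_at_imp_continuous_on differentiable_imp_continuous_within)
next
 case (Suc k)
 then show ?case by (metis Ck.simps(2))
qed

lemma Ck_mono: "Ck k f ==> j \<le> k ==> Ck j f"
proof (induction k)
 case (Suc k)
 then show ?case using Ck_SucD le_Suc_eq by blast
qed simp

lemma Ck_cont: "Ck k f ==> continuous_on UNIV f"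
 using Ck_mono[of k f 0] by simp

lemma Ck_diff: "Ck k f ==> 0 < k ==> f differentiable at x"
 by (cases k) auto

lemma Ck_pd: "Ck (Suc k) f ==> Ck k (pd v f)" by simp

lemma Ck_const [simp]: "Ck k (\<lambda>x. c)"
proof (induction k arbitrary: c)
 case (Suc k)
 have "pd v (\<lambda>x::'a. c) = (\<lambda>x. 0)" for v by auto
 then show ?case using Suc by simp
qed simp

lemma Ck_add: "Ck k f ==> Ck k g ==> Ck k (\<lambda>x. f x + g x)"
proof (induction k arbitrary: f g)
 case 0 then show ?case by (auto intro: continuous_intros)
next
 case (Suc k)
 have "pd v (\<lambda>x. f x + g x) = (\<lambda>x. pd v f x + pd v g x)" for v
  using Suc.prems by (auto simp: pd_add)
 then show ?case using Suc by auto
qed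

lemma Ck_mult: "Ck k f ==> Ck k g ==> Ck k (\<lambda>x. f x * g x)"
proof (induction k arbitrary: f g)
 case 0 then show ?case by (auto intro: continuous_intros)
next
 case (Suc k)
 have "pd v (\<lambda>x. f x * g x) = (\<lambda>x. pd v f x * g x + f x * pd v g x)" for v
  using Suc.prems by (auto simp: pd_mult)
 moreover have "Ck k f" "Ck k g" using Suc.prems Ck_SucD by blast+
 ultimately show ?case using Suc by (auto intro!: Ck_add)
qed

lemma Ck_cmult: "Ck k f ==> Ck k (\<lambda>x. c * f x)"
 by (intro Ck_mult Ck_const)

lemma Ck_minus: "Ck k f ==> Ck k g ==> Ck k (\<lambda>x. f x - g x)"
 using Ck_add[of k f "\<lambda>x. (-1) * g x"] Ck_cmult[of k g "-1"] by simp

lemma Ck_sum: "(\<And>i. i \<in> I ==> Ck k (f i)) ==> Ck k (\<lambda>x. \<Sum>i\<in>I. f i x)"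
 by (induction I rule: infinite_finite_induct) (auto intro: Ck_add)

lemma Ck_linear: "bounded_linear f ==> Ck k f"
proof (cases k)
 case (Suc j)
 assume b: "bounded_linear f"
 have "pd v f = (\<lambda>x. f v)" for v
  by (rule ext, rule pdI, rule bounded_linear_imp_has_derivative[OF b])
 moreover have "f differentiable at x" for x
  using bounded_linear_imp_differentiable[OF b] by blast
 ultimately show ?thesis using Suc by simp
qed (simp add: linear_continuous_on)

lemma pd_compose_linear:
 assumes "bounded_linear T" "f differentiable at (a + T x)"
 shows "pd v (\<lambda>x. f (a + T x)) x = pd (T v) f (a + T x)"
  and "(\<lambda>x. f (a + T x)) differentiable at x"
proof -
 have T: "((\<lambda>x. a + T x) has_derivative T) (at x)"
  using bounded_linear_imp_has_derivative[OF assms(1)] by (auto intro!: derivative_eq_intros)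
 have "((\<lambda>x. f (a + T x)) has_derivative (\<lambda>v. pd (T v) f (a + T x))) (at x)"
  using has_derivative_compose[OF T has_derivative_pd[OF assms(2)]] .
 then show "pd v (\<lambda>x. f (a + T x)) x = pd (T v) f (a + T x)"
  and "(\<lambda>x. f (a + T x)) differentiable at x"
  by (auto intro: pdI simp: differentiable_def)
qed

lemma Ck_compose_linear:
 assumes "bounded_linear T" shows "Ck k f ==> Ck k (\<lambda>x. f (a + T x))"
proof (induction k arbitrary: f)
 case 0
 have "continuous_on UNIV (\<lambda>x. a + T x)"
  by (intro continuous_on_add continuous_on_const linear_continuous_on[OF assms])
 then show ?case using continuous_on_compose2[of UNIV f UNIV "\<lambda>x. a + T x"] 0 by simp
next
 case (Suc k)
 have "pd v (\<lambda>x. f (a + T x)) = (\<lambda>x. pd (T v) f (a + T x))" for v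
  using Suc.prems pd_compose_linear[OF assms] by auto
 then show ?case using Suc pd_compose_linear(2)[OF assms] by auto
qed

lemma pd_real_compose:
 fixes g :: "real => real"
 assumes "f differentiable at x" "(g has_real_derivative d) (at (f x))"
 shows "pd v (\<lambda>x. g (f x)) x = d * pd v f x" "(\<lambda>x. g (f x)) differentiable at x"
proof -
 have "((\<lambda>x. g (f x)) has_derivative (\<lambda>v. d * pd v f x)) (at x)"
  using has_derivative_compose[OF has_derivative_pd[OF assms(1)] assms(2)[unfolded has_field_derivative_def]]
  by (simp add: mult.commute)
 then show "pd v (\<lambda>x. g (f x)) x = d * pd v f x" "(\<lambda>x. g (f x)) differentiable at x"
  by (auto intro: pdI simp: differentiable_def)
qed

lemma Ck_exp: "Ck k f ==> Ck k (\<lambda>x. exp (f x))"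
proof (induction k arbitrary: f)
 case 0 then show ?case by (auto intro: continuous_intros)
next
 case (Suc k)
 have "pd v (\<lambda>x. exp (f x)) = (\<lambda>x. exp (f x) * pd v f x)" for v
  using Suc.prems pd_real_compose(1)[of f _ exp] by (auto intro!: DERIV_exp)
 moreover have "(\<lambda>x. exp (f x)) differentiable at x" for x
  using Suc.prems pd_real_compose(2)[of f x exp] by (auto intro!: DERIV_exp)
 moreover have "Ck k (\<lambda>x. exp (f x))" using Suc Ck_SucD by blast
 ultimately show ?case using Suc.prems by (auto intro!: Ck_mult)
qed

lemma bsuppE: assumes "bsupp f" obtains M where "0 < M" "\<And>x. M \<le> norm x ==> f x = 0"
proof -
 obtain M where M: "\<forall>x. M < norm x \<longrightarrow> f x = 0" using assms by (auto simp: bsupp_def)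
 show ?thesis by (rule that[of "\<bar>M\<bar> + 1"]) (use M in \<open>auto simp: abs_real_def split: if_splits\<close>)
qed

lemma bsuppI: "(\<And>x. M \<le> norm x ==> f x = 0) ==> bsupp f"
 unfolding bsupp_def by (meson less_imp_le)

lemma pd_zero_outside:
 assumes "\<And>x. M < norm x ==> f x = 0" "M < norm x"
 shows "pd v f x = 0"
proof (rule pdI)
 have "open {x::'a. M < norm x}" by (intro open_Collect_less continuous_intros)
 then show "(f has_derivative (\<lambda>_. 0)) (at x)"
  using has_derivative_transform_within_open[OF has_derivative_const, of "{x. M < norm x}" x "0::real" f UNIV] assms
  by auto
qed

lemma bsupp_pd: "bsupp f ==> bsupp (pd v f)"
 unfolding bsupp_def using pd_zero_outside by metis

lemma bsupp_mult1: "bsupp f ==> bsupp (\<lambda>x. f x * (g x::real))"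
 and bsupp_mult2: "bsupp f ==> bsupp (\<lambda>x. (g x::real) * f x)"
 unfolding bsupp_def by auto

lemma bsupp_add: assumes "bsupp f" "bsupp g" shows "bsupp (\<lambda>x. f x + (g x::real))"
proof -
 obtain M N where "\<forall>x. M < norm x \<longrightarrow> f x = 0" "\<forall>x. N < norm x \<longrightarrow> g x = 0"
  using assms by (auto simp: bsupp_def)
 then show ?thesis unfolding bsupp_def by (intro exI[of _ "max M N"]) auto
qed

lemma bsupp_diff: assumes "bsupp f" "bsupp g" shows "bsupp (\<lambda>x. f x - (g x::real))"
 using bsupp_add[OF assms(1) bsupp_mult2[OF assms(2), of "\<lambda>_. -1"]] by simp

lemma bsupp_sum: "(\<And>i. i \<in> I ==> bsupp (f i)) ==> bsupp (\<lambda>x. \<Sum>i\<in>I. (f i x::real))"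
 by (induction I rule: infinite_finite_induct) (simp_all add: bsupp_add, simp_all add: bsupp_def)

lemma integrable_bsupp:
 fixes f :: "'a::euclidean_space => real"
 assumes "continuous_on UNIV f" "bsupp f" shows "integrable lborel f"
proof -
 obtain M where M: "0 < M" "\<And>x. M \<le> norm x ==> f x = 0" using bsuppE[OF assms(2)] by blast
 have "integrable lborel (\<lambda>x. indicator (cball 0 M) x *\<^sub>R f x)"
  by (intro borel_integrable_compact) (auto intro: continuous_on_subset[OF assms(1)])
 also have "(\<lambda>x. indicator (cball 0 M) x *\<^sub>R f x) = f"
  using M(2) by (auto simp: indicator_def fun_eq_iff)
 finally show ?thesis .
qed

lemma bsupp_bounded:
 fixes f :: "'a::euclidean_space => real"
 assumes "continuous_on UNIV f" "bsupp f" obtains B where "0 < B" "\<And>x. \<bar>f x\<bar> \<le> B"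
proof -
 obtain M where M: "0 < M" "\<And>x. M \<le> norm x ==> f x = 0" using bsuppE[OF assms(2)] by blast
 have "compact (f ` cball 0 M)"
  by (intro compact_continuous_image continuous_on_subset[OF assms(1)]) auto
 then obtain B where B: "0 < B" "\<forall>y\<in>f ` cball 0 M. norm y \<le> B"
  using bounded_pos compact_imp_bounded by metis
 have "\<bar>f x\<bar> \<le> B" for x
 proof (cases "norm x \<le> M")
  case True
  then have "f x \<in> f ` cball 0 M" by auto
  then show ?thesis using B(2) by auto
 qed (use M(2)[of x] B(1) in auto)
 then show ?thesis using B(1) that by blast
qed

lemma borel_measurable_cont: "continuous_on UNIV f ==> f \<in> borel_measurable borel"
 by (rule borel_measurable_continuous_onI)

lemma lborel_translate:
 fixes f :: "'a::euclidean_space => real"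
 assumes [measurable]: "f \<in> borel_measurable borel"
 shows "integral\<^sup>L lborel (\<lambda>x. f (t + x)) = integral\<^sup>L lborel f"
 by (subst (2) lborel_distr_plus[of t, symmetric]) (simp add: integral_distr)

lemma nn_lborel_translate:
 fixes f :: "'a::euclidean_space => ennreal"
 assumes [measurable]: "f \<in> borel_measurable borel"
 shows "integral\<^sup>N lborel (\<lambda>x. f (t + x)) = integral\<^sup>N lborel f"
 by (subst (2) lborel_distr_plus[of t, symmetric]) (simp add: nn_integral_distr)

lemma integrable_lborel_translate:
 fixes f :: "'a::euclidean_space => real"
 assumes "integrable lborel f"
 shows "integrable lborel (\<lambda>x. f (t + x))"
proof -
 have "integrable (distr lborel borel ((+) t)) f" by (simp add: lborel_distr_plus assms)
 then show ?thesis
  using assms borel_measurable_integrable by (subst (asm) integrable_distr_eq) auto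
qed

text \<open>Integrating \<open>f (T x) g (y - T x)\<close> over \<open>x\<close> and \<open>y\<close> in both orders, with \<open>g\<close> the indicator of the unit
ball, compares the two integrals of \<open>f\<close>: the order \<open>y\<close> first gives the left one times the volume of
the ball; after a translation of \<open>x\<close> the other order gives the right one times the same volume,
because \<open>T\<close> preserves the ball.\<close>

lemma nn_integral_orthogonal_transformation:
 fixes T :: "'a::euclidean_space => 'a" and f :: "'a => ennreal"
 assumes T: "orthogonal_transformation T" and f [measurable]: "f \<in> borel_measurable borel"
 shows "(NNINT x. f (T x)) = (NNINT x. f x)"
proof -
 have lin: "linear T" by (rule orthogonal_transformation_linear[OF T])
 have Tm [measurable]: "T \<in> borel_measurable borel"
  by (intro borel_measurable_continuous_onI linear_continuous_on) (simp add: lin linear_conv_bounded_linear[symmetric])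
 define g :: "'a => ennreal" where "g = indicator (ball 0 1)"
 have [measurable]: "g \<in> borel_measurable borel" unfolding g_def by (intro borel_measurable_indicator) simp
 have gT: "g (- T x) = g x" for x using orthogonal_transformation_norm[OF T, of x] by (simp add: g_def indicator_def)
 have "emeasure lborel (ball 0 1 :: 'a set) \<noteq> 0"
  using content_ball_pos[of 1 "0::'a"] by (auto simp: measure_def)
 then have gi: "0 < (NNINT x. g x)" "(NNINT x. g x) < \<infinity>"
  using emeasure_lborel_ball_finite[of "0::'a" 1] by (auto simp: g_def zero_less_iff_neq_zero)
 have trans: "(NNINT y. g (z + y)) = (NNINT y. g y)" "(NNINT y. f (z + y)) = (NNINT y. f y)" for z
  by (rule nn_lborel_translate, measurable)+
 have "(NNINT x. f (T x)) * (NNINT x. g x) = (NNINT x. f (T x) * (NNINT y. g (- T x + y)))"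
  unfolding trans by (rule nn_integral_multc[symmetric]) measurable
 also have "... = (NNINT x. (NNINT y. f (T x) * g (- T x + y)))" by (simp add: nn_integral_cmult)
 also have "... = (NNINT y. (NNINT x. f (T x) * g (- T x + y)))"
  by (rule lborel_pair.Fubini') measurable
 also have "... = (NNINT y. (NNINT x. f (T x + y) * g x))"
 proof (rule nn_integral_cong)
  fix y :: 'a
  obtain z where z: "y = T z" using orthogonal_transformation_surj[OF T] by (metis surjD)
  have "(NNINT x. f (T x) * g (- T x + y)) = (NNINT x. f (T (z + x)) * g (- T (z + x) + y))"
   by (rule nn_lborel_translate[symmetric]) measurable
  then show "(NNINT x. f (T x) * g (- T x + y)) = (NNINT x. f (T x + y) * g x)"
   by (simp add: z linear_add[OF lin] gT add.commute)
 qed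
 also have "... = (NNINT x. (NNINT y. f (T x + y) * g x))"
  by (rule lborel_pair.Fubini') measurable
 also have "... = (NNINT x. f x) * (NNINT x. g x)"
 proof -
  have "(NNINT y. f (T x + y) * g x) = (NNINT x. f x) * g x" for x
   unfolding trans(2)[symmetric, of "T x"] by (rule nn_integral_multc) measurable
  then show ?thesis by (simp add: nn_integral_cmult)
 qed
 finally show ?thesis using gi by (auto simp: ennreal_mult_cancel_left mult.commute[of _ "\<integral>\<^sup>+x. g x \<partial>lborel"])
qed

lemma mvt_pd:
 assumes "\<And>x. f differentiable at x"
 shows "\<exists>\<theta>. 0 < \<theta> \<and> \<theta> < (1::real) \<and> f (x + h) - f x = pd h f (x + \<theta> *\<^sub>R h)"
proof -
 have D: "((\<lambda>t. f (x + t *\<^sub>R h)) has_derivative (\<lambda>s. s * pd h f (x + t *\<^sub>R h))) (at t)" for t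
 proof -
  have 1: "((\<lambda>t. x + t *\<^sub>R h) has_derivative (\<lambda>s. s *\<^sub>R h)) (at t)"
   by (auto intro!: derivative_eq_intros)
  show ?thesis
   using has_derivative_compose[OF 1 has_derivative_pd[OF assms]] by (simp add: pd_scaleR assms)
 qed
 have "\<exists>\<theta>\<in>{0<..<1}. f (x + 1 *\<^sub>R h) - f (x + 0 *\<^sub>R h) = (1 - 0) * pd h f (x + \<theta> *\<^sub>R h)"
  by (rule mvt_simple[where f = "\<lambda>t. f (x + t *\<^sub>R h)" and f' = "\<lambda>t s. s * pd h f (x + t *\<^sub>R h)"])
    (auto intro: has_derivative_at_withinI D)
 then show ?thesis by auto
qed

text \<open>Translation invariance makes the integral of every difference quotient vanish; the quotients are
bounded with a common support, so dominated convergence applies.\<close>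

lemma integral_pd_eq_0:
 fixes f :: "'a::euclidean_space => real"
 assumes f: "Ck 1 f" "bsupp f"
 shows "integral\<^sup>L lborel (pd v f) = 0"
proof -
 have d: "f differentiable at x" for x using f by simp
 have c: "continuous_on UNIV f" "continuous_on UNIV (pd v f)" using f Ck_cont[of 1 f] by auto
 have [measurable]: "f \<in> borel_measurable borel" "pd v f \<in> borel_measurable borel"
  using c borel_measurable_cont by auto
 obtain M where M: "0 < M" "\<And>x. M \<le> norm x ==> f x = 0" using bsuppE[OF f(2)] by blast
 obtain B where B: "0 < B" "\<And>x. \<bar>pd v f x\<bar> \<le> B"
  using bsupp_bounded[OF c(2) bsupp_pd[OF f(2)]] by blast
 define h where "h n = 1 / real (Suc n)" for n
 have h: "0 < h n" "h n \<le> 1" for n by (auto simp: h_def)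
 have h0: "h \<longlonglongrightarrow> 0" unfolding h_def by (rule LIMSEQ_Suc[OF lim_1_over_n])
 define q where "q n x = (f (h n *\<^sub>R v + x) - f x) / h n" for n x
 have "(\<lambda>n. integral\<^sup>L lborel (q n)) \<longlonglongrightarrow> integral\<^sup>L lborel (pd v f)"
 proof (rule integral_dominated_convergence[where w = "\<lambda>x. B * indicator (cball 0 (M + norm v)) x"])
  show "q n \<in> borel_measurable lborel" for n unfolding q_def by simp
  show "integrable lborel (\<lambda>x::'a. B * indicator (cball 0 (M + norm v)) x)"
   using borel_integrable_compact[of "cball (0::'a) (M + norm v)" "\<lambda>_. B"] by (simp add: mult.commute)
  show "AE x in lborel. (\<lambda>n. q n x) \<longlonglongrightarrow> pd v f x"
  proof (rule AE_I2)
   fix x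
   have D: "((\<lambda>t. f (x + t *\<^sub>R v)) has_real_derivative pd v f x) (at 0)"
   proof -
    have 1: "((\<lambda>t::real. x + t *\<^sub>R v) has_derivative (\<lambda>s. s *\<^sub>R v)) (at 0)"
     by (auto intro!: derivative_eq_intros)
    show ?thesis
     using has_derivative_compose[OF 1, of f "\<lambda>v. pd v f x"] has_derivative_pd[OF d]
     by (simp add: pd_scaleR d has_field_derivative_def mult_commute_abs)
   qed
   have "(\<lambda>n. (f (x + h n *\<^sub>R v) - f (x + 0 *\<^sub>R v)) / (h n - 0)) \<longlonglongrightarrow> pd v f x"
   proof -
    have lim: "((\<lambda>t. (f (x + t *\<^sub>R v) - f (x + 0 *\<^sub>R v)) / (t - 0)) \<longlongrightarrow> pd v f x) (at 0)"
     using D by (simp only: has_field_derivative_iff)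
    have "filterlim h (at 0) sequentially"
     using h0 h by (auto simp: filterlim_at eventually_at_top_linorder intro!: always_eventually) (metis less_irrefl)
    from filterlim_compose[OF lim this] show ?thesis .
   qed
   then show "(\<lambda>n. q n x) \<longlonglongrightarrow> pd v f x" by (simp add: q_def add.commute)
  qed
  fix n
  show "AE x in lborel. norm (q n x) \<le> B * indicator (cball 0 (M + norm v)) x"
  proof (rule AE_I2)
   fix x
   show "norm (q n x) \<le> B * indicator (cball 0 (M + norm v)) x"
   proof (cases "norm x \<le> M + norm v")
    case True
    obtain \<theta> where "f (x + h n *\<^sub>R v) - f x = pd (h n *\<^sub>R v) f (x + \<theta> *\<^sub>R h n *\<^sub>R v)"
     using mvt_pd[OF d] by blast
    also have "... = h n * pd v f (x + \<theta> *\<^sub>R h n *\<^sub>R v)"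
     by (simp add: pd_scaleR d)
    finally have "q n x = pd v f (x + \<theta> *\<^sub>R h n *\<^sub>R v)"
     using h[of n] by (simp add: q_def add.commute)
    then show ?thesis using B True by simp
   next
    case False
    have "norm (h n *\<^sub>R v) \<le> norm v" using h[of n] by (simp add: mult_left_le_one_le)
    then have "M \<le> norm (h n *\<^sub>R v + x)" "M \<le> norm x"
     using False norm_diff_ineq[of x "h n *\<^sub>R v"] norm_ge_zero[of v]
     by (auto simp: add.commute simp del: norm_ge_zero)
    then show ?thesis using M(2) by (simp add: q_def False)
   qed
  qed
 qed simp
 moreover have "integral\<^sup>L lborel (q n) = 0" for n
 proof -
  have i: "integrable lborel f" using integrable_bsupp c f by blast
  have "integral\<^sup>L lborel (q n) = (integral\<^sup>L lborel (\<lambda>x. f (h n *\<^sub>R v + x)) - integral\<^sup>L lborel f) / h n"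
   unfolding q_def using i integrable_lborel_translate[OF i] by (simp add: Bochner_Integration.integral_diff)
  then show ?thesis by (simp add: lborel_translate)
 qed
 ultimately show ?thesis by (simp add: LIMSEQ_const_iff)
qed

lemma integral_by_parts:
 fixes f g :: "'a::euclidean_space => real"
 assumes f: "Ck 1 f" and g: "Ck 1 g" and s: "bsupp f \<or> bsupp g"
 shows "(LBINT x. pd v f x * g x) = - (LBINT x. f x * pd v g x)"
proof -
 have s': "bsupp (\<lambda>x. f x * g x)" "bsupp (\<lambda>x. pd v f x * g x)" "bsupp (\<lambda>x. f x * pd v g x)"
  using s bsupp_mult1 bsupp_mult2 bsupp_pd by blast+
 have c: "continuous_on UNIV f" "continuous_on UNIV g" "continuous_on UNIV (pd v f)" "continuous_on UNIV (pd v g)"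
  using f g Ck_cont[of 1 f] Ck_cont[of 1 g] by auto
 have i: "integrable lborel (\<lambda>x. pd v f x * g x)" "integrable lborel (\<lambda>x. f x * pd v g x)"
  using c s' by (auto intro!: integrable_bsupp continuous_intros)
 have "pd v (\<lambda>x. f x * g x) = (\<lambda>x. pd v f x * g x + f x * pd v g x)"
  using f g by (auto simp: pd_mult)
 then show ?thesis
  using integral_pd_eq_0[OF Ck_mult[OF f g] s'(1), of v] i by simp
qed

section \<open>Mollification\<close>

definition loc_int :: "('a::euclidean_space => real) => bool" where
 "loc_int g \<longleftrightarrow> g \<in> borel_measurable borel \<and>
   (\<forall>M. integrable lborel (\<lambda>x. indicator (cball 0 M) x * g x))"

definition conv :: "('a::euclidean_space => real) => ('a => real) => 'a => real" where
 "conv k g x = (LBINT y. k (x - y) * g y)"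

lemma loc_int_measurable [measurable_dest]: "loc_int g ==> g \<in> borel_measurable borel"
 by (simp add: loc_int_def)

lemma loc_int_cont:
 assumes "continuous_on UNIV f" shows "loc_int (f :: 'a::euclidean_space => real)"
 unfolding loc_int_def
proof safe
 show "f \<in> borel_measurable borel" using assms by (rule borel_measurable_cont)
 fix M
 show "integrable lborel (\<lambda>x. indicator (cball 0 M) x * f x)"
  using borel_integrable_compact[of "cball 0 M" f] continuous_on_subset[OF assms] by auto
qed

lemma loc_int_mult_bounded:
 assumes "loc_int f" "g \<in> borel_measurable borel" "\<And>M. \<exists>B. \<forall>x. norm x \<le> M \<longrightarrow> \<bar>g x\<bar> \<le> B"
 shows "loc_int (\<lambda>x. g x * f x)"
 unfolding loc_int_def
proof safe
 note [measurable] = assms(2) loc_int_measurable[OF assms(1)]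
 show "(\<lambda>x. g x * f x) \<in> borel_measurable borel" by measurable
 fix M
 obtain B where B: "\<forall>x. norm x \<le> M \<longrightarrow> \<bar>g x\<bar> \<le> B" using assms(3) by blast
 show "integrable lborel (\<lambda>x. indicator (cball 0 M) x * (g x * f x))"
 proof (rule Bochner_Integration.integrable_bound)
  show "integrable lborel (\<lambda>x. B * (indicator (cball 0 M) x * f x))"
   using assms(1) by (auto simp: loc_int_def)
  show "AE x in lborel. norm (indicator (cball 0 M) x * (g x * f x))
    \<le> norm (B * (indicator (cball 0 M) x * f x))"
  proof (rule AE_I2)
   fix x
   have "\<bar>g x\<bar> * \<bar>f x\<bar> \<le> \<bar>B\<bar> * \<bar>f x\<bar>" if "norm x \<le> M"
    using B that by (intro mult_right_mono order_trans[OF _ abs_ge_self[of B]]) auto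
   then show "norm (indicator (cball 0 M) x * (g x * f x)) \<le> norm (B * (indicator (cball 0 M) x * f x))"
    by (auto simp: indicator_def abs_mult)
  qed
 qed (auto intro!: borel_measurable_times borel_measurable_indicator simp: assms(2) loc_int_measurable[OF assms(1)])
qed

lemma cont_bounded_cball:
 fixes g :: "'a::euclidean_space => real"
 assumes "continuous_on UNIV g" shows "\<exists>B>0. \<forall>x. norm x \<le> M \<longrightarrow> \<bar>g x\<bar> \<le> B"
proof -
 have "compact (g ` cball 0 M)"
  by (intro compact_continuous_image continuous_on_subset[OF assms]) auto
 then obtain B where "0 < B" "\<forall>y\<in>g ` cball 0 M. norm y \<le> B"
  using bounded_pos compact_imp_bounded by metis
 then show ?thesis by (intro exI[of _ B]) auto
qed

lemma loc_int_mult_cont: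
 assumes "loc_int f" "continuous_on UNIV g" shows "loc_int (\<lambda>x. g x * f x)"
 using loc_int_mult_bounded[OF assms(1) borel_measurable_cont[OF assms(2)]]
  cont_bounded_cball[OF assms(2)] by meson

lemma integrable_loc_int_mult:
 assumes f: "loc_int f" and g: "continuous_on UNIV g" "bsupp g"
 shows "integrable lborel (\<lambda>x. g x * f x)"
proof -
 obtain M where M: "0 < M" "\<And>x. M \<le> norm x ==> g x = 0" using bsuppE[OF g(2)] by blast
 have "(\<lambda>x. g x * f x) = (\<lambda>x. indicator (cball 0 M) x * (g x * f x))"
  using M(2) by (auto simp: fun_eq_iff indicator_def)
 then show ?thesis using loc_int_mult_cont[OF f g(1)] unfolding loc_int_def by metis
qed

lemma loc_int_abs: "loc_int g ==> loc_int (\<lambda>x. \<bar>g x\<bar>)"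
proof (unfold loc_int_def, safe, measurable)
 fix M assume "\<forall>M. integrable lborel (\<lambda>x. indicator (cball 0 M) x * g x)"
 then have "integrable lborel (\<lambda>x. \<bar>indicator (cball 0 M) x * g x\<bar>)" by simp
 then show "integrable lborel (\<lambda>x. indicator (cball 0 M) x * \<bar>g x\<bar>)" by (simp add: abs_mult)
qed

lemma loc_int_add: "loc_int f ==> loc_int g ==> loc_int (\<lambda>x. f x + g x)"
 unfolding loc_int_def by (auto simp: distrib_left)

lemma loc_int_integrable: "integrable lborel f ==> loc_int f"
proof (unfold loc_int_def, safe)
 fix M assume f: "integrable lborel f"
 show "integrable lborel (\<lambda>x. indicator (cball 0 M) x * f x)"
  using integrable_mult_indicator[OF _ f, of "cball 0 M"] by simp
qed simp

lemma conv_integrable: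
 assumes "loc_int g" "continuous_on UNIV k" "bsupp k"
 shows "integrable lborel (\<lambda>y. k (x - y) * g y)"
proof (rule integrable_loc_int_mult[OF assms(1)])
 show "continuous_on UNIV (\<lambda>y. k (x - y))"
  by (rule continuous_on_compose2[OF assms(2)]) (auto intro: continuous_intros)
 obtain M where M: "0 < M" "\<And>x. M \<le> norm x ==> k x = 0" using bsuppE[OF assms(3)] by blast
 have "k (x - y) = 0" if "M + norm x \<le> norm y" for y
 proof (rule M(2))
  show "M \<le> norm (x - y)" using that norm_triangle_ineq2[of y x] by (simp add: norm_minus_commute)
 qed
 then show "bsupp (\<lambda>y. k (x - y))" by (rule bsuppI)
qed

lemma uniform_cont_bsupp:
 fixes f :: "'a::euclidean_space => real"
 assumes "continuous_on UNIV f" "bsupp f" "0 < e"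
 obtains d where "0 < d" "\<And>x y. norm (x - y) < d ==> \<bar>f x - f y\<bar> < e"
proof -
 obtain M where M: "0 < M" "\<And>x. M \<le> norm x ==> f x = 0" using bsuppE[OF assms(2)] by blast
 have "uniformly_continuous_on (cball 0 (M+1)) f"
  by (intro compact_uniformly_continuous continuous_on_subset[OF assms(1)]) auto
 then obtain d where d: "0 < d" "\<And>x y. x \<in> cball 0 (M+1) ==> y \<in> cball 0 (M+1) ==> dist x y < d ==> dist (f x) (f y) < e"
  unfolding uniformly_continuous_on_def using assms(3) by metis
 show ?thesis
 proof (rule that[of "min d 1"])
  fix x y :: 'a assume xy: "norm (x - y) < min d 1"
  show "\<bar>f x - f y\<bar> < e"
  proof (cases "norm x \<le> M \<or> norm y \<le> M")
   case True
   have "norm y \<le> norm x + norm (x - y)" "norm x \<le> norm y + norm (x - y)"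
    by norm+
   then have "norm x \<le> M + 1" "norm y \<le> M + 1" using True xy by auto
   then show ?thesis using d(2)[of x y] xy by (auto simp: dist_norm)
  next
   case False then show ?thesis using M(2)[of x] M(2)[of y] assms(3) by auto
  qed
 qed (use d in auto)
qed

text \<open>A convolution whose kernel is uniformly small is small; this is how uniform continuity of the kernel
and of its derivatives passes to the convolution.\<close>

lemma conv_remainder:
 assumes g: "loc_int g" and k: "continuous_on UNIV k" "bsupp k"
  and M: "\<And>y. M < norm y ==> k (x - y) = 0" and e: "\<And>z. \<bar>k z\<bar> \<le> e"
 shows "\<bar>conv k g x\<bar> \<le> e * (LBINT y. indicator (cball 0 M) y * \<bar>g y\<bar>)"
proof -
 have "\<bar>conv k g x\<bar> \<le> (LBINT y. \<bar>k (x - y) * g y\<bar>)"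
  unfolding conv_def by (rule integral_abs_bound)
 also have "... \<le> (LBINT y. e * (indicator (cball 0 M) y * \<bar>g y\<bar>))"
 proof (rule integral_mono)
  show "integrable lborel (\<lambda>y. \<bar>k (x - y) * g y\<bar>)"
   using conv_integrable[OF g k] by simp
  show "integrable lborel (\<lambda>y. e * (indicator (cball 0 M) y * \<bar>g y\<bar>))"
   using loc_int_abs[OF g] by (simp add: loc_int_def)
  fix y show "\<bar>k (x - y) * g y\<bar> \<le> e * (indicator (cball 0 M) y * \<bar>g y\<bar>)"
   using M[of y] e[of "x - y"] by (cases "M < norm y") (auto simp: abs_mult intro: mult_right_mono)
 qed
 finally show ?thesis by simp
qed

lemma conv_add: "loc_int u ==> continuous_on UNIV f ==> bsupp f ==> continuous_on UNIV g ==> bsupp g ==>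
 conv (\<lambda>z. f z + g z) u x = conv f u x + conv g u x"
 unfolding conv_def by (simp add: distrib_right conv_integrable)

lemma conv_diff: "loc_int u ==> continuous_on UNIV f ==> bsupp f ==> continuous_on UNIV g ==> bsupp g ==>
 conv (\<lambda>z. f z - g z) u x = conv f u x - conv g u x"
 unfolding conv_def by (simp add: left_diff_distrib conv_integrable)

lemma conv_cmult: "conv (\<lambda>z. c * f z) g x = c * conv f g x"
 unfolding conv_def by (simp add: mult.assoc)

lemma conv_diff_right: "loc_int f ==> loc_int g ==> continuous_on UNIV k ==> bsupp k ==>
 conv k (\<lambda>z. f z - g z) x = conv k f x - conv k g x"
 unfolding conv_def by (simp add: right_diff_distrib conv_integrable)

lemma bsupp_translate:
 assumes "bsupp (f :: 'a::real_normed_vector => real)" shows "bsupp (\<lambda>z. f (z + h))"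
proof -
 obtain M where M: "0 < M" "\<And>x. M \<le> norm x ==> f x = 0" using bsuppE[OF assms] by blast
 have "f (z + h) = 0" if "M + norm h \<le> norm z" for z
 proof (rule M(2))
  show "M \<le> norm (z + h)" using that norm_diff_ineq[of z h] by simp
 qed
 then show ?thesis by (rule bsuppI)
qed

lemma conv_shift: "conv k g (x + h) = conv (\<lambda>z. k (z + h)) g x"
 unfolding conv_def by (simp add: algebra_simps)

lemma continuous_conv:
 assumes g: "loc_int g" and k: "continuous_on UNIV k" "bsupp k"
 shows "continuous_on UNIV (conv k g)"
 unfolding continuous_on_iff
proof (intro ballI allI impI)
 fix x :: 'a and e :: real assume "0 < e"
 obtain M where M: "0 < M" "\<And>x. M \<le> norm x ==> k x = 0" using bsuppE[OF k(2)] by blast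
 define I where "I = (LBINT y. indicator (cball 0 (M + 1 + norm x)) y * \<bar>g y\<bar>)"
 have "I \<ge> 0" unfolding I_def by simp
  have e': "0 < e / (I + 1)" using \<open>I \<ge> 0\<close> \<open>0 < e\<close> by simp
  obtain d where d: "0 < d" "\<And>x y. norm (x - y) < d ==> \<bar>k x - k y\<bar> < e / (I + 1)"
   using uniform_cont_bsupp[OF k e'] by blast
  show "\<exists>d>0. \<forall>x'\<in>UNIV. dist x' x < d \<longrightarrow> dist (conv k g x') (conv k g x) < e"
  proof (intro exI[of _ "min d 1"] conjI ballI impI)
   fix x' assume "dist x' x < min d 1"
   then have x': "norm (x' - x) < min d 1" by (simp add: dist_norm)
   define h where "h = x' - x"
   have ct: "continuous_on UNIV (\<lambda>z. k (z + h))"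
    by (rule continuous_on_compose2[OF k(1)]) (auto intro: continuous_intros)
   have "conv k g x' - conv k g x = conv (\<lambda>z. k (z + h) - k z) g x"
    using conv_shift[of k g x h] by (simp add: h_def conv_diff[OF g ct[unfolded h_def] bsupp_translate[OF k(2)] k])
   also have "\<bar>...\<bar> \<le> e / (I + 1) * I"
   proof (rule conv_remainder[OF g, of _ "M + 1 + norm x" x, folded I_def])
    show "continuous_on UNIV (\<lambda>z. k (z + h) - k z)" using ct k(1) by (intro continuous_intros)
    show "bsupp (\<lambda>z. k (z + h) - k z)" using bsupp_translate[OF k(2)] k(2) by (rule bsupp_diff)
    show "\<bar>k (z + h) - k z\<bar> \<le> e / (I + 1)" for z
     using d(2)[of "z + h" z] x' by (simp add: h_def)
    fix y :: 'a assume y: "M + 1 + norm x < norm y"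
    have "M \<le> norm (x - y + h)" "M \<le> norm (x - y)"
     using y x' norm_triangle_ineq2[of y x] norm_triangle_ineq2[of y x'] norm_triangle_ineq2[of x' x]
     by (auto simp: h_def norm_minus_commute)
    then show "k (x - y + h) - k (x - y) = 0" using M(2) by simp
   qed
   also have "... < e" using \<open>I \<ge> 0\<close> \<open>0 < e\<close> by (simp add: field_simps)
   finally show "dist (conv k g x') (conv k g x) < e" by (simp add: dist_norm)
  qed (use d in simp)
qed

lemma conv_has_derivative:
 fixes k :: "'a::euclidean_space => real"
 assumes g: "loc_int g" and k: "Ck 1 k" "bsupp k"
 shows "(conv k g has_derivative (\<lambda>v. conv (pd v k) g x)) (at x)"
proof -
 have df: "k differentiable at z" for z using k by simp
 have c: "continuous_on UNIV k" "continuous_on UNIV (pd v k)" for v using k Ck_cont[of 1 k] by auto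
 have b: "bsupp (pd v k)" for v using bsupp_pd[OF k(2)] .
 obtain M where M: "0 < M" "\<And>x. M \<le> norm x ==> k x = 0" using bsuppE[OF k(2)] by blast
 have Mp: "pd v k z = 0" if "M < norm z" for v z by (rule pd_zero_outside[OF _ that]) (simp add: M)
 define I where "I = (LBINT y. indicator (cball 0 (M + 1 + norm x)) y * \<bar>g y\<bar>)"
 have "I \<ge> 0" unfolding I_def by simp
 have "bounded_linear (\<lambda>v. conv (pd v k) g x)"
 proof (intro linear_conv_bounded_linear[THEN iffD1] linearI)
  fix v w :: 'a and r :: real
  have "pd (v + w) k = (\<lambda>z. pd v k z + pd w k z)"
   using linear_add[OF linear_pd[OF df]] by (intro ext) blast
  then show "conv (pd (v + w) k) g x = conv (pd v k) g x + conv (pd w k) g x"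
   using conv_add[OF g c(2) b c(2) b] by simp
  have "pd (r *\<^sub>R v) k = (\<lambda>z. r * pd v k z)" using pd_scaleR[OF df] by blast
  then show "conv (pd (r *\<^sub>R v) k) g x = r *\<^sub>R conv (pd v k) g x"
   by (simp add: conv_cmult)
 qed
 moreover have "\<exists>d>0. \<forall>y. norm (y - x) < d \<longrightarrow>
   norm (conv k g y - conv k g x - conv (pd (y - x) k) g x) \<le> e * norm (y - x)" if "0 < e" for e
 proof -
  define e' where "e' = e / (real DIM('a) * (I + 1))"
  have e': "0 < e'" using that \<open>I \<ge> 0\<close> by (simp add: e'_def)
  have "\<forall>b\<in>Basis. \<exists>d. 0 < d \<and> (\<forall>x y. norm (x - y) < d \<longrightarrow> \<bar>pd b k x - pd b k y\<bar> < e')"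
   using uniform_cont_bsupp[OF c(2) b e'] by metis
  then obtain d where d: "\<And>b. b \<in> Basis ==> 0 < d b"
   "\<And>b x y. b \<in> Basis ==> norm (x - y) < d b ==> \<bar>pd b k x - pd b k y\<bar> < e'" by metis
  define d' where "d' = Min (insert 1 (d ` Basis))"
  have d': "0 < d'" "d' \<le> 1" "\<And>b. b \<in> Basis ==> d' \<le> d b"
   unfolding d'_def using d(1) by (auto simp del: Min_insert intro!: Min_le Min_gr_iff[THEN iffD2])
  show ?thesis
  proof (intro exI[of _ d'] conjI allI impI d')
   fix y assume y: "norm (y - x) < d'"
   define h where "h = y - x"
   have ct: "continuous_on UNIV (\<lambda>z. k (z + h))"
    by (rule continuous_on_compose2[OF c(1)]) (auto intro: continuous_intros)
   have rem: "\<bar>k (z + h) - k z - pd h k z\<bar> \<le> norm h * (real DIM('a) * e')" for z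
   proof -
    obtain t where t: "0 < t" "t < (1::real)" "k (z + h) - k z = pd h k (z + t *\<^sub>R h)"
     using mvt_pd[OF df] by blast
    have "k (z + h) - k z - pd h k z = (\<Sum>b\<in>Basis. (h \<bullet> b) * (pd b k (z + t *\<^sub>R h) - pd b k z))"
     unfolding t(3) by (simp add: pd_expand[OF df, of h] right_diff_distrib sum_subtractf)
    also have "\<bar>...\<bar> \<le> (\<Sum>b\<in>Basis. \<bar>(h \<bullet> b) * (pd b k (z + t *\<^sub>R h) - pd b k z)\<bar>)"
     by (rule sum_abs)
    also have "... \<le> (\<Sum>b\<in>(Basis::'a set). norm h * e')"
    proof (rule sum_mono)
     fix b :: 'a assume b: "b \<in> Basis"
     have "norm ((z + t *\<^sub>R h) - z) < d b"
     proof -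
      have "norm ((z + t *\<^sub>R h) - z) \<le> norm h" using t by (simp add: mult_left_le_one_le)
      then show ?thesis using y d'(3)[OF b] by (simp add: h_def)
     qed
     then have "\<bar>pd b k (z + t *\<^sub>R h) - pd b k z\<bar> \<le> e'" using d(2)[OF b] less_imp_le by blast
     then show "\<bar>(h \<bullet> b) * (pd b k (z + t *\<^sub>R h) - pd b k z)\<bar> \<le> norm h * e'"
      unfolding abs_mult using Basis_le_norm[OF b, of h] by (intro mult_mono) auto
    qed
    finally show ?thesis by (simp add: mult_ac)
   qed
   have "conv k g y - conv k g x - conv (pd h k) g x
     = conv (\<lambda>z. k (z + h) - k z - pd h k z) g x"
   proof -
    have "conv k g y = conv (\<lambda>z. k (z + h)) g x" using conv_shift[of k g x h] by (simp add: h_def)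
    moreover have "continuous_on UNIV (\<lambda>z. k (z + h) - k z)" using ct c by (intro continuous_intros)
    ultimately show ?thesis
     using bsupp_diff[OF bsupp_translate[OF k(2)] k(2), of h] ct c b bsupp_translate[OF k(2)] k(2)
     by (simp add: conv_diff[OF g])
   qed
   also have "\<bar>...\<bar> \<le> norm h * (real DIM('a) * e') * I"
   proof (rule conv_remainder[OF g, of _ "M + 1 + norm x" x, folded I_def])
    show "continuous_on UNIV (\<lambda>z. k (z + h) - k z - pd h k z)" using ct c by (intro continuous_intros)
    show "bsupp (\<lambda>z. k (z + h) - k z - pd h k z)"
     by (intro bsupp_diff bsupp_translate b k(2))
    show "\<bar>k (z + h) - k z - pd h k z\<bar> \<le> norm h * (real DIM('a) * e')" for z by (rule rem)
    fix w :: 'a assume w: "M + 1 + norm x < norm w"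
    have "M < norm (x - w + h)" "M < norm (x - w)"
     using w y d'(2) norm_triangle_ineq2[of w x] norm_triangle_ineq2[of w y] norm_triangle_ineq2[of y x]
     by (auto simp: h_def norm_minus_commute)
    then show "k (x - w + h) - k (x - w) - pd h k (x - w) = 0" using M(2) Mp by simp
   qed
   also have "... \<le> e * norm h"
   proof -
    have "real DIM('a) * e' = e / (I + 1)" using \<open>I \<ge> 0\<close> by (simp add: e'_def)
    moreover have "e / (I + 1) * I \<le> e" using \<open>I \<ge> 0\<close> that by (simp add: field_simps)
    ultimately have "real DIM('a) * e' * I \<le> e" by metis
    from mult_left_mono[OF this norm_ge_zero[of h]] show ?thesis by (simp add: mult_ac)
   qed
   finally show "norm (conv k g y - conv k g x - conv (pd (y - x) k) g x) \<le> e * norm (y - x)"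
    by (simp add: h_def)
  qed
 qed
 ultimately show ?thesis unfolding has_derivative_at_alt by blast
qed

lemma pd_conv:
 assumes "loc_int g" "Ck 1 k" "bsupp k" shows "pd v (conv k g) = conv (pd v k) g"
 by (rule ext, rule pdI, rule conv_has_derivative[OF assms])

lemma Ck_conv:
 "loc_int g ==> Ck k q ==> bsupp q ==> Ck k (conv q g)"
proof (induction k arbitrary: q)
 case 0 then show ?case by (simp add: continuous_conv)
next
 case (Suc k)
 have 1: "Ck 1 q" using Suc.prems(2) Ck_mono[of "Suc k" q 1] by simp
 have "conv q g differentiable at x" for x
  using conv_has_derivative[OF Suc.prems(1) 1 Suc.prems(3)] by (auto simp: differentiable_def)
 moreover have "Ck k (pd v (conv q g))" for v
  unfolding pd_conv[OF Suc.prems(1) 1 Suc.prems(3)]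
  using Suc.prems bsupp_pd by (intro Suc.IH) auto
 ultimately show ?case by simp
qed

lemma bsupp_conv:
 assumes "bsupp k" "bsupp g" shows "bsupp (conv k g)"
proof -
 obtain M where M: "0 < M" "\<And>x. M \<le> norm x ==> k x = 0" using bsuppE[OF assms(1)] by blast
 obtain N where N: "0 < N" "\<And>x. N \<le> norm x ==> g x = 0" using bsuppE[OF assms(2)] by blast
 have "conv k g x = 0" if "M + N \<le> norm x" for x
 proof -
  have "k (x - y) * g y = 0" for y
  proof (cases "N \<le> norm y")
   case False
   then have "M \<le> norm (x - y)" using that norm_triangle_ineq2[of x y] by simp
   then show ?thesis using M(2) by simp
  qed (simp add: N)
  then show ?thesis unfolding conv_def by (subst Bochner_Integration.integral_cong[OF refl, of _ _ "\<lambda>_. 0"]) auto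
 qed
 then show ?thesis by (rule bsuppI)
qed

lemma conv_adjoint:
 assumes g: "loc_int g" and k: "continuous_on UNIV k" "bsupp k" and f: "continuous_on UNIV f" "bsupp f"
 shows "(LBINT x. conv k g x * f x) = (LBINT y. g y * conv (\<lambda>z. k (- z)) f y)"
proof -
 note [measurable] = loc_int_measurable[OF g] borel_measurable_cont[OF k(1)] borel_measurable_cont[OF f(1)]
 obtain M where M: "0 < M" "\<And>x. M \<le> norm x ==> k x = 0" using bsuppE[OF k(2)] by blast
 obtain N where N: "0 < N" "\<And>x. N \<le> norm x ==> f x = 0" using bsuppE[OF f(2)] by blast
 obtain B where B: "0 < B" "\<And>x. \<bar>k x\<bar> \<le> B" using bsupp_bounded[OF k] by blast
 define I where "I = (LBINT y. indicator (cball 0 (M+N)) y * \<bar>g y\<bar>)"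
 have "integrable (lborel \<Otimes>\<^sub>M lborel) (\<lambda>(x, y). k (x - y) * g y * f x)"
 proof (rule lborel_pair.Fubini_integrable)
  show "AE x in lborel. integrable lborel (\<lambda>y. case (x, y) of (x, y) => k (x - y) * g y * f x)"
   using conv_integrable[OF g k] by simp
  show "integrable lborel (\<lambda>x. LBINT y. norm (case (x, y) of (x, y) => k (x - y) * g y * f x))"
  proof (rule Bochner_Integration.integrable_bound)
   show "integrable lborel (\<lambda>x. B * I * \<bar>f x\<bar>)" using integrable_bsupp[OF f] by simp
   show "AE x in lborel. norm (LBINT y. norm (case (x, y) of (x, y) => k (x - y) * g y * f x))
     \<le> norm (B * I * \<bar>f x\<bar>)"
   proof (rule AE_I2)
    fix x
    have e: "(LBINT y. \<bar>k (x - y) * g y * f x\<bar>) = (LBINT y. \<bar>k (x - y) * g y\<bar>) * \<bar>f x\<bar>"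
     by (simp add: abs_mult)
    show "norm (LBINT y. norm (case (x, y) of (x, y) => k (x - y) * g y * f x)) \<le> norm (B * I * \<bar>f x\<bar>)"
    proof (cases "norm x < N")
     case False then show ?thesis using N(2)[of x] by simp
    next
     case True
     have "(LBINT y. \<bar>k (x - y) * g y\<bar>) \<le> (LBINT y. B * (indicator (cball 0 (M+N)) y * \<bar>g y\<bar>))"
     proof (rule integral_mono)
      show "integrable lborel (\<lambda>y. \<bar>k (x - y) * g y\<bar>)" using conv_integrable[OF g k] by simp
      show "integrable lborel (\<lambda>y. B * (indicator (cball 0 (M+N)) y * \<bar>g y\<bar>))"
       using loc_int_abs[OF g] by (simp add: loc_int_def)
      fix y show "\<bar>k (x - y) * g y\<bar> \<le> B * (indicator (cball 0 (M+N)) y * \<bar>g y\<bar>)"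
      proof (cases "norm y \<le> M + N")
       case True then show ?thesis using B(2)[of "x-y"] by (auto simp: abs_mult intro: mult_right_mono)
      next
       case False
       then have "M \<le> norm (x - y)" using True norm_triangle_ineq2[of y x] by (simp add: norm_minus_commute)
       then show ?thesis using M(2) B(1) by simp
      qed
     qed
     then have "(LBINT y. \<bar>k (x - y) * g y\<bar>) * \<bar>f x\<bar> \<le> B * I * \<bar>f x\<bar>"
      by (intro mult_right_mono) (simp_all add: I_def)
     then have "\<bar>(LBINT y. \<bar>k (x - y) * g y\<bar>) * \<bar>f x\<bar>\<bar> \<le> \<bar>B * I * \<bar>f x\<bar>\<bar>"
      by (subst abs_of_nonneg) (auto intro: order_trans)
     then show ?thesis using e by simp
    qed
   qed
  qed measurable
 qed measurable
 from lborel_pair.Fubini_integral[OF this]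
 have "(LBINT x. conv k g x * f x) = (\<integral>y. \<integral>x. k (x - y) * g y * f x \<partial>lborel \<partial>lborel)"
  by (simp add: conv_def)
 also have "... = (LBINT y. g y * conv (\<lambda>z. k (- z)) f y)"
  unfolding conv_def by (simp add: mult_ac flip: Bochner_Integration.integral_mult_right_zero)
 finally show ?thesis .
qed

lemma conv_pd_swap:
 assumes f: "Ck 1 f" and k: "Ck 1 k" "bsupp k"
 shows "conv (pd v k) f = conv k (pd v f)"
proof
 fix x
 have lin: "bounded_linear (\<lambda>y::'a. - y)" by (intro bounded_linear_minus bounded_linear_ident)
 have df: "k differentiable at z" for z using k by simp
 have 1: "Ck 1 (\<lambda>y. k (x + - y))" using Ck_compose_linear[OF lin k(1)] .
 have 2: "pd v (\<lambda>y. k (x + - y)) = (\<lambda>y. - pd v k (x - y))"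
  using pd_compose_linear(1)[OF lin df, of v x] pd_scaleR[OF df, of "-1" v] by auto
 have 3: "bsupp (\<lambda>y. k (x + - y))"
 proof -
  obtain M where M: "0 < M" "\<And>x. M \<le> norm x ==> k x = 0" using bsuppE[OF k(2)] by blast
  have "k (x + - y) = 0" if "M + norm x \<le> norm y" for y
  proof (rule M(2))
   show "M \<le> norm (x + - y)" using that norm_triangle_ineq2[of y x] by (simp add: norm_minus_commute)
  qed
  then show ?thesis by (rule bsuppI)
 qed
 have "(LBINT y. pd v (\<lambda>y. k (x + - y)) y * f y) = - (LBINT y. k (x + - y) * pd v f y)"
  by (rule integral_by_parts[OF 1 f]) (use 3 in simp)
 then show "conv (pd v k) f x = conv k (pd v f) x" unfolding 2 conv_def by simp
qed

lemma integral_Cauchy_Schwarz: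
 fixes f g :: "'a => real"
 assumes [measurable]: "f \<in> borel_measurable M" "g \<in> borel_measurable M"
  and i: "integrable M (\<lambda>x. (f x)^2)" "integrable M (\<lambda>x. (g x)^2)"
 shows "integrable M (\<lambda>x. f x * g x)"
  and "(\<integral>x. f x * g x \<partial>M)^2 \<le> (\<integral>x. (f x)^2 \<partial>M) * (\<integral>x. (g x)^2 \<partial>M)"
proof -
 show fg: "integrable M (\<lambda>x. f x * g x)"
 proof (rule Bochner_Integration.integrable_bound)
  show "integrable M (\<lambda>x. (f x)^2 + (g x)^2)" using i by simp
  have "\<bar>f x * g x\<bar> \<le> (f x)^2 + (g x)^2" for x
  proof -
   have "0 \<le> (\<bar>f x\<bar> - \<bar>g x\<bar>)^2" by simp
   then have "2 * (\<bar>f x\<bar> * \<bar>g x\<bar>) \<le> (f x)^2 + (g x)^2" by (simp add: power2_diff)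
   moreover have "0 \<le> \<bar>f x\<bar> * \<bar>g x\<bar>" by simp
   ultimately show ?thesis unfolding abs_mult by linarith
  qed
  then show "AE x in M. norm (f x * g x) \<le> norm ((f x)^2 + (g x)^2)" by auto
 qed measurable
 define A where "A = (\<integral>x. (f x)^2 \<partial>M)"
 define B where "B = (\<integral>x. f x * g x \<partial>M)"
 define C where "C = (\<integral>x. (g x)^2 \<partial>M)"
 have q: "0 \<le> A * t^2 + 2 * B * t + C" for t
 proof -
  have "0 \<le> (\<integral>x. (t * f x + g x)^2 \<partial>M)" by simp
  also have "(\<lambda>x. (t * f x + g x)^2) = (\<lambda>x. t^2 * (f x)^2 + 2 * t * (f x * g x) + (g x)^2)"
   by (auto simp: power2_eq_square algebra_simps)
  also have "(\<integral>x. t^2 * (f x)^2 + 2 * t * (f x * g x) + (g x)^2 \<partial>M) = t^2 * A + 2 * t * B + C"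
   using i fg by (simp add: A_def B_def C_def)
  also have "... = A * t^2 + 2 * B * t + C" by (simp add: mult_ac)
  finally show ?thesis .
 qed
 have "0 \<le> A" "0 \<le> C" by (simp_all add: A_def C_def)
 have "B^2 \<le> A * C"
 proof (cases "A = 0")
  case True
  have "B = 0"
  proof (rule ccontr)
   assume "B \<noteq> 0"
   have "0 \<le> 2 * B * (- (C + 1) / (2 * B)) + C" using q[of "- (C + 1) / (2 * B)"] True by simp
   then show False using \<open>B \<noteq> 0\<close> by simp
  qed
  then show ?thesis using True by simp
 next
  case False
  then have A: "0 < A" using \<open>0 \<le> A\<close> by simp
  have "0 \<le> A * (- B / A)^2 + 2 * B * (- B / A) + C" by (rule q)
  also have "... = C - B^2 / A" using A by (simp add: power2_eq_square field_simps)
  finally show ?thesis using A by (simp add: field_simps)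
 qed
 then show "(\<integral>x. f x * g x \<partial>M)^2 \<le> (\<integral>x. (f x)^2 \<partial>M) * (\<integral>x. (g x)^2 \<partial>M)"
  by (simp add: A_def B_def C_def)
qed

definition mollifier :: "real => ('a::euclidean_space => real) => bool" where
 "mollifier e k \<longleftrightarrow> Ck 3 k \<and> (\<forall>x. 0 \<le> k x) \<and> (\<forall>x. k (- x) = k x) \<and>
   (\<forall>x. e \<le> norm x \<longrightarrow> k x = 0) \<and> integral\<^sup>L lborel k = 1"

text \<open>Mollifiers are normalised powers of \<open>max 0 (c - x \<bullet> x)\<close>. Only three derivatives are ever taken, so that a
polynomial profile is enough.\<close>

lemma DERIV_pos_part_power:
 "((\<lambda>s::real. max 0 s ^ Suc (Suc k)) has_real_derivative real (Suc (Suc k)) * max 0 s ^ Suc k) (at s)"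
proof -
 consider "s < 0" | "s = 0" | "0 < s" by linarith
 then show ?thesis
 proof cases
  case 1
  have "((\<lambda>s::real. 0) has_real_derivative 0) (at s)" by simp
  then have "((\<lambda>s::real. max 0 s ^ Suc (Suc k)) has_real_derivative 0) (at s)"
   by (rule has_field_derivative_transform_within_open[where S = "{..<0}"]) (use 1 in \<open>auto simp: max_def\<close>)
  then show ?thesis using 1 by (simp add: max_def)
 next
  case 3
  have "((\<lambda>s::real. s ^ Suc (Suc k)) has_real_derivative real (Suc (Suc k)) * s ^ Suc k) (at s)"
   by (rule DERIV_pow[THEN DERIV_cong]) simp
  then have "((\<lambda>s::real. max 0 s ^ Suc (Suc k)) has_real_derivative real (Suc (Suc k)) * s ^ Suc k) (at s)"
   by (rule has_field_derivative_transform_within_open[where S = "{0<..}"]) (use 3 in \<open>auto simp: max_def\<close>)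
  then show ?thesis using 3 by (simp add: max_def)
 next
  case 2
  have "(\<lambda>h::real. (max 0 (0 + h) ^ Suc (Suc k) - max 0 0 ^ Suc (Suc k)) / h) \<midarrow>0\<rightarrow> 0"
  proof (rule Lim_null_comparison)
   have "\<bar>max 0 h ^ Suc (Suc k) / h\<bar> \<le> \<bar>h\<bar> ^ Suc k" for h :: real
   proof (cases "0 < h")
    case True then show ?thesis by (simp add: max_def)
   next
    case False
    then have m: "max 0 h = 0" by simp
    have "\<bar>max 0 h ^ Suc (Suc k) / h\<bar> = 0" unfolding m by simp
    then show ?thesis by (metis abs_ge_zero zero_le_power)
   qed
   then show "\<forall>\<^sub>F h in at (0::real). norm ((max 0 (0 + h) ^ Suc (Suc k) - max 0 0 ^ Suc (Suc k)) / h) \<le> \<bar>h\<bar> ^ Suc k"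
    by (intro always_eventually) simp
   have "(\<lambda>h::real. \<bar>h\<bar> ^ Suc k) \<midarrow>0\<rightarrow> \<bar>0\<bar> ^ Suc k" by (intro tendsto_intros)
   then show "(\<lambda>h::real. \<bar>h\<bar> ^ Suc k) \<midarrow>0\<rightarrow> 0" by simp
  qed
  then show ?thesis using 2 by (simp add: DERIV_def)
 qed
qed

lemma Ck_bump: "Ck k (\<lambda>x::'a::euclidean_space. max 0 (c - x \<bullet> x) ^ Suc k)"
proof (induction k)
 case 0 then show ?case by (auto intro!: continuous_intros)
next
 case (Suc k)
 have D: "((\<lambda>x::'a. c - x \<bullet> x) has_derivative (\<lambda>v. - 2 * (x \<bullet> v))) (at x)" for x
  by (auto intro!: derivative_eq_intros simp: inner_commute)
 then have df: "(\<lambda>x::'a. c - x \<bullet> x) differentiable at x" for x by (auto simp: differentiable_def)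
 have p: "pd v (\<lambda>x::'a. c - x \<bullet> x) x = - 2 * (x \<bullet> v)" for v x using pdI[OF D] .
 have e: "pd v (\<lambda>x::'a. max 0 (c - x \<bullet> x) ^ Suc (Suc k)) =
   (\<lambda>x. real (Suc (Suc k)) * max 0 (c - x \<bullet> x) ^ Suc k * (- 2 * (x \<bullet> v)))" for v
  using pd_real_compose(1)[OF df DERIV_pos_part_power, of v] p by (intro ext) metis
 have "Ck k (\<lambda>x::'a. real (Suc (Suc k)) * max 0 (c - x \<bullet> x) ^ Suc k * (- 2 * (x \<bullet> v)))" for v
  by (intro Ck_mult Ck_const Suc.IH Ck_linear bounded_linear_inner_left)
 then show ?case
  unfolding Ck.simps e using pd_real_compose(2)[OF df DERIV_pos_part_power] by blast
qed

lemma mollifier_exists: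
 assumes e: "0 < e" shows "\<exists>k::'a::euclidean_space => real. mollifier e k"
proof -
 define f where "f x = max 0 (e^2 - x \<bullet> x) ^ Suc 3" for x :: 'a
 have C: "Ck 3 f" unfolding f_def by (rule Ck_bump)
 have nn: "0 \<le> f x" for x by (simp add: f_def)
 have z: "f x = 0" if "e \<le> norm x" for x
 proof -
  have "e^2 \<le> x \<bullet> x" using that e by (simp add: dot_square_norm power_mono)
  then show ?thesis by (simp add: f_def)
 qed
 have b: "bsupp f" using z by (rule bsuppI)
 have i: "integrable lborel f" using integrable_bsupp[OF Ck_cont[OF C] b] .
 define I where "I = integral\<^sup>L lborel f"
 have "0 < I"
 proof -
  define d where "d = (e^2 * 3 / 4) ^ 4"
  have d: "0 < d" using e by (simp add: d_def)
  have bi: "integrable lborel (indicat_real (ball (0::'a) (e/2)))"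
   by (rule integrable_real_indicator) (use emeasure_lborel_ball_finite[of "0::'a" "e/2"] in auto)
  have "0 < d * measure lborel (ball (0::'a) (e/2))"
   using d content_ball_pos[of "e/2" "0::'a"] e by simp
  also have "... = (LBINT x. d * indicator (ball (0::'a) (e/2)) x)"
   using bi by simp
  also have "... \<le> I" unfolding I_def
  proof (rule integral_mono[OF _ i])
   show "integrable lborel (\<lambda>x. d * indicator (ball (0::'a) (e/2)) x)" using bi by simp
   fix x :: 'a
   show "d * indicator (ball (0::'a) (e/2)) x \<le> f x"
   proof (cases "norm x < e/2")
    case True
    have "(norm x)^2 \<le> (e/2)^2" using True by (intro power_mono) auto
    then have "e^2 * 3 / 4 \<le> e^2 - x \<bullet> x" by (simp add: dot_square_norm power_divide)
    then have "(e^2 * 3 / 4) ^ 4 \<le> max 0 (e^2 - x \<bullet> x) ^ 4" by (intro power_mono max.coboundedI2) auto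
    then show ?thesis using True by (simp add: f_def d_def)
   qed (use nn in simp)
  qed
  finally show ?thesis .
 qed
 have ev: "f (- x) = f x" for x by (simp add: f_def)
 have "mollifier e (\<lambda>x. (1 / I) * f x)"
  unfolding mollifier_def using Ck_cmult[OF C, of "1/I"] nn z \<open>0 < I\<close> i
  by (auto simp: I_def ev)
 then show ?thesis by blast
qed

lemma
 assumes "mollifier e k"
 shows mollifier_Ck: "Ck 3 k" and mollifier_cont: "continuous_on UNIV k"
  and mollifier_bsupp: "bsupp k" and mollifier_nonneg: "0 \<le> k x" and mollifier_even: "k (- x) = k x"
  and mollifier_integral: "integral\<^sup>L lborel k = 1" and mollifier_zero: "e \<le> norm x ==> k x = 0"
  and mollifier_C1: "Ck 1 k" and mollifier_C2: "Ck 2 k"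
 using assms Ck_cont[of 3 k] Ck_mono[of 3 k 1] Ck_mono[of 3 k 2] by (auto simp: mollifier_def intro: bsuppI)

lemma lborel_reflect:
 fixes f :: "'a::euclidean_space => real"
 assumes [measurable]: "f \<in> borel_measurable borel"
 shows "(LBINT y. f (x - y)) = integral\<^sup>L lborel f"
proof -
 have "lborel = distr lborel borel (\<lambda>y::'a. x + (-1) *\<^sub>R y)"
  using lborel_affine[of "-1" x] by (simp add: density_1 one_ennreal_def[symmetric])
 then have "integral\<^sup>L lborel f = integral\<^sup>L (distr lborel borel (\<lambda>y::'a. x + (-1) *\<^sub>R y)) f" by simp
 then show ?thesis by (simp add: integral_distr)
qed

lemma conv_const: "mollifier e k ==> conv k (\<lambda>_. c) x = c"
 unfolding conv_def using lborel_reflect[of k x] mollifier_integral[of e k]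
 by (simp add: borel_measurable_cont mollifier_cont)

lemma conv_mono:
 assumes k: "mollifier e k" and f: "loc_int f" "loc_int g"
  and le: "\<And>y. norm (x - y) < e ==> f y \<le> g y"
 shows "conv k f x \<le> conv k g x"
 unfolding conv_def
proof (rule integral_mono)
 show "integrable lborel (\<lambda>y. k (x - y) * f y)" "integrable lborel (\<lambda>y. k (x - y) * g y)"
  using conv_integrable f mollifier_cont[OF k] mollifier_bsupp[OF k] by blast+
 fix y show "k (x - y) * f y \<le> k (x - y) * g y"
  using le mollifier_nonneg[OF k] mollifier_zero[OF k, of "x - y"]
  by (cases "norm (x - y) < e") (auto intro: mult_left_mono)
qed

lemma conv_approx:
 assumes q: "mollifier e q" and f: "loc_int f" and le: "\<And>y. norm (x - y) < e ==> \<bar>f y - a\<bar> \<le> d"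
 shows "\<bar>conv q f x - a\<bar> \<le> d"
proof -
 have c: "loc_int (\<lambda>_. k)" for k by (rule loc_int_cont) simp
 have "conv q f x \<le> conv q (\<lambda>_. a + d) x" using le by (intro conv_mono[OF q f c]) force
 moreover have "conv q (\<lambda>_. a - d) x \<le> conv q f x" using le by (intro conv_mono[OF q c f]) force
 ultimately show ?thesis by (simp add: conv_const[OF q])
qed

lemma conv_nonneg: "mollifier e k ==> (\<And>y. 0 \<le> f y) ==> 0 \<le> conv k f x"
 unfolding conv_def by (intro integral_nonneg_AE AE_I2 mult_nonneg_nonneg) (auto simp: mollifier_nonneg[of e k])

lemma conv_Cauchy_Schwarz:
 assumes k: "mollifier e k" and [measurable]: "f \<in> borel_measurable borel" "g \<in> borel_measurable borel"
  and f: "loc_int (\<lambda>x. (f x)^2)" and g: "loc_int (\<lambda>x. (g x)^2)"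
 shows "(conv k (\<lambda>y. f y * g y) x)^2 \<le> conv k (\<lambda>y. (f y)^2) x * conv k (\<lambda>y. (g y)^2) x"
proof -
 have [measurable]: "k \<in> borel_measurable borel" using mollifier_cont[OF k] by (rule borel_measurable_cont)
 have sq: "sqrt (k z) * sqrt (k z) = k z" for z using mollifier_nonneg[OF k] by simp
 have e: "(\<lambda>y. (sqrt (k (x - y)) * h y)^2) = (\<lambda>y. k (x - y) * (h y)^2)" for h
  using mollifier_nonneg[OF k] by (simp add: power_mult_distrib)
 have e2: "(\<lambda>y. (sqrt (k (x - y)) * f y) * (sqrt (k (x - y)) * g y)) = (\<lambda>y. k (x - y) * (f y * g y))"
  using sq by (metis (no_types, opaque_lifting) mult.assoc mult.left_commute)
 have "(LBINT y. (sqrt (k (x - y)) * f y) * (sqrt (k (x - y)) * g y))^2 \<le>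
   (LBINT y. (sqrt (k (x - y)) * f y)^2) * (LBINT y. (sqrt (k (x - y)) * g y)^2)"
 proof (rule integral_Cauchy_Schwarz(2))
  show "integrable lborel (\<lambda>y. (sqrt (k (x - y)) * f y)^2)" "integrable lborel (\<lambda>y. (sqrt (k (x - y)) * g y)^2)"
   unfolding e using conv_integrable[OF _ mollifier_cont[OF k] mollifier_bsupp[OF k]] f g by blast+
 qed measurable
 then show ?thesis unfolding e e2 conv_def .
qed

lemma conv_Jensen:
 assumes k: "mollifier e k" and "f \<in> borel_measurable borel" and f: "loc_int (\<lambda>x. (f x)^2)"
 shows "(conv k f x)^2 \<le> conv k (\<lambda>y. (f y)^2) x"
 using conv_Cauchy_Schwarz[OF k assms(2) _ f, of "\<lambda>_. 1"] conv_const[OF k, of 1]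
 by (simp add: loc_int_cont)

definition moll :: "nat => 'a::euclidean_space => real" where
 "moll n = (SOME k. mollifier (1 / real (Suc n)) k)"

lemma moll: "mollifier (1 / real (Suc n)) (moll n)"
 unfolding moll_def by (rule someI_ex[OF mollifier_exists]) simp

lemma conv_moll_uniform:
 fixes f :: "'a::euclidean_space => real"
 assumes f: "continuous_on UNIV f" "bsupp f" and e: "0 < e"
 shows "\<exists>N. \<forall>n\<ge>N. \<forall>x. \<bar>conv (moll n) f x - f x\<bar> \<le> e"
proof -
 obtain d where d: "0 < d" "\<And>x y. norm (x - y) < d ==> \<bar>f x - f y\<bar> < e"
  using uniform_cont_bsupp[OF f e] by blast
 obtain N where N: "1 / real (Suc N) < d" using d(1) nat_approx_posE by blast
 show ?thesis
 proof (intro exI[of _ N] allI impI)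
  fix n and x :: 'a assume "N \<le> n"
  then have n: "1 / real (Suc n) < d" using N by (smt (verit) Suc_le_mono frac_le of_nat_0_less_iff of_nat_le_iff zero_less_Suc)
  show "\<bar>conv (moll n) f x - f x\<bar> \<le> e"
  proof (rule conv_approx[OF moll loc_int_cont[OF f(1)]])
   fix y assume "norm (x - y) < 1 / real (Suc n)"
   then show "\<bar>f y - f x\<bar> \<le> e" using d(2)[of y x] n by (simp add: norm_minus_commute)
  qed
 qed
qed

lemma conv_moll_pointwise:
 fixes f :: "'a::euclidean_space => real"
 assumes f: "continuous_on UNIV f"
 shows "(\<lambda>n. conv (moll n) f x) \<longlonglongrightarrow> f x"
proof (rule LIMSEQ_I)
 fix r :: real assume "0 < r"
 then obtain d where d: "0 < d" "\<And>y. dist y x < d ==> dist (f y) (f x) < r / 2"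
  using f[unfolded continuous_on_iff, rule_format, of x "r/2"] by auto
 obtain N where N: "1 / real (Suc N) < d" using d(1) nat_approx_posE by blast
 show "\<exists>N. \<forall>n\<ge>N. norm (conv (moll n) f x - f x) < r"
 proof (intro exI[of _ N] allI impI)
  fix n assume "N \<le> n"
  then have n: "1 / real (Suc n) < d" using N by (smt (verit) Suc_le_mono frac_le of_nat_0_less_iff of_nat_le_iff zero_less_Suc)
  have "\<bar>conv (moll n) f x - f x\<bar> \<le> r / 2"
  proof (rule conv_approx[OF moll loc_int_cont[OF f(1)]])
   fix y assume "norm (x - y) < 1 / real (Suc n)"
   then show "\<bar>f y - f x\<bar> \<le> r / 2" using d(2)[of y] n by (simp add: dist_norm norm_minus_commute)
  qed
  then show "norm (conv (moll n) f x - f x) < r" using \<open>0 < r\<close> by simp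
 qed
qed

lemma conv_moll_self_adjoint:
 fixes g :: "'a::euclidean_space => real"
 assumes "loc_int g" "continuous_on UNIV f" "bsupp f"
 shows "(LBINT x. conv (moll n) g x * f x) = (LBINT y. g y * conv (moll n) f y)"
proof -
 have "(\<lambda>z. moll n (- z)) = (moll n :: 'a => real)" using mollifier_even[OF moll] by blast
 then show ?thesis
  using conv_adjoint[OF assms(1) mollifier_cont[OF moll] mollifier_bsupp[OF moll] assms(2,3)] by simp
qed

lemma conv_moll_zero:
 assumes "\<And>x. M \<le> norm x ==> f x = 0" "M + 1 \<le> norm x" shows "conv (moll n) f x = 0"
proof -
 have "moll n (x - y) * f y = 0" for y
 proof (cases "M \<le> norm y")
  case False
  then have "1 \<le> norm (x - y)" using assms(2) norm_triangle_ineq2[of x y] by simp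
  then have "1 / real (Suc n) \<le> norm (x - y)" by (rule order_trans[rotated]) simp
  then have "moll n (x - y) = 0" by (rule mollifier_zero[OF moll])
  then show ?thesis by simp
 qed (simp add: assms)
 then show ?thesis unfolding conv_def by (subst Bochner_Integration.integral_cong[OF refl, of _ _ "\<lambda>_. 0"]) auto
qed

lemma conv_moll_weak:
 fixes g :: "'a::euclidean_space => real"
 assumes g: "loc_int g" and f: "continuous_on UNIV f" "bsupp f"
 shows "(\<lambda>n. LBINT x. conv (moll n) g x * f x) \<longlonglongrightarrow> (LBINT x. g x * f x)"
proof -
 obtain M where M: "0 < M" "\<And>x. M \<le> norm x ==> f x = 0" using bsuppE[OF f(2)] by blast
 obtain B where B: "0 < B" "\<And>x. \<bar>f x\<bar> \<le> B" using bsupp_bounded[OF f] by blast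
 show ?thesis unfolding conv_moll_self_adjoint[OF assms]
proof (rule integral_dominated_convergence[where w = "\<lambda>x. B * (indicator (cball 0 (M+1)) x * \<bar>g x\<bar>)"])
 show "integrable lborel (\<lambda>x. B * (indicator (cball 0 (M+1)) x * \<bar>g x\<bar>))"
  using loc_int_abs[OF g] by (simp add: loc_int_def)
 note [measurable] = loc_int_measurable[OF g] borel_measurable_cont[OF f(1)]
 show "(\<lambda>x. g x * f x) \<in> borel_measurable lborel" by measurable
 fix n
 have [measurable]: "conv (moll n) f \<in> borel_measurable borel"
  by (intro borel_measurable_cont continuous_conv loc_int_cont f mollifier_cont[OF moll] mollifier_bsupp[OF moll])
 show "(\<lambda>x. g x * conv (moll n) f x) \<in> borel_measurable lborel" by measurable
 show "AE x in lborel. norm (g x * conv (moll n) f x) \<le> B * (indicator (cball 0 (M+1)) x * \<bar>g x\<bar>)"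
 proof (rule AE_I2)
  fix x
  have "\<bar>conv (moll n) f x\<bar> \<le> B"
   using conv_approx[OF moll loc_int_cont[OF f(1)], of x n 0 B] B by simp
  then show "norm (g x * conv (moll n) f x) \<le> B * (indicator (cball 0 (M+1)) x * \<bar>g x\<bar>)"
   using conv_moll_zero[of M f x n] M
   by (cases "norm x \<le> M + 1") (auto simp: abs_mult mult.commute[of B] intro!: mult_left_mono)
 qed
next
 show "AE x in lborel. (\<lambda>n. g x * conv (moll n) f x) \<longlonglongrightarrow> g x * f x"
  by (intro AE_I2 tendsto_mult tendsto_const conv_moll_pointwise f)
qed
qed

lemma Ck2_pd: "Ck 2 f ==> Ck 1 (pd v f)"
 using Ck_pd[of 1 f v] by (simp del: Ck.simps add: eval_nat_numeral)

lemma Ck3_pd: "Ck 3 f ==> Ck 2 (pd v f)"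
 using Ck_pd[of 2 f v] by (simp del: Ck.simps add: eval_nat_numeral)

text \<open>The two derivatives of a mollification can be moved between kernel and function one at a time, so the mollified
mixed derivatives agree.\<close>

lemma pd_commute:
 fixes f :: "'a::euclidean_space => real"
 assumes f: "Ck 2 f" shows "pd a (pd b f) = pd b (pd a f)"
proof
 fix x
 have f1: "Ck 1 f" by (rule Ck_mono[OF f]) simp
 have f': "Ck 1 (pd v f)" for v using f by (rule Ck2_pd)
 have f'': "continuous_on UNIV (pd w (pd v f))" for v w using Ck_cont[OF f', of v] f'[of v] by simp
 have "conv (moll n) (pd a (pd b f)) = conv (moll n) (pd b (pd a f))" for n
 proof -
  define k :: "'a => real" where "k = moll n"
  have e: "Ck 1 k" "Ck 1 (pd v k)" "bsupp k" "bsupp (pd v k)" for v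
   unfolding k_def using mollifier_C1[OF moll] Ck2_pd[OF mollifier_C2[OF moll]] mollifier_bsupp[OF moll] bsupp_pd
   by blast+
  have l: "loc_int f" "loc_int (pd v f)" for v using loc_int_cont Ck_cont f1 f' by blast+
  have s: "conv k (pd w (pd v f)) = conv (pd v (pd w k)) f" for v w
   using conv_pd_swap[OF f' e(1,3)] conv_pd_swap[OF f1 e(2,4)] by metis
  have "conv (pd a (pd b k)) f = pd a (conv (pd b k) f)" using pd_conv[OF l(1) e(2,4)] by simp
  also have "conv (pd b k) f = conv k (pd b f)" by (rule conv_pd_swap[OF f1 e(1,3)])
  also have "pd a ... = conv (pd a k) (pd b f)" by (rule pd_conv[OF l(2) e(1,3)])
  also have "... = conv k (pd a (pd b f))" by (rule conv_pd_swap[OF f' e(1,3)])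
  finally show ?thesis using s[of b a] unfolding k_def by metis
 qed
 then have "(\<lambda>n. conv (moll n) (pd a (pd b f)) x) \<longlonglongrightarrow> pd b (pd a f) x"
  using conv_moll_pointwise[OF f''[of b a], of x] by simp
 then show "pd a (pd b f) x = pd b (pd a f) x"
  using conv_moll_pointwise[OF f''] LIMSEQ_unique by blast
qed

text \<open>Continuous functions decreasing to the indicator of a box show that \<open>d\<close> has integral zero over all boxes;
Lebesgue's differentiation theorem then recovers \<open>d\<close> almost everywhere.\<close>

lemma AE_zero_if_test_zero:
 fixes d :: "'a::euclidean_space => real"
 assumes d: "loc_int d"
  and z: "\<And>f. continuous_on UNIV f ==> bsupp f ==> (LBINT x. d x * f x) = 0"
 shows "AE x in lborel. d x = 0"
proof -
 note [measurable] = loc_int_measurable[OF d]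
 have int: "set_integrable lborel (cbox a b) d" for a b
 proof -
  obtain M where "\<forall>x\<in>cbox a b. norm x \<le> M" using bounded_cbox[of a b] by (auto simp: bounded_iff)
  then have M: "cbox a b \<subseteq> cball 0 M" by auto
  have "integrable lborel (\<lambda>x. indicator (cbox a b) x *\<^sub>R (indicator (cball 0 M) x * d x))"
   by (rule integrable_mult_indicator) (use d in \<open>auto simp: loc_int_def\<close>)
  moreover have "(\<lambda>x. indicator (cbox a b) x *\<^sub>R (indicator (cball 0 M) x * d x)) = (\<lambda>x. indicator (cbox a b) x *\<^sub>R d x)"
   using M by (auto simp: fun_eq_iff indicator_def)
  ultimately show ?thesis by (simp add: set_integrable_def)
 qed
 have box0: "(LINT x:cbox a b|lborel. d x) = 0" for a b
 proof (cases "cbox a b = {}")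
  case False
  define f where "f k x = max 0 (1 - real k * infdist x (cbox a b))" for k and x :: 'a
  have ne: "infdist x (cbox a b) = 0 \<longleftrightarrow> x \<in> cbox a b" for x
   using in_closed_iff_infdist_zero[OF closed_cbox False] by blast
  obtain M where M: "0 < M" "\<forall>x\<in>cbox a b. norm x \<le> M" using bounded_cbox bounded_pos by metis
  have far: "f k x = 0" if "M + 1 \<le> norm x" "1 \<le> k" for k x
  proof -
   have "1 \<le> infdist x (cbox a b)"
   proof (rule ccontr)
    assume "\<not> 1 \<le> infdist x (cbox a b)"
    then obtain y where "y \<in> cbox a b" "dist x y < 1"
     using infdist_attains_inf[OF closed_cbox False, of x] by (metis not_le)
    then show False using M(2) that norm_triangle_ineq2[of x y] by (force simp: dist_norm)
   qed
   then have "1 \<le> real k * infdist x (cbox a b)" using that(2)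
    by (metis (no_types, opaque_lifting) mult_mono mult_1 of_nat_1 of_nat_le_iff of_nat_0_le_iff zero_le_one order.trans)
   then show ?thesis by (simp add: f_def)
  qed
  have c: "continuous_on UNIV (f k)" for k unfolding f_def by (intro continuous_intros)
  have "(\<lambda>n. LBINT x. d x * f (Suc n) x) \<longlonglongrightarrow> (LBINT x. indicator (cbox a b) x *\<^sub>R d x)"
  proof (rule integral_dominated_convergence)
   show "integrable lborel (\<lambda>x. indicator (cball 0 (M+1)) x * \<bar>d x\<bar>)"
    using loc_int_abs[OF d] by (simp add: loc_int_def)
   show "(\<lambda>x. indicator (cbox a b) x *\<^sub>R d x) \<in> borel_measurable lborel" by measurable
   show "AE x in lborel. (\<lambda>n. d x * f (Suc n) x) \<longlonglongrightarrow> indicator (cbox a b) x *\<^sub>R d x"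
   proof (rule AE_I2)
    fix x
    show "(\<lambda>n. d x * f (Suc n) x) \<longlonglongrightarrow> indicator (cbox a b) x *\<^sub>R d x"
    proof (cases "x \<in> cbox a b")
     case True then show ?thesis using ne[of x] by (simp add: f_def)
    next
     case False
     then have p: "0 < infdist x (cbox a b)" using ne[of x] infdist_nonneg[of x "cbox a b"] by linarith
     obtain N :: nat where N: "1 / infdist x (cbox a b) < real N" using reals_Archimedean2 by blast
     have "f (Suc n) x = 0" if "N \<le> n" for n
     proof -
      have "1 / infdist x (cbox a b) \<le> real (Suc n)" using N that by linarith
      then have "1 \<le> real (Suc n) * infdist x (cbox a b)" using p by (simp add: pos_divide_le_eq)
      then show ?thesis by (simp add: f_def)
     qed
     then have "\<forall>\<^sub>F n in sequentially. d x * f (Suc n) x = 0" unfolding eventually_sequentially by (intro exI[of _ N]) auto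
     then show ?thesis using False by (simp add: tendsto_eventually)
    qed
   qed
   fix n
   have [measurable]: "f (Suc n) \<in> borel_measurable borel" using c by (rule borel_measurable_cont)
   show "(\<lambda>x. d x * f (Suc n) x) \<in> borel_measurable lborel" by measurable
   show "AE x in lborel. norm (d x * f (Suc n) x) \<le> indicator (cball 0 (M+1)) x * \<bar>d x\<bar>"
   proof (rule AE_I2)
    fix x
    have "0 \<le> f (Suc n) x" "f (Suc n) x \<le> 1" by (auto simp: f_def infdist_nonneg)
    then show "norm (d x * f (Suc n) x) \<le> indicator (cball 0 (M+1)) x * \<bar>d x\<bar>"
     using far[of x "Suc n"] by (cases "norm x \<le> M + 1") (auto simp: abs_mult mult_left_le)
   qed
  qed
  moreover have "(LBINT x. d x * f (Suc n) x) = 0" for n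
   by (rule z[OF c bsuppI[OF far]]) auto
  ultimately show ?thesis by (simp add: set_lebesgue_integral_def LIMSEQ_const_iff)
 qed (simp add: set_lebesgue_integral_def)
 have HK: "d integrable_on cbox a b" "integral (cbox a b) d = 0" for a b
  using set_borel_integral_eq_integral[OF int[of a b]] box0[of a b] by auto
 obtain N where N: "negligible N" "\<And>x e. [| x \<notin> N; 0 < e |] ==> \<exists>\<delta>>0. \<forall>h. 0 < h \<and> h < \<delta> \<longrightarrow>
    norm (integral (cbox x (x + h *\<^sub>R One)) d /\<^sub>R h ^ DIM('a) - d x) < e"
  using integrable_ccontinuous_explicit[of d] HK(1) by blast
 have "d x = 0" if "x \<notin> N" for x
 proof (rule ccontr)
  assume "d x \<noteq> 0"
  then obtain \<delta> where "\<delta> > 0" "\<forall>h. 0 < h \<and> h < \<delta> \<longrightarrow>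
    norm (integral (cbox x (x + h *\<^sub>R One)) d /\<^sub>R h ^ DIM('a) - d x) < \<bar>d x\<bar>"
   using N(2)[OF \<open>x \<notin> N\<close>, of "\<bar>d x\<bar>"] by auto
  then have "norm (0 - d x) < \<bar>d x\<bar>" using HK(2) by (metis dense scaleR_zero_right)
  then show False by simp
 qed
 then have "{x. d x \<noteq> 0} \<subseteq> N" by blast
 then have "negligible {x. d x \<noteq> 0}" using N(1) negligible_subset by blast
 then have "{x. d x \<noteq> 0} \<in> null_sets lebesgue" by (simp add: negligible_iff_null_sets)
 then have "{x. d x \<noteq> 0} \<in> null_sets lborel"
  by (subst (asm) null_sets_completion_iff) auto
 then show ?thesis by (rule AE_I') auto
qed

section \<open>Density of the range of a weighted Laplacian\<close>

text \<open>The generator \<open>\<Delta> u - \<nabla>U \<cdot> \<nabla>u\<close>, symmetric with respect to the density \<open>exp (- U)\<close>.\<close>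

definition gen :: "('a::euclidean_space => real) => ('a => real) => 'a => real" where
 "gen U u x = (\<Sum>b\<in>Basis. pd b (pd b u) x - pd b U x * pd b u x)"

lemma pd_exp_minus:
 assumes "U differentiable at x"
 shows "pd v (\<lambda>x. exp (- U x)) x = - pd v U x * exp (- U x)"
proof -
 have "pd v (\<lambda>x. -1 * U x) x = -1 * pd v U x" by (rule pd_cmult[OF assms])
 moreover have "(\<lambda>x. -1 * U x) differentiable at x"
  using assms by simp
 ultimately show ?thesis using pd_real_compose(1)[of "\<lambda>x. -1 * U x" x exp _ v, OF _ DERIV_exp] by simp
qed

lemma Ck_exp_minus: "Ck k U ==> Ck k (\<lambda>x. exp (- U x))"
 using Ck_exp[OF Ck_cmult[of k U "-1"]] by simp

lemma Ck_gen: assumes "Ck 2 U" "Ck 3 u" shows "Ck 1 (gen U u)"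
proof -
 have "Ck 1 (pd b (pd b u))" "Ck 1 (pd b U)" "Ck 1 (pd b u)" for b
  using Ck2_pd[OF Ck3_pd[OF assms(2)]] Ck2_pd[OF assms(1)] Ck_mono[OF Ck3_pd[OF assms(2)], of 1] by auto
 then show ?thesis unfolding gen_def by (intro Ck_sum Ck_minus Ck_mult)
qed

lemma bsupp_gen: "bsupp u ==> bsupp (gen U u)"
 unfolding gen_def by (intro bsupp_sum bsupp_diff bsupp_mult2 bsupp_pd)

lemma integral_gen:
 fixes U :: "'a::euclidean_space => real"
 assumes U: "Ck 1 U" and u: "Ck 2 u" "bsupp u" and f: "Ck 1 f"
 shows "(LBINT x. f x * gen U u x * exp (- U x)) =
   - (\<Sum>b\<in>Basis. LBINT x. pd b f x * pd b u x * exp (- U x))"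
proof -
 define w where "w x = exp (- U x)" for x
 have w: "Ck 1 w" unfolding w_def by (rule Ck_exp_minus[OF U])
 have dU: "U differentiable at x" for x using U by simp
 have d: "pd b u differentiable at x" "w differentiable at x" for b x
  using Ck2_pd[OF u(1)] w by simp_all
 have g: "Ck 1 (\<lambda>x. pd b u x * w x)" "bsupp (\<lambda>x. pd b u x * w x)" for b
  using Ck_mult[OF Ck2_pd[OF u(1)] w] bsupp_mult1[OF bsupp_pd[OF u(2)]] by auto
 have e: "pd b (\<lambda>x. pd b u x * w x) = (\<lambda>x. (pd b (pd b u) x - pd b U x * pd b u x) * w x)" for b
 proof
  fix x
  have "pd b w x = - pd b U x * w x" using pd_exp_minus[OF dU] by (simp add: w_def[abs_def])
  then show "pd b (\<lambda>x. pd b u x * w x) x = (pd b (pd b u) x - pd b U x * pd b u x) * w x"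
   by (simp add: pd_mult d algebra_simps)
 qed
 have i: "integrable lborel (\<lambda>x. f x * pd b (\<lambda>x. pd b u x * w x) x)" for b
  using Ck_cont[OF f] Ck_cont[OF Ck_pd[of 0 "\<lambda>x. pd b u x * w x" b]] g(1)[of b]
  by (intro integrable_bsupp continuous_on_mult bsupp_mult2 bsupp_pd g) simp_all
 have "(\<lambda>x. f x * gen U u x * w x) = (\<lambda>x. \<Sum>b\<in>Basis. f x * pd b (\<lambda>x. pd b u x * w x) x)"
  unfolding e gen_def by (simp add: sum_distrib_left sum_distrib_right mult.assoc)
 then have "(LBINT x. f x * gen U u x * w x) = (\<Sum>b\<in>Basis. LBINT x. f x * pd b (\<lambda>x. pd b u x * w x) x)"
  using i by simp
 also have "... = (\<Sum>b\<in>Basis. - (LBINT x. pd b f x * (pd b u x * w x)))"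
  using integral_by_parts[OF f g(1)] g(2) by (intro sum.cong refl) simp
 finally show ?thesis by (simp add: w_def sum_negf mult.assoc)
qed

text \<open>A subspace \<open>D\<close> approximates \<open>f\<close> in \<open>L\<^sup>2\<close> if \<open>f\<close> is orthogonal to everything that \<open>D\<close> is orthogonal to. The proof is the
projection theorem by hand: the residuals \<open>f - g\<^sub>k\<close> of a minimising sequence form a Cauchy sequence by
the parallelogram identity, and their limit \<open>R\<close> is orthogonal to \<open>D\<close>. Then \<open>R\<close> is orthogonal to \<open>f\<close>, hence
to every residual and to itself.\<close>

lemma L2_dense:
 fixes f :: "'a => real" and D :: "('a => real) set"
 assumes fin: "finite_measure M"
  and f [measurable]: "f \<in> borel_measurable M" and f2: "integrable M (\<lambda>x. (f x)^2)"
  and Dm: "\<And>g. g \<in> D ==> g \<in> borel_measurable M" and D2: "\<And>g. g \<in> D ==> integrable M (\<lambda>x. (g x)^2)"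
  and Dne: "D \<noteq> {}" and Dadd: "\<And>g h a. g \<in> D ==> h \<in> D ==> (\<lambda>x. g x + a * h x) \<in> D"
  and orth: "\<And>r. r \<in> borel_measurable M ==> integrable M (\<lambda>x. (r x)^2) ==>
    (\<And>g. g \<in> D ==> (\<integral>x. r x * g x \<partial>M) = 0) ==> (\<integral>x. r x * f x \<partial>M) = 0"
  and e: "0 < e"
 shows "\<exists>g\<in>D. (\<integral>x. (f x - g x)^2 \<partial>M) < e"
proof -
 interpret finite_measure M by (rule fin)
 define N where "N g = (\<integral>x. (f x - g x)^2 \<partial>M)" for g
 define d where "d = Inf (N ` D)"
 have N0: "0 \<le> N g" for g unfolding N_def by simp
 have bdd: "bdd_below (N ` D)" using N0 by (intro bdd_belowI[of _ 0]) auto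
 have dle: "d \<le> N g" if "g \<in> D" for g unfolding d_def using bdd that by (intro cInf_lower) auto
 have ex: "\<exists>g. g \<in> D \<and> N g < d + (1/4)^k" for k :: nat
 proof -
  have "\<exists>y\<in>N ` D. y < d + (1/4)^k"
   using cInf_lessD[of "N ` D" "d + (1/4)^k"] Dne by (auto simp: d_def)
  then show ?thesis by blast
 qed
 then obtain g where g: "g k \<in> D" "N (g k) < d + (1/4)^k" for k :: nat by metis
 have [measurable]: "g k \<in> borel_measurable M" for k using Dm g by blast
 have sq2: "integrable M (\<lambda>x. (p x + c * q x)^2)"
  if [measurable]: "p \<in> borel_measurable M" "q \<in> borel_measurable M"
   and "integrable M (\<lambda>x. (p x)^2)" "integrable M (\<lambda>x. (q x)^2)" for p q :: "'a => real" and c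
 proof -
  have "integrable M (\<lambda>x. p x * q x)" by (rule integral_Cauchy_Schwarz(1)) (use that in auto)
  then have "integrable M (\<lambda>x. (p x)^2 + 2 * c * (p x * q x) + c^2 * (q x)^2)"
   using that by (intro Bochner_Integration.integrable_add integrable_mult_right) auto
  then show ?thesis by (simp add: power2_eq_square algebra_simps)
 qed
 define r where "r k x = f x - g k x" for k x
 have rm [measurable]: "r k \<in> borel_measurable M" for k unfolding r_def by measurable
 have r2: "integrable M (\<lambda>x. (r k x)^2)" for k
  using sq2[where c = "-1", OF f _ f2 D2[OF g(1)]] by (simp add: r_def)
 have rN: "(\<integral>x. (r k x)^2 \<partial>M) = N (g k)" for k by (simp add: N_def r_def)
 have rd2: "integrable M (\<lambda>x. (r k x - r l x)^2)" for k l
  using sq2[where c = "-1", OF rm rm r2 r2] by simp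
 have cauchy: "(\<integral>x. (r k x - r l x)^2 \<partial>M) \<le> 2 * (1/4)^k + 2 * (1/4)^l" for k l
 proof -
  have "(\<lambda>x. (\<lambda>x. g k x + 1 * g l x) x + (-1/2) * (\<lambda>x. g k x + 1 * g l x) x) \<in> D"
   by (intro Dadd g)
  then have m: "(\<lambda>x. (g k x + g l x) / 2) \<in> D" by (simp add: field_simps)
  have i: "integrable M (\<lambda>x. (f x - (g k x + g l x) / 2)^2)"
   using sq2[where c = "-1", OF f Dm[OF m] f2 D2[OF m]] by (simp only: mult_minus1 flip: diff_conv_add_uminus)
  have eq: "(\<lambda>x. (r k x - r l x)^2) = (\<lambda>x. 2 * (r k x)^2 + 2 * (r l x)^2 - 4 * (f x - (g k x + g l x) / 2)^2)"
   by (auto simp: r_def power2_eq_square field_simps)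
  have "(\<integral>x. (r k x - r l x)^2 \<partial>M) = 2 * N (g k) + 2 * N (g l) - 4 * N (\<lambda>x. (g k x + g l x) / 2)"
   unfolding eq using i r2 by (simp add: rN) (simp add: N_def)
  then show ?thesis using dle[OF m] g(2)[of k] g(2)[of l] by linarith
 qed
 \<comment> \<open>The rate \<open>(1/4)\<^sup>k\<close> makes the increments summable in \<open>L\<^sup>1\<close>, so that the residuals converge pointwise.\<close>
 define s where "s k x = \<bar>r (Suc k) x - r k x\<bar>" for k x
 have [measurable]: "s k \<in> borel_measurable M" for k unfolding s_def by measurable
 define W where "W = measure M (space M)"
 have s1: "(\<integral>\<^sup>+x. ennreal (s k x) \<partial>M) \<le> ennreal (2 * sqrt W * (1/2)^k)" for k
 proof -
  have si: "integrable M (\<lambda>x. (s k x)^2)" using rd2[of "Suc k" k] by (simp add: s_def)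
  have i1: "integrable M (\<lambda>x. s k x * 1)" and
   CS: "(\<integral>x. s k x * 1 \<partial>M)^2 \<le> (\<integral>x. (s k x)^2 \<partial>M) * (\<integral>x. 1^2 \<partial>M)"
   using integral_Cauchy_Schwarz[of "s k" M "\<lambda>_. 1"] si by auto
  have "(\<integral>x. (s k x)^2 \<partial>M) \<le> 4 * (1/4)^k"
  proof -
   have "(1/4::real)^Suc k \<le> (1/4)^k" by (intro power_decreasing) auto
   then have "2 * (1/4)^Suc k + 2 * (1/4)^k \<le> 4 * (1/4::real)^k" by linarith
   from order_trans[OF cauchy[of "Suc k" k] this] show ?thesis by (simp only: s_def power2_abs)
  qed
  then have "(\<integral>x. (s k x)^2 \<partial>M) * W \<le> 4 * (1/4)^k * W" by (intro mult_right_mono) (simp_all add: W_def)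
  also have "... = (2 * sqrt W * (1/2)^k)^2"
  proof -
   have "((1/2::real)^k)^2 = (1/4)^k" by (simp add: power2_eq_square flip: power_mult_distrib)
   then show ?thesis by (simp add: power_mult_distrib W_def)
  qed
  finally have "(\<integral>x. s k x \<partial>M)^2 \<le> (2 * sqrt W * (1/2)^k)^2" using CS by (simp add: W_def)
  then have "(\<integral>x. s k x \<partial>M) \<le> 2 * sqrt W * (1/2)^k" by (rule power2_le_imp_le) (simp add: W_def)
  moreover have "(\<integral>\<^sup>+x. ennreal (s k x) \<partial>M) = ennreal (\<integral>x. s k x \<partial>M)"
   using i1 by (intro nn_integral_eq_integral) (auto simp: s_def)
  ultimately show ?thesis by (simp add: ennreal_leI)
 qed
 have "(\<integral>\<^sup>+x. (\<Sum>k. ennreal (s k x)) \<partial>M) = (\<Sum>k. \<integral>\<^sup>+x. ennreal (s k x) \<partial>M)"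
  by (rule nn_integral_suminf) measurable
 also have "... \<le> (\<Sum>k. ennreal (2 * sqrt W * (1/2)^k))" by (rule suminf_le[OF s1]) auto
 also have "... < \<infinity>"
 proof -
  have "summable (\<lambda>k. 2 * sqrt W * (1/2::real)^k)" by (intro summable_mult summable_geometric) simp
  then have "(\<Sum>k. ennreal (2 * sqrt W * (1/2)^k)) = ennreal (\<Sum>k. 2 * sqrt W * (1/2)^k)"
   by (intro suminf_ennreal2) (auto simp: W_def)
  then show ?thesis by simp
 qed
 finally have "AE x in M. (\<Sum>k. ennreal (s k x)) \<noteq> \<infinity>" by (intro nn_integral_PInf_AE) auto
 then have conv: "AE x in M. convergent (\<lambda>k. r k x)"
 proof eventually_elim
  case (elim x)
  then have "summable (\<lambda>k. s k x)" by (intro summable_suminf_not_top) (auto simp: s_def)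
  then have "summable (\<lambda>k. norm (r (Suc k) x - r k x))" by (simp add: s_def)
  then have "summable (\<lambda>k. r (Suc k) x - r k x)" by (rule summable_norm_cancel)
  then have "convergent (\<lambda>n. \<Sum>k<n. r (Suc k) x - r k x)" by (simp add: summable_iff_convergent)
  then have "convergent (\<lambda>n. r n x - r 0 x)" by (simp only: sum_lessThan_telescope[of "\<lambda>k. r k x"])
  then show ?case by (simp add: convergent_diff_const_right_iff)
 qed
 define R where "R x = lim (\<lambda>k. r k x)" for x
 have Rm [measurable]: "R \<in> borel_measurable M" unfolding R_def by measurable
 have lim: "AE x in M. (\<lambda>k. r k x) \<longlonglongrightarrow> R x"
  using conv by eventually_elim (simp add: R_def convergent_LIMSEQ_iff)
 have fatou: "(\<integral>\<^sup>+x. ennreal ((R x - r k x)^2) \<partial>M) \<le> ennreal (4 * (1/4)^k)" for k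
 proof -
  have "(\<integral>\<^sup>+x. ennreal ((R x - r k x)^2) \<partial>M) = (\<integral>\<^sup>+x. liminf (\<lambda>l. ennreal ((r l x - r k x)^2)) \<partial>M)"
   using lim
  proof (intro nn_integral_cong_AE, eventually_elim)
   case (elim x)
   have "(\<lambda>l. ennreal ((r l x - r k x)^2)) \<longlonglongrightarrow> ennreal ((R x - r k x)^2)"
    by (intro tendsto_ennrealI tendsto_intros elim)
   from lim_imp_Liminf[OF _ this] show ?case by simp
  qed
  also have "... \<le> liminf (\<lambda>l. \<integral>\<^sup>+x. ennreal ((r l x - r k x)^2) \<partial>M)"
   by (rule nn_integral_liminf) measurable
  also have "... \<le> ennreal (4 * (1/4)^k)"
  proof (rule Liminf_le)
   show "\<forall>\<^sub>F l in sequentially. (\<integral>\<^sup>+x. ennreal ((r l x - r k x)^2) \<partial>M) \<le> ennreal (4 * (1/4)^k)"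
    unfolding eventually_sequentially
   proof (intro exI[of _ k] allI impI)
    fix l assume "k \<le> l"
    then have "(1/4::real)^l \<le> (1/4)^k" by (intro power_decreasing) auto
    then have "(\<integral>x. (r l x - r k x)^2 \<partial>M) \<le> 4 * (1/4)^k" using cauchy[of l k] by linarith
    then show "(\<integral>\<^sup>+x. ennreal ((r l x - r k x)^2) \<partial>M) \<le> ennreal (4 * (1/4)^k)"
     using rd2 by (subst nn_integral_eq_integral) (auto intro: ennreal_leI)
   qed
  qed simp
  finally show ?thesis .
 qed
 have Rr2: "integrable M (\<lambda>x. (R x - r k x)^2)" for k
  by (rule integrableI_bounded) (auto intro: le_less_trans[OF fatou])
 have Rr: "(\<integral>x. (R x - r k x)^2 \<partial>M) \<le> 4 * (1/4)^k" for k
 proof -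
  have "ennreal (\<integral>x. (R x - r k x)^2 \<partial>M) \<le> ennreal (4 * (1/4)^k)"
   using fatou[of k] Rr2[of k] by (subst nn_integral_eq_integral[symmetric]) auto
  then show ?thesis by (simp add: ennreal_le_iff)
 qed
 have R2: "integrable M (\<lambda>x. (R x)^2)"
  using sq2[where c = 1, OF _ rm Rr2[of 0] r2[of 0]] by simp
 have quarter: "(\<lambda>k. C * (1/4::real)^k) \<longlonglongrightarrow> 0" for C :: real
  by (rule tendsto_mult_right_zero, rule LIMSEQ_power_zero) simp
 have ip: "(\<lambda>k. \<integral>x. r k x * h x \<partial>M) \<longlonglongrightarrow> (\<integral>x. R x * h x \<partial>M)"
  if h[measurable]: "h \<in> borel_measurable M" and h2: "integrable M (\<lambda>x. (h x)^2)" for h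
 proof -
  have ih: "integrable M (\<lambda>x. R x * h x)" "integrable M (\<lambda>x. r k x * h x)" for k
   using integral_Cauchy_Schwarz(1)[OF _ h _ h2] R2 r2 by auto
  have "((\<integral>x. R x * h x \<partial>M) - (\<integral>x. r k x * h x \<partial>M))^2 \<le> (4 * (\<integral>x. (h x)^2 \<partial>M)) * (1/4)^k" for k
  proof -
   have "(\<integral>x. R x * h x \<partial>M) - (\<integral>x. r k x * h x \<partial>M) = (\<integral>x. (R x - r k x) * h x \<partial>M)"
    using ih by (simp add: left_diff_distrib)
   also have "...^2 \<le> (\<integral>x. (R x - r k x)^2 \<partial>M) * (\<integral>x. (h x)^2 \<partial>M)"
    using integral_Cauchy_Schwarz(2)[OF _ h Rr2 h2] by simp
   also have "... \<le> (4 * (1/4)^k) * (\<integral>x. (h x)^2 \<partial>M)" using Rr by (intro mult_right_mono) auto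
   finally show ?thesis by (simp add: mult_ac)
  qed
  then have "(\<lambda>k. ((\<integral>x. R x * h x \<partial>M) - (\<integral>x. r k x * h x \<partial>M))^2) \<longlonglongrightarrow> 0"
   by (intro tendsto_sandwich[OF _ _ tendsto_const quarter[of "4 * (\<integral>x. (h x)^2 \<partial>M)"]] always_eventually) auto
  then have "(\<lambda>k. (\<integral>x. R x * h x \<partial>M) - (\<integral>x. r k x * h x \<partial>M)) \<longlonglongrightarrow> 0"
   by (simp add: power_tendsto_0_iff)
  from tendsto_diff[OF tendsto_const[of "\<integral>x. R x * h x \<partial>M"] this] show ?thesis by simp
 qed
 have R0: "(\<integral>x. R x * h x \<partial>M) = 0" if h: "h \<in> D" for h
 proof -
  have [measurable]: "h \<in> borel_measurable M" and h2: "integrable M (\<lambda>x. (h x)^2)" using Dm D2 h by auto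
  define H where "H = (\<integral>x. (h x)^2 \<partial>M)"
  have H0: "0 \<le> H" by (simp add: H_def)
  have "\<bar>\<integral>x. r k x * h x \<partial>M\<bar> \<le> (1 + H) * (1/2)^k" for k
  proof -
   define I where "I = (\<integral>x. r k x * h x \<partial>M)"
   have ii: "integrable M (\<lambda>x. r k x * h x)" using integral_Cauchy_Schwarz(1)[OF rm _ r2 h2] by simp
   have "2 * t * I \<le> (1/4)^k + t^2 * H" for t
   proof -
    have "N (\<lambda>x. g k x + t * h x) = (\<integral>x. (r k x)^2 - 2 * t * (r k x * h x) + t^2 * (h x)^2 \<partial>M)"
     unfolding N_def r_def by (intro Bochner_Integration.integral_cong) (auto simp: power2_eq_square algebra_simps)
    also have "... = N (g k) - 2 * t * I + t^2 * H"
     using r2 ii h2 by (simp add: rN I_def H_def)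
    finally show ?thesis using dle[OF Dadd[OF g(1) h], of k t] g(2)[of k] by linarith
   qed
   note ineq = this
   \<comment> \<open>The choice of \<open>t\<close> balances the two terms of the bound.\<close>
   define t where "t = (1/2::real) ^ k"
   have t: "0 < t" "(1/4) ^ k = t^2"
    by (simp_all add: t_def power2_eq_square flip: power_mult_distrib)
   have "t * (2 * \<bar>I\<bar>) \<le> t * (t * (1 + H))"
    using ineq[of t] ineq[of "- t"] unfolding t(2)
    by (cases "0 \<le> I") (auto simp: power2_eq_square algebra_simps)
   then have "2 * \<bar>I\<bar> \<le> t * (1 + H)" using t(1) by simp
   moreover have "0 \<le> t * (1 + H)" using t(1) H0 by simp
   ultimately have "\<bar>I\<bar> \<le> (1 + H) * t" by (simp add: mult.commute)
   then show ?thesis unfolding I_def t_def .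
  qed
  moreover have "(\<lambda>k. (1 + H) * (1/2::real)^k) \<longlonglongrightarrow> 0"
   by (rule tendsto_mult_right_zero, rule LIMSEQ_power_zero) simp
  ultimately have "(\<lambda>k. \<integral>x. r k x * h x \<partial>M) \<longlonglongrightarrow> 0"
   using Lim_null_comparison[of "\<lambda>k. \<integral>x. r k x * h x \<partial>M" "\<lambda>k. (1 + H) * (1/2)^k" sequentially] by simp
  from LIMSEQ_unique[OF ip[OF _ h2] this] show ?thesis by simp
 qed
 have Rf: "(\<integral>x. R x * f x \<partial>M) = 0" by (rule orth[OF Rm R2 R0])
 have "(\<integral>x. R x * r k x \<partial>M) = 0" for k
 proof -
  have "integrable M (\<lambda>x. R x * f x)" "integrable M (\<lambda>x. R x * g k x)"
   using integral_Cauchy_Schwarz(1)[OF Rm _ R2] f2 D2[OF g(1)] by auto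
  then show ?thesis using Rf R0[OF g(1)] by (simp add: r_def right_diff_distrib)
 qed
 then have "(\<lambda>k. \<integral>x. r k x * R x \<partial>M) = (\<lambda>k. 0)" by (simp only: mult.commute)
 from ip[OF Rm R2, unfolded this] have "(\<integral>x. R x * R x \<partial>M) = 0"
  by (simp only: LIMSEQ_const_iff)
 then have "(\<integral>x. (R x)^2 \<partial>M) = 0" by (simp add: power2_eq_square)
 then have "AE x in M. (R x)^2 = 0" using R2 by (subst (asm) integral_nonneg_eq_0_iff_AE) auto
 then have "AE x in M. (r k x)^2 = (R x - r k x)^2" for k by eventually_elim simp
 then have "N (g k) = (\<integral>x. (R x - r k x)^2 \<partial>M)" for k
  unfolding rN[symmetric] by (intro integral_cong_AE) auto
 then have "N (g k) \<le> 4 * (1/4)^k" for k using Rr by simp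
 moreover obtain k where "4 * (1/4::real)^k < e"
  using eventually_happens'[OF _ order_tendstoD(2)[OF quarter[of 4] e]] by auto
 ultimately have "N (g k) < e" by (meson order_le_less_trans)
 then show ?thesis using g(1) by (auto simp: N_def)
qed

lemma Ck1_lipschitz_cball:
 fixes f :: "'a::euclidean_space => real"
 assumes f: "Ck 1 f"
 shows "\<exists>L\<ge>0. \<forall>x y. norm x \<le> M \<longrightarrow> norm y \<le> M \<longrightarrow> \<bar>f x - f y\<bar> \<le> L * norm (x - y)"
proof -
 have d: "f differentiable at x" for x using f by simp
 have "\<exists>B>0. \<forall>x. norm x \<le> M \<longrightarrow> \<bar>pd b f x\<bar> \<le> B" for b
  using f by (intro cont_bounded_cball) simp
 then obtain B where B: "\<And>b. 0 < B b" "\<And>b x. norm x \<le> M ==> \<bar>pd b f x\<bar> \<le> B b" by metis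
 define L where "L = (\<Sum>b\<in>(Basis::'a set). B b)"
 show ?thesis
 proof (intro exI[of _ L] conjI allI impI)
  show "0 \<le> L" unfolding L_def using B(1) by (intro sum_nonneg) (auto intro: less_imp_le)
  fix x y :: 'a assume x: "norm x \<le> M" and y: "norm y \<le> M"
  obtain t where t: "0 < t" "t < (1::real)" "f (y + (x - y)) - f y = pd (x - y) f (y + t *\<^sub>R (x - y))"
   using mvt_pd[of f y "x - y"] d by blast
  define z where "z = y + t *\<^sub>R (x - y)"
  have "z = (1 - t) *\<^sub>R y + t *\<^sub>R x" by (simp add: z_def algebra_simps)
  then have "norm z \<le> (1 - t) * norm y + t * norm x"
   using norm_triangle_ineq[of "(1 - t) *\<^sub>R y" "t *\<^sub>R x"] t by simp
  also have "... \<le> (1 - t) * M + t * M" using x y t by (intro add_mono mult_left_mono) auto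
  finally have z: "norm z \<le> M" by (simp add: algebra_simps)
  have "f x - f y = (\<Sum>b\<in>Basis. ((x - y) \<bullet> b) * pd b f z)"
   using t(3) pd_expand[OF d, of "x - y" z] by (simp add: z_def)
  then have "\<bar>f x - f y\<bar> \<le> (\<Sum>b\<in>Basis. \<bar>((x - y) \<bullet> b) * pd b f z\<bar>)" by (simp add: sum_abs)
  also have "... \<le> (\<Sum>b\<in>Basis. norm (x - y) * B b)"
   unfolding abs_mult using Basis_le_norm B(2)[OF z] by (intro sum_mono mult_mono) auto
  finally show "\<bar>f x - f y\<bar> \<le> L * norm (x - y)" by (simp add: L_def sum_distrib_right mult.commute)
 qed
qed

lemma cutoff_exists:
 "\<exists>g::'a::euclidean_space => real. Ck 3 g \<and> bsupp g \<and> (\<forall>x. 0 \<le> g x \<and> g x \<le> 1) \<and> (\<forall>x. norm x \<le> 1 \<longrightarrow> g x = 1)"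
proof -
 define h where "h x = max 0 (min 1 (3 - norm x))" for x :: 'a
 have c: "continuous_on UNIV h" unfolding h_def by (intro continuous_intros)
 have l: "loc_int h" using c by (rule loc_int_cont)
 have b: "bsupp h" by (rule bsuppI[of 3]) (simp add: h_def)
 have h: "0 \<le> h x" "h x \<le> 1" for x by (auto simp: h_def)
 let ?g = "conv (moll 0) h :: 'a => real"
 have "Ck 3 ?g" by (rule Ck_conv[OF l mollifier_Ck[OF moll] mollifier_bsupp[OF moll]])
 moreover have "bsupp ?g" by (rule bsupp_conv[OF mollifier_bsupp[OF moll] b])
 moreover have "0 \<le> ?g x" for x by (rule conv_nonneg[OF moll h(1)])
 moreover have "?g x \<le> 1" for x
  using conv_mono[OF moll l loc_int_cont[of "\<lambda>_. 1"], of x 0] conv_const[OF moll, of 0 1 x] h(2) by simp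
 moreover have "?g x = 1" if "norm x \<le> 1" for x
 proof -
  have "\<bar>?g x - 1\<bar> \<le> 0"
  proof (rule conv_approx[OF moll l])
   fix y assume "norm (x - y) < 1 / real (Suc 0)"
   then have "norm y \<le> 2" using that norm_triangle_ineq2[of y x] by (simp add: norm_minus_commute)
   then show "\<bar>h y - 1\<bar> \<le> 0" by (simp add: h_def)
  qed
  then show ?thesis by simp
 qed
 ultimately show ?thesis by blast
qed

definition base_cut :: "'a::euclidean_space => real" where
 "base_cut = (SOME g. Ck 3 g \<and> bsupp g \<and> (\<forall>x. 0 \<le> g x \<and> g x \<le> 1) \<and> (\<forall>x. norm x \<le> 1 \<longrightarrow> g x = 1))"

lemma base_cut: "Ck 3 base_cut" "bsupp base_cut" "0 \<le> base_cut x" "base_cut x \<le> 1" "norm x \<le> 1 ==> base_cut x = 1"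
 using someI_ex[OF cutoff_exists, folded base_cut_def] by auto

definition cut :: "nat => 'a::euclidean_space => real" where
 "cut K x = base_cut ((1 / real (Suc K)) *\<^sub>R x)"

lemma cut_C3: "Ck 3 (cut K)"
 using Ck_compose_linear[OF bounded_linear_scaleR_right base_cut(1), of 0 "1 / real (Suc K)"]
 by (simp add: cut_def[abs_def])

lemma cut_C1: "Ck 1 (cut K)" by (rule Ck_mono[OF cut_C3]) simp

lemma cut_bsupp: "bsupp (cut K)"
proof -
 obtain N where N: "0 < N" "\<And>x::'a. N \<le> norm x ==> base_cut x = 0" using bsuppE[OF base_cut(2)] by blast
 have "cut K x = 0" if "N * real (Suc K) \<le> norm x" for x :: 'a
  unfolding cut_def by (rule N(2)) (use that in \<open>simp add: field_simps\<close>)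
 then show ?thesis by (rule bsuppI)
qed

lemma cut_range: "0 \<le> cut K x" "cut K x \<le> 1" by (simp_all add: cut_def base_cut)

lemma cut_one: "norm x \<le> real (Suc K) ==> cut K x = 1"
 unfolding cut_def by (rule base_cut(5)) (simp add: field_simps)

text \<open>Stretching a fixed cutoff by a factor \<open>K + 1\<close> divides its gradient by that factor.\<close>

lemma cut_gradient:
 "\<exists>Q\<ge>0. \<forall>K. \<forall>x::'a::euclidean_space. (\<Sum>b\<in>Basis. (pd b (cut K) x)^2) \<le> Q / (real (Suc K))^2"
proof -
 have gp: "continuous_on UNIV (pd b (base_cut :: 'a => real))" for b using Ck_cont[OF Ck3_pd[OF base_cut(1)]] .
 have "\<forall>b. \<exists>B. \<forall>x::'a. \<bar>pd b base_cut x\<bar> \<le> B"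
  using bsupp_bounded[OF gp bsupp_pd[OF base_cut(2)]] by metis
 then obtain B where B: "\<And>b (x::'a). \<bar>pd b base_cut x\<bar> \<le> B b" by metis
 define Q where "Q = (\<Sum>b\<in>(Basis::'a set). (B b)^2)"
 have d: "(base_cut :: 'a => real) differentiable at x" for x by (rule Ck_diff[OF base_cut(1)]) simp
 show ?thesis
 proof (intro exI[of _ Q] conjI allI)
  show "0 \<le> Q" unfolding Q_def by (intro sum_nonneg) auto
  fix K and x :: 'a
  define k where "k = 1 / real (Suc K)"
  have p: "pd b (cut K) x = k * pd b base_cut (k *\<^sub>R x)" for b
   using pd_compose_linear(1)[OF bounded_linear_scaleR_right d, of b 0 k x] pd_scaleR[OF d]
   by (simp add: cut_def[abs_def] k_def)
  have "(\<Sum>b\<in>Basis. (pd b (cut K) x)^2) = k^2 * (\<Sum>b\<in>Basis. (pd b base_cut (k *\<^sub>R x))^2)"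
   by (simp add: p power_mult_distrib sum_distrib_left)
  also have "... \<le> k^2 * Q" unfolding Q_def
   by (intro mult_left_mono sum_mono) (metis B abs_ge_zero power2_abs power_mono, simp)
  finally show "(\<Sum>b\<in>Basis. (pd b (cut K) x)^2) \<le> Q / (real (Suc K))^2" by (simp add: k_def power_divide)
 qed
qed

lemma cut_tendsto: "(\<lambda>K. cut K x) \<longlonglongrightarrow> 1"
proof -
 obtain N :: nat where N: "norm x \<le> real N" using real_arch_simple by blast
 have "\<forall>\<^sub>F K in sequentially. cut K x = 1"
  unfolding eventually_sequentially by (intro exI[of _ N] allI impI cut_one) (use N in linarith)
 then show ?thesis by (rule tendsto_eventually)
qed

text \<open>The pointwise inequality behind the Caccioppoli estimate: \<open>p\<close>, \<open>q\<close> and \<open>c\<close> stand for a derivative of the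
solution, of the cutoff, and for a commutator; the difference of both sides is a sum of squares.\<close>

lemma sos_ineq:
 fixes w p c h R q :: real assumes w: "0 < w"
 shows "h^2 * w * p^2 / 2 \<le> (w * p + c) * (h^2 * p + 2 * h * R * q) + 5 * (w * R^2) * q^2 + 2 * h^2 * (c^2 / w)"
proof -
 have "0 \<le> w * (h * p / 2 + 2 * R * q)^2 + (w * h * p / 2 + h * c)^2 / w + (w * R * q + h * c)^2 / w"
  using w by (intro add_nonneg_nonneg) auto
 also have "... = (w * p + c) * (h^2 * p + 2 * h * R * q) + 5 * (w * R^2) * q^2 + 2 * h^2 * (c^2 / w) - h^2 * w * p^2 / 2"
  using w by (simp add: field_simps power2_eq_square)
 finally show ?thesis by linarith
qed

locale weight =
 fixes U :: "'a::euclidean_space => real"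
 assumes U2: "Ck 2 U"
begin

definition w :: "'a => real" where "w x = exp (- U x)"

lemma w_pos [simp]: "0 < w x" "0 \<le> w x" "w x \<noteq> 0" by (simp_all add: w_def)

lemma w2: "Ck 2 w" unfolding w_def[abs_def] by (rule Ck_exp_minus[OF U2])

lemma w_cont: "continuous_on UNIV w" by (rule Ck_cont[OF w2])

lemma w_meas [measurable]: "w \<in> borel_measurable borel" by (rule borel_measurable_cont[OF w_cont])

lemma U_diff: "U differentiable at x" by (rule Ck_diff[OF U2]) simp

lemma w_diff: "w differentiable at x" by (rule Ck_diff[OF w2]) simp

lemma pd_w: "pd v w x = - pd v U x * w x"
 using pd_exp_minus[OF U_diff] by (simp add: w_def[abs_def])

lemma pdU1: "Ck 1 (pd v U)" by (rule Ck2_pd[OF U2])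

lemma pdU_cont: "continuous_on UNIV (pd v U)" by (rule Ck_cont[OF pdU1])

lemma expU2: "Ck 2 (\<lambda>x. exp (U x))" by (rule Ck_exp[OF U2])

lemma w_expU: "w x * exp (U x) = 1" "exp (U x) * w x = 1" by (simp_all add: w_def flip: exp_add)

lemma conv_w_le: "\<exists>N. \<forall>n\<ge>N. \<forall>x. norm x \<le> M \<longrightarrow> conv (moll n) w x \<le> 2 * w x"
proof -
 define g where "g x = max 0 (min 1 (M + 2 - norm x)) * w x" for x
 have c: "continuous_on UNIV g" unfolding g_def by (intro continuous_intros w_cont)
 have b: "bsupp g" by (rule bsuppI[of "M + 2"]) (simp add: g_def)
 have l: "loc_int w" "loc_int g" using w_cont c loc_int_cont by auto
 obtain B where B: "0 < B" "\<forall>x. norm x \<le> M \<longrightarrow> \<bar>exp (U x)\<bar> \<le> B"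
  using cont_bounded_cball[OF Ck_cont[OF expU2], of M] by blast
 have wB: "1 / B \<le> w x" if "norm x \<le> M" for x
 proof -
  have "exp (U x) * w x \<le> B * w x" using B(2) that by (intro mult_right_mono) auto
  then show ?thesis using B(1) by (simp add: w_expU field_simps)
 qed
 obtain N where N: "\<forall>n\<ge>N. \<forall>x. \<bar>conv (moll n) g x - g x\<bar> \<le> 1 / B"
  using conv_moll_uniform[OF c b, of "1/B"] B(1) by auto
 show ?thesis
 proof (intro exI[of _ N] allI impI)
  fix n and x :: 'a assume n: "N \<le> n" and x: "norm x \<le> M"
  have gx: "g x = w x" using x by (simp add: g_def)
  have "conv (moll n) w x \<le> conv (moll n) g x"
  proof (rule conv_mono[OF moll l])
   fix y assume "norm (x - y) < 1 / real (Suc n)"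
   also have "... \<le> 1" by simp
   finally have "norm y \<le> M + 1" using x norm_triangle_ineq2[of y x] by (simp add: norm_minus_commute)
   then show "w y \<le> g y" by (simp add: g_def)
  qed
  also have "... \<le> g x + 1 / B" using N[rule_format, OF n, of x] by linarith
  also have "... \<le> 2 * w x" using wB[OF x] gx by simp
  finally show "conv (moll n) w x \<le> 2 * w x" .
 qed
qed

end

section \<open>A Liouville theorem\<close>

text \<open>A Liouville theorem: a function \<open>r\<close> in the weighted \<open>L\<^sup>2\<close> space that is orthogonal to the range of the
generator is constant. Since \<open>r\<close> has no derivatives to start with, \<open>r w\<close> is mollified to \<open>\<rho>n\<close>. The smooth
quotient \<open>Rn\<close> of \<open>\<rho>n\<close> and \<open>w\<close> solves the divergence equation up to the commutator \<open>cm\<close> of mollification with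
multiplication by a derivative of \<open>U\<close>.\<close>

locale weak_harmonic = weight +
 fixes r :: "'a => real"
 assumes r_meas [measurable]: "r \<in> borel_measurable borel"
  and r2: "integrable lborel (\<lambda>x. (r x)^2 * w x)"
  and weak: "\<And>u. Ck 3 u ==> bsupp u ==> (LBINT x. r x * gen U u x * w x) = 0"
begin

definition \<rho> :: "'a => real" where "\<rho> x = r x * w x"
definition A :: real where "A = (LBINT x. (r x)^2 * w x)"
definition \<rho>n :: "nat => 'a => real" where "\<rho>n n = conv (moll n) \<rho>"
definition Rn :: "nat => 'a => real" where "Rn n x = \<rho>n n x * exp (U x)"
definition G :: "nat => 'a => real" where "G n = conv (moll n) (\<lambda>x. (r x)^2 * w x)"
definition cm :: "nat => 'a => 'a => real" where
 "cm n b x = conv (moll n) (\<lambda>y. pd b U y * \<rho> y) x - pd b U x * \<rho>n n x"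

lemma A_nonneg: "0 \<le> A" unfolding A_def by simp

lemma \<rho>_meas [measurable]: "\<rho> \<in> borel_measurable borel" unfolding \<rho>_def[abs_def] by measurable

lemma loc_r2: "loc_int (\<lambda>x. (r x)^2 * w x)" by (rule loc_int_integrable[OF r2])

lemma loc_w: "loc_int w" by (rule loc_int_cont[OF w_cont])

lemma loc_\<rho>: "loc_int \<rho>"
 unfolding loc_int_def
proof safe
 fix M
 show "integrable lborel (\<lambda>x. indicator (cball 0 M) x * \<rho> x)"
 proof (rule Bochner_Integration.integrable_bound)
  show "integrable lborel (\<lambda>x. indicator (cball 0 M) x * ((r x)^2 * w x + w x))"
   using loc_int_add[OF loc_r2 loc_w] by (simp add: loc_int_def)
  have "\<bar>r x\<bar> \<le> (r x)^2 + 1" for x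
  proof -
   have "0 \<le> (\<bar>r x\<bar> - 1)^2" by simp
   then have "2 * \<bar>r x\<bar> \<le> (r x)^2 + 1" by (simp add: power2_diff)
   then show ?thesis using abs_ge_zero[of "r x"] by linarith
  qed
  then have "\<bar>\<rho> x\<bar> \<le> \<bar>(r x)^2 * w x + w x\<bar>" for x
   using mult_right_mono[of "\<bar>r x\<bar>" "(r x)^2 + 1" "w x"] by (simp add: \<rho>_def abs_mult algebra_simps)
  then show "AE x in lborel. norm (indicator (cball 0 M) x * \<rho> x) \<le> norm (indicator (cball 0 M) x * ((r x)^2 * w x + w x))"
   by (intro AE_I2) (auto simp: indicator_def)
 qed (auto intro!: borel_measurable_times borel_measurable_indicator)
qed simp

lemma r_eq: "r x = exp (U x) * \<rho> x"
 using w_expU by (simp add: \<rho>_def mult.left_commute)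

lemma loc_r: "loc_int r"
 using loc_int_mult_cont[OF loc_\<rho> Ck_cont[OF expU2]] unfolding r_eq[symmetric] .

lemma loc_pdU\<rho>: "loc_int (\<lambda>y. pd b U y * \<rho> y)" by (rule loc_int_mult_cont[OF loc_\<rho> pdU_cont])

lemma \<rho>n3: "Ck 3 (\<rho>n n)"
 unfolding \<rho>n_def by (rule Ck_conv[OF loc_\<rho> mollifier_Ck[OF moll] mollifier_bsupp[OF moll]])

lemma Rn2: "Ck 2 (Rn n)"
 unfolding Rn_def[abs_def] by (intro Ck_mult expU2 Ck_mono[OF \<rho>n3]) simp

lemma \<rho>n_eq: "\<rho>n n x = w x * Rn n x" using w_expU by (simp add: Rn_def mult.left_commute)

lemma pd_\<rho>n: "pd v (\<rho>n n) x + pd v U x * \<rho>n n x = w x * pd v (Rn n) x"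
proof -
 have "\<rho>n n = (\<lambda>x. w x * Rn n x)" using \<rho>n_eq by auto
 then have "pd v (\<rho>n n) x = pd v w x * Rn n x + w x * pd v (Rn n) x"
  using pd_mult[where f = w and g = "Rn n" and x = x and v = v, OF w_diff Ck_diff[OF Rn2]] by simp
 then show ?thesis by (simp add: pd_w \<rho>n_eq)
qed

lemma cm_cont: "continuous_on UNIV (cm n b)"
 unfolding cm_def
 by (intro continuous_intros continuous_conv loc_pdU\<rho> mollifier_cont[OF moll] mollifier_bsupp[OF moll]
   pdU_cont Ck_cont[OF \<rho>n3])

lemma G_cont: "continuous_on UNIV (G n)"
 unfolding G_def by (intro continuous_conv loc_r2 mollifier_cont[OF moll] mollifier_bsupp[OF moll])

text \<open>The equation for \<open>r\<close> tested with the mollification of \<open>f\<close>, with the mollifier moved back onto \<open>r w\<close>.\<close>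

lemma flux_divergence_free:
 assumes f: "Ck 1 f" "bsupp f"
 shows "(\<Sum>b\<in>Basis. LBINT x. (w x * pd b (Rn n) x + cm n b x) * pd b f x) = 0"
proof -
 define k :: "'a => real" where "k = moll n"
 have k: "Ck 3 k" "Ck 1 k" "bsupp k" "continuous_on UNIV k" "\<And>x. k (- x) = k x"
  using mollifier_Ck[OF moll] mollifier_C1[OF moll] mollifier_bsupp[OF moll] mollifier_cont[OF moll]
   mollifier_even[OF moll] by (auto simp: k_def)
 have kp: "continuous_on UNIV (pd b k)" "bsupp (pd b k)" for b
  using Ck_cont[OF Ck3_pd[OF k(1)]] bsupp_pd[OF k(3)] by auto
 have fp: "continuous_on UNIV (pd b f)" "bsupp (pd b f)" "loc_int (pd b f)" for b
  using f bsupp_pd[OF f(2)] loc_int_cont[of "pd b f"] by auto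
 have lf: "loc_int f" using loc_int_cont Ck_cont f by blast
 define u where "u = conv k f"
 have u: "Ck 3 u" "bsupp u" unfolding u_def using Ck_conv[OF lf k(1,3)] bsupp_conv[OF k(3) f(2)] by auto
 have u1: "pd b u = conv k (pd b f)" for b
  unfolding u_def using pd_conv[OF lf k(2,3)] conv_pd_swap[OF f(1) k(2,3)] by metis
 have u2: "pd b (pd b u) = conv (pd b k) (pd b f)" for b
  unfolding u1 by (rule pd_conv[OF fp(3) k(2,3)])
 have odd: "(\<lambda>z. pd b k (- z)) = (\<lambda>z. -1 * pd b k z)" for b
 proof
  fix z
  have d: "k differentiable at z" for z using k(2) by simp
  have "pd b (\<lambda>x. k (0 + - x)) z = pd (- b) k (0 + - z)"
   by (rule pd_compose_linear(1)) (auto intro: d bounded_linear_minus bounded_linear_ident)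
  then show "pd b k (- z) = -1 * pd b k z"
   using pd_scaleR[OF d, of "-1" b "- z"] k(5) by simp
 qed
 have t1: "(LBINT x. \<rho> x * pd b (pd b u) x) = - (LBINT x. pd b (\<rho>n n) x * pd b f x)" for b
 proof -
  have "pd b (\<rho>n n) = conv (pd b k) \<rho>" unfolding \<rho>n_def k_def[symmetric] by (rule pd_conv[OF loc_\<rho> k(2,3)])
  then have "(LBINT x. pd b (\<rho>n n) x * pd b f x) = (LBINT x. \<rho> x * conv (\<lambda>z. pd b k (- z)) (pd b f) x)"
   using conv_adjoint[OF loc_\<rho> kp fp(1,2)] by metis
  also have "conv (\<lambda>z. pd b k (- z)) (pd b f) = (\<lambda>x. - pd b (pd b u) x)"
   unfolding odd u2 using conv_cmult[of "-1"] by auto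
  finally show ?thesis by simp
 qed
 have t2: "(LBINT x. \<rho> x * (pd b U x * pd b u x)) = (LBINT x. (cm n b x + pd b U x * \<rho>n n x) * pd b f x)" for b
 proof -
  have "(LBINT x. conv k (\<lambda>y. pd b U y * \<rho> y) x * pd b f x) = (LBINT x. (pd b U x * \<rho> x) * conv (\<lambda>z. k (- z)) (pd b f) x)"
   by (rule conv_adjoint[OF loc_pdU\<rho> k(4,3) fp(1,2)])
  then show ?thesis by (simp add: k(5) cm_def u1 k_def[symmetric] mult_ac)
 qed
 have up: "continuous_on UNIV (pd b u)" "continuous_on UNIV (pd b (pd b u))" for b
  using Ck_cont[OF Ck3_pd[OF u(1)]] Ck_cont[OF Ck2_pd[OF Ck3_pd[OF u(1)]]] by auto
 have i1: "integrable lborel (\<lambda>x. \<rho> x * pd b (pd b u) x)" for b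
  using integrable_loc_int_mult[OF loc_\<rho> up(2) bsupp_pd[OF bsupp_pd[OF u(2)]]] by (simp add: mult.commute)
 have i2: "integrable lborel (\<lambda>x. \<rho> x * (pd b U x * pd b u x))" for b
  using integrable_loc_int_mult[OF loc_pdU\<rho>[of b] up(1)[of b] bsupp_pd[OF u(2), of b]] by (simp add: mult_ac)
 have "(\<lambda>x. r x * gen U u x * w x) = (\<lambda>x. \<Sum>b\<in>Basis. (\<rho> x * pd b (pd b u) x - \<rho> x * (pd b U x * pd b u x)))"
  by (auto simp: gen_def \<rho>_def sum_distrib_left sum_distrib_right algebra_simps intro!: sum.cong)
 then have "0 = (\<Sum>b\<in>Basis. (LBINT x. \<rho> x * pd b (pd b u) x) - (LBINT x. \<rho> x * (pd b U x * pd b u x)))"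
  using weak[OF u] i1 i2 by simp
 also have "... = - (\<Sum>b\<in>Basis. LBINT x. (w x * pd b (Rn n) x + cm n b x) * pd b f x)"
  unfolding sum_negf[symmetric]
 proof (rule sum.cong[OF refl])
  fix b :: 'a
  have j1: "integrable lborel (\<lambda>x. pd b (\<rho>n n) x * pd b f x)"
   by (intro integrable_bsupp continuous_intros fp bsupp_mult2 Ck_cont[OF Ck3_pd[OF \<rho>n3]])
  have j2: "integrable lborel (\<lambda>x. (cm n b x + pd b U x * \<rho>n n x) * pd b f x)"
   by (intro integrable_bsupp continuous_intros fp bsupp_mult2 cm_cont pdU_cont Ck_cont[OF \<rho>n3])
  have "(\<lambda>x. (w x * pd b (Rn n) x + cm n b x) * pd b f x) =
   (\<lambda>x. pd b (\<rho>n n) x * pd b f x + (cm n b x + pd b U x * \<rho>n n x) * pd b f x)"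
   unfolding pd_\<rho>n[symmetric] by (auto simp: algebra_simps)
  then show "(LBINT x. \<rho> x * pd b (pd b u) x) - (LBINT x. \<rho> x * (pd b U x * pd b u x)) =
    - (LBINT x. (w x * pd b (Rn n) x + cm n b x) * pd b f x)"
   using j1 j2 by (simp add: t1 t2)
 qed
 finally show ?thesis by simp
qed

lemma conv_abs_\<rho>_sq: "(conv (moll n) (\<lambda>y. \<bar>\<rho> y\<bar>) x)^2 \<le> G n x * conv (moll n) w x"
proof -
 have e1: "(\<lambda>y. \<bar>\<rho> y\<bar>) = (\<lambda>y. (\<bar>r y\<bar> * sqrt (w y)) * sqrt (w y))" by (simp add: \<rho>_def abs_mult mult.assoc)
 have e2: "(\<lambda>y. (\<bar>r y\<bar> * sqrt (w y))^2) = (\<lambda>x. (r x)^2 * w x)" "(\<lambda>y. (sqrt (w y))^2) = w"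
  by (auto simp: power_mult_distrib)
 show ?thesis
  using conv_Cauchy_Schwarz[OF moll, of "\<lambda>y. \<bar>r y\<bar> * sqrt (w y)" "\<lambda>y. sqrt (w y)" n x, unfolded e2 e1[symmetric]]
   loc_r2 loc_w by (simp add: G_def)
qed

lemma \<rho>n_sq: "(\<rho>n n x)^2 \<le> G n x * conv (moll n) w x"
proof -
 have l: "loc_int (\<lambda>y. \<bar>\<rho> y\<bar>)" by (rule loc_int_abs[OF loc_\<rho>])
 have "\<rho>n n x \<le> conv (moll n) (\<lambda>y. \<bar>\<rho> y\<bar>) x"
  unfolding \<rho>n_def by (rule conv_mono[OF moll loc_\<rho> l]) simp
 moreover have "- \<rho>n n x \<le> conv (moll n) (\<lambda>y. \<bar>\<rho> y\<bar>) x"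
 proof -
  have "conv (moll n) (\<lambda>y. 0 - \<rho> y) x \<le> conv (moll n) (\<lambda>y. \<bar>\<rho> y\<bar>) x"
   using loc_int_mult_cont[OF loc_\<rho>, of "\<lambda>_. -1"] by (intro conv_mono[OF moll _ l]) auto
  moreover have "conv (moll n) (\<lambda>y. 0 - \<rho> y) x = - \<rho>n n x" by (simp add: conv_def \<rho>n_def)
  ultimately show ?thesis by simp
 qed
 ultimately have "\<bar>\<rho>n n x\<bar> \<le> \<bar>conv (moll n) (\<lambda>y. \<bar>\<rho> y\<bar>) x\<bar>" by linarith
 then have "(\<rho>n n x)^2 \<le> (conv (moll n) (\<lambda>y. \<bar>\<rho> y\<bar>) x)^2" by (simp add: abs_le_square_iff)
 then show ?thesis using conv_abs_\<rho>_sq order_trans by blast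
qed

text \<open>The commutator gains a factor \<open>1 / n\<close>, as the derivatives of \<open>U\<close> are Lipschitz on balls and the
mollifier lives at that scale.\<close>

lemma cm_bound:
 "\<exists>L\<ge>0. \<forall>n. \<forall>b\<in>Basis. \<forall>x. norm x \<le> M \<longrightarrow> \<bar>cm n b x\<bar> \<le> L / real (Suc n) * conv (moll n) (\<lambda>y. \<bar>\<rho> y\<bar>) x"
proof -
 have "\<exists>L\<ge>0. \<forall>x y. norm x \<le> M + 1 \<longrightarrow> norm y \<le> M + 1 \<longrightarrow> \<bar>pd b U x - pd b U y\<bar> \<le> L * norm (x - y)" for b
  by (rule Ck1_lipschitz_cball[OF pdU1])
 then obtain L where L: "\<And>b. 0 \<le> L b"
  "\<And>b x y. norm x \<le> M + 1 ==> norm y \<le> M + 1 ==> \<bar>pd b U x - pd b U y\<bar> \<le> L b * norm (x - y)" by metis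
 define S where "S = (\<Sum>b\<in>(Basis::'a set). L b)"
 have LS: "L b \<le> S" if "b \<in> Basis" for b unfolding S_def using that L(1) by (intro member_le_sum) auto
 have S0: "0 \<le> S" unfolding S_def using L(1) by (intro sum_nonneg) auto
 have l: "loc_int (\<lambda>y. S / real (Suc n) * \<bar>\<rho> y\<bar>)" for n
  by (rule loc_int_mult_cont[OF loc_int_abs[OF loc_\<rho>]]) simp
 show ?thesis
 proof (intro exI[of _ S] conjI S0 allI ballI impI)
  fix n and b x :: 'a assume b: "b \<in> Basis" and x: "norm x \<le> M"
  define e where "e = S / real (Suc n)"
  have cx: "loc_int (\<lambda>y. pd b U x * \<rho> y)" by (rule loc_int_mult_cont[OF loc_\<rho>]) simp
  have ld: "loc_int (\<lambda>y. (pd b U y - pd b U x) * \<rho> y)"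
   by (intro loc_int_mult_cont[OF loc_\<rho>] continuous_intros pdU_cont)
  have ld': "loc_int (\<lambda>y. -1 * ((pd b U y - pd b U x) * \<rho> y))"
   by (rule loc_int_mult_cont[OF ld]) simp
  have eq: "cm n b x = conv (moll n) (\<lambda>y. (pd b U y - pd b U x) * \<rho> y) x"
  proof -
   have "conv (moll n) (\<lambda>y. pd b U y * \<rho> y - pd b U x * \<rho> y) x =
     conv (moll n) (\<lambda>y. pd b U y * \<rho> y) x - conv (moll n) (\<lambda>y. pd b U x * \<rho> y) x"
    by (rule conv_diff_right[OF loc_pdU\<rho> cx mollifier_cont[OF moll] mollifier_bsupp[OF moll]])
   moreover have "conv (moll n) (\<lambda>y. pd b U x * \<rho> y) x = pd b U x * \<rho>n n x"
    by (simp add: conv_def \<rho>n_def mult.left_commute[of _ "pd b U x"])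
   ultimately show ?thesis by (simp add: cm_def left_diff_distrib)
  qed
  have pt: "\<bar>(pd b U y - pd b U x) * \<rho> y\<bar> \<le> e * \<bar>\<rho> y\<bar>" if y: "norm (x - y) < 1 / real (Suc n)" for y
  proof -
   have "norm (x - y) \<le> 1" using y by (rule order_trans[OF less_imp_le]) simp
   then have "norm y \<le> M + 1" using x norm_triangle_ineq2[of y x] by (simp add: norm_minus_commute)
   then have "\<bar>pd b U y - pd b U x\<bar> \<le> L b * norm (y - x)" using x by (intro L(2)) auto
   also have "... \<le> S * (1 / real (Suc n))"
    using y LS[OF b] S0 by (intro mult_mono) (auto simp: norm_minus_commute)
   finally show ?thesis unfolding abs_mult e_def by (intro mult_right_mono) auto
  qed
  have "conv (moll n) (\<lambda>y. (pd b U y - pd b U x) * \<rho> y) x \<le> conv (moll n) (\<lambda>y. e * \<bar>\<rho> y\<bar>) x"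
   using pt l by (intro conv_mono[OF moll ld]) (auto simp: e_def abs_le_iff)
  moreover have "conv (moll n) (\<lambda>y. -1 * ((pd b U y - pd b U x) * \<rho> y)) x \<le> conv (moll n) (\<lambda>y. e * \<bar>\<rho> y\<bar>) x"
   using pt l by (intro conv_mono[OF moll ld']) (auto simp: e_def abs_le_iff)
  moreover have "conv (moll n) (\<lambda>y. -1 * ((pd b U y - pd b U x) * \<rho> y)) x = - conv (moll n) (\<lambda>y. (pd b U y - pd b U x) * \<rho> y) x"
   by (simp add: conv_def)
  moreover have "conv (moll n) (\<lambda>y. e * \<bar>\<rho> y\<bar>) x = e * conv (moll n) (\<lambda>y. \<bar>\<rho> y\<bar>) x"
   by (simp add: conv_def mult.left_commute[of _ e])
  ultimately show "\<bar>cm n b x\<bar> \<le> S / real (Suc n) * conv (moll n) (\<lambda>y. \<bar>\<rho> y\<bar>) x"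
   unfolding eq e_def by linarith
 qed
qed

lemma integral_G_le:
 assumes g: "continuous_on UNIV g" "bsupp g" and B: "\<And>x. g x \<le> B"
 shows "(LBINT x. G n x * g x) \<le> B * A"
proof -
 have "(LBINT x. G n x * g x) = (LBINT x. ((r x)^2 * w x) * conv (moll n) g x)"
  unfolding G_def by (rule conv_moll_self_adjoint[OF loc_r2 g])
 also have "... \<le> (LBINT x. B * ((r x)^2 * w x))"
 proof (rule integral_mono)
  have c: "continuous_on UNIV (conv (moll n) g)" "bsupp (conv (moll n) g)"
   using continuous_conv[OF loc_int_cont[OF g(1)] mollifier_cont[OF moll] mollifier_bsupp[OF moll]]
    bsupp_conv[OF mollifier_bsupp[OF moll] g(2)] by auto
  show "integrable lborel (\<lambda>x. ((r x)^2 * w x) * conv (moll n) g x)"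
   using integrable_loc_int_mult[OF loc_r2 c] by (simp add: mult.commute)
  show "integrable lborel (\<lambda>x. B * ((r x)^2 * w x))" using r2 by simp
  fix x
  have "conv (moll n) g x \<le> B"
   using conv_mono[OF moll loc_int_cont[OF g(1)] loc_int_cont[of "\<lambda>_. B"], of x n] B conv_const[OF moll, of n B x] by simp
  then show "((r x)^2 * w x) * conv (moll n) g x \<le> B * ((r x)^2 * w x)"
   by (subst mult.commute, intro mult_right_mono) auto
 qed
 finally show ?thesis by (simp add: A_def)
qed

text \<open>Caccioppoli's inequality: the divergence equation is tested with \<open>h\<^sup>2 Rn\<close>. The terms containing \<open>Rn\<close> itself are bounded
by the mass \<open>A\<close> of \<open>r\<close>, and the commutator only contributes the error \<open>d\<close>.\<close>

lemma energy_estimate: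
 assumes h: "Ck 1 h" "bsupp h" "\<And>x. 0 \<le> h x" "\<And>x. h x \<le> 1"
  and Q: "\<And>x. (\<Sum>b\<in>Basis. (pd b h x)^2) \<le> Q" and d: "0 < d"
 shows "\<exists>N. \<forall>n\<ge>N. (LBINT x. (h x)^2 * w x * (\<Sum>b\<in>Basis. (pd b (Rn n) x)^2)) \<le> 20 * Q * A + d"
proof -
 obtain M where M: "0 < M" "\<And>x. M \<le> norm x ==> h x = 0" using bsuppE[OF h(2)] by blast
 obtain N1 where N1: "\<forall>n\<ge>N1. \<forall>x. norm x \<le> M \<longrightarrow> conv (moll n) w x \<le> 2 * w x" using conv_w_le by blast
 obtain L where L: "0 \<le> L" "\<forall>n. \<forall>b\<in>Basis. \<forall>x. norm x \<le> M \<longrightarrow> \<bar>cm n b x\<bar> \<le> L / real (Suc n) * conv (moll n) (\<lambda>y. \<bar>\<rho> y\<bar>) x"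
  using cm_bound by blast
 define C where "C = 8 * real DIM('a) * L^2 * A"
 have C0: "0 \<le> C" unfolding C_def using A_nonneg by (intro mult_nonneg_nonneg) auto
 obtain N2 :: nat where N2: "C / d < real N2" using reals_Archimedean2 by blast
 have dh: "h differentiable at x" for x using h(1) by simp
 have ch: "continuous_on UNIV h" "continuous_on UNIV (pd b h)" for b using h(1) Ck_cont[OF h(1)] by auto
 show ?thesis
 proof (intro exI[of _ "max N1 N2"] allI impI)
  fix n assume n: "max N1 N2 \<le> n"
  have cR: "continuous_on UNIV (Rn n)" "continuous_on UNIV (pd b (Rn n))" for b
   using Ck_cont[OF Rn2] Ck_cont[OF Ck2_pd[OF Rn2]] by auto
  have dR: "Rn n differentiable at x" for x by (rule Ck_diff[OF Rn2]) simp
  define f where "f x = (h x * h x) * Rn n x" for x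
  have f: "Ck 1 f" "bsupp f" unfolding f_def
   by (intro Ck_mult h Ck_mono[OF Rn2]; simp) (intro bsupp_mult1 h)
  have pf: "pd b f x = (h x)^2 * pd b (Rn n) x + 2 * h x * Rn n x * pd b h x" for b x
   unfolding f_def by (simp add: pd_mult dh dR power2_eq_square algebra_simps)
  define F where "F x = (\<Sum>b\<in>Basis. (w x * pd b (Rn n) x + cm n b x) * pd b f x)" for x
  have iF: "integrable lborel (\<lambda>x. (w x * pd b (Rn n) x + cm n b x) * pd b f x)" for b
   using f by (intro integrable_bsupp continuous_intros w_cont cR cm_cont bsupp_mult2 bsupp_pd) simp_all
  have F0: "integral\<^sup>L lborel F = 0"
   unfolding F_def using iF flux_divergence_free[OF f] by simp
  define Sp where "Sp x = (\<Sum>b\<in>Basis. (pd b (Rn n) x)^2)" for x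
  define Sq where "Sq x = (\<Sum>b\<in>Basis. (pd b h x)^2)" for x
  define e where "e = L / real (Suc n)"
  have pt: "(h x)^2 * w x * Sp x / 2 \<le> F x + 10 * (G n x * Sq x) + 4 * real DIM('a) * e^2 * (G n x * (h x)^2)" for x
  proof (cases "norm x \<le> M")
   case False
   then have z: "h x = 0" "pd b h x = 0" for b using M(2) pd_zero_outside[of M h x b] by auto
   then show ?thesis by (simp add: F_def pf Sq_def)
  next
   case True
   have Wn: "conv (moll n) w x \<le> 2 * w x" using N1 n True by auto
   have G0: "0 \<le> G n x" unfolding G_def by (intro conv_nonneg[OF moll]) auto
   have GW: "G n x * conv (moll n) w x \<le> 2 * G n x * w x" using mult_left_mono[OF Wn G0] by simp
   have wR: "w x * (Rn n x)^2 \<le> 2 * G n x"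
   proof -
    have "w x * (w x * (Rn n x)^2) \<le> w x * (2 * G n x)"
     using order_trans[OF \<rho>n_sq[of n x] GW] by (simp add: \<rho>n_eq power_mult_distrib power2_eq_square mult_ac)
    then show ?thesis by simp
   qed
   have cw: "(cm n b x)^2 / w x \<le> 2 * e^2 * G n x" if b: "b \<in> Basis" for b
   proof -
    have "(cm n b x)^2 \<le> (e * conv (moll n) (\<lambda>y. \<bar>\<rho> y\<bar>) x)^2"
     using L b True unfolding e_def by (metis abs_ge_zero power2_abs power_mono)
    also have "... \<le> e^2 * (2 * G n x * w x)"
     unfolding power_mult_distrib using order_trans[OF conv_abs_\<rho>_sq GW] by (intro mult_left_mono) auto
    finally show ?thesis by (simp add: pos_divide_le_eq mult_ac)
   qed
   have "(h x)^2 * w x * (pd b (Rn n) x)^2 / 2 \<le> (w x * pd b (Rn n) x + cm n b x) * pd b f x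
     + 10 * G n x * (pd b h x)^2 + 4 * e^2 * (G n x * (h x)^2)" if b: "b \<in> Basis" for b
   proof -
    have "5 * (w x * (Rn n x)^2) * (pd b h x)^2 \<le> 5 * (2 * G n x) * (pd b h x)^2"
     using wR by (intro mult_right_mono mult_left_mono) auto
    moreover have "2 * (h x)^2 * ((cm n b x)^2 / w x) \<le> 2 * (h x)^2 * (2 * e^2 * G n x)"
     by (rule mult_left_mono[OF cw[OF b]]) simp
    ultimately show ?thesis
     using sos_ineq[of "w x" "h x" "pd b (Rn n) x" "cm n b x" "Rn n x" "pd b h x"] unfolding pf
     by (simp add: mult_ac)
   qed
   then have "(\<Sum>b\<in>Basis. (h x)^2 * w x * (pd b (Rn n) x)^2 / 2) \<le> (\<Sum>b\<in>Basis. (w x * pd b (Rn n) x + cm n b x) * pd b f x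
     + 10 * G n x * (pd b h x)^2 + 4 * e^2 * (G n x * (h x)^2))" by (rule sum_mono)
   then show ?thesis
    by (simp add: Sp_def Sq_def F_def sum.distrib sum_distrib_left sum_divide_distrib mult_ac)
  qed
  have i1: "integrable lborel (\<lambda>x. (h x)^2 * w x * Sp x)"
   unfolding Sp_def power2_eq_square
   by (intro integrable_bsupp continuous_intros ch cR w_cont bsupp_mult1 h(2))
  have bq: "bsupp Sq" unfolding Sq_def power2_eq_square by (intro bsupp_sum bsupp_mult1 bsupp_pd h(2))
  have cq: "continuous_on UNIV Sq" unfolding Sq_def by (intro continuous_intros ch)
  have bh: "bsupp (\<lambda>x. (h x)^2)" unfolding power2_eq_square by (intro bsupp_mult1 h(2))
  have cc: "continuous_on UNIV (\<lambda>x. (h x)^2)" by (intro continuous_intros ch)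
  have i2: "integrable lborel (\<lambda>x. G n x * Sq x)" "integrable lborel (\<lambda>x. G n x * (h x)^2)"
   by (intro integrable_bsupp continuous_intros G_cont cq bsupp_mult2 bq)
     (intro integrable_bsupp continuous_on_mult G_cont cc bsupp_mult2 bh)
  have i3: "integrable lborel F" unfolding F_def using iF by simp
  have "(LBINT x. (h x)^2 * w x * Sp x / 2) \<le>
    (LBINT x. F x + 10 * (G n x * Sq x) + 4 * real DIM('a) * e^2 * (G n x * (h x)^2))"
   by (rule integral_mono[OF _ _ pt]) (use i1 i2 i3 in auto)
  also have "... = 10 * (LBINT x. G n x * Sq x) + 4 * real DIM('a) * e^2 * (LBINT x. G n x * (h x)^2)"
   using i2 i3 F0 by simp
  also have "... \<le> 10 * (Q * A) + 4 * real DIM('a) * e^2 * (1 * A)"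
  proof (intro add_mono mult_left_mono integral_G_le cq bq cc bh)
   show "Sq x \<le> Q" for x using Q by (simp add: Sq_def)
   show "(h x)^2 \<le> 1" for x using h(3,4)[of x] by (simp add: power_le_one)
  qed auto
  finally have main: "(LBINT x. (h x)^2 * w x * Sp x) \<le> 20 * Q * A + 8 * real DIM('a) * e^2 * A" by simp
  have "8 * real DIM('a) * e^2 * A = C / (real (Suc n))^2"
   unfolding C_def e_def by (simp add: power_divide)
  also have "... \<le> C / real (Suc n)"
   using C0 by (intro divide_left_mono) (auto simp: power2_eq_square)
  also have "... \<le> d"
  proof -
   have "C / d \<le> real (Suc n)" using N2 n by linarith
   then show ?thesis using d by (simp add: pos_divide_le_eq mult.commute)
  qed
  finally show "(LBINT x. (h x)^2 * w x * (\<Sum>b\<in>Basis. (pd b (Rn n) x)^2)) \<le> 20 * Q * A + d"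
   using main by (simp add: Sp_def)
 qed
qed


text \<open>With cutoffs of scale \<open>K\<close> the energy estimate bounds the energy of \<open>Rn\<close> on the support of \<open>f\<close> by a multiple of
\<open>1 / K\<^sup>2\<close>, for all large \<open>n\<close>.\<close>

lemma weak_derivative_zero:
 assumes f: "Ck 1 f" "bsupp f" and b: "b \<in> Basis"
 shows "(LBINT x. r x * pd b f x) = 0"
proof -
 obtain M where M: "0 < M" "\<And>x. M \<le> norm x ==> f x = 0" using bsuppE[OF f(2)] by blast
 obtain Q where Q: "0 \<le> Q" "\<And>K x. (\<Sum>b\<in>Basis. (pd b (cut K) (x::'a))^2) \<le> Q / (real (Suc K))^2"
  using cut_gradient by blast
 define C where "C = (LBINT x. (f x)^2 / w x)"
 define I where "I = (LBINT x. r x * pd b f x)"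
 have C0: "0 \<le> C" unfolding C_def by simp
 have lim: "(\<lambda>n. LBINT x. Rn n x * pd b f x) \<longlonglongrightarrow> I"
 proof -
  have c: "continuous_on UNIV (\<lambda>x. exp (U x) * pd b f x)" "bsupp (\<lambda>x. exp (U x) * pd b f x)"
   using f Ck_cont[OF expU2] bsupp_mult2[OF bsupp_pd[OF f(2)]] by (auto intro!: continuous_on_mult)
  have e1: "(\<lambda>n. LBINT x. conv (moll n) \<rho> x * (exp (U x) * pd b f x)) = (\<lambda>n. LBINT x. Rn n x * pd b f x)"
   by (simp add: Rn_def \<rho>n_def mult.assoc)
  have e2: "(LBINT x. \<rho> x * (exp (U x) * pd b f x)) = I"
   unfolding I_def by (subst r_eq) (simp add: mult_ac)
  show ?thesis using conv_moll_weak[OF loc_\<rho> c] unfolding e1 e2 .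
 qed
 have key: "I^2 \<le> ((20 * Q * A + 1) * C) / (real (Suc K))^2" if K: "M \<le> real (Suc K)" for K :: nat
 proof -
  define k where "k = 1 / real (Suc K)"
  have k: "0 < k" by (simp add: k_def)
  define q :: "'a => real" where "q = cut K"
  have q1: "Ck 1 q" and qb: "bsupp q" unfolding q_def by (rule cut_C1, rule cut_bsupp)
  have q01: "0 \<le> q x" "q x \<le> 1" for x by (simp_all add: q_def cut_range)
  have qQ: "(\<Sum>b\<in>Basis. (pd b q x)^2) \<le> k^2 * Q" for x
   using Q(2)[of K x] by (simp add: q_def k_def power_divide)
  have q1': "q x = 1" if "norm x \<le> M" for x using cut_one[of x K] that K by (simp add: q_def)
  have cq: "continuous_on UNIV q" by (rule Ck_cont[OF q1])
  have cf: "continuous_on UNIV f" by (rule Ck_cont[OF f(1)])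
  obtain N where N: "\<forall>n\<ge>N. (LBINT x. (q x)^2 * w x * (\<Sum>b\<in>Basis. (pd b (Rn n) x)^2)) \<le> 20 * (k^2 * Q) * A + k^2"
   using energy_estimate[OF q1 qb q01 qQ, of "k^2"] k by auto
  have "(LBINT x. Rn n x * pd b f x)^2 \<le> (20 * (k^2 * Q) * A + k^2) * C" if n: "N \<le> n" for n
  proof -
   have R1: "Ck 1 (Rn n)" by (rule Ck_mono[OF Rn2]) simp
   have cR: "continuous_on UNIV (pd b (Rn n))" for b by (rule Ck_cont[OF Ck2_pd[OF Rn2]])
   have "(LBINT x. pd b (Rn n) x * f x) = - (LBINT x. Rn n x * pd b f x)"
    by (rule integral_by_parts[OF R1 f(1)]) (use f in simp)
   then have "(LBINT x. Rn n x * pd b f x)^2 = (LBINT x. pd b (Rn n) x * f x)^2" by simp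
   also have "(\<lambda>x. pd b (Rn n) x * f x) = (\<lambda>x. (q x * sqrt (w x) * pd b (Rn n) x) * (f x / sqrt (w x)))"
   proof
    fix x show "pd b (Rn n) x * f x = (q x * sqrt (w x) * pd b (Rn n) x) * (f x / sqrt (w x))"
     using q1'[of x] M(2)[of x] by (cases "norm x \<le> M") auto
   qed
   also have "(LBINT x. (q x * sqrt (w x) * pd b (Rn n) x) * (f x / sqrt (w x)))^2
     \<le> (LBINT x. (q x * sqrt (w x) * pd b (Rn n) x)^2) * (LBINT x. (f x / sqrt (w x))^2)"
   proof (rule integral_Cauchy_Schwarz(2))
    have c: "continuous_on UNIV (\<lambda>x. q x * sqrt (w x) * pd b (Rn n) x)" "continuous_on UNIV (\<lambda>x. f x / sqrt (w x))"
     by (intro continuous_intros cq cf w_cont cR; simp)+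
    then show "(\<lambda>x. q x * sqrt (w x) * pd b (Rn n) x) \<in> borel_measurable lborel" "(\<lambda>x. f x / sqrt (w x)) \<in> borel_measurable lborel"
     by (auto intro: borel_measurable_cont)
    show "integrable lborel (\<lambda>x. (q x * sqrt (w x) * pd b (Rn n) x)^2)"
     unfolding power2_eq_square
     by (intro integrable_bsupp continuous_on_mult[OF c(1) c(1)] bsupp_mult1 qb)
    have "bsupp (\<lambda>x. f x * (1 / sqrt (w x)))" by (intro bsupp_mult1 f)
    then have "bsupp (\<lambda>x. f x / sqrt (w x))" by simp
    then show "integrable lborel (\<lambda>x. (f x / sqrt (w x))^2)"
     unfolding power2_eq_square by (intro integrable_bsupp continuous_on_mult[OF c(2) c(2)] bsupp_mult1)
   qed
   also have "(LBINT x. (f x / sqrt (w x))^2) = C" by (simp add: C_def power_divide)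
   also have "(LBINT x. (q x * sqrt (w x) * pd b (Rn n) x)^2) \<le> (LBINT x. (q x)^2 * w x * (\<Sum>b\<in>Basis. (pd b (Rn n) x)^2))"
   proof (rule integral_mono)
    have e: "(\<lambda>x. (q x * sqrt (w x) * pd b (Rn n) x)^2) = (\<lambda>x. (q x * q x) * (w x * (pd b (Rn n) x)^2))"
     by (auto simp: power_mult_distrib power2_eq_square)
    show "integrable lborel (\<lambda>x. (q x * sqrt (w x) * pd b (Rn n) x)^2)" unfolding e
     by (intro integrable_bsupp continuous_intros cq w_cont cR bsupp_mult1 qb)
    show "integrable lborel (\<lambda>x. (q x)^2 * w x * (\<Sum>b\<in>Basis. (pd b (Rn n) x)^2))"
     unfolding power2_eq_square
     by (intro integrable_bsupp continuous_intros cq w_cont cR bsupp_mult1 qb)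
    fix x
    have "(pd b (Rn n) x)^2 \<le> (\<Sum>b\<in>Basis. (pd b (Rn n) x)^2)" using b by (intro member_le_sum) auto
    then have "(q x)^2 * w x * (pd b (Rn n) x)^2 \<le> (q x)^2 * w x * (\<Sum>b\<in>Basis. (pd b (Rn n) x)^2)"
     by (intro mult_left_mono) auto
    then show "(q x * sqrt (w x) * pd b (Rn n) x)^2 \<le> (q x)^2 * w x * (\<Sum>b\<in>Basis. (pd b (Rn n) x)^2)"
     by (simp add: power_mult_distrib)
   qed
   also have "... \<le> 20 * (k^2 * Q) * A + k^2" using N n by blast
   finally show ?thesis using C0 by (auto intro: mult_right_mono)
  qed
  then have "I^2 \<le> (20 * (k^2 * Q) * A + k^2) * C"
   by (intro LIMSEQ_le_const2[OF tendsto_power[OF lim]]) auto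
  also have "... = ((20 * Q * A + 1) * C) / (real (Suc K))^2"
   by (simp add: k_def power_divide algebra_simps add_divide_distrib)
  finally show ?thesis .
 qed
 have "(\<lambda>K. ((20 * Q * A + 1) * C) / (real (Suc K))^2) \<longlonglongrightarrow> 0"
  by (rule LIMSEQ_Suc, intro real_tendsto_divide_at_top[OF tendsto_const] filterlim_pow_at_top filterlim_real_sequentially) simp
 moreover obtain K0 :: nat where K0: "M \<le> real K0" using real_arch_simple by blast
 have "\<exists>N. \<forall>K\<ge>N. I^2 \<le> ((20 * Q * A + 1) * C) / (real (Suc K))^2"
  by (intro exI[of _ K0] allI impI key) (use K0 in auto)
 ultimately have "I^2 \<le> 0" by (rule LIMSEQ_le_const)
 then show ?thesis unfolding I_def by simp
qed

text \<open>The mollifications of \<open>r\<close> have vanishing gradient, so each of them is constant.\<close>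

lemma constant_ae: "\<exists>c. AE x in lborel. r x = c"
proof -
 have grad0: "pd b (conv (moll n) r) x = 0" if b: "b \<in> Basis" for n b x
 proof -
  have bl: "bounded_linear (\<lambda>y::'a. - y)" by (intro bounded_linear_minus bounded_linear_ident)
  have d: "(moll n :: 'a => real) differentiable at z" for z by (rule Ck_diff[OF mollifier_C1[OF moll]]) simp
  have 1: "Ck 1 (\<lambda>y. moll n (x + - y) :: real)" by (rule Ck_compose_linear[OF bl mollifier_C1[OF moll]])
  have 2: "bsupp (\<lambda>y. moll n (x + - y) :: real)"
  proof -
   have "moll n (x + - y) = (0::real)" if "1 + norm x \<le> norm y" for y
   proof (rule mollifier_zero[OF moll])
    have "1 \<le> norm (x - y)" using that norm_triangle_ineq2[of y x] by (simp add: norm_minus_commute)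
    moreover have "1 / real (Suc n) \<le> 1" by simp
    ultimately show "1 / real (Suc n) \<le> norm (x + - y)" unfolding diff_conv_add_uminus by (rule order_trans[rotated])
   qed
   then show ?thesis by (rule bsuppI)
  qed
  have 3: "pd b (\<lambda>y. moll n (x + - y)) y = - pd b (moll n) (x - y)" for y
   using pd_compose_linear(1)[OF bl d, of b x y] pd_scaleR[OF d, of "-1" b] by simp
  have "pd b (conv (moll n) r) x = conv (pd b (moll n)) r x"
   using pd_conv[OF loc_r mollifier_C1[OF moll] mollifier_bsupp[OF moll]] by metis
  also have "... = - (LBINT y. r y * pd b (\<lambda>y. moll n (x + - y)) y)"
   unfolding conv_def 3 by (simp add: mult.commute)
  finally show ?thesis using weak_derivative_zero[OF 1 2 b] by simp
 qed
 have "\<exists>c. \<forall>x. conv (moll n) r x = c" for n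
 proof -
  have d: "conv (moll n) r differentiable at x" for x
   by (rule Ck_diff[OF Ck_conv[OF loc_r mollifier_C1[OF moll] mollifier_bsupp[OF moll]]]) simp
  have "(conv (moll n) r has_derivative (\<lambda>h. 0)) (at x)" for x
  proof -
   have "pd v (conv (moll n) r) x = 0" for v using pd_expand[OF d, of v x] grad0 by simp
   then show ?thesis using has_derivative_pd[OF d, of x] by simp
  qed
  then show ?thesis using has_derivative_zero_unique[of UNIV "conv (moll n) r"] by (metis UNIV_I convex_UNIV has_derivative_at_withinI)
 qed
 then obtain c where c: "\<And>n x. conv (moll n) r x = c n" by metis
 have lim: "(\<lambda>n. c n * (LBINT x. f x)) \<longlonglongrightarrow> (LBINT x. r x * f x)"
  if "continuous_on UNIV f" "bsupp f" for f
  using conv_moll_weak[OF loc_r that] by (simp add: c)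
 have "c \<longlonglongrightarrow> (LBINT x. r x * moll 0 x)"
  using lim[OF mollifier_cont[OF moll] mollifier_bsupp[OF moll], of 0] by (simp add: mollifier_integral[OF moll])
 then obtain C where C: "c \<longlonglongrightarrow> C" by blast
 have "AE x in lborel. r x + - C = 0"
 proof (rule AE_zero_if_test_zero)
  have lc: "loc_int (\<lambda>_::'a. - C)" by (rule loc_int_cont) simp
  show "loc_int (\<lambda>x. r x + - C)" by (rule loc_int_add[OF loc_r lc])
  fix f :: "'a => real" assume f: "continuous_on UNIV f" "bsupp f"
  have "(LBINT x. r x * f x) = C * (LBINT x. f x)"
   by (rule LIMSEQ_unique[OF lim[OF f] tendsto_mult[OF C tendsto_const]])
  moreover have "integrable lborel (\<lambda>x. r x * f x)"
   using integrable_loc_int_mult[OF loc_r f] by (simp add: mult.commute)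
  ultimately show "(LBINT x. (r x + - C) * f x) = 0"
   using integrable_bsupp[OF f] by (simp add: left_diff_distrib)
 qed
 then show ?thesis by (intro exI[of _ C]) (auto elim: eventually_mono)
qed

end

context weight begin

text \<open>By the Liouville theorem only constants are orthogonal to the range of the generator, and \<open>f\<close> has
mean zero.\<close>

lemma gen_range_dense:
 assumes wi: "integrable lborel w"
  and f [measurable]: "f \<in> borel_measurable borel" and f2: "integrable lborel (\<lambda>x. (f x)^2 * w x)"
  and f0: "(LBINT x. f x * w x) = 0" and e: "0 < e"
 shows "\<exists>u. Ck 3 u \<and> bsupp u \<and> (LBINT x. (f x - gen U u x)^2 * w x) < e"
proof -
 define M where "M = density lborel (\<lambda>x. ennreal (w x))"
 have M: "integral\<^sup>L M h = (LBINT x. h x * w x)" "integrable M h = integrable lborel (\<lambda>x. h x * w x)"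
  if "h \<in> borel_measurable borel" for h
  using that by (auto simp: M_def integral_density integrable_density mult.commute)
 have sM [measurable_cong]: "sets M = sets borel" by (simp add: M_def)
 have fin: "finite_measure M"
 proof
  have "(NNINT x. ennreal (w x)) = ennreal (integral\<^sup>L lborel w)"
   by (rule nn_integral_eq_integral[OF wi]) simp
  then show "emeasure M (space M) \<noteq> \<infinity>" by (simp add: M_def emeasure_density)
 qed
 define D where "D = {gen U u | u. Ck 3 u \<and> bsupp u}"
 have Dc: "continuous_on UNIV g" "bsupp g" if "g \<in> D" for g
  using that Ck_cont[OF Ck_gen[OF U2]] bsupp_gen by (auto simp: D_def)
 have Dm: "g \<in> borel_measurable borel" if "g \<in> D" for g using Dc(1)[OF that] by (rule borel_measurable_cont)
 have "\<exists>g\<in>D. (\<integral>x. (f x - g x)^2 \<partial>M) < e"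
 proof (rule L2_dense[OF fin _ _ _ _ _ _ _ e])
  show "f \<in> borel_measurable M" by measurable
  show "integrable M (\<lambda>x. (f x)^2)" using f2 by (subst M(2)) auto
  show "g \<in> borel_measurable M" if "g \<in> D" for g using Dm[OF that] by (simp add: measurable_def[of borel] sM space_borel M_def)
  show "integrable M (\<lambda>x. (g x)^2)" if "g \<in> D" for g
  proof -
   note [measurable] = Dm[OF that]
   have "integrable lborel (\<lambda>x. (g x)^2 * w x)"
    unfolding power2_eq_square by (intro integrable_bsupp continuous_intros Dc[OF that] w_cont bsupp_mult1)
   then show ?thesis by (subst M(2)) auto
  qed
  have "gen U (\<lambda>_. 0) \<in> D" by (auto simp: D_def bsupp_def intro!: exI[of _ "\<lambda>_. 0"])
  then show "D \<noteq> {}" by blast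
  show "(\<lambda>x. g x + a * h x) \<in> D" if gh: "g \<in> D" "h \<in> D" for g h a
  proof -
   obtain u v where u: "g = gen U u" "Ck 3 u" "bsupp u" and v: "h = gen U v" "Ck 3 v" "bsupp v"
    using gh unfolding D_def by blast
   have d: "u differentiable at x" "v differentiable at x" for x using u v by (auto intro: Ck_diff)
   have d1: "pd b u differentiable at x" "pd b v differentiable at x" for b x
    using Ck_diff[OF Ck3_pd[OF u(2)]] Ck_diff[OF Ck3_pd[OF v(2)]] by auto
   have dd: "(\<lambda>x. a * v x) differentiable at x" "(\<lambda>x. a * pd b v x) differentiable at x" for b x
    using d d1 by auto
   have 1: "pd b (\<lambda>x. u x + a * v x) = (\<lambda>x. pd b u x + a * pd b v x)" for b
    by (auto simp: pd_add pd_cmult d dd)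
   have 2: "pd b (\<lambda>x. pd b u x + a * pd b v x) x = pd b (pd b u) x + a * pd b (pd b v) x" for b x
    by (simp add: pd_add pd_cmult d1 dd)
   have "(\<lambda>x. g x + a * h x) = gen U (\<lambda>x. u x + a * v x)"
    by (auto simp: gen_def u v 1 2 sum_distrib_left sum.distrib[symmetric] algebra_simps intro!: sum.cong)
   moreover have "Ck 3 (\<lambda>x. u x + a * v x)" "bsupp (\<lambda>x. u x + a * v x)"
    using u v by (auto intro!: Ck_add Ck_cmult bsupp_add bsupp_mult2)
   ultimately show ?thesis by (auto simp: D_def)
  qed
  fix r assume r: "r \<in> borel_measurable M" "integrable M (\<lambda>x. (r x)^2)" "\<And>g. g \<in> D ==> (\<integral>x. r x * g x \<partial>M) = 0"
  have rm [measurable]: "r \<in> borel_measurable borel" using r(1) by (simp add: M_def)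
  interpret weak_harmonic U r
  proof
   show "integrable lborel (\<lambda>x. (r x)^2 * w x)" using r(2) by (subst (asm) M(2)) auto
   fix u :: "'a => real" assume u: "Ck 3 u" "bsupp u"
   then have "gen U u \<in> D" by (auto simp: D_def)
   from r(3)[OF this] show "(LBINT x. r x * gen U u x * w x) = 0"
    using Dm[OF \<open>gen U u \<in> D\<close>] by (subst (asm) M(1)) auto
  qed (fact rm)
  obtain c where "AE x in lborel. r x = c" using constant_ae by blast
  then have "AE x in lborel. r x * f x * w x = c * (f x * w x)" by eventually_elim simp
  then have "(LBINT x. r x * f x * w x) = (LBINT x. c * (f x * w x))"
   by (intro integral_cong_AE) auto
  then show "(\<integral>x. r x * f x \<partial>M) = 0" using f0 by (subst M(1)) auto
 qed
 then obtain u where u: "Ck 3 u" "bsupp u" "(\<integral>x. (f x - gen U u x)^2 \<partial>M) < e" by (auto simp: D_def)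
 have [measurable]: "gen U u \<in> borel_measurable borel"
  by (rule borel_measurable_cont[OF Ck_cont[OF Ck_gen[OF U2 u(1)]]])
 have "(\<integral>x. (f x - gen U u x)^2 \<partial>M) = (LBINT x. (f x - gen U u x)^2 * w x)"
  by (rule M(1)) measurable
 then show ?thesis using u by metis
qed

end

section \<open>Bochner's formula\<close>

context weight begin

text \<open>Differentiating the generator gives \<open>\<partial>\<^sub>j (L u) = L (\<partial>\<^sub>j u) - \<nabla>(\<partial>\<^sub>j U) \<cdot> \<nabla>u\<close>; two integrations by
parts yield the formula.\<close>

lemma bochner:
 assumes u: "Ck 3 u" "bsupp u"
 shows "(LBINT x. (gen U u x)^2 * w x) =
   (\<Sum>a\<in>Basis. \<Sum>b\<in>Basis. LBINT x. (pd a (pd b u) x)^2 * w x)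
  + (\<Sum>a\<in>Basis. \<Sum>b\<in>Basis. LBINT x. pd a (pd b U) x * pd a u x * pd b u x * w x)"
proof -
 have u2: "Ck 2 u" by (rule Ck_mono[OF u(1)]) simp
 have U1: "Ck 1 U" by (rule Ck_mono[OF U2]) simp
 have pu2: "Ck 2 (pd b u)" for b by (rule Ck3_pd[OF u(1)])
 have pu1: "Ck 1 (pd b u)" for b by (rule Ck2_pd[OF u2])
 have ppu1: "Ck 1 (pd a (pd b u))" for a b by (rule Ck2_pd[OF pu2])
 have ppU: "continuous_on UNIV (pd a (pd b U))" for a b using pdU1[of b] by simp
 have bs: "bsupp (pd b u)" "bsupp (pd a (pd b u))" for a b using u(2) bsupp_pd by blast+
 have d: "pd b u differentiable at x" "pd a (pd b u) differentiable at x" "pd b U differentiable at x" for a b x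
  using pu1 ppu1 pdU1 by (auto intro: Ck_diff)
 have c1: "continuous_on UNIV (pd b u)" "continuous_on UNIV (pd a (pd b u))" for a b
  using Ck_cont pu1 ppu1 by blast+
 have i1: "integrable lborel (\<lambda>x. (pd a (pd b u) x)^2 * w x)" for a b
  unfolding power2_eq_square by (intro integrable_bsupp continuous_intros c1 w_cont bsupp_mult1 bs)
 have i2: "integrable lborel (\<lambda>x. pd a (pd b U) x * pd a u x * pd b u x * w x)" for a b
  by (intro integrable_bsupp continuous_intros c1 w_cont ppU) (intro bsupp_mult1 bsupp_mult2 bs)
 have comm: "pd j (pd i (pd i u)) = pd i (pd i (pd j u))" for i j
  using pd_commute[OF pu2, of j i i] pd_commute[OF u2, of j i] by simp
 have dg: "pd j (gen U u) x = gen U (pd j u) x - (\<Sum>i\<in>Basis. pd j (pd i U) x * pd i u x)" for j x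
 proof -
  have "pd j (gen U u) x = (\<Sum>i\<in>Basis. pd j (pd i (pd i u)) x - (pd j (pd i U) x * pd i u x + pd i U x * pd j (pd i u) x))"
   unfolding gen_def by (simp add: pd_sum pd_diff pd_mult d)
  also have "... = (\<Sum>i\<in>Basis. (pd i (pd i (pd j u)) x - pd i U x * pd i (pd j u) x) - pd j (pd i U) x * pd i u x)"
   using pd_commute[OF u2, of j] by (intro sum.cong refl) (simp add: comm)
  finally show ?thesis by (simp add: gen_def sum_subtractf)
 qed
 have cg: "continuous_on UNIV (gen U (pd j u))" for j
  unfolding gen_def by (intro continuous_intros c1 Ck_cont[OF Ck_pd[of 0 _]] pdU_cont) (use ppu1 in simp)
 have i3: "integrable lborel (\<lambda>x. pd j u x * gen U (pd j u) x * w x)" for j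
  by (intro integrable_bsupp continuous_intros c1 cg w_cont bsupp_mult1 bs)
 have "(LBINT x. (gen U u x)^2 * w x) = - (\<Sum>j\<in>Basis. LBINT x. pd j (gen U u) x * pd j u x * w x)"
  using integral_gen[OF U1 u2 u(2) Ck_gen[OF U2 u(1)]] by (simp add: power2_eq_square w_def)
 also have "... = (\<Sum>j\<in>Basis. (\<Sum>i\<in>Basis. LBINT x. (pd i (pd j u) x)^2 * w x)
   + (\<Sum>i\<in>Basis. LBINT x. pd j (pd i U) x * pd j u x * pd i u x * w x))"
  unfolding sum_negf[symmetric]
 proof (rule sum.cong[OF refl])
  fix j :: 'a
  have "(\<lambda>x. pd j (gen U u) x * pd j u x * w x) =
    (\<lambda>x. pd j u x * gen U (pd j u) x * w x - (\<Sum>i\<in>Basis. pd j (pd i U) x * pd j u x * pd i u x * w x))"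
   unfolding dg by (auto simp: algebra_simps sum_distrib_left)
  then have "(LBINT x. pd j (gen U u) x * pd j u x * w x) = (LBINT x. pd j u x * gen U (pd j u) x * w x)
    - (\<Sum>i\<in>Basis. LBINT x. pd j (pd i U) x * pd j u x * pd i u x * w x)"
   using i2 i3 by simp
  moreover have "(LBINT x. pd j u x * gen U (pd j u) x * w x) = - (\<Sum>i\<in>Basis. LBINT x. (pd i (pd j u) x)^2 * w x)"
   using integral_gen[OF U1 pu2 bs(1) pu1, of j j] by (simp add: power2_eq_square w_def)
  ultimately show "- (LBINT x. pd j (gen U u) x * pd j u x * w x) =
    (\<Sum>i\<in>Basis. LBINT x. (pd i (pd j u) x)^2 * w x)
   + (\<Sum>i\<in>Basis. LBINT x. pd j (pd i U) x * pd j u x * pd i u x * w x)" by simp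
 qed
 also have "... = (\<Sum>j\<in>Basis. \<Sum>i\<in>Basis. LBINT x. (pd i (pd j u) x)^2 * w x)
   + (\<Sum>j\<in>Basis. \<Sum>i\<in>Basis. LBINT x. pd j (pd i U) x * pd j u x * pd i u x * w x)"
  by (rule sum.distrib)
 also have "(\<Sum>j\<in>(Basis::'a set). \<Sum>i\<in>Basis. LBINT x. (pd i (pd j u) x)^2 * w x) =
   (\<Sum>a\<in>Basis. \<Sum>b\<in>Basis. LBINT x. (pd a (pd b u) x)^2 * w x)"
  by (rule sum.swap)
 finally show ?thesis .
qed

end

section \<open>Coordinate permutations\<close>

definition pm :: "('n => 'n) => real ^ 'n => real ^ ('n::finite)" where
 "pm p x = (\<chi> i. x $ p i)"

lemma pm_nth [simp]: "pm p x $ i = x $ p i" by (simp add: pm_def)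

lemma pm_compose: "pm q (pm p x) = pm (p \<circ> q) x" by (simp add: vec_eq_iff)

lemma pm_id [simp]: "pm id x = x" by (simp add: vec_eq_iff)

lemma linear_pm: "linear (pm p)" by (rule linearI) (simp_all add: vec_eq_iff)

lemma bounded_linear_pm: "bounded_linear (pm p)" using linear_pm linear_conv_bounded_linear by blast

lemma cont_pm: "continuous_on S (pm p)" by (rule linear_continuous_on[OF bounded_linear_pm])

lemma pm_measurable [measurable]: "pm p \<in> borel_measurable borel"
 by (rule borel_measurable_continuous_onI[OF cont_pm])

lemma pm_axis:
 assumes "p permutes UNIV" shows "pm p (axis (p i) c) = axis i c"
 using permutes_inj[OF assms] by (auto simp: vec_eq_iff axis_def inj_eq)

lemma pm_Basis: assumes "p permutes UNIV" shows "bij_betw (pm p) Basis (Basis :: (real ^ 'n::finite) set)"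
proof (rule bij_betw_imageI)
 show "inj_on (pm p) Basis"
 proof (rule inj_onI)
  fix x y :: "real ^ 'n" assume "pm p x = pm p y"
  then have "pm (inv p) (pm p x) = pm (inv p) (pm p y)" by simp
  then show "x = y" by (simp add: pm_compose permutes_inv_o[OF assms])
 qed
 have e: "Basis = range (\<lambda>i::'n. axis i (1::real))" by (auto simp: Basis_vec_def)
 have "pm p ` range (\<lambda>i::'n. axis (p i) (1::real)) = range (\<lambda>i. axis i 1)"
  by (auto simp: pm_axis[OF assms] image_iff)
 moreover have "range (\<lambda>i::'n. axis (p i) (1::real)) = range (\<lambda>i. axis i 1)"
 proof -
  have "range (\<lambda>i::'n. axis (p i) (1::real)) = (\<lambda>i. axis i 1) ` range p" by (simp add: image_image)
  then show ?thesis using permutes_surj[OF assms] by simp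
 qed
 ultimately show "pm p ` Basis = (Basis :: (real ^ 'n) set)" unfolding e by simp
qed

lemma sum_Basis_pm:
 assumes "p permutes UNIV" shows "(\<Sum>b\<in>(Basis :: (real ^ 'n::finite) set). h (pm p b)) = (\<Sum>b\<in>Basis. h b)"
 using sum.reindex_bij_betw[OF pm_Basis[OF assms]] .

lemma sum_Basis_axis: "(\<Sum>b\<in>(Basis :: (real ^ 'n::finite) set). h b) = (\<Sum>i\<in>UNIV. h (axis i 1))"
proof -
 have e: "Basis = range (\<lambda>i::'n. axis i (1::real))" by (auto simp: Basis_vec_def)
 have "inj (\<lambda>i::'n. axis i (1::real))" by (auto simp: inj_on_def axis_eq_axis)
 then show ?thesis unfolding e by (simp add: sum.reindex)
qed

lemma norm_pm: assumes "p permutes UNIV" shows "norm (pm p x) = norm x"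
proof -
 have "(\<Sum>i\<in>UNIV. (norm (x $ p i))^2) = (\<Sum>i\<in>UNIV. (norm (x $ i))^2)"
  by (rule sum.reindex_bij_betw[OF permutes_bij[OF assms]])
 then show ?thesis by (simp add: norm_vec_def L2_set_def)
qed

lemma distr_pm:
 assumes p: "p permutes UNIV" shows "distr lborel borel (pm p) = (lborel :: (real ^ 'n::finite) measure)"
proof (rule measure_eqI)
 fix A :: "(real ^ 'n) set" assume "A \<in> sets (distr lborel borel (pm p))"
 then have A [measurable]: "A \<in> sets borel" by simp
 have T: "orthogonal_transformation (pm p :: real ^ 'n => real ^ 'n)"
  by (simp add: orthogonal_transformation linear_pm norm_pm[OF p])
 have "emeasure (distr lborel borel (pm p)) A = (NNINT x. indicator A (pm p x))"
  by (subst nn_integral_indicator[symmetric], simp, subst nn_integral_distr) auto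
 also have "... = emeasure lborel A" by (subst nn_integral_orthogonal_transformation[OF T]) auto
 finally show "emeasure (distr lborel borel (pm p)) A = emeasure lborel A" .
qed simp

lemma integral_pm:
 fixes h :: "real ^ 'n::finite => real"
 assumes p: "p permutes UNIV" and [measurable]: "h \<in> borel_measurable borel"
 shows "(LBINT x. h (pm p x)) = integral\<^sup>L lborel h"
 by (subst (2) distr_pm[OF p, symmetric]) (simp add: integral_distr)

lemma pd_pm: fixes f :: "_ => real" shows "f differentiable at (pm p x) ==> pd v (\<lambda>x. f (pm p x)) x = pd (pm p v) f (pm p x)"
 using pd_compose_linear(1)[OF bounded_linear_pm, of f 0 p x v] by simp

lemma diff_pm: fixes f :: "_ => real" shows "f differentiable at (pm p x) ==> (\<lambda>x. f (pm p x)) differentiable at x"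
 using pd_compose_linear(2)[OF bounded_linear_pm, of f 0 p x] by simp

lemma Ck_pm: "Ck k f ==> Ck k (\<lambda>x. f (pm p x))"
 using Ck_compose_linear[OF bounded_linear_pm, of k f 0 p] by simp

lemma bsupp_pm: assumes "p permutes UNIV" "bsupp f" shows "bsupp (\<lambda>x. f (pm p x))"
 using assms(2) by (simp add: bsupp_def) (metis norm_pm[OF assms(1)])

definition perms :: "('n::finite => 'n) set" where "perms = {p. p permutes UNIV}"

definition Sym :: "(real ^ 'n::finite => real) => real ^ 'n => real" where
 "Sym f x = (\<Sum>p\<in>perms. f (pm p x)) / real (card (perms :: ('n => 'n) set))"

lemma finite_perms [simp]: "finite perms" unfolding perms_def by (rule finite_permutations) simp

lemma id_perms: "id \<in> perms" by (simp add: perms_def permutes_id)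

lemma card_perms [simp]: "0 < card perms" "card perms \<noteq> 0"
 using id_perms finite_perms by (auto simp: card_gt_0_iff)

lemma permsD: "p \<in> perms ==> p permutes UNIV" by (simp add: perms_def)

lemma sum_perms_compose_right:
 assumes "q \<in> perms" shows "(\<Sum>p\<in>perms. h (p \<circ> q)) = (\<Sum>p\<in>perms. (h p :: real))"
proof -
 have "bij_betw (\<lambda>p. p \<circ> q) perms perms"
 proof (rule bij_betwI[where g = "\<lambda>p. p \<circ> inv q"])
  show "(\<lambda>p. p \<circ> q) \<in> perms \<rightarrow> perms" "(\<lambda>p. p \<circ> inv q) \<in> perms \<rightarrow> perms"
   using assms by (auto simp: perms_def intro!: permutes_compose permutes_inv)
  show "p \<circ> q \<circ> inv q = p" "p \<circ> inv q \<circ> q = p" for p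
   using permutes_inv_o[OF permsD[OF assms]] by (simp_all add: comp_assoc)
 qed
 then show ?thesis by (rule sum.reindex_bij_betw)
qed

lemma sum_perms_compose_left:
 assumes "q \<in> perms" shows "(\<Sum>p\<in>perms. h (q \<circ> p)) = (\<Sum>p\<in>perms. (h p :: real))"
proof -
 have "bij_betw (\<lambda>p. q \<circ> p) perms perms"
 proof (rule bij_betwI[where g = "\<lambda>p. inv q \<circ> p"])
  show "(\<lambda>p. q \<circ> p) \<in> perms \<rightarrow> perms" "(\<lambda>p. inv q \<circ> p) \<in> perms \<rightarrow> perms"
   using assms by (auto simp: perms_def intro!: permutes_compose permutes_inv)
  show "inv q \<circ> (q \<circ> p) = p" "q \<circ> (inv q \<circ> p) = p" for p
   using permutes_inv_o[OF permsD[OF assms]] by (simp_all flip: comp_assoc)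
 qed
 then show ?thesis by (rule sum.reindex_bij_betw)
qed

lemma Sym_pm: assumes "q \<in> perms" shows "Sym f (pm q x) = Sym f x"
 unfolding Sym_def using sum_perms_compose_left[OF assms, of "\<lambda>p. f (pm p x)"] by (simp add: pm_compose)

lemma Sym_fixed: assumes "\<And>p. p \<in> perms ==> f (pm p x) = f x" shows "Sym f x = f x"
 unfolding Sym_def by (simp add: assms)

lemma Ck_Sym: "Ck k f ==> Ck k (Sym f)"
 using Ck_cmult[OF Ck_sum[of perms k "\<lambda>p x. f (pm p x)"], of "1 / real (card perms)"]
 by (simp add: Ck_pm Sym_def[abs_def])

lemma bsupp_Sym: assumes "bsupp f" shows "bsupp (Sym f)"
proof -
 have "bsupp (\<lambda>x. (\<Sum>p\<in>perms. f (pm p x)) * (1 / real (card perms)))"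
  by (intro bsupp_mult1 bsupp_sum bsupp_pm assms permsD)
 then show ?thesis by (simp add: Sym_def[abs_def])
qed

lemma avg_sq_le:
 fixes h :: "'i => real"
 assumes "finite P" "P \<noteq> {}"
 shows "((\<Sum>p\<in>P. h p) / real (card P))^2 \<le> (\<Sum>p\<in>P. (h p)^2) / real (card P)"
proof -
 have "(\<Sum>p\<in>P. h p)^2 \<le> real (card P) * (\<Sum>p\<in>P. (h p)^2)"
  using sum_squared_le_sum_of_squares[of h P] by (simp add: mult.commute)
 moreover have "0 < real (card P)" using assms by (simp add: card_gt_0_iff)
 ultimately show ?thesis by (simp add: power_divide field_simps power2_eq_square)
qed

section \<open>Two matrix inequalities\<close>

lemma sum_sq_differences:
 fixes v :: "'n::finite => real"
 shows "(\<Sum>i\<in>UNIV. \<Sum>j\<in>UNIV. (v i - v j)^2) = 2 * real CARD('n) * (\<Sum>i\<in>UNIV. (v i)^2) - 2 * (\<Sum>i\<in>UNIV. v i)^2"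
proof -
 have "(\<Sum>i\<in>UNIV. \<Sum>j\<in>UNIV. (v i - v j)^2) = (\<Sum>i\<in>UNIV. \<Sum>j\<in>UNIV. (v i)^2 + (v j)^2 - 2 * (v i * v j))"
  by (intro sum.cong refl) (simp add: power2_diff)
 also have "... = 2 * real CARD('n) * (\<Sum>i\<in>UNIV. (v i)^2) - 2 * (\<Sum>i\<in>UNIV. \<Sum>j\<in>UNIV. v i * v j)"
 proof -
  have "(\<Sum>i\<in>UNIV. \<Sum>j\<in>(UNIV::'n set). (v i)^2) = real CARD('n) * (\<Sum>i\<in>UNIV. (v i)^2)"
   by (simp add: sum_distrib_left)
  moreover have "(\<Sum>i\<in>(UNIV::'n set). \<Sum>j\<in>UNIV. (v j)^2) = real CARD('n) * (\<Sum>i\<in>UNIV. (v i)^2)"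
   by simp
  moreover have "(\<Sum>i\<in>UNIV. \<Sum>j\<in>UNIV. 2 * (v i * v j)) = 2 * (\<Sum>i\<in>UNIV. \<Sum>j\<in>UNIV. v i * v j)"
   by (simp only: sum_distrib_left)
  ultimately show ?thesis by (simp only: sum.distrib sum_subtractf)
 qed
 also have "(\<Sum>i\<in>UNIV. \<Sum>j\<in>UNIV. v i * v j) = (\<Sum>i\<in>UNIV. v i)^2"
  by (simp add: power2_eq_square sum_product)
 finally show ?thesis .
qed

text \<open>Applied to the Hessian of \<open>u\<close>, the terms on the left are the derivatives of \<open>\<partial>\<^sub>i u - \<partial>\<^sub>j u\<close> along \<open>e\<^sub>i - e\<^sub>j\<close>, which
the pair inequality produces.\<close>

lemma sum_sq_second_differences:
 fixes a :: "'n::finite => 'n => real"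
 assumes sym: "\<And>i j. a i j = a j i"
 shows "(\<Sum>i\<in>UNIV. \<Sum>j\<in>UNIV. (a i i - 2 * a i j + a j j)^2) \<le> 4 * real CARD('n) * (\<Sum>i\<in>UNIV. \<Sum>j\<in>UNIV. (a i j)^2)"
proof -
 define n where "n = real CARD('n)"
 have n: "1 \<le> n" unfolding n_def by (simp add: Suc_leI)
 define t where "t i j = a i i - 2 * a i j + a j j" for i j
 have tii: "t i i = 0" and ts: "t i j = t j i" for i j by (simp_all add: t_def sym[of i j])
 define s where "s i = (\<Sum>j\<in>UNIV. t i j)" for i
 define m where "m i j = (if i = j then s i else 0) - t i j" for i j
 define T where "T = (\<Sum>i\<in>UNIV. \<Sum>j\<in>UNIV. (t i j)^2)"
 define N where "N = (\<Sum>i\<in>UNIV. \<Sum>j\<in>UNIV. (a i j)^2)"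
 have s_le: "(s i)^2 \<le> (n - 1) * (\<Sum>j\<in>UNIV. (t i j)^2)" for i
 proof -
  have s: "s i = (\<Sum>j\<in>UNIV-{i}. t i j)" unfolding s_def by (simp add: sum.remove[of UNIV i] tii)
  have q: "(\<Sum>j\<in>UNIV. (t i j)^2) = (\<Sum>j\<in>UNIV-{i}. (t i j)^2)" by (simp add: sum.remove[of UNIV i] tii)
  have "real (card (UNIV - {i})) = n - 1" unfolding n_def by (simp add: card_Diff_singleton of_nat_diff Suc_leI)
  then show ?thesis unfolding s q using sum_squared_le_sum_of_squares[of "t i" "UNIV - {i}"] by (simp add: mult.commute)
 qed
 have mm: "(\<Sum>i\<in>UNIV. \<Sum>j\<in>UNIV. (m i j)^2) \<le> n * T"
 proof -
  have "(m i j)^2 = (if i = j then (s i)^2 else 0) + (t i j)^2" for i j by (simp add: m_def tii)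
  then have "(\<Sum>i\<in>UNIV. \<Sum>j\<in>UNIV. (m i j)^2) = (\<Sum>i\<in>UNIV. (s i)^2) + T"
   by (simp add: sum.distrib T_def)
  also have "... \<le> (\<Sum>i\<in>UNIV. (n - 1) * (\<Sum>j\<in>UNIV. (t i j)^2)) + T"
   by (intro add_mono sum_mono s_le order_refl)
  also have "(\<Sum>i\<in>UNIV. (n - 1) * (\<Sum>j\<in>UNIV. (t i j)^2)) = (n - 1) * T"
   unfolding T_def by (simp only: sum_distrib_left)
  also have "(n - 1) * T + T = n * T" by (simp add: algebra_simps)
  finally show ?thesis .
 qed
 have Tm: "T = 2 * (\<Sum>i\<in>UNIV. \<Sum>j\<in>UNIV. a i j * m i j)"
 proof -
  have "T = (\<Sum>i\<in>UNIV. \<Sum>j\<in>UNIV. t i j * a i i + t i j * a j j - 2 * (a i j * t i j))"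
   unfolding T_def by (intro sum.cong refl) (simp add: power2_eq_square t_def algebra_simps)
  also have "... = (\<Sum>i\<in>UNIV. \<Sum>j\<in>UNIV. t i j * a i i) + (\<Sum>i\<in>UNIV. \<Sum>j\<in>UNIV. t i j * a j j)
    - 2 * (\<Sum>i\<in>UNIV. \<Sum>j\<in>UNIV. a i j * t i j)"
   by (simp add: sum.distrib sum_subtractf sum_distrib_left)
  also have "(\<Sum>i\<in>UNIV. \<Sum>j\<in>UNIV. t i j * a j j) = (\<Sum>i\<in>UNIV. \<Sum>j\<in>UNIV. t i j * a i i)"
   by (subst sum.swap) (simp add: ts)
  also have "(\<Sum>i\<in>UNIV. \<Sum>j\<in>UNIV. t i j * a i i) = (\<Sum>i\<in>UNIV. \<Sum>j\<in>UNIV. a i j * (if i = j then s i else 0))"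
   by (simp add: s_def sum_distrib_right[symmetric] if_distrib cong: if_cong) (simp add: mult.commute)
  finally show ?thesis
   by (simp add: m_def right_diff_distrib sum_subtractf)
 qed
 have "T \<le> 2 * n * N + T / 2"
 proof -
  have ineq: "2 * (a i j * m i j) \<le> 2 * n * (a i j)^2 + (m i j)^2 / (2 * n)" for i j
  proof -
   have "0 \<le> (2 * n * a i j - m i j)^2 / (2 * n)" using n by simp
   also have "... = 2 * n * (a i j)^2 + (m i j)^2 / (2 * n) - 2 * (a i j * m i j)"
    using n by (simp add: power2_eq_square field_simps)
   finally show ?thesis by simp
  qed
  have "T = (\<Sum>i\<in>UNIV. \<Sum>j\<in>UNIV. 2 * (a i j * m i j))" unfolding Tm by (simp add: sum_distrib_left)
  also have "... \<le> (\<Sum>i\<in>UNIV. \<Sum>j\<in>UNIV. 2 * n * (a i j)^2 + (m i j)^2 / (2 * n))"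
   by (intro sum_mono ineq)
  also have "... = 2 * n * N + (\<Sum>i\<in>UNIV. \<Sum>j\<in>UNIV. (m i j)^2) / (2 * n)"
   by (simp add: sum.distrib N_def sum_distrib_left sum_divide_distrib)
  also have "... \<le> 2 * n * N + n * T / (2 * n)"
   using mm n by (intro add_left_mono divide_right_mono) auto
  finally show ?thesis using n by simp
 qed
 then have "T \<le> 4 * n * N" by linarith
 then show ?thesis by (simp add: T_def N_def t_def n_def)
qed

section \<open>The random transposition walk\<close>

abbreviation tr :: "'a => 'a => 'a => 'a" where "tr \<equiv> Transposition.transpose"

text \<open>Functions of a permutation \<open>p\<close> stand for the values \<open>g (pm p x)\<close> at the rearrangements of one point. The
average runs over the permutations of the positions in \<open>I\<close>, acting from the right.\<close>

definition SymOn :: "'n set => (('n::finite => 'n) => real) => ('n => 'n) => real" where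
 "SymOn I f p = (\<Sum>q | q permutes I. f (p \<circ> q)) / fact (card I)"

definition TDir :: "'n set => (('n::finite => 'n) => real) => real" where
 "TDir I f = (\<Sum>i\<in>I. \<Sum>j\<in>I. \<Sum>p\<in>perms. (f p - f (p \<circ> tr i j))^2)"

lemma card_permutes: "card {q. q permutes (I :: 'n::finite set)} = fact (card I)"
 by (rule card_permutations) auto

lemma permutes_perms: "q permutes I ==> q \<in> perms"
 by (auto simp: perms_def intro: permutes_subset)

lemma SymOn_inv: assumes "q permutes I" shows "SymOn I f (p \<circ> q) = SymOn I f p"
proof -
 have "bij_betw (\<lambda>r. q \<circ> r) {r. r permutes I} {r. r permutes I}"
 proof (rule bij_betwI[where g = "\<lambda>r. inv q \<circ> r"])
  show "(\<lambda>r. q \<circ> r) \<in> {r. r permutes I} \<rightarrow> {r. r permutes I}" "(\<lambda>r. inv q \<circ> r) \<in> {r. r permutes I} \<rightarrow> {r. r permutes I}"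
   using assms by (auto intro!: permutes_compose permutes_inv)
  show "inv q \<circ> (q \<circ> r) = r" "q \<circ> (inv q \<circ> r) = r" for r
   using permutes_inv_o[OF assms] by (simp_all flip: comp_assoc)
 qed
 from sum.reindex_bij_betw[OF this, of "\<lambda>r. f (p \<circ> r)"]
 show ?thesis by (simp add: SymOn_def comp_assoc)
qed

lemma SymOn_orth:
 fixes f g :: "('n::finite => 'n) => real"
 assumes inv: "\<And>p q. q permutes I ==> g (p \<circ> q) = g p"
 shows "(\<Sum>p\<in>perms. (f p - SymOn I f p) * g p) = 0"
proof -
 have "(\<Sum>p\<in>perms. SymOn I f p * g p) = (\<Sum>q | q permutes I. \<Sum>p\<in>perms. f (p \<circ> q) * g p) / fact (card I)"
  by (simp add: SymOn_def sum_distrib_right sum_divide_distrib sum.swap[of _ perms])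
 also have "(\<Sum>q | q permutes I. \<Sum>p\<in>perms. f (p \<circ> q) * g p) = (\<Sum>q | q permutes I. \<Sum>p\<in>perms. f p * g p)"
 proof (rule sum.cong[OF refl])
  fix q assume "q \<in> {q. q permutes I}"
  then have q: "q permutes I" by simp
  have "(\<Sum>p\<in>perms. f (p \<circ> q) * g p) = (\<Sum>p\<in>perms. f (p \<circ> q) * g (p \<circ> q))" by (simp add: inv[OF q])
  also have "... = (\<Sum>p\<in>perms. f p * g p)"
   by (rule sum_perms_compose_right[OF permutes_perms[OF q], of "\<lambda>p. f p * g p"])
  finally show "(\<Sum>p\<in>perms. f (p \<circ> q) * g p) = (\<Sum>p\<in>perms. f p * g p)" .
 qed
 also have "... / fact (card I) = (\<Sum>p\<in>perms. f p * g p)"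
  by (simp add: card_permutes)
 finally show ?thesis by (simp add: left_diff_distrib sum_subtractf)
qed

lemma SymOn_subset_inv:
 assumes "J \<subseteq> I" "q permutes J" shows "SymOn I f (p \<circ> q) = SymOn I f p"
 by (rule SymOn_inv) (rule permutes_subset[OF assms(2,1)])

lemma SymOn_insert:
 fixes J :: "'n::finite set" assumes k: "k \<notin> J"
 shows "SymOn (insert k J) f p = (\<Sum>j\<in>insert k J. SymOn J f (p \<circ> tr k j)) / real (card (insert k J))"
proof -
 have "(\<Sum>q | q permutes insert k J. f (p \<circ> q)) = (\<Sum>j\<in>insert k J. \<Sum>q | q permutes J. f (p \<circ> (tr k j \<circ> q)))"
  by (rule sum_over_permutations_insert) (use k in auto)
 then show ?thesis using k
  by (simp only: SymOn_def comp_assoc sum_divide_distrib[symmetric] card_insert_disjoint[OF finite k] fact_Suc) (simp add: mult.commute)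
qed

lemma sum_perms_diff_sq:
 fixes g :: "('n::finite => 'n) => real"
 assumes q: "q \<in> perms"
 shows "(\<Sum>p\<in>perms. g p * (g p - g (p \<circ> q))) = (\<Sum>p\<in>perms. (g p - g (p \<circ> q))^2) / 2"
proof -
 have "(\<Sum>p\<in>perms. (g (p \<circ> q))^2) = (\<Sum>p\<in>perms. (g p)^2)" by (rule sum_perms_compose_right[OF q])
 moreover have "(\<Sum>p\<in>perms. (g p - g (p \<circ> q))^2) =
   (\<Sum>p\<in>perms. (g p)^2) + (\<Sum>p\<in>perms. (g (p \<circ> q))^2) - 2 * (\<Sum>p\<in>perms. g p * g (p \<circ> q))"
  by (simp add: power2_diff sum.distrib sum_subtractf sum_distrib_left mult.assoc)
 moreover have "(\<Sum>p\<in>perms. g p * (g p - g (p \<circ> q))) = (\<Sum>p\<in>perms. (g p)^2) - (\<Sum>p\<in>perms. g p * g (p \<circ> q))"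
  by (simp add: right_diff_distrib sum_subtractf power2_eq_square)
 ultimately show ?thesis by simp
qed

text \<open>A permutation \<open>q\<close> of \<open>J\<close> fixes \<open>k\<close> and conjugates the transposition of \<open>k\<close> and \<open>j\<close> into one of \<open>k\<close> with another
element of \<open>J\<close>, so averaging does not increase the total energy of these transpositions.\<close>

lemma SymOn_transpose_energy:
 fixes J :: "'n::finite set" and k :: 'n assumes k: "k \<notin> J"
 shows "(\<Sum>j\<in>J. \<Sum>p\<in>perms. (SymOn J f p - SymOn J f (p \<circ> tr k j))^2)
   \<le> (\<Sum>j\<in>J. \<Sum>p\<in>perms. (f p - f (p \<circ> tr k j))^2)"
proof -
 define P where "P = {q. q permutes J}"
 have P: "finite P" "P \<noteq> {}" "real (card P) = fact (card J)"
  unfolding P_def using permutes_id[of J] by (blast intro: finite_permutations finite, blast, simp add: card_permutes)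
 have conj: "tr k j \<circ> q = q \<circ> tr k (inv q j)" if "q \<in> P" for q j
 proof -
  have q: "q permutes J" using that by (simp add: P_def)
  have qk: "q k = k" using permutes_not_in[OF q k] .
  show ?thesis
  proof
   fix x
   have 1: "q x = k \<longleftrightarrow> x = k" using qk permutes_inj[OF q] by (metis injD)
   have 2: "q x = j \<longleftrightarrow> x = inv q j" using permutes_inverses[OF q] by metis
   show "(tr k j \<circ> q) x = (q \<circ> tr k (inv q j)) x"
    using 1 2 qk permutes_inverses(1)[OF q] by (auto simp: Transposition.transpose_def)
  qed
 qed
 have "(\<Sum>p\<in>perms. (SymOn J f p - SymOn J f (p \<circ> tr k j))^2)
   \<le> (\<Sum>q\<in>P. \<Sum>p\<in>perms. (f p - f (p \<circ> tr k (inv q j)))^2) / real (card P)" for j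
 proof -
  have "(SymOn J f p - SymOn J f (p \<circ> tr k j))^2 \<le>
    (\<Sum>q\<in>P. (f (p \<circ> q) - f (p \<circ> q \<circ> tr k (inv q j)))^2) / real (card P)" for p
  proof -
   have "SymOn J f p - SymOn J f (p \<circ> tr k j) =
     (\<Sum>q\<in>P. f (p \<circ> q) - f (p \<circ> (tr k j \<circ> q))) / real (card P)"
    by (simp add: SymOn_def P(3) P_def[symmetric] sum_subtractf diff_divide_distrib comp_assoc)
   also have "(\<Sum>q\<in>P. f (p \<circ> q) - f (p \<circ> (tr k j \<circ> q))) = (\<Sum>q\<in>P. f (p \<circ> q) - f (p \<circ> q \<circ> tr k (inv q j)))"
    by (intro sum.cong refl) (simp add: conj comp_assoc)
   finally have e: "SymOn J f p - SymOn J f (p \<circ> tr k j) =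
     (\<Sum>q\<in>P. f (p \<circ> q) - f (p \<circ> q \<circ> tr k (inv q j))) / real (card P)" .
   show ?thesis unfolding e by (rule avg_sq_le[OF P(1,2)])
  qed
  then have "(\<Sum>p\<in>perms. (SymOn J f p - SymOn J f (p \<circ> tr k j))^2) \<le>
    (\<Sum>p\<in>perms. (\<Sum>q\<in>P. (f (p \<circ> q) - f (p \<circ> q \<circ> tr k (inv q j)))^2) / real (card P))"
   by (intro sum_mono)
  also have "... = (\<Sum>q\<in>P. \<Sum>p\<in>perms. (f (p \<circ> q) - f (p \<circ> q \<circ> tr k (inv q j)))^2) / real (card P)"
   by (simp add: sum_divide_distrib[symmetric] sum.swap[of _ perms])
  also have "... = (\<Sum>q\<in>P. \<Sum>p\<in>perms. (f p - f (p \<circ> tr k (inv q j)))^2) / real (card P)"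
  proof -
   have "(\<Sum>p\<in>perms. (f (p \<circ> q) - f (p \<circ> q \<circ> tr k (inv q j)))^2) = (\<Sum>p\<in>perms. (f p - f (p \<circ> tr k (inv q j)))^2)"
    if "q \<in> P" for q
    using sum_perms_compose_right[of q "\<lambda>p. (f p - f (p \<circ> tr k (inv q j)))^2"] permutes_perms[of q J] that
    by (simp add: P_def)
   then show ?thesis by simp
  qed
  finally show ?thesis .
 qed
 then have "(\<Sum>j\<in>J. \<Sum>p\<in>perms. (SymOn J f p - SymOn J f (p \<circ> tr k j))^2) \<le>
   (\<Sum>j\<in>J. (\<Sum>q\<in>P. \<Sum>p\<in>perms. (f p - f (p \<circ> tr k (inv q j)))^2) / real (card P))"
  by (intro sum_mono)
 also have "... = (\<Sum>q\<in>P. \<Sum>j\<in>J. \<Sum>p\<in>perms. (f p - f (p \<circ> tr k (inv q j)))^2) / real (card P)"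
  by (simp add: sum_divide_distrib[symmetric] sum.swap[of _ J])
 also have "... = (\<Sum>q\<in>P. \<Sum>j\<in>J. \<Sum>p\<in>perms. (f p - f (p \<circ> tr k j))^2) / real (card P)"
 proof -
  have "(\<Sum>j\<in>J. \<Sum>p\<in>perms. (f p - f (p \<circ> tr k (inv q j)))^2) = (\<Sum>j\<in>J. \<Sum>p\<in>perms. (f p - f (p \<circ> tr k j))^2)"
   if "q \<in> P" for q
  proof -
   have "bij_betw (inv q) J J" using permutes_imp_bij permutes_inv that by (auto simp: P_def)
   from sum.reindex_bij_betw[OF this, of "\<lambda>j. \<Sum>p\<in>perms. (f p - f (p \<circ> tr k j))^2"] show ?thesis .
  qed
  then show ?thesis by simp
 qed
 also have "... = (\<Sum>j\<in>J. \<Sum>p\<in>perms. (f p - f (p \<circ> tr k j))^2)"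
  using P by simp
 finally show ?thesis .
qed

text \<open>The average over \<open>insert k J\<close> is the mean of the average over \<open>J\<close> composed with the transpositions that move \<open>k\<close>.
The two steps are orthogonal, and the second costs the energy of these transpositions.\<close>

lemma SymOn_step:
 fixes J :: "'n::finite set" and k :: 'n assumes k: "k \<notin> J"
 defines "I \<equiv> insert k J"
 shows "(\<Sum>p\<in>perms. (g p - SymOn I g p)^2) \<le> (\<Sum>p\<in>perms. (g p - SymOn J g p)^2)
   + (\<Sum>j\<in>J. \<Sum>p\<in>perms. (g p - g (p \<circ> tr k j))^2) / (2 * real (card I))"
proof -
 have JI: "J \<subseteq> I" by (auto simp: I_def)
 define u where "u = SymOn J g"
 have uinv: "u (p \<circ> q) = u p" if "q permutes J" for p q using SymOn_inv[OF that] by (simp add: u_def)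
 have Ine: "I \<noteq> {}" by (simp add: I_def)
 have c0: "0 < real (card I)" by (simp add: I_def card_gt_0_iff)
 have SI: "SymOn I g p = (\<Sum>j\<in>I. u (p \<circ> tr k j)) / real (card I)" for p
  unfolding I_def u_def by (rule SymOn_insert[OF k])
 have o1: "(\<Sum>p\<in>perms. (g p - u p) * (u p - SymOn I g p)) = 0"
  unfolding u_def by (intro SymOn_orth) (simp add: SymOn_subset_inv[OF JI] SymOn_inv)
 have o2: "(\<Sum>p\<in>perms. (u p - SymOn I g p) * SymOn I g p) = 0"
 proof -
  have "(\<Sum>p\<in>perms. (g p - SymOn I g p) * SymOn I g p) = 0" by (rule SymOn_orth) (rule SymOn_inv)
  moreover have "(\<Sum>p\<in>perms. (g p - u p) * SymOn I g p) = 0"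
   unfolding u_def by (rule SymOn_orth) (rule SymOn_subset_inv[OF JI])
  ultimately show ?thesis by (simp add: left_diff_distrib sum_subtractf)
 qed
 have "(\<Sum>p\<in>perms. (g p - SymOn I g p)^2) = (\<Sum>p\<in>perms. (g p - u p)^2 + (u p - SymOn I g p)^2
   + 2 * ((g p - u p) * (u p - SymOn I g p)))"
  by (intro sum.cong refl) (simp add: power2_eq_square algebra_simps)
 also have "... = (\<Sum>p\<in>perms. (g p - u p)^2) + (\<Sum>p\<in>perms. (u p - SymOn I g p)^2)"
  using o1 by (simp add: sum.distrib sum_distrib_left[symmetric])
 also have "(\<Sum>p\<in>perms. (u p - SymOn I g p)^2) = (\<Sum>p\<in>perms. u p * (u p - SymOn I g p))"
 proof -
  have "(\<Sum>p\<in>perms. (u p - SymOn I g p)^2) = (\<Sum>p\<in>perms. u p * (u p - SymOn I g p) - (u p - SymOn I g p) * SymOn I g p)"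
   by (intro sum.cong refl) (simp add: power2_eq_square algebra_simps)
  then show ?thesis using o2 by (simp add: sum_subtractf)
 qed
 also have "... = (\<Sum>j\<in>I. \<Sum>p\<in>perms. u p * (u p - u (p \<circ> tr k j))) / real (card I)"
 proof -
  have "u p - SymOn I g p = (\<Sum>j\<in>I. u p - u (p \<circ> tr k j)) / real (card I)" for p
   unfolding SI using c0 Ine by (simp add: sum_subtractf diff_divide_distrib)
  then have "(\<Sum>p\<in>perms. u p * (u p - SymOn I g p)) = (\<Sum>p\<in>perms. \<Sum>j\<in>I. u p * (u p - u (p \<circ> tr k j))) / real (card I)"
   by (simp add: sum_distrib_left sum_divide_distrib)
  then show ?thesis by (simp add: sum.swap[of _ perms])
 qed
 also have "... = (\<Sum>j\<in>I. (\<Sum>p\<in>perms. (u p - u (p \<circ> tr k j))^2) / 2) / real (card I)"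
  by (intro arg_cong2[where f = "(/)"] sum.cong refl sum_perms_diff_sq)
    (simp add: perms_def permutes_swap_id)
 also have "... = (\<Sum>j\<in>J. \<Sum>p\<in>perms. (u p - u (p \<circ> tr k j))^2) / (2 * real (card I))"
  using k by (simp add: I_def sum_divide_distrib[symmetric])
 also have "... \<le> (\<Sum>j\<in>J. \<Sum>p\<in>perms. (g p - g (p \<circ> tr k j))^2) / (2 * real (card I))"
  unfolding u_def using SymOn_transpose_energy[OF k] by (intro divide_right_mono) auto
 finally show ?thesis by (simp add: u_def)
qed

text \<open>Adding one position at a time makes the bound for \<open>I\<close> depend on the removed position; averaging over
all choices of it replaces the energy of one star of transpositions by that of all of them.\<close>

lemma transposition_gap_on:
 fixes I :: "'n::finite set"
 assumes "card I = m" "1 \<le> m"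
 shows "(\<Sum>p\<in>perms. (f p - SymOn I f p)^2) \<le> TDir I f / (2 * real m)"
 using assms
proof (induction m arbitrary: I)
 case (Suc m)
 show ?case
 proof (cases "m = 0")
  case True
  then obtain k where I: "I = {k}" using Suc.prems(1) by (auto simp: card_1_singleton_iff)
  have "{q. q permutes {k}} = {id}" by (auto simp: permutes_id)
  then have "SymOn I f p = f p" for p by (simp add: SymOn_def I)
  then show ?thesis by (simp add: TDir_def sum_nonneg)
 next
  case False
  define E where "E i j = (\<Sum>p\<in>perms. (f p - f (p \<circ> tr i j))^2)" for i j
  have Eii: "E i i = 0" for i by (simp add: E_def)
  have Es: "E i j = E j i" for i j by (simp add: E_def Transposition.transpose_commute)
  have T: "TDir K f = (\<Sum>i\<in>K. \<Sum>j\<in>K. E i j)" for K by (simp add: TDir_def E_def)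
  define V where "V = (\<Sum>p\<in>perms. (f p - SymOn I f p)^2)"
  have c: "card I = Suc m" by fact
  have step: "V \<le> TDir (I - {k}) f / (2 * real m) + (\<Sum>j\<in>I. E k j) / (2 * real (Suc m))" if k: "k \<in> I" for k
  proof -
   have e: "insert k (I - {k}) = I" using k by auto
   have "(\<Sum>p\<in>perms. (f p - SymOn (I - {k}) f p)^2) \<le> TDir (I - {k}) f / (2 * real m)"
    using Suc.IH[of "I - {k}"] False c k by simp
   moreover have "(\<Sum>j\<in>I - {k}. E k j) = (\<Sum>j\<in>I. E k j)" using k by (simp add: sum.remove[of I k] Eii)
   ultimately show ?thesis
    using SymOn_step[of k "I - {k}" f] unfolding e c V_def E_def[symmetric] by simp
  qed
  have Tk: "TDir (I - {k}) f = TDir I f - 2 * (\<Sum>j\<in>I. E k j)" if k: "k \<in> I" for k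
  proof -
   have "TDir I f = (\<Sum>j\<in>I. E k j) + (\<Sum>i\<in>I-{k}. \<Sum>j\<in>I. E i j)"
    unfolding T using k by (simp add: sum.remove[of I k "\<lambda>i. \<Sum>j\<in>I. E i j"])
   also have "(\<Sum>i\<in>I-{k}. \<Sum>j\<in>I. E i j) = (\<Sum>i\<in>I-{k}. E i k) + TDir (I - {k}) f"
    unfolding T using k by (simp add: sum.remove[of I k] sum.distrib)
   also have "(\<Sum>i\<in>I-{k}. E i k) = (\<Sum>i\<in>I. E k i)" using k by (simp add: sum.remove[of I k] Eii Es)
   finally show ?thesis by simp
  qed
  have T0: "0 \<le> TDir I f" by (simp add: TDir_def sum_nonneg)
  have m: "0 < real m" using False by simp
  have "real (Suc m) * V = (\<Sum>k\<in>I. V)" using c by simp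
  also have "... \<le> (\<Sum>k\<in>I. (TDir I f - 2 * (\<Sum>j\<in>I. E k j)) / (2 * real m) + (\<Sum>j\<in>I. E k j) / (2 * real (Suc m)))"
   using step Tk by (intro sum_mono) simp
  also have "... = (real (Suc m) * TDir I f - 2 * TDir I f) / (2 * real m) + TDir I f / (2 * real (Suc m))"
   using c by (simp add: sum.distrib sum_divide_distrib[symmetric] sum_subtractf sum_distrib_left[symmetric] T[symmetric])
  also have "... \<le> TDir I f / 2"
  proof -
   have "(real (Suc m) - 2) / (2 * real m) + 1 / (2 * real (Suc m)) \<le> 1 / 2"
   proof -
    define a b where "a = 1 / real m" and "b = 1 / real (Suc m)"
    have "b \<le> a" unfolding a_def b_def using m by (intro divide_left_mono) auto
    moreover have "(real (Suc m) - 2) / (2 * real m) = 1 / 2 - a / 2"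
     using m by (simp add: a_def field_simps)
    moreover have "1 / (2 * real (Suc m)) = b / 2" by (simp add: b_def)
    ultimately show ?thesis by simp
   qed
   from mult_right_mono[OF this T0]
   have "((real (Suc m) - 2) / (2 * real m) + 1 / (2 * real (Suc m))) * TDir I f \<le> TDir I f / 2" by simp
   moreover have "(a * t - 2 * t) / c + t / d = ((a - 2) / c + 1 / d) * t" for a c d t :: real
    by (simp add: left_diff_distrib distrib_right)
   ultimately show ?thesis by (simp only:)
  qed
  finally have "V \<le> TDir I f / 2 / real (Suc m)" by (simp add: pos_le_divide_eq algebra_simps)
  then show ?thesis by (simp add: V_def)
 qed
qed simp

section \<open>Poincare inequality for smooth functions\<close>

lemma pd_pd_expand:
 assumes U: "Ck 2 U"
 shows "pd v (pd v U) x = (\<Sum>a\<in>Basis. \<Sum>b\<in>Basis. (v \<bullet> a) * (v \<bullet> b) * pd a (pd b U) x)"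
proof -
 have d: "U differentiable at x" for x by (rule Ck_diff[OF U]) simp
 have d1: "pd b U differentiable at x" for b x by (rule Ck_diff[OF Ck2_pd[OF U]]) simp
 have e: "pd v U = (\<lambda>x. \<Sum>b\<in>Basis. (v \<bullet> b) * pd b U x)" by (rule ext, rule pd_expand[OF d])
 have "pd v (pd v U) x = (\<Sum>a\<in>Basis. (v \<bullet> a) * pd a (pd v U) x)" by (rule pd_expand[OF d1])
 also have "... = (\<Sum>a\<in>Basis. (v \<bullet> a) * (\<Sum>b\<in>Basis. (v \<bullet> b) * pd a (pd b U) x))"
 proof -
  have dd: "(\<lambda>x. (v \<bullet> b) * pd b U x) differentiable at x" for b x using d1 by auto
  show ?thesis by (simp only: e pd_sum[OF dd] pd_cmult[OF d1])
 qed
 finally show ?thesis by (simp add: sum_distrib_left mult.assoc)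
qed

context weight begin

definition En :: "('a => real) => real" where
 "En f = (LBINT x. (\<Sum>b\<in>Basis. (pd b f x)^2) * w x)"

lemma En_integrable:
 assumes f: "Ck 1 f" "bsupp f" shows "integrable lborel (\<lambda>x. (\<Sum>b\<in>Basis. (pd b f x)^2) * w x)"
proof -
 have "continuous_on UNIV (pd b f)" for b using f by simp
 then show ?thesis unfolding power2_eq_square
  by (intro integrable_bsupp continuous_intros w_cont bsupp_mult1 bsupp_sum bsupp_pd f)
qed

lemma En_nonneg: "0 \<le> En f" unfolding En_def by (intro integral_nonneg_AE AE_I2 mult_nonneg_nonneg sum_nonneg) auto

lemma integrable_bounded_w:
 assumes wi: "integrable lborel w" and c: "continuous_on UNIV f" and b: "\<And>x. \<bar>f x\<bar> \<le> B"
 shows "integrable lborel (\<lambda>x. f x * w x)"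
proof (rule Bochner_Integration.integrable_bound)
 show "integrable lborel (\<lambda>x. B * w x)" using wi by simp
 show "(\<lambda>x. f x * w x) \<in> borel_measurable lborel" using borel_measurable_cont[OF c] by simp
 have "\<bar>f x\<bar> * w x \<le> \<bar>B\<bar> * w x" for x using b[of x] by (intro mult_right_mono) auto
 then show "AE x in lborel. norm (f x * w x) \<le> norm (B * w x)" by (simp add: abs_mult)
qed

end

text \<open>The Hessian bound separates the component of \<open>v\<close> along the diagonal, with constant \<open>\<kappa>\<close>, from the
orthogonal one, with constant \<open>- \<alpha>\<close>.\<close>

locale sym_weight = weight U for U :: "real ^ 'n::finite => real" +
 fixes \<alpha> \<kappa> :: real
 assumes wi: "integrable lborel w"
  and Uinv: "\<And>p x. p \<in> perms ==> U (pm p x) = U x"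
  and \<kappa>: "0 < \<kappa>" and \<alpha>: "0 \<le> \<alpha>"
  and hess: "\<And>x v. - \<alpha> * ((\<Sum>i\<in>UNIV. (v $ i)^2) - (\<Sum>i\<in>UNIV. v $ i)^2 / real CARD('n))
    + \<kappa> * (\<Sum>i\<in>UNIV. v $ i)^2 / real CARD('n) \<le> pd v (pd v U) x"
  and line: "\<And>i j F. i \<noteq> j ==> Ck 1 F ==> bsupp F ==> (\<And>x. F (pm (tr i j) x) = - F x) ==>
    (LBINT x. (F x)^2 * w x) \<le> 1 / (2 * (\<alpha> + \<kappa>)) * (LBINT x. (pd (axis i 1 - axis j 1) F x)^2 * w x)"
begin

lemma winv: "p \<in> perms ==> w (pm p x) = w x" by (simp add: w_def Uinv)

lemma tr_perms: "tr i j \<in> perms" by (simp add: perms_def permutes_swap_id)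

lemma integral_w_pm:
 assumes p: "p \<in> perms" and [measurable]: "h \<in> borel_measurable borel"
 shows "(LBINT x. h (pm p x) * w x) = (LBINT x. h x * w x)"
 using integral_pm[OF permsD[OF p], of "\<lambda>x. h x * w x"] winv[OF p] by simp

definition n :: real where "n = real CARD('n)"

lemma n_pos: "0 < n" by (simp add: n_def card_gt_0_iff)

abbreviation D :: "'n => (real ^ 'n => real) => real ^ 'n => real" where "D i \<equiv> pd (axis i 1)"

lemma En_axis: "En f = (LBINT x. (\<Sum>i\<in>UNIV. (D i f x)^2) * w x)"
 unfolding En_def by (simp add: sum_Basis_axis)

lemma pd_axis_diff:
 assumes "f differentiable at x" shows "pd (axis i 1 - axis j 1) f x = D i f x - D j f x"
 using linear_diff[OF linear_pd[OF assms]] .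

lemma pm_tr_diff: "pm (tr i j) (axis i 1 - axis j 1) = -1 *\<^sub>R (axis i 1 - axis j (1::real) :: real ^ 'n)"
proof -
 have "pm (tr i j) (axis i 1) = (axis j 1 :: real ^ 'n)" "pm (tr i j) (axis j 1) = (axis i 1 :: real ^ 'n)"
  using pm_axis[OF permsD[OF tr_perms[of i j]], of j 1] pm_axis[OF permsD[OF tr_perms[of i j]], of i 1] by simp_all
 then show ?thesis unfolding linear_diff[OF linear_pm] by simp
qed

lemma int_cb: "continuous_on UNIV h ==> bsupp h ==> integrable lborel (\<lambda>x. h x * w x)"
 by (intro integrable_bsupp continuous_intros w_cont bsupp_mult1)

text \<open>For symmetric \<open>u\<close> the function \<open>\<partial>\<^sub>i u - \<partial>\<^sub>j u\<close> is odd under exchanging \<open>i\<close> and \<open>j\<close>; the line inequality is summed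
over all pairs.\<close>

lemma symmetric_hessian:
 assumes u: "Ck 3 u" "bsupp u" and s: "\<And>p x. p \<in> perms ==> u (pm p x) = u x"
 shows "(\<alpha> + \<kappa>) * (LBINT x. ((\<Sum>i\<in>UNIV. (D i u x)^2) - (\<Sum>i\<in>UNIV. D i u x)^2 / n) * w x)
   \<le> (LBINT x. (\<Sum>i\<in>UNIV. \<Sum>j\<in>UNIV. (D i (D j u) x)^2) * w x)"
proof -
 have u2: "Ck 2 u" by (rule Ck_mono[OF u(1)]) simp
 have du: "u differentiable at x" for x by (rule Ck_diff[OF u(1)]) simp
 have d1: "pd v u differentiable at x" for v x by (rule Ck_diff[OF Ck3_pd[OF u(1)]]) simp
 have c: "continuous_on UNIV (pd v u)" "continuous_on UNIV (pd v (pd v' u))" for v v'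
  using Ck_cont[OF Ck3_pd[OF u(1)]] Ck_cont[OF Ck2_pd[OF Ck3_pd[OF u(1)]]] by auto
 have b: "bsupp (pd v u)" "bsupp (pd v (pd v' u))" for v v' using bsupp_pd u(2) by blast+
 have pair: "2 * (\<alpha> + \<kappa>) * (LBINT x. (D i u x - D j u x)^2 * w x)
   \<le> (LBINT x. (D i (D i u) x - 2 * D i (D j u) x + D j (D j u) x)^2 * w x)" for i j
 proof (cases "i = j")
  case False
  define v :: "real ^ 'n" where "v = axis i 1 - axis j 1"
  have odd: "pd v u (pm (tr i j) x) = - pd v u x" for x
  proof -
   have "pd v (\<lambda>x. u (pm (tr i j) x)) x = pd (pm (tr i j) v) u (pm (tr i j) x)" by (rule pd_pm[OF du])
   moreover have "(\<lambda>x. u (pm (tr i j) x)) = u" using s[OF tr_perms] by auto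
   ultimately show ?thesis using pd_scaleR[OF du, of "-1" v] by (simp add: v_def pm_tr_diff)
  qed
  have C1: "Ck 1 (pd v u)" by (rule Ck2_pd[OF u2])
  have e1: "pd v u = (\<lambda>x. D i u x - D j u x)" using pd_axis_diff[OF du] by (auto simp: v_def)
  have e2: "pd v (pd v u) x = D i (D i u) x - 2 * D i (D j u) x + D j (D j u) x" for x
  proof -
   have "pd v (pd v u) x = D i (pd v u) x - D j (pd v u) x" using pd_axis_diff[OF d1] by (simp add: v_def)
   also have "... = D i (D i u) x - 2 * D i (D j u) x + D j (D j u) x"
    unfolding e1 using pd_commute[OF u2, of "axis j 1" "axis i 1"] by (simp add: pd_diff d1)
   finally show ?thesis .
  qed
  have "(LBINT x. (pd v u x)^2 * w x) \<le> 1 / (2 * (\<alpha> + \<kappa>)) * (LBINT x. (pd v (pd v u) x)^2 * w x)"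
   unfolding v_def by (rule line[OF False]) (use C1 b odd in \<open>auto simp: v_def\<close>)
  then have "2 * (\<alpha> + \<kappa>) * (LBINT x. (pd v u x)^2 * w x) \<le> (LBINT x. (pd v (pd v u) x)^2 * w x)"
   using \<alpha> \<kappa> by (simp add: field_simps)
  then show ?thesis unfolding e2 by (simp add: e1)
 qed simp
 have i1: "integrable lborel (\<lambda>x. (D i u x - D j u x)^2 * w x)" for i j
  unfolding power2_eq_square by (intro int_cb continuous_intros c bsupp_mult1 bsupp_diff b)
 have i2: "integrable lborel (\<lambda>x. (D i (D i u) x - 2 * D i (D j u) x + D j (D j u) x)^2 * w x)" for i j
  unfolding power2_eq_square by (intro int_cb continuous_intros c bsupp_mult1 bsupp_diff bsupp_add bsupp_mult2 b)
 have i3: "integrable lborel (\<lambda>x. ((\<Sum>i\<in>UNIV. (D i u x)^2) - (\<Sum>i\<in>UNIV. D i u x)^2 / n) * w x)"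
 proof -
  have "bsupp (\<lambda>x. (\<Sum>i\<in>UNIV. D i u x * D i u x) - (\<Sum>i\<in>UNIV. D i u x) * ((\<Sum>i\<in>UNIV. D i u x) * (1 / n)))"
   by (intro bsupp_diff bsupp_sum bsupp_mult1 b)
  then show ?thesis using n_pos by (intro int_cb continuous_intros c) (simp_all add: power2_eq_square)
 qed
 have i4: "integrable lborel (\<lambda>x. (\<Sum>i\<in>UNIV. \<Sum>j\<in>UNIV. (D i (D j u) x)^2) * w x)"
  unfolding power2_eq_square by (intro int_cb continuous_intros c bsupp_sum bsupp_mult1 b)
 have "2 * (\<alpha> + \<kappa>) * (LBINT x. (\<Sum>i\<in>UNIV. \<Sum>j\<in>UNIV. (D i u x - D j u x)^2) * w x)
   = (\<Sum>i\<in>UNIV. \<Sum>j\<in>UNIV. 2 * (\<alpha> + \<kappa>) * (LBINT x. (D i u x - D j u x)^2 * w x))"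
  using i1 by (simp add: sum_distrib_right sum_distrib_left)
 also have "... \<le> (\<Sum>i\<in>UNIV. \<Sum>j\<in>UNIV. (LBINT x. (D i (D i u) x - 2 * D i (D j u) x + D j (D j u) x)^2 * w x))"
  by (intro sum_mono pair)
 also have "... = (LBINT x. (\<Sum>i\<in>UNIV. \<Sum>j\<in>UNIV. (D i (D i u) x - 2 * D i (D j u) x + D j (D j u) x)^2) * w x)"
  using i2 by (simp add: sum_distrib_right)
 also have "... \<le> (LBINT x. 4 * n * ((\<Sum>i\<in>UNIV. \<Sum>j\<in>UNIV. (D i (D j u) x)^2) * w x))"
 proof (rule integral_mono)
  show "integrable lborel (\<lambda>x. (\<Sum>i\<in>UNIV. \<Sum>j\<in>UNIV. (D i (D i u) x - 2 * D i (D j u) x + D j (D j u) x)^2) * w x)"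
   using i2 by (simp add: sum_distrib_right)
  show "integrable lborel (\<lambda>x. 4 * n * ((\<Sum>i\<in>UNIV. \<Sum>j\<in>UNIV. (D i (D j u) x)^2) * w x))" using i4 by simp
  fix x
  have "(\<Sum>i\<in>UNIV. \<Sum>j\<in>UNIV. (D i (D i u) x - 2 * D i (D j u) x + D j (D j u) x)^2) \<le> 4 * n * (\<Sum>i\<in>UNIV. \<Sum>j\<in>UNIV. (D i (D j u) x)^2)"
   unfolding n_def by (rule sum_sq_second_differences) (simp add: pd_commute[OF u2])
  from mult_right_mono[OF this w_pos(2)[of x]]
  show "(\<Sum>i\<in>UNIV. \<Sum>j\<in>UNIV. (D i (D i u) x - 2 * D i (D j u) x + D j (D j u) x)^2) * w x
   \<le> 4 * n * ((\<Sum>i\<in>UNIV. \<Sum>j\<in>UNIV. (D i (D j u) x)^2) * w x)" by (simp add: mult.assoc)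
 qed
 also have "(\<lambda>x. (\<Sum>i\<in>UNIV. \<Sum>j\<in>UNIV. (D i u x - D j u x)^2) * w x) =
   (\<lambda>x. 2 * n * (((\<Sum>i\<in>UNIV. (D i u x)^2) - (\<Sum>i\<in>UNIV. D i u x)^2 / n) * w x))"
  using n_pos unfolding sum_sq_differences by (auto simp: n_def[symmetric] field_simps)
 finally have *: "2 * (\<alpha> + \<kappa>) * (LBINT x. 2 * n * (((\<Sum>i\<in>UNIV. (D i u x)^2) - (\<Sum>i\<in>UNIV. D i u x)^2 / n) * w x))
   \<le> (LBINT x. 4 * n * ((\<Sum>i\<in>UNIV. \<Sum>j\<in>UNIV. (D i (D j u) x)^2) * w x))" .
 define q where "q = (LBINT x. ((\<Sum>i\<in>UNIV. (D i u x)^2) - (\<Sum>i\<in>UNIV. D i u x)^2 / n) * w x)"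
 define r where "r = (LBINT x. (\<Sum>i\<in>UNIV. \<Sum>j\<in>UNIV. (D i (D j u) x)^2) * w x)"
 have "2 * (\<alpha> + \<kappa>) * (2 * n * q) \<le> 4 * n * r"
  using * unfolding Bochner_Integration.integral_mult_right_zero q_def[symmetric] r_def[symmetric] .
 then have "(4 * n) * ((\<alpha> + \<kappa>) * q) \<le> (4 * n) * r" by (simp only: algebra_simps)
 then show ?thesis using n_pos unfolding q_def[symmetric] r_def[symmetric] by simp
qed

lemma symmetric_gap:
 assumes u: "Ck 3 u" "bsupp u" and s: "\<And>p x. p \<in> perms ==> u (pm p x) = u x"
 shows "\<kappa> * En u \<le> (LBINT x. (gen U u x)^2 * w x)"
proof -
 have u2: "Ck 2 u" by (rule Ck_mono[OF u(1)]) simp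
 have u1: "Ck 1 u" by (rule Ck_mono[OF u(1)]) simp
 have du: "u differentiable at x" for x by (rule Ck_diff[OF u(1)]) simp
 have c: "continuous_on UNIV (pd v u)" "continuous_on UNIV (pd v (pd v' u))" for v v'
  using Ck_cont[OF Ck3_pd[OF u(1)]] Ck_cont[OF Ck2_pd[OF Ck3_pd[OF u(1)]]] by auto
 have b: "bsupp (pd v u)" "bsupp (pd v (pd v' u))" for v v' using bsupp_pd u(2) by blast+
 have ppU: "continuous_on UNIV (pd a (pd b U))" for a b using pdU1[of b] by simp
 define Q where "Q x = (\<Sum>i\<in>UNIV. (D i u x)^2) - (\<Sum>i\<in>UNIV. D i u x)^2 / n" for x
 define S where "S x = (\<Sum>i\<in>UNIV. D i u x)^2 / n" for x
 define H where "H x = pd (grad u x) (pd (grad u x) U) x" for x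
 have gu: "grad u x $ i = D i u x" for x i
  using inner_grad[OF du, of x "axis i 1"] by (simp add: inner_axis)
 have Heq: "H x = (\<Sum>a\<in>Basis. \<Sum>b\<in>Basis. pd a (pd b U) x * pd a u x * pd b u x)" for x
  unfolding H_def pd_pd_expand[OF U2] inner_grad[OF du] by (simp add: mult_ac)
 have iS: "integrable lborel (\<lambda>x. S x * w x)"
 proof -
  have "bsupp (\<lambda>x. (\<Sum>i\<in>UNIV. D i u x) * ((\<Sum>i\<in>UNIV. D i u x) * (1 / n)))"
   by (intro bsupp_sum bsupp_mult1 b)
  then show ?thesis unfolding S_def using n_pos by (intro int_cb continuous_intros c) (simp_all add: power2_eq_square)
 qed
 have iE: "integrable lborel (\<lambda>x. (\<Sum>i\<in>UNIV. (D i u x)^2) * w x)"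
  using En_integrable[OF u1 u(2)] by (simp add: sum_Basis_axis)
 have QS: "Q x * w x = (\<Sum>i\<in>UNIV. (D i u x)^2) * w x - S x * w x" for x by (simp add: Q_def S_def algebra_simps)
 have iQ: "integrable lborel (\<lambda>x. Q x * w x)" unfolding QS using iE iS by simp
 have iab: "integrable lborel (\<lambda>x. pd a (pd b U) x * pd a u x * pd b u x * w x)" for a b
  by (intro integrable_bsupp continuous_intros c w_cont ppU) (intro bsupp_mult1 bsupp_mult2 b)
 have iH: "integrable lborel (\<lambda>x. H x * w x)"
  unfolding Heq sum_distrib_right using iab by simp
 have "- \<alpha> * (LBINT x. Q x * w x) + \<kappa> * (LBINT x. S x * w x) = (LBINT x. - \<alpha> * (Q x * w x) + \<kappa> * (S x * w x))"
  using iQ iS by simp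
 also have "... \<le> (LBINT x. H x * w x)"
 proof (rule integral_mono)
  show "integrable lborel (\<lambda>x. - \<alpha> * (Q x * w x) + \<kappa> * (S x * w x))" using iQ iS by simp
  fix x
  have "- \<alpha> * Q x + \<kappa> * S x \<le> H x"
   using hess[of "grad u x" x] unfolding gu by (simp add: Q_def S_def H_def n_def)
  from mult_right_mono[OF this w_pos(2)[of x]]
  show "- \<alpha> * (Q x * w x) + \<kappa> * (S x * w x) \<le> H x * w x" by (simp add: algebra_simps)
 qed (rule iH)
 finally have 1: "- \<alpha> * (LBINT x. Q x * w x) + \<kappa> * (LBINT x. S x * w x) \<le> (LBINT x. H x * w x)" .
 have 2: "(\<alpha> + \<kappa>) * (LBINT x. Q x * w x) \<le> (LBINT x. (\<Sum>i\<in>UNIV. \<Sum>j\<in>UNIV. (D i (D j u) x)^2) * w x)"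
  unfolding Q_def by (rule symmetric_hessian[OF u s])
 have i2: "integrable lborel (\<lambda>x. (D i (D j u) x)^2 * w x)" for i j
  unfolding power2_eq_square by (intro int_cb continuous_intros c bsupp_mult1 b)
 have 3: "(LBINT x. (gen U u x)^2 * w x) = (LBINT x. (\<Sum>i\<in>UNIV. \<Sum>j\<in>UNIV. (D i (D j u) x)^2) * w x) + (LBINT x. H x * w x)"
 proof -
  have "(LBINT x. (\<Sum>i\<in>UNIV. \<Sum>j\<in>UNIV. (D i (D j u) x)^2) * w x) = (\<Sum>i\<in>UNIV. \<Sum>j\<in>UNIV. LBINT x. (D i (D j u) x)^2 * w x)"
   using i2 by (simp add: sum_distrib_right)
  moreover have "(LBINT x. H x * w x) = (\<Sum>a\<in>Basis. \<Sum>b\<in>Basis. LBINT x. pd a (pd b U) x * pd a u x * pd b u x * w x)"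
   unfolding Heq sum_distrib_right using iab by simp
  ultimately show ?thesis using bochner[OF u] by (simp add: sum_Basis_axis)
 qed
 have "En u = (LBINT x. Q x * w x) + (LBINT x. S x * w x)"
  unfolding En_axis QS using iE iS by simp
 then have "\<kappa> * En u = (\<alpha> + \<kappa>) * (LBINT x. Q x * w x) + (- \<alpha> * (LBINT x. Q x * w x) + \<kappa> * (LBINT x. S x * w x))"
  by (simp add: algebra_simps)
 also have "... \<le> (LBINT x. (gen U u x)^2 * w x)" unfolding 3 by (rule add_mono[OF 2 1])
 finally show ?thesis .
qed

definition W :: real where "W = integral\<^sup>L lborel w"

lemma W_pos: "0 < W"
proof -
 have "0 \<le> W" by (simp add: W_def)
 moreover have "W \<noteq> 0"
 proof
  assume "W = 0"
  then have "AE x in lborel. w x = 0" using wi by (subst (asm) W_def, subst (asm) integral_nonneg_eq_0_iff_AE) auto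
  then have "AE x in (lborel :: (real ^ 'n) measure). False" by eventually_elim simp
  then show False by (simp add: AE_iff_null) (metis emeasure_lborel_UNIV ennreal_zero_neq_top infinity_ennreal_def null_setsD1 UNIV_I)
 qed
 ultimately show ?thesis by simp
qed

definition mean :: "(real ^ 'n => real) => real" where "mean f = (LBINT x. f x * w x) / W"

lemma gen_pm:
 assumes p: "p \<in> perms" and u: "Ck 2 u"
 shows "gen U (\<lambda>x. u (pm p x)) x = gen U u (pm p x)"
proof -
 have du: "u differentiable at x" for x by (rule Ck_diff[OF u]) simp
 have d1: "pd v u differentiable at x" for v x by (rule Ck_diff[OF Ck2_pd[OF u]]) simp
 have e1: "pd b (\<lambda>x. u (pm p x)) = (\<lambda>x. pd (pm p b) u (pm p x))" for b using pd_pm[OF du] by auto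
 have e2: "pd b (\<lambda>x. pd (pm p b) u (pm p x)) x = pd (pm p b) (pd (pm p b) u) (pm p x)" for b by (rule pd_pm[OF d1])
 have e3: "pd b U x = pd (pm p b) U (pm p x)" for b
 proof -
  have "(\<lambda>x. U (pm p x)) = U" using Uinv[OF p] by auto
  then show ?thesis using pd_pm[OF U_diff, of b p x] by simp
 qed
 show ?thesis unfolding gen_def e1 e2 e3
  by (rule sum_Basis_pm[OF permsD[OF p], of "\<lambda>b. pd b (pd b u) (pm p x) - pd b U (pm p x) * pd b u (pm p x)"])
qed

lemma gen_Sym:
 assumes u: "Ck 2 u"
 shows "gen U (Sym u) x = (\<Sum>p\<in>perms. gen U u (pm p x)) / real (card (perms :: ('n => 'n) set))"
proof -
 define N where "N = real (card (perms :: ('n => 'n) set))"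
 have C: "Ck 2 (\<lambda>x. u (pm p x))" for p by (rule Ck_pm[OF u])
 have d: "(\<lambda>x. u (pm p x)) differentiable at x" for p x by (rule Ck_diff[OF C]) simp
 have ds: "(\<lambda>x. \<Sum>p\<in>perms. u (pm p x)) differentiable at x" for x by (rule differentiable_sum) (auto intro: d)
 have d1: "pd v (\<lambda>x. u (pm p x)) differentiable at x" for v p x by (rule Ck_diff[OF Ck2_pd[OF C]]) simp
 have ds1: "(\<lambda>x. \<Sum>p\<in>perms. pd v (\<lambda>x. u (pm p x)) x) differentiable at x" for v x
  by (rule differentiable_sum) (auto intro: d1)
 have S: "Sym u = (\<lambda>x. (1 / N) * (\<Sum>p\<in>perms. u (pm p x)))" by (auto simp: Sym_def N_def)
 have e1: "pd v (Sym u) = (\<lambda>x. (1 / N) * (\<Sum>p\<in>perms. pd v (\<lambda>x. u (pm p x)) x))" for v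
  unfolding S by (rule ext) (simp only: pd_cmult[OF ds] pd_sum[OF d])
 have e2: "pd v (\<lambda>x. (1 / N) * (\<Sum>p\<in>perms. pd v (\<lambda>x. u (pm p x)) x)) x
   = (1 / N) * (\<Sum>p\<in>perms. pd v (pd v (\<lambda>x. u (pm p x))) x)" for v x
  by (simp only: pd_cmult[OF ds1] pd_sum[OF d1])
 have "gen U (Sym u) x = (1 / N) * (\<Sum>p\<in>perms. gen U (\<lambda>x. u (pm p x)) x)"
  unfolding gen_def e1 e2
  by (simp add: sum_distrib_left sum.swap[of _ perms] sum_subtractf right_diff_distrib mult.left_commute)
 also have "(\<Sum>p\<in>perms. gen U (\<lambda>x. u (pm p x)) x) = (\<Sum>p\<in>perms. gen U u (pm p x))"
  by (intro sum.cong refl gen_pm u)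
 finally show ?thesis by (simp add: N_def)
qed

text \<open>Approximating \<open>f - mean f\<close> by \<open>L u\<close> reduces its square integral to the pairing of the gradients of \<open>f\<close> and \<open>u\<close>.
Replacing \<open>u\<close> by its average over permutations keeps the approximation, as \<open>f\<close> and the generator are symmetric.\<close>

lemma symmetric_poincare:
 assumes f: "Ck 1 f" "bsupp f" and s: "\<And>p x. p \<in> perms ==> f (pm p x) = f x"
 shows "\<kappa> * (LBINT x. (f x - mean f)^2 * w x) \<le> En f"
proof -
 define g where "g x = f x - mean f" for x
 have cf: "continuous_on UNIV f" by (rule Ck_cont[OF f(1)])
 obtain B where B: "0 < B" "\<And>x. \<bar>f x\<bar> \<le> B" using bsupp_bounded[OF cf f(2)] by blast
 have cg: "continuous_on UNIV g" unfolding g_def by (intro continuous_intros cf)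
 have gB: "\<bar>g x\<bar> \<le> B + \<bar>mean f\<bar>" for x unfolding g_def using B(2)[of x] by linarith
 have gm [measurable]: "g \<in> borel_measurable borel" using cg by (rule borel_measurable_cont)
 have ig: "integrable lborel (\<lambda>x. g x * w x)" by (rule integrable_bounded_w[OF wi cg gB])
 have ig2: "integrable lborel (\<lambda>x. (g x)^2 * w x)"
 proof (rule integrable_bounded_w[OF wi])
  show "continuous_on UNIV (\<lambda>x. (g x)^2)" by (intro continuous_intros cg)
  show "\<bar>(g x)^2\<bar> \<le> (B + \<bar>mean f\<bar>)^2" for x using power_mono[OF gB[of x], of 2] by simp
 qed
 have ifw: "integrable lborel (\<lambda>x. f x * w x)" by (rule int_cb[OF cf f(2)])
 have g0: "(LBINT x. g x * w x) = 0"
  using ifw wi W_pos by (simp add: g_def left_diff_distrib mean_def W_def)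
 define A where "A = (LBINT x. (g x)^2 * w x)"
 have "\<kappa> * A \<le> En f + \<kappa> * e" if e: "0 < e" for e
 proof -
  obtain u where u: "Ck 3 u" "bsupp u" "(LBINT x. (g x - gen U u x)^2 * w x) < e"
   using gen_range_dense[OF wi gm ig2 g0 e] by blast
  define v where "v = Sym u"
  have v: "Ck 3 v" "bsupp v" unfolding v_def by (rule Ck_Sym[OF u(1)], rule bsupp_Sym[OF u(2)])
  have v2: "Ck 2 v" by (rule Ck_mono[OF v(1)]) simp
  have u2: "Ck 2 u" by (rule Ck_mono[OF u(1)]) simp
  have vs: "v (pm p x) = v x" if "p \<in> perms" for p x unfolding v_def by (rule Sym_pm[OF that])
  define G where "G = gen U v"
  have cG: "continuous_on UNIV G" "continuous_on UNIV (gen U u)"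
   unfolding G_def using Ck_cont[OF Ck_gen[OF U2 v(1)]] Ck_cont[OF Ck_gen[OF U2 u(1)]] by auto
  have bG: "bsupp G" unfolding G_def by (rule bsupp_gen[OF v(2)])
  have idiff: "integrable lborel (\<lambda>x. (g x - h x)^2 * w x)" if "continuous_on UNIV h" "bsupp h" for h
  proof -
   have 1: "integrable lborel (\<lambda>x. (h x * h x - 2 * g x * h x) * w x)"
    by (intro int_cb continuous_intros that cg bsupp_diff bsupp_mult2 that)
   have "(\<lambda>x. (g x - h x)^2 * w x) = (\<lambda>x. (g x)^2 * w x + (h x * h x - 2 * g x * h x) * w x)"
    by (auto simp: power2_eq_square algebra_simps)
   then show ?thesis using Bochner_Integration.integrable_add[OF ig2 1] by simp
  qed
  define R where "R = (LBINT x. (g x - G x)^2 * w x)"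
  have Re: "R \<le> e"
  proof -
   define N where "N = real (card (perms :: ('n => 'n) set))"
   have N: "0 < N" by (simp add: N_def)
   have m: "(\<lambda>x. (g x - gen U u x)^2) \<in> borel_measurable borel"
    using borel_measurable_cont[OF cG(2)] by measurable
   have gs: "g (pm p x) = g x" if "p \<in> perms" for p x using s[OF that] by (simp add: g_def)
   have ip: "integrable lborel (\<lambda>x. (g x - gen U u (pm p x))^2 * w x)" if "p \<in> perms" for p
   proof (rule idiff)
    show "continuous_on UNIV (\<lambda>x. gen U u (pm p x))" by (rule continuous_on_compose2[OF cG(2) cont_pm]) simp
    show "bsupp (\<lambda>x. gen U u (pm p x))" by (rule bsupp_pm[OF permsD[OF that] bsupp_gen[OF u(2)]])
   qed
   have "R \<le> (LBINT x. (\<Sum>p\<in>perms. (g x - gen U u (pm p x))^2 * w x) / N)"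
    unfolding R_def
   proof (rule integral_mono)
    show "integrable lborel (\<lambda>x. (g x - G x)^2 * w x)" by (rule idiff[OF cG(1) bG])
    show "integrable lborel (\<lambda>x. (\<Sum>p\<in>perms. (g x - gen U u (pm p x))^2 * w x) / N)" using ip by simp
    fix x
    have "g x - G x = (\<Sum>p\<in>perms. g x - gen U u (pm p x)) / real (card (perms :: ('n => 'n) set))"
     using N by (simp add: G_def v_def gen_Sym[OF u2] sum_subtractf diff_divide_distrib N_def)
    also have "...^2 \<le> (\<Sum>p\<in>perms. (g x - gen U u (pm p x))^2) / real (card (perms :: ('n => 'n) set))"
     by (rule avg_sq_le) (use id_perms in auto)
    finally show "(g x - G x)^2 * w x \<le> (\<Sum>p\<in>perms. (g x - gen U u (pm p x))^2 * w x) / N"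
     using mult_right_mono[OF _ w_pos(2)[of x]] by (fastforce simp: N_def sum_distrib_right)
   qed
   also have "... = (\<Sum>p\<in>perms. LBINT x. (g x - gen U u (pm p x))^2 * w x) / N" using ip by simp
   also have "(\<Sum>p\<in>perms. LBINT x. (g x - gen U u (pm p x))^2 * w x) = (\<Sum>p\<in>(perms :: ('n => 'n) set). LBINT x. (g x - gen U u x)^2 * w x)"
   proof (rule sum.cong[OF refl])
    fix p :: "'n => 'n" assume p: "p \<in> perms"
    show "(LBINT x. (g x - gen U u (pm p x))^2 * w x) = (LBINT x. (g x - gen U u x)^2 * w x)"
     using integral_w_pm[OF p m] by (simp add: gs[OF p])
   qed
   also have "... / N = (LBINT x. (g x - gen U u x)^2 * w x)" by (simp add: N_def)
   finally show ?thesis using u(3) by simp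
  qed
  define X where "X = (LBINT x. (G x)^2 * w x)"
  have iX: "integrable lborel (\<lambda>x. (G x)^2 * w x)" unfolding power2_eq_square by (intro int_cb continuous_intros cG bsupp_mult1 bG)
  have igG: "integrable lborel (\<lambda>x. g x * G x * w x)" by (intro int_cb continuous_intros cG cg bsupp_mult2 bG)
  have R: "R = A - 2 * (LBINT x. g x * G x * w x) + X"
  proof -
   have "(\<lambda>x. (g x - G x)^2 * w x) = (\<lambda>x. (g x)^2 * w x - 2 * (g x * G x * w x) + (G x)^2 * w x)"
    by (auto simp: power2_eq_square algebra_simps)
   then show ?thesis unfolding R_def A_def X_def using ig2 igG iX by simp
  qed
  have g1: "Ck 1 g" unfolding g_def by (intro Ck_minus f Ck_const)
  have pg: "pd b g = pd b f" for b
  proof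
   fix x show "pd b g x = pd b f x" unfolding g_def
    using pd_diff[of f x "\<lambda>_. mean f" b] Ck_diff[OF f(1)] by simp
  qed
  have cp: "continuous_on UNIV (pd b f)" "continuous_on UNIV (pd b v)" for b
   using f Ck_cont[OF Ck3_pd[OF v(1)]] by auto
  have ib: "integrable lborel (\<lambda>x. pd b f x * pd b v x * w x)" for b
   by (intro int_cb continuous_intros cp bsupp_mult1 bsupp_pd f)
  have v1: "Ck 1 v" by (rule Ck_mono[OF v(1)]) simp
  have "(LBINT x. g x * G x * w x) = - (\<Sum>b\<in>Basis. LBINT x. pd b f x * pd b v x * w x)"
   using integral_gen[OF Ck_mono[OF U2] v2 v(2) g1] by (simp add: pg w_def G_def)
  then have "- 2 * (LBINT x. g x * G x * w x) = (LBINT x. (\<Sum>b\<in>Basis. 2 * (pd b f x * pd b v x * w x)))"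
   using ib by (simp add: sum_distrib_left sum_negf)
  moreover have "- (LBINT x. (\<Sum>b\<in>Basis. 2 * (pd b f x * pd b v x * w x))) \<le> En f / \<kappa> + \<kappa> * En v"
  proof -
   have "(LBINT x. - (\<Sum>b\<in>Basis. 2 * (pd b f x * pd b v x * w x))) \<le>
     (LBINT x. ((\<Sum>b\<in>Basis. (pd b f x)^2) * w x) / \<kappa> + \<kappa> * ((\<Sum>b\<in>Basis. (pd b v x)^2) * w x))"
   proof (rule integral_mono)
    show "integrable lborel (\<lambda>x. - (\<Sum>b\<in>Basis. 2 * (pd b f x * pd b v x * w x)))" using ib by simp
    show "integrable lborel (\<lambda>x. ((\<Sum>b\<in>Basis. (pd b f x)^2) * w x) / \<kappa> + \<kappa> * ((\<Sum>b\<in>Basis. (pd b v x)^2) * w x))"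
     using En_integrable[OF f] En_integrable[OF v1 v(2)] by simp
    fix x
    have "- (2 * (pd b f x * pd b v x)) \<le> (pd b f x)^2 / \<kappa> + \<kappa> * (pd b v x)^2" for b
    proof -
     have "0 \<le> (pd b f x + \<kappa> * pd b v x)^2 / \<kappa>" using \<kappa> by simp
     also have "... = (pd b f x)^2 / \<kappa> + \<kappa> * (pd b v x)^2 + 2 * (pd b f x * pd b v x)"
      using \<kappa> by (simp add: power2_eq_square field_simps)
     finally show ?thesis by simp
    qed
    then have "(\<Sum>b\<in>Basis. - (2 * (pd b f x * pd b v x)) * w x) \<le> (\<Sum>b\<in>Basis. ((pd b f x)^2 / \<kappa> + \<kappa> * (pd b v x)^2) * w x)"
     by (intro sum_mono mult_right_mono) auto
    then show "- (\<Sum>b\<in>Basis. 2 * (pd b f x * pd b v x * w x)) \<le>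
      ((\<Sum>b\<in>Basis. (pd b f x)^2) * w x) / \<kappa> + \<kappa> * ((\<Sum>b\<in>Basis. (pd b v x)^2) * w x)"
     by (simp add: sum_negf[symmetric] sum_distrib_left sum_distrib_right sum_divide_distrib distrib_right sum.distrib mult.assoc)
   qed
   then show ?thesis using En_integrable[OF f] En_integrable[OF v1 v(2)] ib by (simp add: En_def)
  qed
  moreover have "\<kappa> * En v \<le> X" unfolding X_def G_def by (rule symmetric_gap[OF v vs])
  ultimately have "A \<le> En f / \<kappa> + e" using R Re by linarith
  then have "\<kappa> * A \<le> \<kappa> * (En f / \<kappa> + e)" using \<kappa> by (intro mult_left_mono) auto
  then show ?thesis using \<kappa> by (simp add: distrib_left)
 qed
 note main = this
 have "\<kappa> * A \<le> En f"
 proof (rule field_le_epsilon)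
  fix e :: real assume "0 < e"
  then show "\<kappa> * A \<le> En f + e" using main[of "e / \<kappa>"] \<kappa> by simp
 qed
 then show ?thesis by (simp add: A_def g_def)
qed


text \<open>The function \<open>g - g \<circ> \<tau>\<^sub>i\<^sub>j\<close> is odd, and its derivative along \<open>e\<^sub>i - e\<^sub>j\<close> is the sum of the derivatives at a point
and at its mirror image.\<close>

lemma transposition_energy:
 assumes g: "Ck 1 g" "bsupp g"
 shows "(\<alpha> + \<kappa>) * (LBINT x. (g x - g (pm (tr i j) x))^2 * w x) \<le> 2 * (LBINT x. (D i g x - D j g x)^2 * w x)"
proof (cases "i = j")
 case False
 define v :: "real ^ 'n" where "v = axis i 1 - axis j 1"
 let ?t = "pm (tr i j) :: real ^ 'n => real ^ 'n"
 have tt: "?t (?t x) = x" for x by (simp add: pm_compose)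
 have dg: "g differentiable at x" for x by (rule Ck_diff[OF g(1)]) simp
 define F where "F x = g x - g (?t x)" for x
 have gt: "Ck 1 (\<lambda>x. g (?t x))" "bsupp (\<lambda>x. g (?t x))"
  by (rule Ck_pm[OF g(1)], rule bsupp_pm[OF permsD[OF tr_perms] g(2)])
 have F: "Ck 1 F" "bsupp F" unfolding F_def by (intro Ck_minus g gt, intro bsupp_diff g gt)
 have odd: "F (?t x) = - F x" for x by (simp add: F_def tt)
 have pF: "pd v F x = pd v g x + pd v g (?t x)" for x
 proof -
  have "pd v F x = pd v g x - pd v (\<lambda>x. g (?t x)) x"
   unfolding F_def by (rule pd_diff[OF dg Ck_diff[OF gt(1)]]) simp
  also have "pd v (\<lambda>x. g (?t x)) x = pd (?t v) g (?t x)" by (rule pd_pm[OF dg])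
  also have "... = - pd v g (?t x)" using pd_scaleR[OF dg, of "-1" v] by (simp add: v_def pm_tr_diff)
  finally show ?thesis by simp
 qed
 have cv: "continuous_on UNIV (pd v g)" using g by simp
 have m: "(\<lambda>x. (pd v g x)^2) \<in> borel_measurable borel" using borel_measurable_cont[OF cv] by measurable
 have i1: "integrable lborel (\<lambda>x. (pd v g x)^2 * w x)"
  unfolding power2_eq_square by (intro int_cb continuous_intros cv bsupp_mult1 bsupp_pd g)
 have i2: "integrable lborel (\<lambda>x. (pd v g (?t x))^2 * w x)"
  unfolding power2_eq_square
  by (intro int_cb continuous_on_mult continuous_on_compose2[OF cv cont_pm] bsupp_mult1
    bsupp_pm[OF permsD[OF tr_perms]] bsupp_pd g) auto
 have i3: "integrable lborel (\<lambda>x. (pd v F x)^2 * w x)"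
  unfolding power2_eq_square using F by (intro int_cb continuous_on_mult bsupp_mult1 bsupp_pd) auto
 have "(LBINT x. (pd v F x)^2 * w x) \<le> (LBINT x. 2 * ((pd v g x)^2 * w x) + 2 * ((pd v g (?t x))^2 * w x))"
 proof (rule integral_mono[OF i3])
  show "integrable lborel (\<lambda>x. 2 * ((pd v g x)^2 * w x) + 2 * ((pd v g (?t x))^2 * w x))" using i1 i2 by simp
  fix x
  have "(pd v F x)^2 \<le> 2 * (pd v g x)^2 + 2 * (pd v g (?t x))^2"
   using zero_le_power2[of "pd v g x - pd v g (?t x)"] by (simp add: pF power2_diff power2_sum)
  from mult_right_mono[OF this w_pos(2)[of x]]
  show "(pd v F x)^2 * w x \<le> 2 * ((pd v g x)^2 * w x) + 2 * ((pd v g (?t x))^2 * w x)" by (simp add: algebra_simps)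
 qed
 also have "... = 4 * (LBINT x. (pd v g x)^2 * w x)"
  using i1 i2 integral_w_pm[OF tr_perms m, of i j] by simp
 finally have 4: "(LBINT x. (pd v F x)^2 * w x) \<le> 4 * (LBINT x. (pd v g x)^2 * w x)" .
 have "(LBINT x. (F x)^2 * w x) \<le> 1 / (2 * (\<alpha> + \<kappa>)) * (LBINT x. (pd v F x)^2 * w x)"
  unfolding v_def by (rule line[OF False F odd])
 also have "... \<le> 1 / (2 * (\<alpha> + \<kappa>)) * (4 * (LBINT x. (pd v g x)^2 * w x))"
  using \<alpha> \<kappa> by (intro mult_left_mono 4) auto
 finally show ?thesis using \<alpha> \<kappa> by (simp add: F_def v_def pd_axis_diff[OF dg] field_simps)
qed simp

text \<open>The gap of the transposition walk is applied on each orbit of the permutations and then integrated.\<close>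

lemma antisymmetric_gap:
 assumes g: "Ck 1 g" "bsupp g" and s: "\<And>x. Sym g x = 0"
 shows "(\<alpha> + \<kappa>) * (LBINT x. (g x)^2 * w x) \<le> 2 * En g"
proof -
 define N where "N = real (card (perms :: ('n => 'n) set))"
 have N: "0 < N" by (simp add: N_def)
 have cg: "continuous_on UNIV g" by (rule Ck_cont[OF g(1)])
 have gm [measurable]: "g \<in> borel_measurable borel" by (rule borel_measurable_cont[OF cg])
 define T where "T i j x = (g x - g (pm (tr i j) x))^2" for i j x
 have Tm [measurable]: "T i j \<in> borel_measurable borel" for i j unfolding T_def by measurable
 have pt: "(\<Sum>p\<in>perms. (g (pm p x))^2) \<le> (\<Sum>i\<in>UNIV. \<Sum>j\<in>UNIV. \<Sum>p\<in>perms. T i j (pm p x)) / (2 * n)" for x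
 proof -
  have z: "SymOn UNIV (\<lambda>p. g (pm p x)) p = 0" for p
  proof -
   have "SymOn UNIV (\<lambda>p. g (pm p x)) p = Sym g (pm p x)"
    unfolding SymOn_def Sym_def perms_def card_permutes by (simp add: pm_compose)
   then show ?thesis by (simp add: s)
  qed
  have "1 \<le> CARD('n)" by (simp add: Suc_leI)
  from transposition_gap_on[OF refl this, of "\<lambda>p. g (pm p x)"]
  show ?thesis by (simp add: z TDir_def T_def pm_compose n_def)
 qed
 have inv: "(LBINT x. h (pm p x) * w x) = (LBINT x. h x * w x)"
  if "p \<in> perms" "h \<in> borel_measurable borel" for p h by (rule integral_w_pm[OF that])
 have ipm: "integrable lborel (\<lambda>x. h (pm p x) * w x)" if "p \<in> perms" "continuous_on UNIV h" "bsupp h" for p h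
  by (intro int_cb continuous_on_compose2[OF that(2) cont_pm] bsupp_pm[OF permsD[OF that(1)] that(3)]) auto
 have cT: "continuous_on UNIV (T i j)" "bsupp (T i j)" for i j
  unfolding T_def power2_eq_square
  by (intro continuous_intros cg continuous_on_compose2[OF cg cont_pm]; simp)
    (intro bsupp_mult1 bsupp_diff g bsupp_pm[OF permsD[OF tr_perms]])
 have cg2: "continuous_on UNIV (\<lambda>x. (g x)^2)" "bsupp (\<lambda>x. (g x)^2)"
  unfolding power2_eq_square by (intro continuous_intros cg, intro bsupp_mult1 g)
 have "N * (LBINT x. (g x)^2 * w x) = (\<Sum>p\<in>perms. LBINT x. (g (pm p x))^2 * w x)"
  using inv[of _ "\<lambda>x. (g x)^2"] by (simp add: N_def)
 also have "... = (LBINT x. (\<Sum>p\<in>perms. (g (pm p x))^2) * w x)"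
  using ipm[OF _ cg2] by (simp add: sum_distrib_right)
 also have "... \<le> (LBINT x. ((\<Sum>i\<in>UNIV. \<Sum>j\<in>UNIV. \<Sum>p\<in>perms. T i j (pm p x)) / (2 * n)) * w x)"
 proof (rule integral_mono)
  show "integrable lborel (\<lambda>x. (\<Sum>p\<in>perms. (g (pm p x))^2) * w x)"
   using ipm[OF _ cg2] by (simp add: sum_distrib_right)
  show "integrable lborel (\<lambda>x. ((\<Sum>i\<in>UNIV. \<Sum>j\<in>UNIV. \<Sum>p\<in>perms. T i j (pm p x)) / (2 * n)) * w x)"
   using ipm[OF _ cT] by (simp add: sum_distrib_right sum_divide_distrib)
 qed (intro mult_right_mono pt, simp)
 also have "... = (\<Sum>i\<in>UNIV. \<Sum>j\<in>UNIV. \<Sum>p\<in>perms. LBINT x. T i j (pm p x) * w x) / (2 * n)"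
  using ipm[OF _ cT] by (simp add: sum_distrib_right)
 also have "... = N * (\<Sum>i\<in>UNIV. \<Sum>j\<in>UNIV. LBINT x. T i j x * w x) / (2 * n)"
  using inv[OF _ Tm] by (simp add: N_def sum_distrib_left)
 finally have "N * (LBINT x. (g x)^2 * w x) \<le> N * ((\<Sum>i\<in>UNIV. \<Sum>j\<in>UNIV. LBINT x. T i j x * w x) / (2 * n))"
  by (simp only: times_divide_eq_right)
 then have "(LBINT x. (g x)^2 * w x) \<le> (\<Sum>i\<in>UNIV. \<Sum>j\<in>UNIV. LBINT x. T i j x * w x) / (2 * n)"
  by (rule mult_left_le_imp_le[OF _ N])
 then have "(\<alpha> + \<kappa>) * (LBINT x. (g x)^2 * w x) \<le> (\<alpha> + \<kappa>) * ((\<Sum>i\<in>UNIV. \<Sum>j\<in>UNIV. LBINT x. T i j x * w x) / (2 * n))"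
  using \<alpha> \<kappa> by (intro mult_left_mono) auto
 also have "... = (\<Sum>i\<in>UNIV. \<Sum>j\<in>UNIV. (\<alpha> + \<kappa>) * (LBINT x. T i j x * w x)) / (2 * n)"
  by (simp add: sum_distrib_left)
 also have "... \<le> (\<Sum>i\<in>UNIV. \<Sum>j\<in>UNIV. 2 * (LBINT x. (D i g x - D j g x)^2 * w x)) / (2 * n)"
  using n_pos unfolding T_def by (intro divide_right_mono sum_mono transposition_energy g) auto
 also have "... = (LBINT x. (\<Sum>i\<in>UNIV. \<Sum>j\<in>UNIV. (D i g x - D j g x)^2) * w x) / n"
 proof -
  have "integrable lborel (\<lambda>x. (D i g x - D j g x)^2 * w x)" for i j
   unfolding power2_eq_square using g by (intro int_cb continuous_intros bsupp_mult1 bsupp_diff bsupp_pd) auto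
  then show ?thesis by (simp add: sum_distrib_right sum_distrib_left[symmetric])
 qed
 also have "... \<le> (2 * n * En g) / n"
 proof (intro divide_right_mono)
  have "(LBINT x. (\<Sum>i\<in>UNIV. \<Sum>j\<in>UNIV. (D i g x - D j g x)^2) * w x) \<le> (LBINT x. 2 * n * ((\<Sum>i\<in>UNIV. (D i g x)^2) * w x))"
  proof (rule integral_mono)
   show "integrable lborel (\<lambda>x. (\<Sum>i\<in>UNIV. \<Sum>j\<in>UNIV. (D i g x - D j g x)^2) * w x)"
    unfolding power2_eq_square using g by (intro int_cb continuous_intros bsupp_sum bsupp_mult1 bsupp_diff bsupp_pd) auto
   show "integrable lborel (\<lambda>x. 2 * n * ((\<Sum>i\<in>UNIV. (D i g x)^2) * w x))"
    using En_integrable[OF g] by (simp add: sum_Basis_axis)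
   fix x
   have "(\<Sum>i\<in>UNIV. \<Sum>j\<in>UNIV. (D i g x - D j g x)^2) \<le> 2 * n * (\<Sum>i\<in>UNIV. (D i g x)^2)"
    unfolding sum_sq_differences n_def by simp
   from mult_right_mono[OF this w_pos(2)[of x]]
   show "(\<Sum>i\<in>UNIV. \<Sum>j\<in>UNIV. (D i g x - D j g x)^2) * w x \<le> 2 * n * ((\<Sum>i\<in>UNIV. (D i g x)^2) * w x)" by (simp add: mult.assoc)
  qed
  then show "(LBINT x. (\<Sum>i\<in>UNIV. \<Sum>j\<in>UNIV. (D i g x - D j g x)^2) * w x) \<le> 2 * n * En g" by (simp add: En_axis)
 qed (use n_pos in simp)
 finally show ?thesis using n_pos by simp
qed

lemma integral_Sym_mult:
 assumes H: "continuous_on UNIV H" "\<And>p x. p \<in> perms ==> H (pm p x) = H x"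
  and g: "continuous_on UNIV g" "bsupp g" and s: "\<And>x. Sym g x = 0"
 shows "(LBINT x. H x * g x * w x) = 0"
proof -
 have [measurable]: "H \<in> borel_measurable borel" "g \<in> borel_measurable borel" using H(1) g(1) borel_measurable_cont by auto
 have ip: "integrable lborel (\<lambda>x. H x * g (pm p x) * w x)" if "p \<in> perms" for p
  by (intro int_cb continuous_on_mult H continuous_on_compose2[OF g(1) cont_pm] bsupp_mult2 bsupp_pm[OF permsD[OF that] g(2)]) auto
 have e: "(LBINT x. H x * g (pm p x) * w x) = (LBINT x. H x * g x * w x)" if "p \<in> perms" for p
  using integral_w_pm[OF that, of "\<lambda>x. H x * g x"] by (simp add: H(2)[OF that])
 have "real (card (perms :: ('n => 'n) set)) * (LBINT x. H x * g x * w x) = (\<Sum>p\<in>perms. LBINT x. H x * g (pm p x) * w x)"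
  by (simp add: e)
 also have "... = (LBINT x. (\<Sum>p\<in>perms. H x * g (pm p x) * w x))" using ip by simp
 also have "(\<lambda>x. \<Sum>p\<in>perms. H x * g (pm p x) * w x) = (\<lambda>x. 0)"
 proof
  fix x
  have "(\<Sum>p\<in>perms. g (pm p x)) = 0" using s[of x] by (simp add: Sym_def)
  then show "(\<Sum>p\<in>perms. H x * g (pm p x) * w x) = 0"
   by (simp add: sum_distrib_left[symmetric] sum_distrib_right[symmetric])
 qed
 finally show ?thesis by simp
qed

lemma dirichlet_Sym_orth:
 assumes h: "Ck 1 h" "bsupp h" "\<And>p x. p \<in> perms ==> h (pm p x) = h x"
  and g: "Ck 1 g" "bsupp g" and s: "\<And>x. Sym g x = 0"
 shows "(LBINT x. (\<Sum>b\<in>Basis. pd b h x * pd b g x) * w x) = 0"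
proof -
 define I where "I x = (\<Sum>b\<in>Basis. pd b h x * pd b g x)" for x
 have dh: "h differentiable at x" and dg: "g differentiable at x" for x
  using Ck_diff[OF h(1)] Ck_diff[OF g(1)] by auto
 have cI: "continuous_on UNIV I" unfolding I_def using h(1) g(1) by (intro continuous_intros) auto
 have bI: "bsupp I" unfolding I_def by (intro bsupp_sum bsupp_mult1 bsupp_pd h)
 have Im: "I \<in> borel_measurable borel" by (rule borel_measurable_cont[OF cI])
 have dgp: "(\<lambda>x. g (pm p x)) differentiable at x" for p x by (rule diff_pm[OF dg])
 have Ip: "I (pm p x) = (\<Sum>b\<in>Basis. pd b h x * pd b (\<lambda>x. g (pm p x)) x)" if p: "p \<in> perms" for p x
 proof -
  have "pd b h x = pd (pm p b) h (pm p x)" for b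
  proof -
   have "(\<lambda>x. h (pm p x)) = h" using h(3)[OF p] by auto
   then show ?thesis using pd_pm[OF dh, of b p x] by simp
  qed
  then show ?thesis unfolding pd_pm[OF dg] I_def
   using sum_Basis_pm[OF permsD[OF p], of "\<lambda>b. pd b h (pm p x) * pd b g (pm p x)"] by simp
 qed
 have zero: "(\<Sum>p\<in>perms. I (pm p x)) = 0" for x
 proof -
  have S0: "(\<lambda>x. \<Sum>p\<in>perms. g (pm p x)) = (\<lambda>x. 0)"
   using s by (auto simp: Sym_def)
  have "(\<Sum>p\<in>perms. I (pm p x)) = (\<Sum>b\<in>Basis. pd b h x * (\<Sum>p\<in>perms. pd b (\<lambda>x. g (pm p x)) x))"
   by (simp add: Ip sum_distrib_left sum.swap[of _ perms])
  also have "... = (\<Sum>b\<in>Basis. pd b h x * pd b (\<lambda>x. \<Sum>p\<in>perms. g (pm p x)) x)"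
   by (simp add: pd_sum[OF dgp])
  finally show ?thesis unfolding S0 by simp
 qed
 have ip: "integrable lborel (\<lambda>x. I (pm p x) * w x)" if "p \<in> perms" for p
  by (intro int_cb continuous_on_compose2[OF cI cont_pm] bsupp_pm[OF permsD[OF that] bI]) auto
 have "real (card (perms :: ('n => 'n) set)) * (LBINT x. I x * w x) = (\<Sum>p\<in>perms. LBINT x. I (pm p x) * w x)"
  using integral_w_pm[OF _ Im] by simp
 also have "... = (LBINT x. (\<Sum>p\<in>perms. I (pm p x)) * w x)" using ip by (simp add: sum_distrib_right)
 also have "... = 0" by (simp add: zero)
 finally show ?thesis by (simp add: I_def)
qed

theorem poincare_C1:
 assumes f: "Ck 1 f" "bsupp f"
 shows "\<kappa> * (LBINT x. (f x - mean f)^2 * w x) \<le> 2 * En f"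
proof -
 define h where "h = Sym f"
 define g where "g x = f x - h x" for x
 have h: "Ck 1 h" "bsupp h" "\<And>p x. p \<in> perms ==> h (pm p x) = h x"
  unfolding h_def by (rule Ck_Sym[OF f(1)], rule bsupp_Sym[OF f(2)], rule Sym_pm)
 have g: "Ck 1 g" "bsupp g" unfolding g_def by (intro Ck_minus f h, intro bsupp_diff f h)
 have s: "Sym g x = 0" for x
 proof -
  have "Sym g x = Sym f x - Sym h x" by (simp add: Sym_def g_def sum_subtractf diff_divide_distrib)
  also have "Sym h x = h x" by (rule Sym_fixed) (rule h(3))
  finally show ?thesis by (simp add: h_def)
 qed
 have c: "continuous_on UNIV f" "continuous_on UNIV h" "continuous_on UNIV g"
  using Ck_cont[OF f(1)] Ck_cont[OF h(1)] Ck_cont[OF g(1)] by auto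
 have if': "integrable lborel (\<lambda>x. f x * w x)" "integrable lborel (\<lambda>x. h x * w x)" "integrable lborel (\<lambda>x. g x * w x)"
  using int_cb c f(2) h(2) g(2) by auto
 have m: "mean h = mean f"
 proof -
  have "(LBINT x. 1 * g x * w x) = 0" by (rule integral_Sym_mult[OF _ _ c(3) g(2) s]) auto
  then have "(LBINT x. h x * w x) = (LBINT x. f x * w x)" using if' by (simp add: g_def left_diff_distrib)
  then show ?thesis by (simp add: mean_def)
 qed
 define H where "H x = h x - mean f" for x
 have cH: "continuous_on UNIV H" unfolding H_def by (intro continuous_intros c)
 obtain B where B: "0 < B" "\<And>x. \<bar>h x\<bar> \<le> B" using bsupp_bounded[OF c(2) h(2)] by blast
 have HB: "\<bar>H x\<bar> \<le> B + \<bar>mean f\<bar>" for x unfolding H_def using B(2)[of x] by linarith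
 have iH: "integrable lborel (\<lambda>x. (H x)^2 * w x)"
 proof (rule integrable_bounded_w[OF wi])
  show "continuous_on UNIV (\<lambda>x. (H x)^2)" by (intro continuous_intros cH)
  show "\<bar>(H x)^2\<bar> \<le> (B + \<bar>mean f\<bar>)^2" for x using power_mono[OF HB[of x], of 2] by simp
 qed
 have ig: "integrable lborel (\<lambda>x. (g x)^2 * w x)"
  unfolding power2_eq_square by (intro int_cb continuous_intros c bsupp_mult1 g)
 have iHg: "integrable lborel (\<lambda>x. H x * g x * w x)" by (intro int_cb continuous_intros cH c bsupp_mult2 g)
 have o1: "(LBINT x. H x * g x * w x) = 0"
  by (rule integral_Sym_mult[OF cH _ c(3) g(2) s]) (simp add: H_def h(3))
 have "(\<lambda>x. (f x - mean f)^2 * w x) = (\<lambda>x. (H x)^2 * w x + (g x)^2 * w x + 2 * (H x * g x * w x))"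
  by (auto simp: H_def g_def power2_eq_square algebra_simps)
 then have V: "(LBINT x. (f x - mean f)^2 * w x) = (LBINT x. (H x)^2 * w x) + (LBINT x. (g x)^2 * w x)"
  using iH ig iHg o1 by simp
 have d: "h differentiable at x" "g differentiable at x" for x using Ck_diff[OF h(1)] Ck_diff[OF g(1)] by auto
 have E: "En f = En h + En g"
 proof -
  have fe: "f = (\<lambda>x. h x + g x)" by (auto simp: g_def)
  have "pd b f x = pd b h x + pd b g x" for b x unfolding fe by (rule pd_add[OF d])
  then have "(\<lambda>x. (\<Sum>b\<in>Basis. (pd b f x)^2) * w x) = (\<lambda>x. (\<Sum>b\<in>Basis. (pd b h x)^2) * w x
    + (\<Sum>b\<in>Basis. (pd b g x)^2) * w x + 2 * ((\<Sum>b\<in>Basis. pd b h x * pd b g x) * w x))"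
   by (auto simp: power2_sum sum.distrib sum_distrib_left algebra_simps)
  moreover have "integrable lborel (\<lambda>x. (\<Sum>b\<in>Basis. pd b h x * pd b g x) * w x)"
   using h g by (intro int_cb continuous_intros bsupp_sum bsupp_mult1 bsupp_pd) auto
  ultimately show ?thesis
   using En_integrable[OF h(1,2)] En_integrable[OF g] dirichlet_Sym_orth[OF h g s] by (simp add: En_def)
 qed
 have 1: "\<kappa> * (LBINT x. (H x)^2 * w x) \<le> En h"
  using symmetric_poincare[OF h] by (simp add: H_def m)
 have "\<kappa> * (LBINT x. (g x)^2 * w x) \<le> (\<alpha> + \<kappa>) * (LBINT x. (g x)^2 * w x)"
  using \<alpha> by (intro mult_right_mono) auto
 also have "... \<le> 2 * En g" by (rule antisymmetric_gap[OF g s])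
 finally have 2: "\<kappa> * (LBINT x. (g x)^2 * w x) \<le> 2 * En g" .
 have "\<kappa> * (LBINT x. (f x - mean f)^2 * w x) \<le> En h + 2 * En g"
  unfolding V distrib_left using 1 2 by simp
 also have "... \<le> 2 * En f" unfolding E using En_nonneg[of h] by simp
 finally show ?thesis .
qed

end

section \<open>Rademacher's theorem\<close>

text \<open>With \<open>M\<close> above the Lipschitz constant, \<open>f x + M x\<close> and \<open>M x - f x\<close> are increasing, and their Stieltjes measures add up to
\<open>2 M\<close> times Lebesgue measure. Hence the first has a density \<open>d\<close>, and Lebesgue's differentiation theorem gives
\<open>d - M\<close> as right derivative of \<open>f\<close>.\<close>

lemma lipschitz_right_derivative_ae:
 fixes f :: "real => real"
 assumes L: "\<And>x y. \<bar>f x - f y\<bar> \<le> L * \<bar>x - y\<bar>"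
 shows "AE t in lborel. convergent (\<lambda>n. real (Suc n) * (f (t + 1 / real (Suc n)) - f t))"
proof -
 define M where "M = \<bar>L\<bar> + 1"
 have M: "0 < M" "\<bar>f x - f y\<bar> \<le> M * \<bar>x - y\<bar>" for x y
 proof -
  show "0 < M" by (simp add: M_def)
  have "L * \<bar>x - y\<bar> \<le> M * \<bar>x - y\<bar>" by (intro mult_right_mono) (auto simp: M_def)
  then show "\<bar>f x - f y\<bar> \<le> M * \<bar>x - y\<bar>" using L[of x y] by linarith
 qed
 have cf: "continuous_on UNIV f"
 proof -
  have "M-lipschitz_on UNIV f" using M by (intro lipschitz_onI) (auto simp: dist_real_def)
  then show ?thesis by (rule lipschitz_on_continuous_on)
 qed
 define g h where "g x = f x + M * x" and "h x = M * x - f x" for x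
 have mono: "g x \<le> g y" "h x \<le> h y" if "x \<le> y" for x y
  using M(2)[of x y] that by (auto simp: g_def h_def abs_le_iff algebra_simps)
 have cg: "continuous_on UNIV g" "continuous_on UNIV h" unfolding g_def h_def by (intro continuous_intros cf)+
 have rc: "continuous (at_right a) g" "continuous (at_right a) h" for a
  using cg by (auto simp: continuous_on_eq_continuous_within intro: continuous_within_subset)
 define \<mu> \<nu> where "\<mu> = interval_measure g" and "\<nu> = interval_measure h"
 define S where "S = measure_of UNIV (sets borel) (\<lambda>A. emeasure \<mu> A + emeasure \<nu> A)"
 have sS: "sets S = sets borel"
  unfolding S_def using sets.sets_measure_of_eq[of "borel :: real measure"] by simp
 have eS: "emeasure S A = emeasure \<mu> A + emeasure \<nu> A" if "A \<in> sets borel" for A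
 proof (rule emeasure_measure_of[OF S_def])
  show "sets borel \<subseteq> Pow (UNIV :: real set)" by simp
  show "A \<in> sets S" using that sS by simp
  show "positive (sets S) (\<lambda>A. emeasure \<mu> A + emeasure \<nu> A)" by (simp add: positive_def)
  show "countably_additive (sets S) (\<lambda>A. emeasure \<mu> A + emeasure \<nu> A)"
  proof (rule countably_additiveI)
   fix A :: "nat => real set" assume A: "range A \<subseteq> sets S" "disjoint_family A" "(\<Union>i. A i) \<in> sets S"
   have "(\<Sum>i. emeasure \<mu> (A i)) = emeasure \<mu> (\<Union>i. A i)" "(\<Sum>i. emeasure \<nu> (A i)) = emeasure \<nu> (\<Union>i. A i)"
    using A sS by (auto intro!: suminf_emeasure simp: \<mu>_def \<nu>_def)
   then show "(\<Sum>i. emeasure \<mu> (A i) + emeasure \<nu> (A i)) = emeasure \<mu> (\<Union>i. A i) + emeasure \<nu> (\<Union>i. A i)"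
    by (simp add: suminf_add[symmetric])
  qed
 qed
 have "S = density lborel (\<lambda>_. ennreal (2 * M))"
 proof (rule measure_eqI_generator_eq[where \<Omega> = UNIV and E = "range (\<lambda>(a, b). {a<..b::real})" and A = "\<lambda>n. {- real n<..real n}"])
  show "Int_stable (range (\<lambda>(a, b). {a<..b::real}))"
   unfolding Int_stable_def
  proof safe
   fix a b c d :: real
   have "{a<..b} \<inter> {c<..d} = (\<lambda>(a, b). {a<..b}) (max a c, min b d)" by auto
   then show "{a<..b} \<inter> {c<..d} \<in> range (\<lambda>(a, b). {a<..b})" by blast
  qed
  show "sets S = sigma_sets UNIV (range (\<lambda>(a, b). {a<..b::real}))"
   by (simp add: sS borel_sigma_sets_Ioc)
  show "sets (density lborel (\<lambda>_. ennreal (2 * M))) = sigma_sets UNIV (range (\<lambda>(a, b). {a<..b::real}))"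
   by (simp add: borel_sigma_sets_Ioc)
  show "(\<Union>i. {- real i<..real i}) = UNIV"
  proof safe
   fix x :: real
   obtain n where "\<bar>x\<bar> < real n" using reals_Archimedean2 by blast
   then show "x \<in> (\<Union>i. {- real i<..real i})" by (intro UN_I[of n]) auto
  qed auto
  have val: "emeasure S {a<..b} = emeasure (density lborel (\<lambda>_. ennreal (2 * M))) {a<..b}" for a b
  proof (cases "a \<le> b")
   case True
   have "emeasure S {a<..b} = ennreal (g b - g a) + ennreal (h b - h a)"
    using True mono rc by (simp add: eS \<mu>_def \<nu>_def emeasure_interval_measure_Ioc)
   also have "... = ennreal (2 * M * (b - a))"
    using True mono[OF True] by (subst ennreal_plus[symmetric]) (auto simp: g_def h_def algebra_simps)
   also have "... = emeasure (density lborel (\<lambda>_. ennreal (2 * M))) {a<..b}"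
    using True M(1) by (simp add: emeasure_density nn_integral_cmult_indicator ennreal_mult)
   finally show ?thesis .
  qed simp
  show "emeasure S X = emeasure (density lborel (\<lambda>_. ennreal (2 * M))) X" if "X \<in> range (\<lambda>(a, b). {a<..b})" for X
   using that val by auto
  show "emeasure S {- real i<..real i} \<noteq> \<infinity>" for i
   unfolding val using M(1) by (simp add: emeasure_density nn_integral_cmult_indicator ennreal_mult_eq_top_iff)
 qed auto
 then have S: "emeasure S A = ennreal (2 * M) * emeasure lborel A" if "A \<in> sets borel" for A
  using that by (simp add: emeasure_density nn_integral_cmult_indicator)
 have "absolutely_continuous lborel \<mu>"
  unfolding absolutely_continuous_def
 proof
  fix A :: "real set" assume A: "A \<in> null_sets lborel"
  then have "A \<in> sets borel" "emeasure lborel A = 0" by auto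
  then have "emeasure \<mu> A + emeasure \<nu> A = 0" using S[of A] eS[of A] by simp
  then show "A \<in> null_sets \<mu>" using A by (auto simp: \<mu>_def null_sets_def)
 qed
 moreover have "sets \<mu> = sets lborel" by (simp add: \<mu>_def)
 ultimately obtain p :: "real => ennreal" where p [measurable]: "p \<in> borel_measurable borel" and d\<mu>: "density lborel p = \<mu>"
  using sigma_finite_measure.Radon_Nikodym[OF sigma_finite_lborel] by auto
 have int: "(NNINT x. p x * indicator {a..b} x) = ennreal (g b - g a)" if "a \<le> b" for a b
  using emeasure_interval_measure_Icc[of a b g] that mono cg
  by (simp add: \<mu>_def[symmetric] d\<mu>[symmetric] emeasure_density)
 have fin: "AE x in lborel. p x \<noteq> \<infinity>"
 proof -
  have "AE x in lborel. p x * indicator {- real n..real n} x \<noteq> \<infinity>" for n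
   by (rule nn_integral_PInf_AE) (auto simp: int)
  then have "AE x in lborel. \<forall>n. p x * indicator {- real n..real n} x \<noteq> \<infinity>" by (simp add: AE_all_countable)
  then show ?thesis
  proof eventually_elim
   case (elim x)
   obtain n where "\<bar>x\<bar> < real n" using reals_Archimedean2 by blast
   then have "indicator {- real n..real n} x = (1::ennreal)" by (auto simp: indicator_def abs_less_iff)
   then show ?case using elim[rule_format, of n] by simp
  qed
 qed
 define d where "d x = enn2real (p x)" for x
 have dm [measurable]: "d \<in> borel_measurable borel" unfolding d_def by measurable
 have d0: "0 \<le> d x" for x by (simp add: d_def)
 have dint: "set_integrable lborel {a..b} d" "(LINT x:{a..b}|lborel. d x) = g b - g a" if "a \<le> b" for a b
 proof -
  have e: "(NNINT x. ennreal (indicator {a..b} x *\<^sub>R d x)) = ennreal (g b - g a)"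
   unfolding int[OF that, symmetric] using fin
   by (intro nn_integral_cong_AE, eventually_elim) (auto simp: d_def indicator_def less_top)
  show "set_integrable lborel {a..b} d" unfolding set_integrable_def
   by (rule integrableI_nonneg) (use e d0 in auto)
  then show "(LINT x:{a..b}|lborel. d x) = g b - g a"
   unfolding set_lebesgue_integral_def set_integrable_def using mono(1)[OF that]
   by (subst integral_eq_nn_integral) (use e d0 in auto)
 qed
 have HK: "d integrable_on cbox a b" "a \<le> b ==> integral (cbox a b) d = g b - g a" for a b
 proof -
  show "d integrable_on cbox a b"
  proof (cases "a \<le> b")
   case True then show ?thesis using set_borel_integral_eq_integral(1)[OF dint(1)] by simp
  qed auto
  show "integral (cbox a b) d = g b - g a" if "a \<le> b"
   using set_borel_integral_eq_integral(2)[OF dint(1)[OF that]] dint(2)[OF that] by simp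
 qed
 obtain N where N: "negligible N" "\<And>x e. [| x \<notin> N; 0 < e |] ==> \<exists>\<delta>>0. \<forall>h. 0 < h \<and> h < \<delta> \<longrightarrow>
    norm (integral (cbox x (x + h *\<^sub>R One)) d /\<^sub>R h ^ DIM(real) - d x) < e"
  using integrable_ccontinuous_explicit[of d] HK(1) by blast
 have "convergent (\<lambda>n. real (Suc n) * (f (t + 1 / real (Suc n)) - f t))" if t: "t \<notin> N" for t
 proof -
  have "(\<lambda>n. real (Suc n) * (f (t + 1 / real (Suc n)) - f t)) \<longlonglongrightarrow> d t - M"
  proof (rule LIMSEQ_I)
   fix e :: real assume "0 < e"
   then obtain \<delta> where \<delta>: "\<delta> > 0" "\<forall>h. 0 < h \<and> h < \<delta> \<longrightarrow> norm (integral (cbox t (t + h *\<^sub>R One)) d /\<^sub>R h ^ DIM(real) - d t) < e"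
    using N(2)[OF t] by blast
   obtain K where K: "1 / real (Suc K) < \<delta>" using \<delta>(1) nat_approx_posE by blast
   show "\<exists>K. \<forall>n\<ge>K. norm (real (Suc n) * (f (t + 1 / real (Suc n)) - f t) - (d t - M)) < e"
   proof (intro exI[of _ K] allI impI)
    fix n assume n: "K \<le> n"
    define h where "h = 1 / real (Suc n)"
    have h: "0 < h" by (simp add: h_def)
    have "h \<le> 1 / real (Suc K)" unfolding h_def using n by (intro divide_left_mono) auto
    then have "norm (integral (cbox t (t + h *\<^sub>R One)) d /\<^sub>R h ^ DIM(real) - d t) < e" using \<delta>(2) h K by auto
    then have "\<bar>(g (t + h) - g t) / h - d t\<bar> < e"
     using HK(2)[of t "t + h"] h by (simp add: divide_inverse mult.commute)
    moreover have "(g (t + h) - g t) / h = real (Suc n) * (f (t + h) - f t) + M"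
     using h by (simp add: g_def h_def field_simps)
    ultimately have "\<bar>real (Suc n) * (f (t + h) - f t) - (d t - M)\<bar> < e" by (smt (verit))
    then show "norm (real (Suc n) * (f (t + 1 / real (Suc n)) - f t) - (d t - M)) < e"
     unfolding h_def real_norm_def .
   qed
  qed
  then show ?thesis by (auto simp: convergent_def)
 qed
 then have "{t. \<not> convergent (\<lambda>n. real (Suc n) * (f (t + 1 / real (Suc n)) - f t))} \<subseteq> N" by blast
 then have "negligible {t. \<not> convergent (\<lambda>n. real (Suc n) * (f (t + 1 / real (Suc n)) - f t))}"
  using N(1) negligible_subset by blast
 then have null: "{t. \<not> convergent (\<lambda>n. real (Suc n) * (f (t + 1 / real (Suc n)) - f t))} \<in> null_sets lebesgue"
  by (simp add: negligible_iff_null_sets)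
 have [measurable]: "f \<in> borel_measurable borel" using cf by (rule borel_measurable_cont)
 have "{t \<in> space lborel. \<not> convergent (\<lambda>n. real (Suc n) * (f (t + 1 / real (Suc n)) - f t))} \<in> sets lborel"
  unfolding Cauchy_convergent_iff[symmetric] by measurable
 then have "{t. \<not> convergent (\<lambda>n. real (Suc n) * (f (t + 1 / real (Suc n)) - f t))} \<in> null_sets lborel"
  using null by (subst (asm) null_sets_completion_iff) auto
 then show ?thesis by (rule AE_I') auto
qed

text \<open>By translation invariance and Tonelli's theorem, the left-hand side is the integral of \<open>H x\<close> times the length of
those \<open>t\<close> for which \<open>x - t v\<close> lies in the slab, and this length is \<open>1 / (v \<bullet> v)\<close>. No coordinates adapted to \<open>v\<close> are needed.\<close>

lemma nn_integral_along_lines: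
 fixes H :: "'a::euclidean_space => ennreal"
 assumes [measurable]: "H \<in> borel_measurable borel" and v: "v \<noteq> 0"
 shows "(NNINT x. indicator {x. 0 \<le> x \<bullet> v \<and> x \<bullet> v \<le> 1} x * (NNINT t. H (x + t *\<^sub>R v)))
   = ennreal (1 / (v \<bullet> v)) * (NNINT x. H x)"
proof -
 define I :: "'a => ennreal" where "I = indicator {x. 0 \<le> x \<bullet> v \<and> x \<bullet> v \<le> 1}"
 have [measurable]: "I \<in> borel_measurable borel" unfolding I_def by measurable
 have vv: "0 < v \<bullet> v" using v by simp
 have "(NNINT x. I x * (NNINT t. H (x + t *\<^sub>R v))) = (NNINT x. (\<integral>\<^sup>+t. I x * H (x + t *\<^sub>R v) \<partial>(lborel::real measure)))"
  by (simp add: nn_integral_cmult)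
 also have "... = (\<integral>\<^sup>+t. (NNINT x. I x * H (x + t *\<^sub>R v)) \<partial>(lborel::real measure))"
  by (rule lborel_pair.Fubini'[symmetric]) measurable
 also have "... = (\<integral>\<^sup>+t. (NNINT x. I (x - t *\<^sub>R v) * H x) \<partial>(lborel::real measure))"
 proof (rule nn_integral_cong)
  fix t :: real
  show "(NNINT x. I x * H (x + t *\<^sub>R v)) = (NNINT x. I (x - t *\<^sub>R v) * H x)"
   using nn_lborel_translate[of "\<lambda>x. I (x - t *\<^sub>R v) * H x" "t *\<^sub>R v"] by (simp add: add.commute)
 qed
 also have "... = (NNINT x. (\<integral>\<^sup>+t. I (x - t *\<^sub>R v) * H x \<partial>(lborel::real measure)))"
  by (rule lborel_pair.Fubini') measurable
 also have "... = (NNINT x. ennreal (1 / (v \<bullet> v)) * H x)"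
 proof (rule nn_integral_cong)
  fix x :: 'a
  have "(\<integral>\<^sup>+t. I (x - t *\<^sub>R v) * H x \<partial>(lborel::real measure)) = (\<integral>\<^sup>+t. I (x - t *\<^sub>R v) \<partial>(lborel::real measure)) * H x"
   by (rule nn_integral_multc) measurable
  also have "(\<integral>\<^sup>+t. I (x - t *\<^sub>R v) \<partial>(lborel::real measure)) = ennreal (1 / (v \<bullet> v))"
  proof -
   have "(\<lambda>t. I (x - t *\<^sub>R v)) = indicator {(x \<bullet> v - 1) / (v \<bullet> v) .. (x \<bullet> v) / (v \<bullet> v)}"
    using vv by (auto simp: I_def indicator_def inner_diff_left field_simps fun_eq_iff)
   moreover
   have "(x \<bullet> v - 1) / (v \<bullet> v) \<le> (x \<bullet> v) / (v \<bullet> v)" using vv by (intro divide_right_mono) auto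
   ultimately show ?thesis using vv by (simp add: diff_divide_distrib[symmetric])
  qed
  finally show "(\<integral>\<^sup>+t. I (x - t *\<^sub>R v) * H x \<partial>(lborel::real measure)) = ennreal (1 / (v \<bullet> v)) * H x" .
 qed
 finally show ?thesis by (simp add: I_def nn_integral_cmult)
qed

text \<open>Difference quotients along the fixed sequence \<open>1 / (n + 1)\<close>. Their limit is a total and measurable function, which
for Lipschitz functions serves as a weak derivative.\<close>

definition dq :: "nat => 'a::real_normed_vector => ('a => real) => 'a => real" where
 "dq n v G x = real (Suc n) * (G (x + (1 / real (Suc n)) *\<^sub>R v) - G x)"

definition Dl :: "'a::real_normed_vector => ('a => real) => 'a => real" where
 "Dl v G x = lim (\<lambda>n. dq n v G x)"

lemma dq_tendsto_pd:
 fixes G :: "'a::euclidean_space => real"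
 assumes "G differentiable at x" shows "(\<lambda>n. dq n v G x) \<longlonglongrightarrow> pd v G x"
proof -
 have 1: "((\<lambda>t::real. x + t *\<^sub>R v) has_derivative (\<lambda>s. s *\<^sub>R v)) (at 0)"
  by (auto intro!: derivative_eq_intros)
 have "((\<lambda>t. G (x + t *\<^sub>R v)) has_real_derivative pd v G x) (at 0)"
  using has_derivative_compose[OF 1, of G "\<lambda>v. pd v G x"] has_derivative_pd[OF assms]
  by (simp add: pd_scaleR assms has_field_derivative_def mult_commute_abs)
 then have lim: "((\<lambda>t. (G (x + t *\<^sub>R v) - G (x + 0 *\<^sub>R v)) / (t - 0)) \<longlongrightarrow> pd v G x) (at 0)"
  by (simp only: has_field_derivative_iff)
 define h where "h n = 1 / real (Suc n)" for n
 have h: "0 < h n" for n by (auto simp: h_def)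
 have "h \<longlonglongrightarrow> 0" unfolding h_def by (rule LIMSEQ_Suc[OF lim_1_over_n])
 then have "filterlim h (at 0) sequentially"
  using h by (auto simp: filterlim_at intro!: always_eventually) (metis less_irrefl)
 from filterlim_compose[OF lim this]
 show ?thesis by (simp add: dq_def h_def mult.commute)
qed

lemma Dl_eq_pd:
 fixes G :: "'a::euclidean_space => real"
 assumes "G differentiable at x" shows "Dl v G x = pd v G x"
 unfolding Dl_def using dq_tendsto_pd[OF assms] by (rule limI)

locale lipschitz_fun =
 fixes G :: "'a::euclidean_space => real" and L :: real
 assumes lip: "\<bar>G x - G y\<bar> \<le> L * norm (x - y)" and L0: "0 \<le> L"
begin

lemma G_cont: "continuous_on UNIV G"
proof -
 have "L-lipschitz_on UNIV G" using lip L0 by (intro lipschitz_onI) (auto simp: dist_norm)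
 then show ?thesis by (rule lipschitz_on_continuous_on)
qed

lemma G_meas [measurable]: "G \<in> borel_measurable borel" by (rule borel_measurable_cont[OF G_cont])

lemma dq_meas [measurable]: "dq n v G \<in> borel_measurable borel" unfolding dq_def[abs_def] by measurable

lemma Dl_meas [measurable]: "Dl v G \<in> borel_measurable borel" unfolding Dl_def[abs_def] by measurable

lemma dq_bound: "\<bar>dq n v G x\<bar> \<le> L * norm v"
proof -
 have "\<bar>G (x + (1 / real (Suc n)) *\<^sub>R v) - G x\<bar> \<le> L * norm ((1 / real (Suc n)) *\<^sub>R v)"
  using lip[of "x + (1 / real (Suc n)) *\<^sub>R v" x] by simp
 then have "real (Suc n) * \<bar>G (x + (1 / real (Suc n)) *\<^sub>R v) - G x\<bar> \<le> real (Suc n) * (L * ((1 / real (Suc n)) * norm v))"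
  by (intro mult_left_mono) auto
 also have "... = L * norm v" by simp
 finally show ?thesis by (simp add: dq_def abs_mult)
qed

lemma dq_convergent: "AE x in lborel. convergent (\<lambda>n. dq n v G x)"
proof (cases "v = 0")
 case True then show ?thesis by (simp add: dq_def convergent_const)
next
 case False
 define Z where "Z = {x. \<not> convergent (\<lambda>n. dq n v G x)}"
 have Z [measurable]: "Z \<in> sets borel"
 proof -
  have "{x \<in> space borel. \<not> convergent (\<lambda>n. dq n v G x)} \<in> sets borel"
   unfolding Cauchy_convergent_iff[symmetric] by measurable
  then show ?thesis by (simp add: Z_def)
 qed
 have line: "(NNINT t. indicator Z (x + t *\<^sub>R v)) = 0" for x
 proof -
  have "AE t in lborel. convergent (\<lambda>n. real (Suc n) * (G (x + (t + 1 / real (Suc n)) *\<^sub>R v) - G (x + t *\<^sub>R v)))"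
  proof (rule lipschitz_right_derivative_ae[of "\<lambda>t. G (x + t *\<^sub>R v)" "L * norm v"])
   fix s t
   have "(x + s *\<^sub>R v) - (x + t *\<^sub>R v) = (s - t) *\<^sub>R v" by (simp add: algebra_simps)
   then show "\<bar>G (x + s *\<^sub>R v) - G (x + t *\<^sub>R v)\<bar> \<le> L * norm v * \<bar>s - t\<bar>"
    using lip[of "x + s *\<^sub>R v" "x + t *\<^sub>R v"] by (simp add: mult_ac)
  qed
  then have "AE t in lborel. (indicator Z (x + t *\<^sub>R v) :: ennreal) = 0"
   by eventually_elim (simp add: Z_def dq_def scaleR_left_distrib add.assoc)
  then show ?thesis by (subst nn_integral_0_iff_AE) auto
 qed
 have "0 = ennreal (1 / (v \<bullet> v)) * (NNINT x. indicator Z x)"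
  using nn_integral_along_lines[of "indicator Z" v] False by (simp add: line)
 moreover have "\<not> v \<bullet> v \<le> 0" using False by (metis inner_gt_zero_iff not_le)
 ultimately have "emeasure lborel Z = 0" by (simp add: ennreal_eq_0_iff)
 then have "Z \<in> null_sets lborel" using Z by (simp add: null_sets_def)
 then show ?thesis by (rule AE_I') (auto simp: Z_def)
qed

lemma dq_tendsto_Dl: "AE x in lborel. (\<lambda>n. dq n v G x) \<longlonglongrightarrow> Dl v G x"
 using dq_convergent[of v] by eventually_elim (simp add: Dl_def convergent_LIMSEQ_iff)

lemma Dl_bound: "AE x in lborel. \<bar>Dl v G x\<bar> \<le> L * norm v"
 using dq_tendsto_Dl[of v]
proof eventually_elim
 case (elim x)
 show ?case by (rule LIMSEQ_le_const2[OF tendsto_rabs[OF elim]]) (auto intro: dq_bound)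
qed

lemma loc_int_Dl: "loc_int (Dl v G)" "loc_int (\<lambda>x. (Dl v G x)^2)"
proof -
 have "integrable lborel (\<lambda>x. indicator (cball 0 M) x * Dl v G x)"
    "integrable lborel (\<lambda>x. indicator (cball 0 M) x * (Dl v G x)^2)" for M
 proof -
  have ib: "integrable lborel (\<lambda>x::'a. indicator (cball 0 M) x * B)" for B :: real
   using borel_integrable_compact[of "cball (0::'a) M" "\<lambda>_. B"] by simp
  show "integrable lborel (\<lambda>x. indicator (cball 0 M) x * Dl v G x)"
  proof (rule Bochner_Integration.integrable_bound[OF ib[of "L * norm v"]])
   show "AE x in lborel. norm (indicator (cball 0 M) x * Dl v G x) \<le> norm (indicator (cball 0 M) x * (L * norm v))"
    using Dl_bound[of v] by eventually_elim (auto simp: indicator_def)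
  qed (auto intro!: borel_measurable_times borel_measurable_indicator)
  show "integrable lborel (\<lambda>x. indicator (cball 0 M) x * (Dl v G x)^2)"
  proof (rule Bochner_Integration.integrable_bound[OF ib[of "(L * norm v)^2"]])
   show "AE x in lborel. norm (indicator (cball 0 M) x * (Dl v G x)^2) \<le> norm (indicator (cball 0 M) x * (L * norm v)^2)"
    using Dl_bound[of v]
   proof eventually_elim
    case (elim x)
    then have "(Dl v G x)^2 \<le> (L * norm v)^2" using power_mono[OF elim, of 2] by simp
    then show ?case by (auto simp: indicator_def)
   qed
  qed (auto intro!: borel_measurable_times borel_measurable_indicator borel_measurable_power)
 qed
 then show "loc_int (Dl v G)" "loc_int (\<lambda>x. (Dl v G x)^2)" unfolding loc_int_def by simp_all
qed

lemma loc_int_G: "loc_int G" by (rule loc_int_cont[OF G_cont])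

lemma weak_derivative:
 assumes f: "Ck 1 f" "bsupp f"
 shows "(LBINT x. Dl v G x * f x) = - (LBINT x. G x * pd v f x)"
proof -
 have c: "continuous_on UNIV f" by (rule Ck_cont[OF f(1)])
 have d: "f differentiable at x" for x by (rule Ck_diff[OF f(1)]) simp
 have [measurable]: "f \<in> borel_measurable borel" by (rule borel_measurable_cont[OF c])
 have cp: "continuous_on UNIV (pd v f)" using f by simp
 have [measurable]: "pd v f \<in> borel_measurable borel" by (rule borel_measurable_cont[OF cp])
 have "(\<lambda>n. LBINT x. dq n v G x * f x) \<longlonglongrightarrow> (LBINT x. Dl v G x * f x)"
 proof (rule integral_dominated_convergence)
  show "integrable lborel (\<lambda>x. L * norm v * \<bar>f x\<bar>)" using integrable_bsupp[OF c f(2)] by simp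
  show "AE x in lborel. (\<lambda>n. dq n v G x * f x) \<longlonglongrightarrow> Dl v G x * f x"
   using dq_tendsto_Dl[of v] by eventually_elim (intro tendsto_intros)
  show "AE x in lborel. norm (dq n v G x * f x) \<le> L * norm v * \<bar>f x\<bar>" for n
   using dq_bound[of n v] by (intro AE_I2) (auto simp: abs_mult intro!: mult_right_mono)
 qed measurable
 moreover have "(\<lambda>n. LBINT x. dq n v G x * f x) \<longlonglongrightarrow> - (LBINT x. G x * pd v f x)"
 proof -
  obtain M where M: "0 < M" "\<And>x. M \<le> norm x ==> f x = 0" using bsuppE[OF f(2)] by blast
  obtain B where B: "0 < B" "\<And>x. \<bar>pd v f x\<bar> \<le> B" using bsupp_bounded[OF cp bsupp_pd[OF f(2)]] by blast
  have e: "(LBINT x. dq n v G x * f x) = (LBINT x. G x * dq n (- v) f x)" for n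
  proof -
   define h where "h = (1 / real (Suc n)) *\<^sub>R v"
   have bt: "bsupp (\<lambda>x. f (x + - h))" by (rule bsupp_translate[OF f(2)])
   have ct: "continuous_on UNIV (\<lambda>x. f (x + - h))" by (rule continuous_on_compose2[OF c]) (auto intro: continuous_intros)
   have Gt: "continuous_on UNIV (\<lambda>x. G (x + h))" by (rule continuous_on_compose2[OF G_cont]) (auto intro: continuous_intros)
   have i: "integrable lborel (\<lambda>x. G (x + h) * f x)" "integrable lborel (\<lambda>x. G x * f x)" "integrable lborel (\<lambda>x. G x * f (x + - h))"
    by (intro integrable_bsupp continuous_on_mult Gt G_cont c ct bsupp_mult2 f(2) bt)+
   have "(LBINT x. G (x + h) * f x) = (LBINT x. G x * f (x + - h))"
    using lborel_translate[of "\<lambda>x. G x * f (x + - h)" h] by (simp add: add.commute)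
   then have "(LBINT x. real (Suc n) * (G (x + h) * f x - G x * f x)) = (LBINT x. real (Suc n) * (G x * f (x + - h) - G x * f x))"
    using i by simp
   then show ?thesis by (simp add: dq_def h_def left_diff_distrib right_diff_distrib mult.assoc mult.left_commute)
  qed
  have "(\<lambda>n. LBINT x. G x * dq n (- v) f x) \<longlonglongrightarrow> (LBINT x. G x * pd (- v) f x)"
  proof (rule integral_dominated_convergence)
   show "(\<lambda>x. G x * pd (- v) f x) \<in> borel_measurable lborel"
   proof -
    have "continuous_on UNIV (pd (- v) f)" using f by simp
    then have "continuous_on UNIV (\<lambda>x. G x * pd (- v) f x)" by (intro continuous_on_mult G_cont)
    then show ?thesis by (simp add: borel_measurable_cont)
   qed
   show "(\<lambda>x. G x * dq n (- v) f x) \<in> borel_measurable lborel" for n unfolding dq_def by measurable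
   show "AE x in lborel. (\<lambda>n. G x * dq n (- v) f x) \<longlonglongrightarrow> G x * pd (- v) f x"
    by (intro AE_I2 tendsto_mult tendsto_const dq_tendsto_pd d)
   show "integrable lborel (\<lambda>x. B * (indicator (cball 0 (M + norm v)) x * \<bar>G x\<bar>))"
    using loc_int_abs[OF loc_int_G] by (simp add: loc_int_def)
   fix n
   show "AE x in lborel. norm (G x * dq n (- v) f x) \<le> B * (indicator (cball 0 (M + norm v)) x * \<bar>G x\<bar>)"
   proof (rule AE_I2)
    fix x :: 'a
    define t where "t = 1 / real (Suc n)"
    have t: "0 < t" "t \<le> 1" by (simp_all add: t_def)
    show "norm (G x * dq n (- v) f x) \<le> B * (indicator (cball 0 (M + norm v)) x * \<bar>G x\<bar>)"
    proof (cases "norm x \<le> M + norm v")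
     case True
     obtain s where "f (x + t *\<^sub>R (- v)) - f x = pd (t *\<^sub>R (- v)) f (x + s *\<^sub>R t *\<^sub>R (- v))"
      using mvt_pd[OF d] by blast
     also have "... = - t * pd v f (x + s *\<^sub>R t *\<^sub>R (- v))" using pd_scaleR[OF d, of "- t" v] by simp
     finally have "\<bar>dq n (- v) f x\<bar> = \<bar>pd v f (x + s *\<^sub>R t *\<^sub>R (- v))\<bar>"
      using t by (simp add: dq_def t_def abs_mult)
     then have "\<bar>dq n (- v) f x\<bar> \<le> B" using B(2) by simp
     then have "\<bar>dq n (- v) f x\<bar> * \<bar>G x\<bar> \<le> B * \<bar>G x\<bar>" by (intro mult_right_mono) auto
     then show ?thesis using True by (simp add: abs_mult mult.commute)
    next
     case False
     have "norm (t *\<^sub>R (- v)) \<le> norm v" using t by (simp add: mult_left_le_one_le)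
     moreover have "norm x \<le> norm (x + t *\<^sub>R (- v)) + norm (t *\<^sub>R (- v))"
      using norm_triangle_ineq4[of "x + t *\<^sub>R (- v)" "t *\<^sub>R (- v)"] by simp
     ultimately have "M \<le> norm (x + t *\<^sub>R (- v))" "M \<le> norm x"
      using False norm_ge_zero[of v] by linarith+
     then show ?thesis using M(2) False by (simp add: dq_def t_def)
    qed
   qed
  qed
  moreover have "pd (- v) f x = - pd v f x" for x using pd_scaleR[OF d, of "-1" v] by simp
  ultimately show ?thesis unfolding e by simp
 qed
 ultimately show ?thesis by (rule LIMSEQ_unique)
qed

lemma AE_zero_if_smooth_test_zero:
 assumes "loc_int (d :: 'a => real)" and z: "\<And>f. Ck 1 f ==> bsupp f ==> (LBINT x. d x * f x) = 0"
 shows "AE x in lborel. d x = 0"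
proof (rule AE_zero_if_test_zero[OF assms(1)])
 fix f :: "'a => real" assume f: "continuous_on UNIV f" "bsupp f"
 have "(LBINT x. conv (moll n) d x * f x) = 0" for n
  unfolding conv_moll_self_adjoint[OF assms(1) f]
  by (rule z) (rule Ck_conv[OF loc_int_cont[OF f(1)] mollifier_C1[OF moll] mollifier_bsupp[OF moll]],
    rule bsupp_conv[OF mollifier_bsupp[OF moll] f(2)])
 then show "(LBINT x. d x * f x) = 0" using conv_moll_weak[OF assms(1) f] by (simp add: LIMSEQ_const_iff)
qed

text \<open>Weak derivatives are linear in the direction, and weak derivatives are unique almost everywhere.\<close>

lemma Dl_linear: "AE x in lborel. Dl v G x = (\<Sum>b\<in>Basis. (v \<bullet> b) * Dl b G x)"
proof -
 have ls: "loc_int (\<lambda>x. \<Sum>b\<in>B. - (v \<bullet> b) * Dl b G x)" if "finite B" for B :: "'a set"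
  using that
 proof induction
  case empty then show ?case by (simp add: loc_int_cont)
 next
  case (insert b B)
  have "loc_int (\<lambda>x. - (v \<bullet> b) * Dl b G x)" by (rule loc_int_mult_cont[OF loc_int_Dl(1)]) simp
  from loc_int_add[OF this insert.IH] show ?case using insert.hyps by simp
 qed
 have "AE x in lborel. Dl v G x + (\<Sum>b\<in>Basis. - (v \<bullet> b) * Dl b G x) = 0"
 proof (rule AE_zero_if_smooth_test_zero)
  show "loc_int (\<lambda>x. Dl v G x + (\<Sum>b\<in>Basis. - (v \<bullet> b) * Dl b G x))"
   by (rule loc_int_add[OF loc_int_Dl(1) ls]) simp
  fix f :: "'a => real" assume f: "Ck 1 f" "bsupp f"
  have d: "f differentiable at x" for x by (rule Ck_diff[OF f(1)]) simp
  have i: "integrable lborel (\<lambda>x. Dl v G x * f x)" for v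
   using integrable_loc_int_mult[OF loc_int_Dl(1) Ck_cont[OF f(1)] f(2), of v] by (simp add: mult.commute)
  have j: "integrable lborel (\<lambda>x. G x * pd v f x)" for v
   using f G_cont by (intro integrable_bsupp continuous_on_mult bsupp_mult2 bsupp_pd) auto
  have "(LBINT x. (Dl v G x + (\<Sum>b\<in>Basis. - (v \<bullet> b) * Dl b G x)) * f x) =
    (LBINT x. Dl v G x * f x + (\<Sum>b\<in>Basis. - (v \<bullet> b) * (Dl b G x * f x)))"
   by (simp add: distrib_right sum_distrib_right mult.assoc)
  also have "... = (LBINT x. Dl v G x * f x) + (\<Sum>b\<in>Basis. - (v \<bullet> b) * (LBINT x. Dl b G x * f x))"
   using i by simp
  also have "... = - ((LBINT x. G x * pd v f x) - (\<Sum>b\<in>Basis. (v \<bullet> b) * (LBINT x. G x * pd b f x)))"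
   unfolding weak_derivative[OF f] by (simp add: sum_negf)
  also have "(LBINT x. G x * pd v f x) = (\<Sum>b\<in>Basis. (v \<bullet> b) * (LBINT x. G x * pd b f x))"
  proof -
   have "G x * pd v f x = (\<Sum>b\<in>Basis. (v \<bullet> b) * (G x * pd b f x))" for x
    using pd_expand[OF d, of v x] by (simp add: sum_distrib_left mult.left_commute)
   then show ?thesis using j by simp
  qed
  finally show "(LBINT x. (Dl v G x + (\<Sum>b\<in>Basis. - (v \<bullet> b) * Dl b G x)) * f x) = 0" by simp
 qed
 then show ?thesis by eventually_elim (simp add: sum_negf)
qed

text \<open>Finitely many directions in the dense set \<open>Q\<close> come close to all unit vectors, and the Lipschitz bound makes
the error in between uniform.\<close>

lemma differentiable_if_directional:
 assumes Q: "\<And>X::'a set. open X ==> X \<noteq> {} ==> \<exists>q\<in>Q. q \<in> X"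
  and lim: "\<And>q. q \<in> Q ==> (\<lambda>n. dq n q G x) \<longlonglongrightarrow> g \<bullet> q"
 shows "(G has_derivative (\<lambda>h. g \<bullet> h)) (at x)"
 unfolding has_derivative_at_alt
proof (intro conjI allI impI)
 show "bounded_linear (\<lambda>h. g \<bullet> h)" by (rule bounded_linear_inner_right)
 fix e :: real assume e: "0 < e"
 define C where "C = L + norm g"
 have C: "0 \<le> C" using L0 by (simp add: C_def)
 define \<delta> where "\<delta> = e / (4 * (C + 1))"
 have \<delta>: "0 < \<delta>" using e C by (simp add: \<delta>_def)
 have "sphere (0::'a) 1 \<subseteq> (\<Union>q\<in>Q. ball q \<delta>)"
 proof
  fix u :: 'a
  obtain q where "q \<in> Q" "q \<in> ball u \<delta>" using Q[of "ball u \<delta>"] \<delta> by auto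
  then show "u \<in> (\<Union>q\<in>Q. ball q \<delta>)" by (auto simp: dist_commute)
 qed
 moreover have "compact (sphere (0::'a) 1)" by simp
 ultimately obtain F where F: "F \<subseteq> Q" "finite F" "sphere (0::'a) 1 \<subseteq> (\<Union>q\<in>F. ball q \<delta>)"
  using compactE_image[of "sphere (0::'a) 1" Q "\<lambda>q. ball q \<delta>"] by (metis open_ball)
 have "\<forall>q\<in>F. \<exists>N. \<forall>n\<ge>N. \<bar>dq n q G x - g \<bullet> q\<bar> \<le> \<delta>"
 proof
  fix q assume "q \<in> F"
  then have "(\<lambda>n. dq n q G x) \<longlonglongrightarrow> g \<bullet> q" using lim F by auto
  from LIMSEQ_D[OF this \<delta>] show "\<exists>N. \<forall>n\<ge>N. \<bar>dq n q G x - g \<bullet> q\<bar> \<le> \<delta>" by (auto intro: less_imp_le)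
 qed
 then obtain N where N: "\<And>q n. q \<in> F ==> N q \<le> n ==> \<bar>dq n q G x - g \<bullet> q\<bar> \<le> \<delta>" by metis
 define K where "K = Suc (\<Sum>q\<in>F. N q)"
 have NK: "N q \<le> K" if "q \<in> F" for q
  unfolding K_def using that F(2) by (intro le_SucI member_le_sum) auto
 define d where "d = min (1 / real (Suc (Suc K))) \<delta>"
 show "\<exists>d>0. \<forall>y. norm (y - x) < d \<longrightarrow> norm (G y - G x - g \<bullet> (y - x)) \<le> e * norm (y - x)"
 proof (intro exI[of _ d] conjI allI impI)
  show "0 < d" using \<delta> by (simp add: d_def)
  fix y assume y: "norm (y - x) < d"
  define h where "h = y - x"
  define r where "r = norm h"
  show "norm (G y - G x - g \<bullet> (y - x)) \<le> e * norm (y - x)"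
  proof (cases "h = 0")
   case False
   then have r: "0 < r" by (simp add: r_def)
   have rK: "r < 1 / real (Suc (Suc K))" "r < \<delta>" using y by (auto simp: d_def r_def h_def)
   define m where "m = nat \<lfloor>1 / r\<rfloor>"
   have big: "real (Suc (Suc K)) < 1 / r" using rK(1) r by (simp add: field_simps)
   have m1: "real m \<le> 1 / r" "1 / r < real m + 1" unfolding m_def using r by (auto simp: of_nat_nat)
   have mK: "Suc K < m"
   proof -
    have "real (Suc K) < real m" using big m1(2) by simp
    then show ?thesis by simp
   qed
   define s where "s = 1 / real m"
   have s: "r \<le> s" "0 < s" using m1(1) r mK by (auto simp: s_def field_simps)
   have sr: "s - r \<le> s * r"
   proof -
    have "1 < r * (real m + 1)" using m1(2) r by (simp add: field_simps)
    then have "s * 1 \<le> s * (r * (real m + 1))" using s by (intro mult_left_mono) auto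
    also have "... = r + s * r" using mK by (simp add: s_def field_simps)
    finally show ?thesis by simp
   qed
   have s2: "s \<le> 2 * r"
   proof -
    have "r \<le> 1 / 2" using rK(1) by (rule order_trans[OF less_imp_le]) simp
    then have "s * r \<le> s * (1/2)" using s by (intro mult_left_mono) auto
    then show ?thesis using sr by simp
   qed
   define u where "u = (1 / r) *\<^sub>R h"
   have hu: "h = r *\<^sub>R u" using r by (simp add: u_def)
   have nu: "norm u = 1" using r by (simp add: u_def r_def)
   then obtain q where q: "q \<in> F" "norm (q - u) < \<delta>" using F(3) by (force simp: dist_norm)
   obtain n where n: "m = Suc n" using mK by (cases m) auto
   have "\<bar>dq n q G x - g \<bullet> q\<bar> \<le> \<delta>" using N[OF q(1), of n] NK[OF q(1)] mK n by simp
   then have "s * \<bar>dq n q G x - g \<bullet> q\<bar> \<le> s * \<delta>" using s by (intro mult_left_mono) auto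
   then have "\<bar>s * (dq n q G x - g \<bullet> q)\<bar> \<le> s * \<delta>" using s by (simp add: abs_mult)
   moreover have "s * (dq n q G x - g \<bullet> q) = G (x + s *\<^sub>R q) - G x - s * (g \<bullet> q)"
    using s by (simp add: dq_def s_def n right_diff_distrib)
   ultimately have 1: "\<bar>G (x + s *\<^sub>R q) - G x - s * (g \<bullet> q)\<bar> \<le> s * \<delta>"
    by simp
   have "h - s *\<^sub>R q = (r - s) *\<^sub>R u + s *\<^sub>R (u - q)" by (simp add: hu algebra_simps)
   then have "norm (h - s *\<^sub>R q) \<le> norm ((r - s) *\<^sub>R u) + norm (s *\<^sub>R (u - q))" by (metis norm_triangle_ineq)
   also have "... = (s - r) + s * norm (u - q)" using s nu by simp
   also have "... \<le> s * r + s * \<delta>" using sr q(2) s by (intro add_mono mult_left_mono) (auto simp: norm_minus_commute)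
   also have "... \<le> s * (2 * \<delta>)" using rK(2) s by (simp add: distrib_left[symmetric])
   finally have nh: "norm (h - s *\<^sub>R q) \<le> s * (2 * \<delta>)" .
   have 2: "\<bar>G (x + h) - G (x + s *\<^sub>R q)\<bar> \<le> L * (s * (2 * \<delta>))"
    using lip[of "x + h" "x + s *\<^sub>R q"] mult_left_mono[OF nh L0] by simp
   have 3: "\<bar>s * (g \<bullet> q) - g \<bullet> h\<bar> \<le> norm g * (s * (2 * \<delta>))"
   proof -
    have "\<bar>g \<bullet> (s *\<^sub>R q - h)\<bar> \<le> norm g * norm (s *\<^sub>R q - h)" by (rule Cauchy_Schwarz_ineq2)
    also have "... \<le> norm g * (s * (2 * \<delta>))" using nh by (intro mult_left_mono) (auto simp: norm_minus_commute)
    finally show ?thesis by (simp add: inner_diff_right)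
   qed
   have "\<bar>G (x + h) - G x - g \<bullet> h\<bar> \<le> L * (s * (2 * \<delta>)) + s * \<delta> + norm g * (s * (2 * \<delta>))"
    using 1 2 3 by linarith
   also have "... \<le> s * (2 * \<delta> * (C + 1))"
    using s \<delta> by (simp add: C_def algebra_simps)
   also have "... = s * (e / 2)" using C by (simp add: \<delta>_def field_simps)
   also have "... \<le> (2 * r) * (e / 2)" using s2 e by (intro mult_right_mono) auto
   finally show ?thesis by (simp add: h_def[symmetric] r_def[symmetric] mult.commute) (simp add: h_def)
  qed (simp add: h_def)
 qed
qed

theorem rademacher: "AE x in lborel. G differentiable at x"
proof -
 obtain Q :: "'a set" where Q: "countable Q" "\<And>X. open X ==> X \<noteq> {} ==> \<exists>q\<in>Q. q \<in> X"
  using countable_dense_exists by blast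
 have "AE x in lborel. \<forall>q\<in>Q. (\<lambda>n. dq n q G x) \<longlonglongrightarrow> (\<Sum>b\<in>Basis. (q \<bullet> b) * Dl b G x)"
 proof (subst AE_ball_countable[OF Q(1)], intro ballI)
  fix q
  show "AE x in lborel. (\<lambda>n. dq n q G x) \<longlonglongrightarrow> (\<Sum>b\<in>Basis. (q \<bullet> b) * Dl b G x)"
   using dq_tendsto_Dl[of q] Dl_linear[of q] by eventually_elim simp
 qed
 then show ?thesis
 proof eventually_elim
  case (elim x)
  define g where "g = (\<Sum>b\<in>Basis. Dl b G x *\<^sub>R b)"
  have "(\<lambda>n. dq n q G x) \<longlonglongrightarrow> g \<bullet> q" if "q \<in> Q" for q
  proof -
   have "g \<bullet> q = (\<Sum>b\<in>Basis. (Dl b G x *\<^sub>R b) \<bullet> q)" unfolding g_def by (rule inner_sum_left)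
   also have "... = (\<Sum>b\<in>Basis. (q \<bullet> b) * Dl b G x)"
    by (intro sum.cong refl) (simp add: inner_commute mult.commute)
   finally show ?thesis using elim that by simp
  qed
  from differentiable_if_directional[OF Q(2) this] show ?case by (auto simp: differentiable_def)
 qed
qed

end

section \<open>From smooth to locally Lipschitz functions\<close>

lemma lipschitz_zero_outside:
 fixes F :: "'a::euclidean_space => real"
 assumes L: "\<And>x y. norm x \<le> M + 1 ==> norm y \<le> M + 1 ==> \<bar>F x - F y\<bar> \<le> L * norm (x - y)"
  and z: "\<And>x. M \<le> norm x ==> F x = 0" and B: "\<And>x. \<bar>F x\<bar> \<le> B"
 shows "\<bar>F x - F y\<bar> \<le> max (max L B) 0 * norm (x - y)"
proof -
 define C where "C = max (max L B) 0"
 have LC: "L * norm (x - y) \<le> C * norm (x - y)" and BC: "B \<le> C" for x y :: 'a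
  unfolding C_def by (intro mult_right_mono) auto
 have far: "\<bar>F x - F y\<bar> \<le> C * norm (x - y)" if xy: "M + 1 < norm x" for x y
 proof (cases "norm y \<le> M")
  case True
  then have "1 \<le> norm (x - y)" using xy norm_triangle_ineq2[of x y] by linarith
  then have "C * 1 \<le> C * norm (x - y)" by (intro mult_left_mono) (auto simp: C_def)
  moreover have "\<bar>F x - F y\<bar> \<le> B" using z[of x] xy B[of y] by simp
  ultimately show ?thesis using BC by linarith
 next
  case False
  then have "F x = 0" "F y = 0" using z xy by auto
  then show ?thesis by (simp add: C_def)
 qed
 show ?thesis unfolding C_def[symmetric]
 proof (cases "norm x \<le> M + 1 \<and> norm y \<le> M + 1")
  case True
  then show "\<bar>F x - F y\<bar> \<le> C * norm (x - y)" using L[of x y] LC[of x y] by linarith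
 next
  case False
  then show "\<bar>F x - F y\<bar> \<le> C * norm (x - y)"
   using far[of x y] far[of y x] by (auto simp: norm_minus_commute abs_minus_commute not_le)
 qed
qed

definition lip_balls :: "('a::euclidean_space => real) => bool" where
 "lip_balls G \<longleftrightarrow> (\<forall>M. \<exists>L\<ge>0. \<forall>x y. norm x \<le> M \<longrightarrow> norm y \<le> M \<longrightarrow> \<bar>G x - G y\<bar> \<le> L * norm (x - y))"

lemma lip_balls_cont:
 assumes "lip_balls G" shows "continuous_on UNIV G"
proof (intro continuous_at_imp_continuous_on ballI)
 fix x :: 'a
 obtain L where L: "0 \<le> L" "\<And>y z. norm y \<le> norm x + 1 ==> norm z \<le> norm x + 1 ==> \<bar>G y - G z\<bar> \<le> L * norm (y - z)"
  using assms unfolding lip_balls_def by meson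
 have "L-lipschitz_on (ball 0 (norm x + 1)) G"
  using L by (intro lipschitz_onI) (auto simp: dist_norm)
 then have "continuous_on (ball 0 (norm x + 1)) G" by (rule lipschitz_on_continuous_on)
 then show "isCont G x" by (simp add: continuous_on_eq_continuous_at)
qed

lemma cutoff_lipschitz:
 fixes G :: "'a::euclidean_space => real"
 assumes G: "lip_balls G" and q: "Ck 1 q" "bsupp q"
 shows "\<exists>L. lipschitz_fun (\<lambda>x. q x * G x) L"
proof -
 obtain M where M: "0 < M" "\<And>x. M \<le> norm x ==> q x = 0" using bsuppE[OF q(2)] by blast
 define F where "F x = q x * G x" for x
 have c: "continuous_on UNIV q" "continuous_on UNIV G" by (rule Ck_cont[OF q(1)], rule lip_balls_cont[OF G])
 obtain L1 where L1: "0 \<le> L1" "\<And>x y. norm x \<le> M + 1 ==> norm y \<le> M + 1 ==> \<bar>G x - G y\<bar> \<le> L1 * norm (x - y)"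
  using G unfolding lip_balls_def by meson
 obtain L2 where L2: "0 \<le> L2" "\<And>x y. norm x \<le> M + 1 ==> norm y \<le> M + 1 ==> \<bar>q x - q y\<bar> \<le> L2 * norm (x - y)"
  using Ck1_lipschitz_cball[OF q(1), of "M + 1"] by meson
 obtain B1 where B1: "0 < B1" "\<And>x. norm x \<le> M + 1 ==> \<bar>G x\<bar> \<le> B1" using cont_bounded_cball[OF c(2)] by meson
 obtain B2 where B2: "0 < B2" "\<And>x. \<bar>q x\<bar> \<le> B2" using bsupp_bounded[OF c(1) q(2)] by blast
 have cF: "continuous_on UNIV F" "bsupp F" unfolding F_def by (intro continuous_intros c, intro bsupp_mult1 q)
 obtain B where B: "0 < B" "\<And>x. \<bar>F x\<bar> \<le> B" using bsupp_bounded[OF cF] by blast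
 have loc: "\<bar>F x - F y\<bar> \<le> (B2 * L1 + L2 * B1) * norm (x - y)" if "norm x \<le> M + 1" "norm y \<le> M + 1" for x y
 proof -
  have "F x - F y = q x * (G x - G y) + (q x - q y) * G y" by (simp add: F_def algebra_simps)
  then have "\<bar>F x - F y\<bar> \<le> \<bar>q x\<bar> * \<bar>G x - G y\<bar> + \<bar>q x - q y\<bar> * \<bar>G y\<bar>"
   by (metis abs_mult abs_triangle_ineq)
  also have "... \<le> B2 * (L1 * norm (x - y)) + (L2 * norm (x - y)) * B1"
   using L1 L2 B1 B2 that by (intro add_mono mult_mono) auto
  finally show ?thesis by (simp add: algebra_simps)
 qed
 have z: "F x = 0" if "M \<le> norm x" for x using M(2)[OF that] by (simp add: F_def)
 have "lipschitz_fun F (max (max (B2 * L1 + L2 * B1) B) 0)"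
  by standard (rule lipschitz_zero_outside[of M F, OF loc z B(2)], auto)
 then show ?thesis by (auto simp: F_def[abs_def])
qed

theorem rademacher_local:
 fixes G :: "'a::euclidean_space => real"
 assumes G: "lip_balls G" shows "AE x in lborel. G differentiable at x"
proof -
 have "AE x in lborel. (\<lambda>x. cut K x * G x) differentiable at x" for K
  using cutoff_lipschitz[OF G cut_C1 cut_bsupp] lipschitz_fun.rademacher by blast
 then have "AE x in lborel. \<forall>K. (\<lambda>x. cut K x * G x) differentiable at x" by (simp add: AE_all_countable)
 then show ?thesis
 proof eventually_elim
  case (elim x)
  obtain K :: nat where K: "norm x \<le> real K" using real_arch_simple by blast
  obtain D where D: "((\<lambda>x. cut K x * G x) has_derivative D) (at x)" using elim by (auto simp: differentiable_def)
  have "(G has_derivative D) (at x)"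
  proof (rule has_derivative_transform_within_open[OF D, where s = "ball 0 (real (Suc K))"])
   show "x \<in> ball 0 (real (Suc K))" using K by simp
   show "cut K y * G y = G y" if "y \<in> ball 0 (real (Suc K))" for y using cut_one[of y K] that by simp
  qed simp
  then show ?case by (auto simp: differentiable_def)
 qed
qed

locale smooth_poincare = weight +
 fixes C :: real
 assumes wi: "integrable lborel w" and C0: "0 \<le> C"
  and smooth: "\<And>f. Ck 1 f ==> bsupp f ==>
   (LBINT x. (f x)^2 * w x) - (LBINT x. f x * w x)^2 / integral\<^sup>L lborel w \<le> C * En f"
begin

text \<open>Applied to mollifications of \<open>G\<close>: by Jensen's inequality their energy density is at most the mollified
energy density of \<open>G\<close>.\<close>

lemma poincare_lipschitz_bsupp:
 assumes G: "lipschitz_fun G L" "bsupp G"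
 shows "(LBINT x. (G x)^2 * w x) - (LBINT x. G x * w x)^2 / integral\<^sup>L lborel w
   \<le> C * (LBINT x. (\<Sum>b\<in>Basis. (Dl b G x)^2) * w x)"
proof -
 interpret lipschitz_fun G L by (rule G(1))
 obtain M where M: "0 < M" "\<And>x. M \<le> norm x ==> G x = 0" using bsuppE[OF G(2)] by blast
 obtain B where B: "0 < B" "\<And>x. \<bar>G x\<bar> \<le> B" using bsupp_bounded[OF G_cont G(2)] by blast
 define Gn where "Gn n = conv (moll n) G" for n
 have Gn: "Ck 1 (Gn n)" "bsupp (Gn n)" "continuous_on UNIV (Gn n)" for n
 proof -
  show "Ck 1 (Gn n)" unfolding Gn_def by (rule Ck_conv[OF loc_int_G mollifier_C1[OF moll] mollifier_bsupp[OF moll]])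
  then show "continuous_on UNIV (Gn n)" by (rule Ck_cont)
  show "bsupp (Gn n)" unfolding Gn_def by (rule bsupp_conv[OF mollifier_bsupp[OF moll] G(2)])
 qed
 have [measurable]: "Gn n \<in> borel_measurable borel" for n by (rule borel_measurable_cont[OF Gn(3)])
 have GnB: "\<bar>Gn n x\<bar> \<le> B" for n x
  unfolding Gn_def using conv_approx[OF moll loc_int_G, of x n 0 B] B by simp
 have GnG: "(\<lambda>n. Gn n x) \<longlonglongrightarrow> G x" for x unfolding Gn_def by (rule conv_moll_pointwise[OF G_cont])
 have l1: "(\<lambda>n. LBINT x. (Gn n x)^2 * w x) \<longlonglongrightarrow> (LBINT x. (G x)^2 * w x)"
 proof (rule integral_dominated_convergence)
  show "integrable lborel (\<lambda>x. B^2 * w x)" using wi by simp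
  show "AE x in lborel. (\<lambda>n. (Gn n x)^2 * w x) \<longlonglongrightarrow> (G x)^2 * w x" by (intro AE_I2 tendsto_intros GnG)
  show "AE x in lborel. norm ((Gn n x)^2 * w x) \<le> B^2 * w x" for n
   using power_mono[OF GnB, of _ _ 2] by (intro AE_I2) (simp add: abs_mult mult_right_mono)
 qed measurable
 have l2: "(\<lambda>n. LBINT x. Gn n x * w x) \<longlonglongrightarrow> (LBINT x. G x * w x)"
 proof (rule integral_dominated_convergence)
  show "integrable lborel (\<lambda>x. B * w x)" using wi by simp
  show "AE x in lborel. (\<lambda>n. Gn n x * w x) \<longlonglongrightarrow> G x * w x" by (intro AE_I2 tendsto_intros GnG)
  show "AE x in lborel. norm (Gn n x * w x) \<le> B * w x" for n
   using GnB by (intro AE_I2) (simp add: abs_mult mult_right_mono)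
 qed measurable
 define W where "W = integral\<^sup>L lborel w"
 have lV: "(\<lambda>n. (LBINT x. (Gn n x)^2 * w x) - (LBINT x. Gn n x * w x)^2 / W) \<longlonglongrightarrow>
   (LBINT x. (G x)^2 * w x) - (LBINT x. G x * w x)^2 / W"
  using tendsto_diff[OF l1 tendsto_mult[OF tendsto_power[OF l2, of 2] tendsto_const[of "1 / W"]]] by simp
 define E where "E x = (\<Sum>b\<in>Basis. (Dl b G x)^2)" for x
 have Dz: "Dl b G x = 0" if "M < norm x" for b x
 proof -
  have "(G has_derivative (\<lambda>_. 0)) (at x)"
  proof (rule has_derivative_transform_within_open[OF has_derivative_const, where s = "{x. M < norm x}"])
   show "open {x::'a. M < norm x}" by (intro open_Collect_less continuous_intros)
  qed (use that M in auto)
  then have "G differentiable at x" "pd b G x = 0" by (auto simp: differentiable_def intro: pdI)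
  then show ?thesis by (simp add: Dl_eq_pd)
 qed
 obtain K :: nat where K: "M + 1 \<le> real K" using real_arch_simple by blast
 define f where "f x = w x * cut K x" for x
 have f: "continuous_on UNIV f" "bsupp f"
  unfolding f_def by (intro continuous_intros w_cont Ck_cont[OF cut_C1], intro bsupp_mult2 cut_bsupp)
 have fw: "f x = w x" if "norm x \<le> M + 1" for x using cut_one[of x K] that K by (simp add: f_def)
 have lE: "loc_int E"
 proof -
  have "loc_int (\<lambda>x. \<Sum>b\<in>A. (Dl b G x)^2)" if "finite A" for A :: "'a set"
   using that by induction (auto intro: loc_int_add loc_int_Dl loc_int_cont)
  then show ?thesis by (simp add: E_def[abs_def])
 qed
 have En_le: "En (Gn n) \<le> (LBINT x. conv (moll n) E x * f x)" for n
  unfolding En_def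
 proof (rule integral_mono)
  show "integrable lborel (\<lambda>x. (\<Sum>b\<in>Basis. (pd b (Gn n) x)^2) * w x)" by (rule En_integrable[OF Gn(1,2)])
  show "integrable lborel (\<lambda>x. conv (moll n) E x * f x)"
   by (intro integrable_bsupp continuous_on_mult continuous_conv lE mollifier_cont[OF moll] mollifier_bsupp[OF moll] f bsupp_mult2)
  fix x
  have pG: "pd b (Gn n) x = conv (moll n) (Dl b G) x" for b
  proof -
   have bl: "bounded_linear (\<lambda>y::'a. - y)" by (intro bounded_linear_minus bounded_linear_ident)
   have d: "(moll n :: 'a => real) differentiable at z" for z by (rule Ck_diff[OF mollifier_C1[OF moll]]) simp
   have 1: "Ck 1 (\<lambda>y. moll n (x + - y) :: real)" by (rule Ck_compose_linear[OF bl mollifier_C1[OF moll]])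
   have 2: "bsupp (\<lambda>y. moll n (x + - y) :: real)"
   proof -
    have "moll n (x + - y) = (0::real)" if "1 + norm x \<le> norm y" for y
    proof (rule mollifier_zero[OF moll])
     have "1 \<le> norm (x - y)" using that norm_triangle_ineq2[of y x] by (simp add: norm_minus_commute)
     moreover have "1 / real (Suc n) \<le> 1" by simp
     ultimately show "1 / real (Suc n) \<le> norm (x + - y)" unfolding diff_conv_add_uminus by (rule order_trans[rotated])
    qed
    then show ?thesis by (rule bsuppI)
   qed
   have 3: "pd b (\<lambda>y. moll n (x + - y)) y = - pd b (moll n) (x - y)" for y
    using pd_compose_linear(1)[OF bl d, of b x y] pd_scaleR[OF d, of "-1" b] by simp
   have "pd b (Gn n) x = conv (pd b (moll n)) G x"
    unfolding Gn_def using pd_conv[OF loc_int_G mollifier_C1[OF moll] mollifier_bsupp[OF moll]] by metis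
   also have "... = - (LBINT y. G y * pd b (\<lambda>y. moll n (x + - y)) y)"
    unfolding conv_def 3 by (simp add: mult.commute)
   also have "... = (LBINT y. Dl b G y * moll n (x + - y))"
    using weak_derivative[OF 1 2, of b] by simp
   finally show ?thesis by (simp add: conv_def mult.commute)
  qed
  have "(\<Sum>b\<in>Basis. (pd b (Gn n) x)^2) \<le> (\<Sum>b\<in>Basis. conv (moll n) (\<lambda>y. (Dl b G y)^2) x)"
   unfolding pG by (intro sum_mono conv_Jensen[OF moll] loc_int_Dl Dl_meas)
  also have "... = conv (moll n) E x"
  proof -
   have "integrable lborel (\<lambda>y. moll n (x - y) * (Dl b G y)^2)" for b
    by (rule conv_integrable[OF loc_int_Dl(2) mollifier_cont[OF moll] mollifier_bsupp[OF moll]])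
   then show ?thesis by (simp add: conv_def E_def sum_distrib_left)
  qed
  finally have le: "(\<Sum>b\<in>Basis. (pd b (Gn n) x)^2) * w x \<le> conv (moll n) E x * w x" by (rule mult_right_mono) simp
  show "(\<Sum>b\<in>Basis. (pd b (Gn n) x)^2) * w x \<le> conv (moll n) E x * f x"
  proof (cases "norm x \<le> M + 1")
   case True then show ?thesis using le fw by simp
  next
   case False
   have "conv (moll n) E x = 0"
   proof -
    have "moll n (x - y) * E y = 0" for y
    proof (cases "M < norm y")
     case True then show ?thesis using Dz[OF True] by (simp add: E_def)
    next
     case y: False
     then have "1 \<le> norm (x - y)" using False norm_triangle_ineq2[of x y] by simp
     moreover have "1 / real (Suc n) \<le> 1" by simp
     ultimately have "moll n (x - y) = 0" by (intro mollifier_zero[OF moll]) (rule order_trans)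
     then show ?thesis by simp
    qed
    then show ?thesis unfolding conv_def by (subst Bochner_Integration.integral_cong[OF refl, of _ _ "\<lambda>_. 0"]) auto
   qed
   then show ?thesis using le by simp
  qed
 qed
 have lR: "(\<lambda>n. C * (LBINT x. conv (moll n) E x * f x)) \<longlonglongrightarrow> C * (LBINT x. E x * f x)"
  by (intro tendsto_mult tendsto_const conv_moll_weak lE f)
 have "(LBINT x. (G x)^2 * w x) - (LBINT x. G x * w x)^2 / W \<le> C * (LBINT x. E x * f x)"
 proof (rule LIMSEQ_le[OF lV lR], intro exI[of _ 0] allI impI)
  fix n
  show "(LBINT x. (Gn n x)^2 * w x) - (LBINT x. Gn n x * w x)^2 / W \<le> C * (LBINT x. conv (moll n) E x * f x)"
   using smooth[OF Gn(1,2), of n] mult_left_mono[OF En_le C0, of n] unfolding W_def by linarith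
 qed
 also have "(\<lambda>x. E x * f x) = (\<lambda>x. E x * w x)"
 proof
  fix x show "E x * f x = E x * w x"
   using fw[of x] Dz[of x] by (cases "norm x \<le> M + 1") (auto simp: E_def)
 qed
 finally show ?thesis by (simp add: E_def W_def)
qed

text \<open>Cutoffs of scale \<open>K\<close> reduce this to bounded support. By Young's inequality with a parameter \<open>t\<close> the energy of the
cutoff function is at most \<open>1 + t\<close> times that of \<open>G\<close>, up to a term of order \<open>1 / K\<^sup>2\<close>; first \<open>K\<close> tends to infinity, then
\<open>t\<close> to zero.\<close>

theorem poincare_locally_lipschitz:
 assumes G: "lip_balls G" and G2: "integrable lborel (\<lambda>x. (G x)^2 * w x)"
  and E: "integrable lborel (\<lambda>x. (\<Sum>b\<in>Basis. (Dl b G x)^2) * w x)"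
 shows "(LBINT x. (G x)^2 * w x) - (LBINT x. G x * w x)^2 / integral\<^sup>L lborel w
   \<le> C * (LBINT x. (\<Sum>b\<in>Basis. (Dl b G x)^2) * w x)"
proof -
 have cG: "continuous_on UNIV G" by (rule lip_balls_cont[OF G])
 have Gm [measurable]: "G \<in> borel_measurable borel" by (rule borel_measurable_cont[OF cG])
 have Dm [measurable]: "Dl b G \<in> borel_measurable borel" for b unfolding Dl_def[abs_def] dq_def[abs_def] by measurable
 obtain Q where Q: "0 \<le> Q" "\<And>K x. (\<Sum>b\<in>Basis. (pd b (cut K) (x::'a))^2) \<le> Q / (real (Suc K))^2"
  using cut_gradient by blast
 define W where "W = integral\<^sup>L lborel w"
 define GK where "GK K x = cut K x * G x" for K x
 have cm [measurable]: "cut K \<in> borel_measurable borel" for K :: nat by (rule borel_measurable_cont[OF Ck_cont[OF cut_C1]])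
 have [measurable]: "GK K \<in> borel_measurable borel" for K unfolding GK_def[abs_def] by measurable
 have GKle: "\<bar>GK K x\<bar> \<le> \<bar>G x\<bar>" for K x
  using cut_range[of K x] by (simp add: GK_def abs_mult mult_left_le_one_le)
 have GKlim: "(\<lambda>K. GK K x) \<longlonglongrightarrow> G x" for x
  unfolding GK_def using tendsto_mult[OF cut_tendsto tendsto_const, of x "G x"] by simp
 have iG: "integrable lborel (\<lambda>x. \<bar>G x\<bar> * w x)"
 proof (rule Bochner_Integration.integrable_bound)
  show "integrable lborel (\<lambda>x. (G x)^2 * w x + w x)" using G2 wi by simp
  have "\<bar>G x\<bar> * w x \<le> ((G x)^2 + 1) * w x" for x
  proof (intro mult_right_mono)
   have "0 \<le> (\<bar>G x\<bar> - 1)^2" by simp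
   then have "2 * \<bar>G x\<bar> \<le> (G x)^2 + 1" by (simp add: power2_diff)
   then show "\<bar>G x\<bar> \<le> (G x)^2 + 1" using abs_ge_zero[of "G x"] by linarith
  qed simp
  then show "AE x in lborel. norm (\<bar>G x\<bar> * w x) \<le> norm ((G x)^2 * w x + w x)"
   by (intro AE_I2) (simp add: distrib_right abs_mult)
 qed measurable
 have l1: "(\<lambda>K. LBINT x. (GK K x)^2 * w x) \<longlonglongrightarrow> (LBINT x. (G x)^2 * w x)"
 proof (rule integral_dominated_convergence[OF _ _ G2])
  show "AE x in lborel. (\<lambda>K. (GK K x)^2 * w x) \<longlonglongrightarrow> (G x)^2 * w x" by (intro AE_I2 tendsto_intros GKlim)
  show "AE x in lborel. norm ((GK K x)^2 * w x) \<le> (G x)^2 * w x" for K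
   using GKle by (intro AE_I2) (simp add: abs_mult mult_right_mono abs_le_square_iff)
 qed measurable
 have l2: "(\<lambda>K. LBINT x. GK K x * w x) \<longlonglongrightarrow> (LBINT x. G x * w x)"
 proof (rule integral_dominated_convergence[OF _ _ iG])
  show "AE x in lborel. (\<lambda>K. GK K x * w x) \<longlonglongrightarrow> G x * w x" by (intro AE_I2 tendsto_intros GKlim)
  show "AE x in lborel. norm (GK K x * w x) \<le> \<bar>G x\<bar> * w x" for K
   using GKle by (intro AE_I2) (simp add: abs_mult mult_right_mono)
 qed measurable
 have lV: "(\<lambda>K. (LBINT x. (GK K x)^2 * w x) - (LBINT x. GK K x * w x)^2 / W) \<longlonglongrightarrow>
   (LBINT x. (G x)^2 * w x) - (LBINT x. G x * w x)^2 / W"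
  using tendsto_diff[OF l1 tendsto_mult[OF tendsto_power[OF l2, of 2] tendsto_const[of "1 / W"]]] by simp
 define E0 where "E0 = (LBINT x. (\<Sum>b\<in>Basis. (Dl b G x)^2) * w x)"
 define A where "A = (LBINT x. (G x)^2 * w x)"
 have E00: "0 \<le> E0" unfolding E0_def by (intro integral_nonneg_AE AE_I2 mult_nonneg_nonneg sum_nonneg) auto
 have bound: "(LBINT x. (G x)^2 * w x) - (LBINT x. G x * w x)^2 / W \<le> C * ((1 + t) * E0)" if t: "0 < t" for t
 proof -
  have energy: "(LBINT x. (\<Sum>b\<in>Basis. (Dl b (GK K) x)^2) * w x) \<le> (1 + t) * E0 + (1 + 1 / t) * (Q / (real (Suc K))^2) * A" for K
  proof -
   have "(LBINT x. (\<Sum>b\<in>Basis. (Dl b (GK K) x)^2) * w x) \<le>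
     (LBINT x. (1 + t) * ((\<Sum>b\<in>Basis. (Dl b G x)^2) * w x) + (1 + 1 / t) * (Q / (real (Suc K))^2) * ((G x)^2 * w x))"
   proof (rule integral_mono_AE')
    show "integrable lborel (\<lambda>x. (1 + t) * ((\<Sum>b\<in>Basis. (Dl b G x)^2) * w x) + (1 + 1 / t) * (Q / (real (Suc K))^2) * ((G x)^2 * w x))"
     using E G2 by simp
    show "AE x in lborel. 0 \<le> (1 + t) * ((\<Sum>b\<in>Basis. (Dl b G x)^2) * w x) + (1 + 1 / t) * (Q / (real (Suc K))^2) * ((G x)^2 * w x)"
     using t Q(1) by (intro AE_I2 add_nonneg_nonneg mult_nonneg_nonneg sum_nonneg) auto
    show "AE x in lborel. (\<Sum>b\<in>Basis. (Dl b (GK K) x)^2) * w x \<le>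
      (1 + t) * ((\<Sum>b\<in>Basis. (Dl b G x)^2) * w x) + (1 + 1 / t) * (Q / (real (Suc K))^2) * ((G x)^2 * w x)"
     using rademacher_local[OF G]
    proof eventually_elim
     case (elim x)
     have dc: "cut K differentiable at x" by (rule Ck_diff[OF cut_C1]) simp
     have dGK: "GK K differentiable at x" unfolding GK_def by (intro differentiable_mult dc elim)
     have p: "Dl b (GK K) x = pd b (cut K) x * G x + cut K x * Dl b G x" for b
      unfolding Dl_eq_pd[OF dGK] Dl_eq_pd[OF elim] unfolding GK_def by (rule pd_mult[OF dc elim])
     have young: "(a + b)^2 \<le> (1 + t) * b^2 + (1 + 1 / t) * a^2" for a b :: real
     proof -
      have "0 \<le> (t * b - a)^2 / t" using t by simp
      also have "... = t * b^2 - 2 * (a * b) + a^2 / t" using t by (simp add: power2_eq_square field_simps)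
      finally show ?thesis by (simp add: power2_sum algebra_simps)
     qed
     have "(\<Sum>b\<in>Basis. (Dl b (GK K) x)^2) \<le> (\<Sum>b\<in>Basis. (1 + t) * (Dl b G x)^2 + (1 + 1 / t) * ((G x)^2 * (pd b (cut K) x)^2))"
     proof (rule sum_mono)
      fix b :: 'a
      have "(cut K x)^2 * (Dl b G x)^2 \<le> 1 * (Dl b G x)^2"
       using cut_range[of K x] by (intro mult_right_mono) (auto simp: power_le_one)
      then have "(1 + t) * ((cut K x)^2 * (Dl b G x)^2) \<le> (1 + t) * (Dl b G x)^2" using t by (intro mult_left_mono) auto
      then show "(Dl b (GK K) x)^2 \<le> (1 + t) * (Dl b G x)^2 + (1 + 1 / t) * ((G x)^2 * (pd b (cut K) x)^2)"
       unfolding p using young[of "pd b (cut K) x * G x" "cut K x * Dl b G x"] by (simp add: power_mult_distrib mult.commute)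
     qed
     also have "... = (1 + t) * (\<Sum>b\<in>Basis. (Dl b G x)^2) + (1 + 1 / t) * ((G x)^2 * (\<Sum>b\<in>Basis. (pd b (cut K) x)^2))"
      by (simp only: sum.distrib sum_distrib_left)
     also have "... \<le> (1 + t) * (\<Sum>b\<in>Basis. (Dl b G x)^2) + (1 + 1 / t) * ((G x)^2 * (Q / (real (Suc K))^2))"
      using t by (intro add_left_mono mult_left_mono Q) auto
     finally have "(\<Sum>b\<in>Basis. (Dl b (GK K) x)^2) * w x \<le> ((1 + t) * (\<Sum>b\<in>Basis. (Dl b G x)^2) + (1 + 1 / t) * ((G x)^2 * (Q / (real (Suc K))^2))) * w x"
      by (rule mult_right_mono) simp
     then show ?case by (simp only: distrib_right distrib_left mult_ac)

    qed
   qed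
   also have "... = (1 + t) * E0 + (1 + 1 / t) * (Q / (real (Suc K))^2) * A"
    using E G2 by (simp add: E0_def A_def)
   finally show ?thesis .
  qed
  have "(LBINT x. (GK K x)^2 * w x) - (LBINT x. GK K x * w x)^2 / W
    \<le> C * ((1 + t) * E0 + (1 + 1 / t) * (Q / (real (Suc K))^2) * A)" for K
  proof -
   obtain L where L: "lipschitz_fun (GK K) L" using cutoff_lipschitz[OF G cut_C1 cut_bsupp] by (auto simp: GK_def[abs_def])
   have b: "bsupp (GK K)" unfolding GK_def by (intro bsupp_mult1 cut_bsupp)
   show ?thesis
    using poincare_lipschitz_bsupp[OF L b] mult_left_mono[OF energy C0, of K] unfolding W_def by linarith
  qed
  moreover have "(\<lambda>K. C * ((1 + t) * E0 + (1 + 1 / t) * (Q / (real (Suc K))^2) * A)) \<longlonglongrightarrow> C * ((1 + t) * E0 + (1 + 1 / t) * 0 * A)"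
  proof -
   have "(\<lambda>K. Q / (real (Suc K))^2) \<longlonglongrightarrow> 0"
    by (rule LIMSEQ_Suc[of "\<lambda>K. Q / (real K)^2"],
      intro real_tendsto_divide_at_top[OF tendsto_const] filterlim_pow_at_top filterlim_real_sequentially) simp
   then show ?thesis by (intro tendsto_intros)
  qed
  ultimately have "(LBINT x. (G x)^2 * w x) - (LBINT x. G x * w x)^2 / W \<le> C * ((1 + t) * E0 + (1 + 1 / t) * 0 * A)"
   by (intro LIMSEQ_le[OF lV]) auto
  then show ?thesis by simp
 qed
 have "(LBINT x. (G x)^2 * w x) - (LBINT x. G x * w x)^2 / W \<le> C * E0"
 proof (rule field_le_epsilon)
  fix e :: real assume e: "0 < e"
  define t where "t = e / (C * E0 + 1)"
  have p: "0 \<le> C * E0" using C0 E00 by simp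
  then have t: "0 < t" using e by (simp add: t_def)
  have "C * ((1 + t) * E0) = C * E0 + t * (C * E0)" by (simp add: algebra_simps)
  also have "t * (C * E0) \<le> e" using p e by (simp add: t_def field_simps)
  finally show "(LBINT x. (G x)^2 * w x) - (LBINT x. G x * w x)^2 / W \<le> C * E0 + e"
   using bound[OF t] by linarith
 qed
 then show ?thesis by (simp add: W_def E0_def)
qed

end

section \<open>Lebesgue measure in orthonormal coordinates\<close>

lemma nn_integral_PiM_lborel_reindex:
 fixes F :: "('b => real) => ennreal"
 assumes f: "bij_betw f A B" and A: "finite A" and F: "F \<in> borel_measurable (PiM B (\<lambda>_. lborel))"
 shows "(\<integral>\<^sup>+c. F c \<partial>PiM B (\<lambda>_. lborel)) = (\<integral>\<^sup>+c. F (\<lambda>b\<in>B. c (inv_into A f b)) \<partial>PiM A (\<lambda>_. lborel))"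
proof -
 interpret product_sigma_finite "\<lambda>_. lborel :: real measure" by standard
 define r where "r c = (\<lambda>b\<in>B. c (inv_into A f b))" for c :: "'a => real"
 have inv: "inv_into A f b \<in> A" if "b \<in> B" for b using f that by (simp add: bij_betw_def inv_into_into)
 have r [measurable]: "r \<in> measurable (PiM A (\<lambda>_. lborel)) (PiM B (\<lambda>_. lborel))"
  unfolding r_def by (intro measurable_restrict measurable_component_singleton inv)
 have fB: "finite B" using f A by (simp add: bij_betw_finite)
 have "distr (PiM A (\<lambda>_. lborel)) (PiM B (\<lambda>_. lborel)) r = PiM B (\<lambda>_. lborel)"
 proof (rule PiM_eqI[OF fB])
  fix X :: "'b => real set" assume X: "\<And>i. i \<in> B ==> X i \<in> sets lborel"
  have "r -` Pi\<^sub>E B X \<inter> space (PiM A (\<lambda>_. lborel)) = Pi\<^sub>E A (\<lambda>a. X (f a))"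
  proof (intro equalityI subsetI)
   fix c assume c: "c \<in> r -` Pi\<^sub>E B X \<inter> space (PiM A (\<lambda>_. lborel))"
   have "c a \<in> X (f a)" if "a \<in> A" for a
   proof -
    have fa: "f a \<in> B" "inv_into A f (f a) = a" using f that by (auto simp: bij_betw_def)
    have "r c (f a) \<in> X (f a)" using c fa(1) by (auto simp: PiE_def)
    then show ?thesis using fa by (simp add: r_def)
   qed
   then show "c \<in> Pi\<^sub>E A (\<lambda>a. X (f a))" using c by (auto simp: space_PiM PiE_def)
  next
   fix c assume c: "c \<in> Pi\<^sub>E A (\<lambda>a. X (f a))"
   have "c (inv_into A f b) \<in> X b" if "b \<in> B" for b
   proof -
    have "f (inv_into A f b) = b" using f that by (simp add: bij_betw_inv_into_right)
    then show ?thesis using c inv[OF that] by (auto simp: PiE_def Pi_def)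
   qed
   then show "c \<in> r -` Pi\<^sub>E B X \<inter> space (PiM A (\<lambda>_. lborel))" using c by (auto simp: r_def space_PiM PiE_def)
  qed
  then have "emeasure (distr (PiM A (\<lambda>_. lborel)) (PiM B (\<lambda>_. lborel)) r) (Pi\<^sub>E B X) = (\<Prod>a\<in>A. emeasure lborel (X (f a)))"
   using X fB A f by (subst emeasure_distr) (auto intro!: sets_PiM_I_finite emeasure_PiM simp: bij_betw_def)
  also have "... = (\<Prod>b\<in>B. emeasure lborel (X b))" by (rule prod.reindex_bij_betw[OF f])
  finally show "emeasure (distr (PiM A (\<lambda>_. lborel)) (PiM B (\<lambda>_. lborel)) r) (Pi\<^sub>E B X) = (\<Prod>b\<in>B. emeasure lborel (X b))" .
 qed simp
 then have "(\<integral>\<^sup>+c. F c \<partial>PiM B (\<lambda>_. lborel)) = (\<integral>\<^sup>+c. F c \<partial>distr (PiM A (\<lambda>_. lborel)) (PiM B (\<lambda>_. lborel)) r)" by simp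
 also have "... = (\<integral>\<^sup>+c. F (r c) \<partial>PiM A (\<lambda>_. lborel))" using F by (intro nn_integral_distr) auto
 finally show ?thesis by (simp add: r_def)
qed

lemma measurable_coordinates:
 fixes B :: "'a::euclidean_space set"
 assumes "finite B"
 shows "(\<lambda>c. p + (\<Sum>b\<in>B. c b *\<^sub>R b)) \<in> measurable (PiM B (\<lambda>_. lborel)) borel"
 by (intro borel_measurable_add borel_measurable_const borel_measurable_sum borel_measurable_scaleR) (auto intro!: measurable_component_singleton)

lemma nn_integral_lborel_onb:
 fixes G :: "'a::euclidean_space => ennreal"
 assumes G: "G \<in> borel_measurable borel" and B: "is_onb UNIV B"
 shows "(NNINT x. G x) = (\<integral>\<^sup>+c. G (\<Sum>b\<in>B. c b *\<^sub>R b) \<partial>PiM B (\<lambda>_. lborel))"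
proof -
 have orth: "pairwise orthogonal B" "\<And>b. b \<in> B ==> norm b = 1" "span B = UNIV" using B by (auto simp: is_onb_def)
 have ind: "independent B" using orth by (intro pairwise_orthogonal_independent) force+
 have fB: "finite B" using ind by (rule independent_imp_finite)
 have "card B = DIM('a)" using basis_card_eq_dim[of B UNIV] ind orth(3) by simp
 then obtain f where f: "bij_betw f (Basis :: ('a) set) B"
  using finite_same_card_bij[OF finite_Basis fB] by metis
 define T where "T x = (\<Sum>b\<in>Basis. (x \<bullet> b) *\<^sub>R f b)" for x :: "'a"
 have ff: "f a \<bullet> f b = (if a = b then 1 else 0)" if "a \<in> Basis" "b \<in> Basis" for a b
 proof (cases "a = b")
  case True
  have "f a \<in> B" using f that by (auto simp: bij_betw_def)
  then show ?thesis using orth(2) True by (simp add: norm_eq_1)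
 next
  case False
  have "f a \<in> B" "f b \<in> B" "f a \<noteq> f b" using f that False by (auto simp: bij_betw_def inj_on_def)
  then show ?thesis using orth(1) False by (simp add: pairwise_def orthogonal_def)
 qed
 have T: "orthogonal_transformation T"
 proof -
  have "linear T" unfolding T_def by (intro linearI) (auto simp: inner_add_left scaleR_left_distrib sum.distrib scaleR_sum_right)
  moreover have "T x \<bullet> T y = x \<bullet> y" for x y
  proof -
   have fT: "f a \<bullet> T y = y \<bullet> a" if "a \<in> Basis" for a
    using that by (simp add: T_def inner_sum_right ff if_distrib cong: if_cong)
   have "T x \<bullet> T y = (\<Sum>a\<in>Basis. (x \<bullet> a) * (f a \<bullet> T y))" by (simp add: T_def[of x] inner_sum_left)
   also have "... = (\<Sum>a\<in>Basis. (x \<bullet> a) * (y \<bullet> a))" by (intro sum.cong refl) (simp add: fT)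
   finally show ?thesis by (simp add: euclidean_inner[of x y])
  qed
  ultimately show ?thesis by (simp add: orthogonal_transformation_def)
 qed
 have Tm [measurable]: "T \<in> borel_measurable borel"
  using orthogonal_transformation_linear[OF T]
  by (intro borel_measurable_continuous_onI linear_continuous_on) (simp add: linear_conv_bounded_linear[symmetric])
 note G [measurable]
 have m: "(\<lambda>c. \<Sum>b\<in>B. c b *\<^sub>R b) \<in> measurable (PiM B (\<lambda>_. lborel)) borel"
  using measurable_coordinates[OF fB, of 0] by simp
 have "(\<integral>\<^sup>+c. G (\<Sum>b\<in>B. c b *\<^sub>R b) \<partial>PiM B (\<lambda>_. lborel))
   = (\<integral>\<^sup>+c. G (\<Sum>b\<in>B. (\<lambda>b\<in>B. c (inv_into Basis f b)) b *\<^sub>R b) \<partial>PiM Basis (\<lambda>_. lborel))"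
  using measurable_compose[OF m G] by (intro nn_integral_PiM_lborel_reindex[OF f]) auto
 also have "... = (\<integral>\<^sup>+c. G (T (\<Sum>b\<in>Basis. c b *\<^sub>R b)) \<partial>PiM Basis (\<lambda>_. lborel))"
 proof (intro nn_integral_cong arg_cong[where f = G])
  fix c :: "'a => real"
  have "(\<Sum>b\<in>B. (\<lambda>b\<in>B. c (inv_into Basis f b)) b *\<^sub>R b) = (\<Sum>b\<in>B. c (inv_into Basis f b) *\<^sub>R b)" by (rule sum.cong) auto
  also have "... = (\<Sum>a\<in>Basis. c (inv_into Basis f (f a)) *\<^sub>R f a)"
   by (rule sum.reindex_bij_betw[OF f, symmetric])
  also have "... = (\<Sum>a\<in>Basis. c a *\<^sub>R f a)"
   using f by (intro sum.cong refl) (simp add: bij_betw_def)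
  also have "... = T (\<Sum>b\<in>Basis. c b *\<^sub>R b)" by (simp add: T_def)
  finally show "(\<Sum>b\<in>B. (\<lambda>b\<in>B. c (inv_into Basis f b)) b *\<^sub>R b) = T (\<Sum>b\<in>Basis. c b *\<^sub>R b)" .
 qed
 also have "... = (\<integral>\<^sup>+x. G (T x) \<partial>distr (PiM Basis (\<lambda>_. lborel)) borel (\<lambda>f. \<Sum>b\<in>Basis. f b *\<^sub>R b))"
  using measurable_coordinates[OF finite_Basis, of 0] by (subst nn_integral_distr) auto
 also have "... = (NNINT x. G (T x))" by (simp add: lborel_eq[symmetric])
 also have "... = (NNINT x. G x)" by (rule nn_integral_orthogonal_transformation[OF T G])
 finally show ?thesis by simp
qed

lemma direction_hyperplane:
 fixes e :: "'a::euclidean_space"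
 assumes e: "norm e = 1" shows "direction {x. x \<bullet> e = c} = {x. x \<bullet> e = 0}"
proof (intro equalityI subsetI)
 fix x assume "x \<in> {x. x \<bullet> e = 0}"
 then have "x = (x + c *\<^sub>R e) - c *\<^sub>R e" "(x + c *\<^sub>R e) \<bullet> e = c" "(c *\<^sub>R e) \<bullet> e = c"
  using e by (auto simp: inner_add_left norm_eq_1)
 then show "x \<in> direction {x. x \<bullet> e = c}" unfolding direction_def by blast
qed (auto simp: direction_def inner_diff_left)

lemma affine_hyperplane': "affine {x. x \<bullet> e = c}"
 using affine_hyperplane[of e c] by (simp add: inner_commute)

text \<open>An orthonormal basis of the direction of the hyperplane together with \<open>e\<close> is one of the whole space, whatever
origin and basis \<open>affine_lborel\<close> has chosen.\<close>

theorem nn_integral_hyperplane_slices: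
 fixes e :: "'a::euclidean_space" and G :: "'a => ennreal"
 assumes e: "norm e = 1" and G [measurable]: "G \<in> borel_measurable borel"
 shows "(NNINT x. G x) = (\<integral>\<^sup>+y. (NNINT s. G (y + s *\<^sub>R e)) \<partial>affine_lborel {x. x \<bullet> e = c})"
proof -
 interpret product_sigma_finite "\<lambda>_. lborel :: real measure" by standard
 define S where "S = {x :: 'a. x \<bullet> e = c}"
 have ne: "S \<noteq> {}" using e by (auto simp: S_def norm_eq_1 intro!: exI[of _ "c *\<^sub>R e"])
 have dS: "direction S = {x. x \<bullet> e = 0}" unfolding S_def by (rule direction_hyperplane[OF e])
 define p where "p = (SOME p. p \<in> S)"
 define B where "B = (SOME B. is_onb (direction S) B)"
 have pS: "p \<in> S" unfolding p_def using ne by (simp add: some_in_eq)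
 have onb: "is_onb (direction S) B"
  unfolding B_def by (rule is_onb_some[OF _ ne]) (simp add: S_def affine_hyperplane')
 have BS: "B \<subseteq> {x. x \<bullet> e = 0}" using onb span_superset[of B] dS by (simp add: is_onb_def)
 have "independent B" using onb by (intro pairwise_orthogonal_independent) (auto simp: is_onb_def)
 then have fB: "finite B" by (rule independent_imp_finite)
 have eB: "e \<notin> B" using BS e by (auto simp: norm_eq_1)
 have "is_onb UNIV (insert e B)"
  unfolding is_onb_def
 proof (intro conjI)
  show "pairwise orthogonal (insert e B)"
   using onb BS by (auto simp: is_onb_def pairwise_insert orthogonal_def inner_commute)
  show "\<forall>b\<in>insert e B. norm b = 1" using onb e by (auto simp: is_onb_def)
  show "span (insert e B) = UNIV"
  proof (intro equalityI subsetI UNIV_I)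
   fix x :: "'a"
   have "x - (x \<bullet> e) *\<^sub>R e \<in> direction S" using e by (simp add: dS inner_diff_left norm_eq_1)
   then have "x - (x \<bullet> e) *\<^sub>R e \<in> span B" using onb by (simp add: is_onb_def)
   then show "x \<in> span (insert e B)" by (auto simp: span_insert)
  qed
 qed
 define \<Phi> where "\<Phi> c = p + (\<Sum>b\<in>B. c b *\<^sub>R b)" for c
 have \<Phi>S: "\<Phi> c \<in> S" for c
  using pS BS by (auto simp: S_def \<Phi>_def inner_add_left inner_sum_left intro!: sum.neutral)
 have \<Phi>m: "\<Phi> \<in> measurable (PiM B (\<lambda>_. lborel)) borel" unfolding \<Phi>_def by (rule measurable_coordinates[OF fB])
 have \<Phi>r: "\<Phi> \<in> measurable (PiM B (\<lambda>_. lborel)) (restrict_space borel S)"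
  by (rule measurable_restrict_space2[OF _ \<Phi>m]) (use \<Phi>S in auto)
 have A: "affine_lborel S = distr (PiM B (\<lambda>_. lborel)) (restrict_space borel S) \<Phi>"
  unfolding affine_lborel_def Let_def p_def[symmetric] B_def[symmetric] \<Phi>_def[abs_def] ..
 have H: "(\<lambda>y. NNINT s. G (y + s *\<^sub>R e)) \<in> borel_measurable borel" by measurable
 have m: "(\<lambda>c. G (p + (\<Sum>b\<in>insert e B. c b *\<^sub>R b))) \<in> borel_measurable (PiM (insert e B) (\<lambda>_. lborel))"
  using measurable_compose[OF measurable_coordinates[of "insert e B" p] G] fB by simp
 have "(NNINT x. G x) = (NNINT x. G (p + x))" by (rule nn_lborel_translate[OF G, symmetric])
 also have "... = (\<integral>\<^sup>+c. G (p + (\<Sum>b\<in>insert e B. c b *\<^sub>R b)) \<partial>PiM (insert e B) (\<lambda>_. lborel))"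
  by (rule nn_integral_lborel_onb) (measurable, fact)
 also have "... = (\<integral>\<^sup>+c. (NNINT s. G (p + (\<Sum>b\<in>insert e B. (c(e := s)) b *\<^sub>R b))) \<partial>PiM B (\<lambda>_. lborel))"
  by (rule product_nn_integral_insert[OF fB eB m])
 also have "... = (\<integral>\<^sup>+c. (NNINT s. G (\<Phi> c + s *\<^sub>R e)) \<partial>PiM B (\<lambda>_. lborel))"
 proof (intro nn_integral_cong arg_cong[where f = G])
  fix c :: "'a => real" and s
  have "(\<Sum>b\<in>B. (c(e := s)) b *\<^sub>R b) = (\<Sum>b\<in>B. c b *\<^sub>R b)" using eB by (intro sum.cong) auto
  then show "p + (\<Sum>b\<in>insert e B. (c(e := s)) b *\<^sub>R b) = \<Phi> c + s *\<^sub>R e"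
   using fB eB by (simp add: \<Phi>_def add_ac)
 qed
 also have "... = (\<integral>\<^sup>+y. (NNINT s. G (y + s *\<^sub>R e)) \<partial>affine_lborel S)"
  unfolding A by (subst nn_integral_distr[OF \<Phi>r]) (auto intro: measurable_restrict_space1[OF H])
 finally show ?thesis by (simp add: S_def)
qed

section \<open>Hyperplanes of constant mean\<close>

definition mean_dir :: "real ^ 'n::finite" where "mean_dir = (\<chi> i. 1 / sqrt (real CARD('n)))"

text \<open>Orthogonal projection onto \<open>mean_hyperplane m\<close>.\<close>

definition proj :: "real => real ^ 'n::finite => real ^ 'n" where
 "proj m x = (\<chi> i. x $ i - (\<Sum>j\<in>UNIV. x $ j) / real CARD('n) + m)"

lemma card_pos: "0 < real CARD('n::finite)" by (simp add: card_gt_0_iff)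

lemma inner_mean_dir: "x \<bullet> (mean_dir :: real ^ 'n::finite) = (\<Sum>i\<in>UNIV. x $ i) / sqrt (real CARD('n))"
 by (simp add: inner_vec_def mean_dir_def sum_divide_distrib)

lemma norm_mean_dir: "norm (mean_dir :: real ^ 'n::finite) = 1"
proof -
 have "mean_dir \<bullet> (mean_dir :: real ^ 'n) = 1" by (simp add: inner_vec_def mean_dir_def)
 then show ?thesis by (simp add: norm_eq_1)
qed

lemma mean_hyperplane_eq:
 "(mean_hyperplane m :: (real ^ 'n::finite) set) = {x. x \<bullet> mean_dir = sqrt (real CARD('n)) * m}"
proof -
 have s: "0 < sqrt (real CARD('n))" "sqrt (real CARD('n)) * sqrt (real CARD('n)) = real CARD('n)"
  using card_pos[where 'n = 'n] by simp_all
 have "y = real CARD('n) * m \<longleftrightarrow> y / sqrt (real CARD('n)) = sqrt (real CARD('n)) * m" for y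
  using s by (simp add: field_simps)
 then show ?thesis by (simp add: mean_hyperplane_def inner_mean_dir)
qed

lemma sum_plus_mean_dir: "(\<Sum>i\<in>UNIV. (x + s *\<^sub>R (mean_dir :: real ^ 'n::finite)) $ i)
  = (\<Sum>i\<in>UNIV. x $ i) + s * sqrt (real CARD('n))"
proof -
 have "real CARD('n) / sqrt (real CARD('n)) = sqrt (real CARD('n))" by (simp add: real_div_sqrt)
 then have "s * (real CARD('n) / sqrt (real CARD('n))) = s * sqrt (real CARD('n))" by simp
 then show ?thesis by (simp add: sum.distrib mean_dir_def mult.commute)
qed

lemma proj_plus_mean_dir:
 fixes x :: "real ^ 'n::finite"
 shows "proj m (x + s *\<^sub>R mean_dir) = proj m x"
proof -
 have "sqrt (real CARD('n)) / real CARD('n) = 1 / sqrt (real CARD('n))"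
  using card_pos[where 'n = 'n] by (simp add: field_simps)
 then have "s * (sqrt (real CARD('n)) / real CARD('n)) = s / sqrt (real CARD('n))" by simp
 then show ?thesis
  unfolding proj_def sum_plus_mean_dir by (simp add: vec_eq_iff add_divide_distrib mean_dir_def)
qed

lemma proj_id: "x \<in> mean_hyperplane m ==> proj m x = x"
 by (simp add: proj_def mean_hyperplane_def vec_eq_iff)

lemma proj_in: "proj m x \<in> mean_hyperplane m"
 by (simp add: proj_def mean_hyperplane_def sum.distrib sum_subtractf)

lemma continuous_proj: "continuous_on S (proj m)"
 unfolding proj_def by (auto intro!: continuous_intros)

lemma measurable_proj [measurable]: "proj m \<in> borel_measurable borel"
 by (intro borel_measurable_continuous_onI continuous_proj)

lemma measurable_affine_lborel: "f \<in> borel_measurable borel ==> f \<in> borel_measurable (affine_lborel S)"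
 unfolding affine_lborel_def Let_def by (simp add: measurable_restrict_space1)

lemma space_affine_lborel: "space (affine_lborel S) = S"
 by (simp add: affine_lborel_def Let_def space_restrict_space)

lemma nn_integral_proj:
 fixes f :: "real ^ 'n::finite => ennreal"
 assumes f [measurable]: "f \<in> borel_measurable borel" and p [measurable]: "p \<in> borel_measurable borel"
 shows "(NNINT x. p (x \<bullet> mean_dir) * f (proj m x))
   = (NNINT s. p s) * (\<integral>\<^sup>+y. f y \<partial>affine_lborel (mean_hyperplane m))"
proof -
 define c where "c = sqrt (real CARD('n)) * m"
 have "(NNINT x. p (x \<bullet> mean_dir) * f (proj m x))
   = (\<integral>\<^sup>+y. (NNINT s. p ((y + s *\<^sub>R mean_dir) \<bullet> mean_dir) * f (proj m (y + s *\<^sub>R mean_dir))) \<partial>affine_lborel (mean_hyperplane m))"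
  unfolding mean_hyperplane_eq by (intro nn_integral_hyperplane_slices norm_mean_dir) measurable
 also have "... = (\<integral>\<^sup>+y. (NNINT s. p s) * f y \<partial>affine_lborel (mean_hyperplane m))"
 proof (rule nn_integral_cong)
  fix y :: "real ^ 'n" assume "y \<in> space (affine_lborel (mean_hyperplane m))"
  then have y: "y \<in> mean_hyperplane m" by (simp add: space_affine_lborel)
  then have "(y + s *\<^sub>R mean_dir) \<bullet> mean_dir = c + s" for s
   using norm_mean_dir[where 'n = 'n] by (simp add: inner_add_left mean_hyperplane_eq c_def norm_eq_1)
  then have "(NNINT s. p ((y + s *\<^sub>R mean_dir) \<bullet> mean_dir) * f (proj m (y + s *\<^sub>R mean_dir)))
    = (NNINT s. p (c + s) * f y)" by (simp add: proj_plus_mean_dir proj_id[OF y])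
  also have "... = (NNINT s. p s * f y)" by (rule nn_lborel_translate) measurable
  finally show "(NNINT s. p ((y + s *\<^sub>R mean_dir) \<bullet> mean_dir) * f (proj m (y + s *\<^sub>R mean_dir)))
    = (NNINT s. p s) * f y" by (simp add: nn_integral_multc)
 qed
 also have "... = (NNINT s. p s) * (\<integral>\<^sup>+y. f y \<partial>affine_lborel (mean_hyperplane m))"
  by (intro nn_integral_cmult measurable_affine_lborel f)
 finally show ?thesis .
qed

lemma measurable_cond_weight:
 fixes V :: "real => real"
 assumes V: "continuous_on UNIV V"
 shows "(\<lambda>x :: real ^ 'n::finite. ennreal (exp (- (\<Sum>i\<in>UNIV. V (x $ i))))) \<in> borel_measurable borel"
proof -
 have "continuous_on UNIV (\<lambda>x :: real ^ 'n. exp (- (\<Sum>i\<in>UNIV. V (x $ i))))"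
  by (intro continuous_intros continuous_on_compose2[OF V]) auto
 then show ?thesis by (intro measurable_compose[OF borel_measurable_continuous_onI measurable_ennreal])
qed

lemma nn_integral_cond_measure:
 fixes f :: "real ^ 'n::finite => ennreal"
 assumes V: "continuous_on UNIV V" and f: "f \<in> borel_measurable borel"
 shows "(\<integral>\<^sup>+x. f x \<partial>cond_measure V m)
  = inverse (\<integral>\<^sup>+y. ennreal (exp (- (\<Sum>i\<in>UNIV. V (y $ i)))) \<partial>affine_lborel (mean_hyperplane m :: (real ^ 'n) set))
   * (\<integral>\<^sup>+y. f y * ennreal (exp (- (\<Sum>i\<in>UNIV. V (y $ i)))) \<partial>affine_lborel (mean_hyperplane m))"
proof -
 define L where "L = affine_lborel (mean_hyperplane m :: (real ^ 'n) set)"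
 define w where "w x = ennreal (exp (- (\<Sum>i\<in>UNIV. V (x $ i))))" for x :: "real ^ 'n"
 have wm [measurable]: "w \<in> borel_measurable L" and fm [measurable]: "f \<in> borel_measurable L"
  unfolding w_def L_def by (intro measurable_affine_lborel measurable_cond_weight V f)+
 have "(\<integral>\<^sup>+x. f x \<partial>cond_measure V m) = (\<integral>\<^sup>+x. (w x / (\<integral>\<^sup>+y. w y \<partial>L)) * f x \<partial>L)"
  unfolding cond_measure_def Let_def w_def[symmetric] L_def[symmetric] by (subst nn_integral_density) measurable
 also have "... = (\<integral>\<^sup>+x. inverse (\<integral>\<^sup>+y. w y \<partial>L) * (f x * w x) \<partial>L)"
  by (intro nn_integral_cong) (simp add: divide_ennreal_def mult_ac)
 also have "... = inverse (\<integral>\<^sup>+y. w y \<partial>L) * (\<integral>\<^sup>+x. f x * w x \<partial>L)" by (rule nn_integral_cmult) measurable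
 finally show ?thesis by (simp add: w_def L_def)
qed

section \<open>The pair inequality on lines\<close>

definition pair_dir :: "real ^ 2" where "pair_dir = axis 1 1 - axis 2 1"

lemma pair_dir_nth [simp]: "pair_dir $ 1 = 1" "pair_dir $ 2 = - 1"
 by (simp_all add: pair_dir_def axis_def)

definition pair_point :: "real => real => real ^ 2" where "pair_point m t = (\<chi> i. m) + t *\<^sub>R pair_dir"

lemma pair_point_nth [simp]: "pair_point m t $ 1 = m + t" "pair_point m t $ 2 = m - t"
 by (simp_all add: pair_point_def)

text \<open>The integral over the hyperplane is written as one over the plane by \<open>nn_integral_proj\<close>, and the plane is cut into
lines. The value of \<open>K\<close> (the square root of 2) is immaterial for normalised measures, so that it is not computed.\<close>

lemma nn_integral_pair_hyperplane:
 "\<exists>K. \<forall>m f. f \<in> borel_measurable borel \<longrightarrow>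
   (\<integral>\<^sup>+y. f y \<partial>affine_lborel (mean_hyperplane m :: (real ^ 2) set)) = K * (NNINT t. f (pair_point m t))"
proof -
 define I :: "real ^ 2 => ennreal" where "I = indicator {x. 0 \<le> x \<bullet> pair_dir \<and> x \<bullet> pair_dir \<le> 1}"
 define g :: "real => ennreal" where "g = indicator {0..1}"
 have Im [measurable]: "I \<in> borel_measurable borel" unfolding I_def by measurable
 have gm [measurable]: "g \<in> borel_measurable borel" unfolding g_def by measurable
 have v: "pair_dir \<noteq> 0" "pair_dir \<bullet> pair_dir = 2" by (auto simp: vec_eq_iff forall_2 inner_vec_def sum_2)
 define K where "K = 2 * (NNINT x. I x * g (x \<bullet> mean_dir))"
 have "(\<integral>\<^sup>+y. f y \<partial>affine_lborel (mean_hyperplane m)) = K * (NNINT t. f (pair_point m t))"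
  if f [measurable]: "f \<in> borel_measurable borel" for m f
 proof -
  have pm [measurable]: "pair_point m \<in> borel_measurable borel" unfolding pair_point_def[abs_def] by measurable
  have sh: "(x + t *\<^sub>R pair_dir) \<bullet> mean_dir = x \<bullet> mean_dir"
    "proj m (x + t *\<^sub>R pair_dir) = pair_point m ((x $ 1 - x $ 2) / 2 + t)" for x t
   by (simp_all add: inner_mean_dir sum_2 proj_def vec_eq_iff forall_2 field_simps)
  have "ennreal (1 / 2) * (\<integral>\<^sup>+y. f y \<partial>affine_lborel (mean_hyperplane m)) =
    ennreal (1 / (pair_dir \<bullet> pair_dir)) * (NNINT x. g (x \<bullet> mean_dir) * f (proj m x))"
   by (subst nn_integral_proj) (simp_all add: v g_def)
  also have "... = (NNINT x. I x * (NNINT t. g ((x + t *\<^sub>R pair_dir) \<bullet> mean_dir) * f (proj m (x + t *\<^sub>R pair_dir))))"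
   unfolding I_def by (rule nn_integral_along_lines[symmetric]) (measurable, fact)
  also have "... = (NNINT x. I x * g (x \<bullet> mean_dir) * (NNINT t. f (pair_point m t)))"
  proof (rule nn_integral_cong)
   fix x :: "real ^ 2"
   have "(NNINT t. f (pair_point m ((x $ 1 - x $ 2) / 2 + t))) = (NNINT t. f (pair_point m t))"
    by (rule nn_lborel_translate) measurable
   then show "I x * (NNINT t. g ((x + t *\<^sub>R pair_dir) \<bullet> mean_dir) * f (proj m (x + t *\<^sub>R pair_dir)))
     = I x * g (x \<bullet> mean_dir) * (NNINT t. f (pair_point m t))"
    unfolding sh by (subst nn_integral_cmult) (auto simp: mult_ac)
  qed
  also have "... = (NNINT x. I x * g (x \<bullet> mean_dir)) * (NNINT t. f (pair_point m t))"
   by (rule nn_integral_multc) measurable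
  finally have "2 * (ennreal (1 / 2) * (\<integral>\<^sup>+y. f y \<partial>affine_lborel (mean_hyperplane m))) = K * (NNINT t. f (pair_point m t))"
   by (simp only: K_def mult.assoc)
  moreover have "2 * ennreal (1 / 2) = 1" by (subst ennreal_numeral[symmetric], subst ennreal_mult[symmetric]) auto
  ultimately show ?thesis by (simp add: mult.assoc[symmetric])
 qed
 then show ?thesis by blast
qed

lemma poincare_const_less:
 assumes "poincare_const \<nu> < c"
 shows "prob_space \<nu>" "\<And>g. locally_lipschitz_on (space \<nu>) g ==> integrable \<nu> (\<lambda>x. (g x)^2) ==>
   (\<integral>\<^sup>+x. ennreal ((g x - (\<integral>y. g y \<partial>\<nu>))^2) \<partial>\<nu>)
     \<le> c * (\<integral>\<^sup>+x. ennreal ((norm (gradient_on (space \<nu>) g x))^2) \<partial>\<nu>)"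
proof -
 obtain C where C: "C < c" "prob_space \<nu>" "\<And>g. locally_lipschitz_on (space \<nu>) g ==> integrable \<nu> (\<lambda>x. (g x)^2) ==>
   (\<integral>\<^sup>+x. ennreal ((g x - (\<integral>y. g y \<partial>\<nu>))^2) \<partial>\<nu>)
     \<le> C * (\<integral>\<^sup>+x. ennreal ((norm (gradient_on (space \<nu>) g x))^2) \<partial>\<nu>)"
  using assms unfolding poincare_const_def Inf_less_iff by blast
 show "prob_space \<nu>" by fact
 show "(\<integral>\<^sup>+x. ennreal ((g x - (\<integral>y. g y \<partial>\<nu>))^2) \<partial>\<nu>)
     \<le> c * (\<integral>\<^sup>+x. ennreal ((norm (gradient_on (space \<nu>) g x))^2) \<partial>\<nu>)"
  if "locally_lipschitz_on (space \<nu>) g" "integrable \<nu> (\<lambda>x. (g x)^2)" for g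
  using C(3)[OF that] by (rule order_trans) (rule mult_right_mono[OF less_imp_le[OF C(1)]], simp)
qed

lemma direction_mean_hyperplane:
 "direction (mean_hyperplane m :: (real ^ 'n::finite) set) = {x. x \<bullet> mean_dir = 0}"
 unfolding mean_hyperplane_eq by (rule direction_hyperplane[OF norm_mean_dir])

lemma gradient_on_eq:
 assumes "affine S" "x \<in> S" "has_gradient_at S g x v" shows "gradient_on S g x = v"
proof -
 have "(THE v. has_gradient_at S g x v) = v"
  by (rule the_equality, rule assms(3), erule has_gradient_at_unique[OF assms(1,2)], rule assms(3))
 then show ?thesis using assms(3) by (auto simp: gradient_on_def)
qed

text \<open>The pair inequality for \<open>g y = h ((y\<^sub>1 - y\<^sub>2) / 2)\<close>, whose squared gradient is half the squared derivative of \<open>h\<close>. The mean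
\<open>a\<close> of \<open>g\<close> can be dropped: reflection exchanges \<open>(h - a)\<^sup>2\<close> and \<open>(h + a)\<^sup>2\<close>, whose average is at least \<open>h\<^sup>2\<close>. A finite exceptional
set is allowed for truncated linear functions.\<close>

theorem pair_line_inequality:
 fixes V h D :: "real => real"
 assumes V: "continuous_on UNIV V"
  and c: "poincare_const (cond_measure V m :: (real ^ 2) measure) < ennreal c" "0 \<le> c"
  and odd: "\<And>t. h (- t) = - h t" and lip: "\<And>s t. \<bar>h s - h t\<bar> \<le> L * \<bar>s - t\<bar>" and bd: "\<And>t. \<bar>h t\<bar> \<le> B"
  and N: "finite N" "\<And>t. t \<notin> N ==> (h has_real_derivative D t) (at t)"
  and Dm [measurable]: "D \<in> borel_measurable borel"
 shows "(NNINT t. ennreal ((h t)^2) * ennreal (exp (- V (m + t) - V (m - t))))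
  \<le> ennreal (c / 2) * (NNINT t. ennreal ((D t)^2) * ennreal (exp (- V (m + t) - V (m - t))))"
proof -
 define \<nu> where "\<nu> = (cond_measure V m :: (real ^ 2) measure)"
 define S where "S = (mean_hyperplane m :: (real ^ 2) set)"
 define p where "p t = ennreal (exp (- V (m + t) - V (m - t)))" for t
 note prob = poincare_const_less(1)[OF c(1), folded \<nu>_def]
 interpret prob_space \<nu> by (rule prob)
 have Vm [measurable]: "V \<in> borel_measurable borel" by (rule borel_measurable_cont[OF V])
 have pm [measurable]: "p \<in> borel_measurable borel" unfolding p_def[abs_def] by measurable
 have ppm [measurable]: "pair_point m \<in> borel_measurable borel" unfolding pair_point_def[abs_def] by measurable
 have L0: "0 \<le> L" using lip[of 1 0] by simp
 have hc: "continuous_on UNIV h"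
  using L0 lip by (intro lipschitz_on_continuous_on[of L]) (auto intro!: lipschitz_onI simp: dist_real_def)
 have hm [measurable]: "h \<in> borel_measurable borel" by (rule borel_measurable_cont[OF hc])
 have S: "space \<nu> = S" by (simp add: \<nu>_def S_def space_cond_measure)
 have \<nu>m: "f \<in> borel_measurable borel ==> f \<in> borel_measurable \<nu>" for f :: "real ^ 2 => real"
  unfolding \<nu>_def by (subst measurable_cong_sets[OF sets_cond_measure refl]) (rule measurable_restrict_space1)
 obtain K0 where K0: "\<And>f. f \<in> borel_measurable borel ==>
   (\<integral>\<^sup>+y. f y \<partial>affine_lborel S) = K0 * (NNINT t. f (pair_point m t))"
  using nn_integral_pair_hyperplane unfolding S_def by blast
 define K where "K = inverse (\<integral>\<^sup>+y. ennreal (exp (- (\<Sum>i\<in>UNIV. V (y $ i)))) \<partial>affine_lborel S) * K0"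
 have K: "(\<integral>\<^sup>+y. f y \<partial>\<nu>) = K * (NNINT t. f (pair_point m t) * p t)" if f [measurable]: "f \<in> borel_measurable borel" for f
 proof -
  have [measurable]: "(\<lambda>x :: real ^ 2. ennreal (exp (- (\<Sum>i\<in>UNIV. V (x $ i))))) \<in> borel_measurable borel"
   by (rule measurable_cond_weight[OF V])
  have pp: "- (\<Sum>i\<in>UNIV. V (pair_point m t $ i)) = - V (m + t) - V (m - t)" for t by (simp add: sum_2)
  show ?thesis unfolding \<nu>_def nn_integral_cond_measure[OF V f] S_def[symmetric]
   by (subst K0) (measurable, simp only: pp K_def p_def mult.assoc)
 qed
 have "K * (NNINT t. p t) = 1" using K[of "\<lambda>_. 1"] emeasure_space_1 by simp
 moreover have "(NNINT t. p t) \<noteq> 0" by (subst nn_integral_0_iff_AE) (auto simp: p_def AE_iff_null null_sets_def)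
 ultimately have K0: "K \<noteq> 0" "K \<noteq> \<top>" by (auto simp: ennreal_top_mult)
 define q where "q y = (y $ 1 - y $ 2) / 2" for y :: "real ^ 2"
 have qp: "q (pair_point m t) = t" for t by (simp add: q_def)
 have qb: "bounded_linear q"
 proof -
  have "q = (\<lambda>y. ((1 / 2) *\<^sub>R pair_dir) \<bullet> y)" by (rule ext) (simp add: q_def inner_vec_def sum_2 field_simps)
  then show ?thesis by (simp only: bounded_linear_inner_right)
 qed
 have qm [measurable]: "q \<in> borel_measurable borel"
  by (intro borel_measurable_continuous_onI linear_continuous_on qb)
 have qn: "\<bar>q x - q y\<bar> \<le> norm (x - y)" for x y
 proof -
  have "q x - q y = ((x - y) $ 1 - (x - y) $ 2) / 2" by (simp add: q_def field_simps)
  then show ?thesis using component_le_norm_cart[of "x - y" 1] component_le_norm_cart[of "x - y" 2] by simp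
 qed
 define g where "g y = h (q y)" for y
 have gm [measurable]: "g \<in> borel_measurable borel" unfolding g_def[abs_def] by measurable
 have gl: "locally_lipschitz_on (space \<nu>) g"
  unfolding locally_lipschitz_on_def
 proof (intro ballI exI conjI)
  fix x show "L-lipschitz_on (ball x 1 \<inter> space \<nu>) g"
  proof (rule lipschitz_onI[OF _ L0])
   fix y z show "dist (g y) (g z) \<le> L * dist y z"
    using lip[of "q y" "q z"] mult_left_mono[OF qn[of y z] L0] by (simp add: g_def dist_norm)
  qed
 qed simp
 have g2: "integrable \<nu> (\<lambda>x. (g x)^2)"
 proof (rule integrable_const_bound)
  show "AE x in \<nu>. norm ((g x)^2) \<le> B^2"
   using bd by (intro AE_I2) (metis g_def norm_power real_norm_def power_mono abs_ge_zero)
 qed (intro \<nu>m, measurable)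
 define a where "a = (\<integral>y. g y \<partial>\<nu>)"
 have grad: "AE y in \<nu>. ennreal ((norm (gradient_on S g y))^2) = ennreal ((D (q y))^2 / 2)"
 proof -
  have "AE y in \<nu>. q y \<notin> N"
  proof -
   have Nb [measurable]: "N \<in> sets borel" using N(1) by (simp add: borel_closed finite_imp_closed)
   have "(\<integral>\<^sup>+y. indicator N (q y) \<partial>\<nu>) = K * (NNINT t. indicator N t * p t)"
    by (subst K) (measurable, simp add: qp)
   also have "(NNINT t. indicator N t * p t) = 0"
   proof (subst nn_integral_0_iff_AE)
    have "AE t in lborel. t \<notin> N" using finite_imp_null_set_lborel[OF N(1)] by (rule AE_not_in)
    then show "AE t in lborel. indicator N t * p t = 0" by eventually_elim simp
   qed measurable
   finally have "(\<integral>\<^sup>+y. indicator N (q y) \<partial>\<nu>) = 0" by simp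
   moreover have "(\<lambda>y. indicator N (q y) :: ennreal) \<in> borel_measurable \<nu>"
    unfolding \<nu>_def by (subst measurable_cong_sets[OF sets_cond_measure refl]) (intro measurable_restrict_space1, measurable)
   ultimately have "AE y in \<nu>. indicator N (q y) = (0 :: ennreal)" by (subst (asm) nn_integral_0_iff_AE) auto
   then show ?thesis by eventually_elim (simp add: indicator_def split: if_splits)
  qed
  moreover have "AE y in \<nu>. y \<in> S" using S AE_space[of \<nu>] by simp
  ultimately show ?thesis
  proof eventually_elim
   case (elim y)
   define v where "v = (D (q y) / 2) *\<^sub>R pair_dir"
   have "(g has_derivative (\<lambda>k. D (q y) * q k)) (at y within S)"
    unfolding g_def using has_derivative_compose[OF bounded_linear_imp_has_derivative[OF qb], of h "(*) (D (q y))" y S]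
     N(2)[OF elim(1)] by (simp add: has_field_derivative_def)
   moreover have "(\<lambda>k. D (q y) * q k) = (\<lambda>k. v \<bullet> k)"
    by (rule ext) (simp add: v_def q_def inner_vec_def sum_2 field_simps)
   moreover have "v \<in> direction S" unfolding S_def direction_mean_hyperplane
    by (simp add: v_def inner_mean_dir sum_2)
   ultimately have "gradient_on S g y = v"
    using elim(2) by (intro gradient_on_eq) (auto simp: has_gradient_at_def S_def affine_mean_hyperplane)
   moreover have "(norm v)^2 = (D (q y))^2 / 2"
    unfolding power2_norm_eq_inner by (simp add: v_def inner_vec_def sum_2 power2_eq_square)
   ultimately show ?case by simp
  qed
 qed
 have "(\<integral>\<^sup>+y. ennreal ((g y - a)^2) \<partial>\<nu>) \<le> ennreal c * (\<integral>\<^sup>+y. ennreal ((norm (gradient_on S g y))^2) \<partial>\<nu>)"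
  using poincare_const_less(2)[OF c(1), folded \<nu>_def, OF gl g2] by (simp add: S a_def)
 also have "(\<integral>\<^sup>+y. ennreal ((norm (gradient_on S g y))^2) \<partial>\<nu>) = (\<integral>\<^sup>+y. ennreal ((D (q y))^2 / 2) \<partial>\<nu>)"
  by (rule nn_integral_cong_AE[OF grad])
 also have "... = K * (NNINT t. ennreal ((D t)^2 / 2) * p t)" by (subst K) (measurable, simp add: qp)
 also have "(\<integral>\<^sup>+y. ennreal ((g y - a)^2) \<partial>\<nu>) = K * (NNINT t. ennreal ((h t - a)^2) * p t)"
  by (subst K) (measurable, simp add: qp g_def)
 finally have "K * (NNINT t. ennreal ((h t - a)^2) * p t) \<le> K * (ennreal c * (NNINT t. ennreal ((D t)^2 / 2) * p t))"
  by (simp add: mult_ac)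
 then have 1: "(NNINT t. ennreal ((h t - a)^2) * p t) \<le> ennreal c * (NNINT t. ennreal ((D t)^2 / 2) * p t)"
  using K0 by (simp add: ennreal_mult_le_mult_iff)
 have "(NNINT t. ennreal ((D t)^2 / 2) * p t) = (NNINT t. ennreal (1 / 2) * (ennreal ((D t)^2) * p t))"
  by (intro nn_integral_cong) (simp add: ennreal_mult[symmetric] mult.assoc[symmetric] del: ennreal_half)
 also have "... = ennreal (1 / 2) * (NNINT t. ennreal ((D t)^2) * p t)" by (rule nn_integral_cmult) measurable
 finally have 2: "ennreal c * (NNINT t. ennreal ((D t)^2 / 2) * p t) = ennreal (c / 2) * (NNINT t. ennreal ((D t)^2) * p t)"
  using c(2) by (simp only: mult.assoc[symmetric] ennreal_mult[symmetric]) simp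
 have psym: "p (- t) = p t" for t by (simp add: p_def algebra_simps)
 have refl: "(NNINT t. ennreal ((h t - a)^2) * p t) = (NNINT t. ennreal ((h t + a)^2) * p t)"
 proof -
  have "(h (- t) - a)^2 = (h t + a)^2" for t by (simp add: odd power2_eq_square algebra_simps)
  then show ?thesis
   using nn_integral_real_affine[of "\<lambda>t. ennreal ((h t - a)^2) * p t" "-1" 0] by (simp add: psym)
 qed
 have "2 * (NNINT t. ennreal ((h t)^2) * p t) = (NNINT t. 2 * (ennreal ((h t)^2) * p t))"
  by (rule nn_integral_cmult[symmetric]) measurable
 also have "... \<le> (NNINT t. ennreal ((h t - a)^2) * p t + ennreal ((h t + a)^2) * p t)"
 proof (rule nn_integral_mono)
  fix t
  have "2 * ennreal ((h t)^2) = ennreal (2 * (h t)^2)" by (simp add: ennreal_mult)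
  also have "... \<le> ennreal ((h t - a)^2 + (h t + a)^2)" by (intro ennreal_leI) (simp add: power2_eq_square algebra_simps)
  finally show "2 * (ennreal ((h t)^2) * p t) \<le> ennreal ((h t - a)^2) * p t + ennreal ((h t + a)^2) * p t"
   by (simp add: mult.assoc[symmetric] distrib_right[symmetric] mult_right_mono)
 qed
 also have "... = 2 * (NNINT t. ennreal ((h t - a)^2) * p t)"
  by (subst nn_integral_add) (auto simp: refl mult_2)
 finally have "(NNINT t. ennreal ((h t)^2) * p t) \<le> (NNINT t. ennreal ((h t - a)^2) * p t)"
  by (simp add: ennreal_mult_le_mult_iff)
 also note 1
 also note 2
 finally show ?thesis by (simp add: p_def)
qed

text \<open>The hypothesis is only needed for lines based at points with \<open>z\<^sub>i = z\<^sub>j\<close>, as each line parallel to \<open>e\<^sub>i - e\<^sub>j\<close> contains one.\<close>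

lemma nn_integral_mono_lines:
 fixes H1 H2 :: "real ^ 'n::finite => ennreal"
 assumes [measurable]: "H1 \<in> borel_measurable borel" "H2 \<in> borel_measurable borel" and ij: "i \<noteq> j"
  and le: "\<And>z. z $ i = z $ j ==>
   (NNINT t. H1 (z + t *\<^sub>R (axis i 1 - axis j 1))) \<le> c * (NNINT t. H2 (z + t *\<^sub>R (axis i 1 - axis j 1)))"
 shows "(NNINT x. H1 x) \<le> c * (NNINT x. H2 x)"
proof -
 define v :: "real ^ 'n" where "v = axis i 1 - axis j 1"
 have vv: "v \<bullet> v = 2" using ij by (simp add: v_def inner_diff_left inner_diff_right inner_axis_axis)
 then have v0: "v \<noteq> 0" by auto
 have vi: "v $ i = 1" "v $ j = - 1" using ij by (auto simp: v_def axis_def)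
 define I :: "real ^ 'n => ennreal" where "I = indicator {x. 0 \<le> x \<bullet> v \<and> x \<bullet> v \<le> 1}"
 have Im [measurable]: "I \<in> borel_measurable borel" unfolding I_def by measurable
 have line: "(NNINT t. H1 (x + t *\<^sub>R v)) \<le> c * (NNINT t. H2 (x + t *\<^sub>R v))" for x
 proof -
  define s where "s = (x $ j - x $ i) / 2"
  have "(x + s *\<^sub>R v) $ i = (x + s *\<^sub>R v) $ j" by (simp add: vi s_def field_simps)
  note * = le[OF this, folded v_def]
  have tr: "(NNINT t. H (x + s *\<^sub>R v + t *\<^sub>R v)) = (NNINT t. H (x + t *\<^sub>R v))"
   if [measurable]: "H \<in> borel_measurable borel" for H :: "real ^ 'n => ennreal"
  proof -
   have "(NNINT t. H (x + (s + t) *\<^sub>R v)) = (NNINT t. H (x + t *\<^sub>R v))"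
    by (rule nn_lborel_translate) measurable
   then show ?thesis by (simp add: scaleR_left_distrib add.assoc)
  qed
  show ?thesis using * by (simp add: tr)
 qed
 have "ennreal (1 / 2) * (NNINT x. H1 x) = (NNINT x. I x * (NNINT t. H1 (x + t *\<^sub>R v)))"
  unfolding I_def by (subst nn_integral_along_lines) (simp_all add: v0 vv)
 also have "... \<le> (NNINT x. c * (I x * (NNINT t. H2 (x + t *\<^sub>R v))))"
  by (intro nn_integral_mono) (subst mult.left_commute, intro mult_left_mono line, simp)
 also have "... = c * (NNINT x. I x * (NNINT t. H2 (x + t *\<^sub>R v)))" by (rule nn_integral_cmult) measurable
 also have "... = ennreal (1 / 2) * (c * (NNINT x. H2 x))"
  unfolding I_def by (subst nn_integral_along_lines) (simp_all add: v0 vv mult.left_commute)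
 finally show ?thesis by (simp add: ennreal_mult_le_mult_iff)
qed

lemma finite_gaussian_integral:
 assumes k: "0 < k"
 shows "(NNINT s. ennreal (exp (- (k / 2 * s^2)))) < \<infinity>" "(NNINT s. ennreal (exp (- (k / 2 * s^2)))) \<noteq> 0"
proof -
 define \<sigma> where "\<sigma> = 1 / sqrt k"
 have s: "0 < \<sigma>" "\<sigma>^2 = 1 / k" using k by (simp_all add: \<sigma>_def power_divide)
 have "integrable lborel (\<lambda>s. sqrt (2 * pi * \<sigma>^2) * normal_density 0 \<sigma> s)" using integrable_normal_density[OF s(1)] by simp
 moreover have "sqrt (2 * pi * \<sigma>^2) * normal_density 0 \<sigma> t = exp (- (k / 2 * t^2))" for t
  using k s by (simp add: normal_density_def)
 ultimately have "integrable lborel (\<lambda>s. exp (- (k / 2 * s^2)))" by simp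
 then show "(NNINT s. ennreal (exp (- (k / 2 * s^2)))) < \<infinity>" by (subst (asm) integrable_iff_bounded) simp
 show "(NNINT s. ennreal (exp (- (k / 2 * s^2)))) \<noteq> 0"
  by (subst nn_integral_0_iff_AE) (auto simp: AE_iff_null null_sets_def)
qed

lemma proj_eq: "proj m x = (\<chi> i. m) + x - (x \<bullet> mean_dir) *\<^sub>R (mean_dir :: real ^ 'n::finite)"
proof -
 have "sqrt (real CARD('n)) * sqrt (real CARD('n)) = real CARD('n)" by simp
 then show ?thesis by (simp add: vec_eq_iff proj_def inner_mean_dir) (simp add: mean_dir_def)
qed

section \<open>The symmetric potential\<close>

locale pair_gap =
 fixes V :: "real => real" and \<alpha> \<kappa> :: real
 assumes V1: "\<And>t. V differentiable at t" and V2: "\<And>t. deriv V differentiable at t"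
  and V2c: "continuous_on UNIV (deriv (deriv V))"
  and \<alpha>: "0 \<le> \<alpha>" and \<kappa>: "0 < \<kappa>" and V'': "\<And>t. - \<alpha> \<le> deriv (deriv V) t"
  and pair: "\<And>m. poincare_const (cond_measure V m :: (real ^ 2) measure) < ennreal (1 / (\<alpha> + \<kappa>))"
begin

lemma pd_V: "pd s V = (\<lambda>t. s * deriv V t)"
proof
 fix t
 have "(V has_real_derivative deriv V t) (at t)" using V1[of t] by (simp add: DERIV_deriv_iff_real_differentiable)
 then show "pd s V t = s * deriv V t" unfolding has_field_derivative_def by (subst pdI[where D = "(*) (deriv V t)"]) (auto simp: mult.commute)
qed

lemma pd_deriv_V: "pd s (\<lambda>t. c * deriv V t) = (\<lambda>t. c * (s * deriv (deriv V) t))"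
proof
 fix t
 have "(deriv V has_real_derivative deriv (deriv V) t) (at t)" using V2[of t] by (simp add: DERIV_deriv_iff_real_differentiable)
 then have "pd s (deriv V) t = s * deriv (deriv V) t" unfolding has_field_derivative_def by (subst pdI[where D = "(*) (deriv (deriv V) t)"]) (auto simp: mult.commute)
 then show "pd s (\<lambda>t. c * deriv V t) t = c * (s * deriv (deriv V) t)" by (simp add: pd_cmult V2)
qed

lemma V_C2: "Ck 2 V"
 unfolding numeral_2_eq_2 by (auto simp: pd_V pd_deriv_V V1 intro!: continuous_intros V2c derivative_intros V2 differentiable_mult)

lemma V_cont: "continuous_on UNIV V" by (rule Ck_cont[OF V_C2])

definition centred :: "'n => real ^ 'n::finite => real" where
 "centred i x = x $ i - (\<Sum>j\<in>UNIV. x $ j) / real CARD('n)"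

lemma proj_nth: "proj m x $ i = m + centred i x" by (simp add: proj_def centred_def)

lemma centred_linear: "bounded_linear (centred i)"
 unfolding centred_def[abs_def]
 by (intro linear_conv_bounded_linear[THEN iffD1] linearI)
   (simp_all add: sum.distrib add_divide_distrib sum_distrib_left[symmetric] algebra_simps)

text \<open>The quadratic term gives the direction normal to the hyperplane the Hessian \<open>\<kappa>\<close>, the lower bound that the pair
inequality yields in the other directions.\<close>

definition potential :: "real => real ^ 'n::finite => real" where
 "potential m x = (\<Sum>i\<in>UNIV. V (m + centred i x)) + \<kappa> / 2 * (x \<bullet> mean_dir)^2"

lemma potential_C2: "Ck 2 (potential m :: real ^ 'n::finite => real)"
proof -
 have "Ck 2 (\<lambda>x. \<kappa> / 2 * ((x \<bullet> mean_dir) * (x \<bullet> (mean_dir :: real ^ 'n))))"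
  by (intro Ck_cmult Ck_mult Ck_linear bounded_linear_inner_left)
 then show ?thesis unfolding potential_def[abs_def] power2_eq_square
  by (intro Ck_add Ck_sum Ck_compose_linear V_C2 centred_linear)
qed

lemma centred_pm:
 assumes "p \<in> perms" shows "centred i (pm p x) = centred (p i) x"
proof -
 have "(\<Sum>j\<in>UNIV. x $ p j) = (\<Sum>j\<in>UNIV. x $ j)"
  using assms by (intro sum.reindex_bij_betw) (simp add: perms_def permutes_imp_bij)
 then show ?thesis by (simp add: centred_def)
qed

lemma potential_pm:
 assumes p: "p \<in> perms" shows "potential m (pm p x) = potential m x"
proof -
 have b: "bij_betw p UNIV UNIV" using p by (simp add: perms_def permutes_imp_bij)
 have "(\<Sum>i\<in>UNIV. V (m + centred (p i) x)) = (\<Sum>i\<in>UNIV. V (m + centred i x))" by (rule sum.reindex_bij_betw[OF b])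
 moreover have "(\<Sum>j\<in>UNIV. x $ p j) = (\<Sum>j\<in>UNIV. x $ j)" by (rule sum.reindex_bij_betw[OF b])
 ultimately show ?thesis by (simp add: potential_def centred_pm[OF p] inner_mean_dir)
qed

lemma sum_centred_sq:
 "(\<Sum>i\<in>UNIV. (centred i v)^2) = (\<Sum>i\<in>UNIV. (v $ i)^2) - (\<Sum>i\<in>UNIV. (v :: real ^ 'n::finite) $ i)^2 / real CARD('n)"
proof -
 define s where "s = (\<Sum>i\<in>UNIV. v $ i)"
 have "(\<Sum>i\<in>UNIV. (centred i v)^2) = (\<Sum>i\<in>UNIV. (v $ i)^2 - 2 * (s / real CARD('n)) * (v $ i) + (s / real CARD('n))^2)"
  by (simp add: centred_def s_def power2_diff algebra_simps)
 also have "... = (\<Sum>i\<in>UNIV. (v $ i)^2) - 2 * (s / real CARD('n)) * s + real CARD('n) * (s / real CARD('n))^2"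
  unfolding sum.distrib sum_subtractf sum_distrib_left[symmetric] by (simp add: s_def)
 also have "... = (\<Sum>i\<in>UNIV. (v $ i)^2) - s^2 / real CARD('n)" by (simp add: power2_eq_square)
 finally show ?thesis by (simp add: s_def)
qed

lemma potential_hessian:
 fixes x v :: "real ^ 'n::finite"
 shows "- \<alpha> * ((\<Sum>i\<in>UNIV. (v $ i)^2) - (\<Sum>i\<in>UNIV. v $ i)^2 / real CARD('n))
    + \<kappa> * (\<Sum>i\<in>UNIV. v $ i)^2 / real CARD('n) \<le> pd v (pd v (potential m)) x"
proof -
 define e where "e = (mean_dir :: real ^ 'n)"
 have Vd: "V differentiable at t" "pd s V differentiable at t" for s t
  using V1 by (auto simp: pd_V intro!: derivative_intros V2 differentiable_mult)
 have 1: "pd v (potential m) = (\<lambda>x. (\<Sum>i\<in>UNIV. pd (centred i v) V (m + centred i x)) + \<kappa> * (v \<bullet> e) * (x \<bullet> e))"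
 proof (rule ext, rule pdI[where D = "\<lambda>v. (\<Sum>i\<in>UNIV. pd (centred i v) V (m + centred i x)) + \<kappa> * (v \<bullet> e) * (x \<bullet> e)" for x])
  fix x :: "real ^ 'n"
  have "((\<lambda>x. V (m + centred i x)) has_derivative (\<lambda>v. pd (centred i v) V (m + centred i x))) (at x)" for i
   using has_derivative_pd[OF pd_compose_linear(2)[OF centred_linear Vd(1)]]
   by (simp add: pd_compose_linear(1)[OF centred_linear Vd(1)])
  then show "(potential m has_derivative (\<lambda>v. (\<Sum>i\<in>UNIV. pd (centred i v) V (m + centred i x)) + \<kappa> * (v \<bullet> e) * (x \<bullet> e))) (at x)"
   unfolding potential_def[abs_def] e_def[symmetric] by (auto intro!: derivative_eq_intros simp: algebra_simps)
 qed
 have 2: "pd v (pd v (potential m)) x = (\<Sum>i\<in>UNIV. pd (centred i v) (pd (centred i v) V) (m + centred i x)) + \<kappa> * (v \<bullet> e) * (v \<bullet> e)"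
  unfolding 1
 proof (rule pdI[where D = "\<lambda>u. (\<Sum>i\<in>UNIV. pd (centred i u) (pd (centred i v) V) (m + centred i x)) + \<kappa> * (v \<bullet> e) * (u \<bullet> e)"])
  have d: "((\<lambda>x. pd s V (m + centred i x)) has_derivative (\<lambda>v. pd (centred i v) (pd s V) (m + centred i x))) (at x)" for i s
   using has_derivative_pd[OF pd_compose_linear(2)[OF centred_linear Vd(2)]]
   by (simp add: pd_compose_linear(1)[OF centred_linear Vd(2)])
  show "((\<lambda>x. (\<Sum>i\<in>UNIV. pd (centred i v) V (m + centred i x)) + \<kappa> * (v \<bullet> e) * (x \<bullet> e)) has_derivative
    (\<lambda>u. (\<Sum>i\<in>UNIV. pd (centred i u) (pd (centred i v) V) (m + centred i x)) + \<kappa> * (v \<bullet> e) * (u \<bullet> e))) (at x)"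
   by (intro has_derivative_add has_derivative_sum d bounded_linear_imp_has_derivative bounded_linear_mult_const
     bounded_linear_const_mult bounded_linear_inner_left)
 qed
 have "- \<alpha> * (\<Sum>i\<in>UNIV. (centred i v)^2) \<le> (\<Sum>i\<in>UNIV. pd (centred i v) (pd (centred i v) V) (m + centred i x))"
  unfolding sum_distrib_left
 proof (rule sum_mono)
  fix i
  have "(centred i v)^2 * - \<alpha> \<le> (centred i v)^2 * deriv (deriv V) (m + centred i x)"
   by (intro mult_left_mono V'') simp
  then show "- \<alpha> * (centred i v)^2 \<le> pd (centred i v) (pd (centred i v) V) (m + centred i x)"
   unfolding pd_V pd_deriv_V by (simp add: power2_eq_square mult_ac)
 qed
 moreover have "(v \<bullet> e) * (v \<bullet> e) = (\<Sum>i\<in>UNIV. v $ i)^2 / real CARD('n)"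
  by (simp add: e_def inner_mean_dir power2_eq_square)
 ultimately show ?thesis unfolding 2 sum_centred_sq[symmetric] by (simp add: mult.assoc)
qed

end

section \<open>The line inequality and integrability of the symmetric weight\<close>

context pair_gap
begin

definition wt :: "real => real ^ 'n::finite => real" where "wt m x = exp (- potential m x)"

lemma wt_pos [simp]: "0 < wt m x" "0 \<le> wt m x" by (simp_all add: wt_def)

lemma wt_cont: "continuous_on UNIV (wt m)"
 unfolding wt_def[abs_def] by (intro continuous_intros Ck_cont[OF potential_C2])

lemma wt_meas [measurable]: "wt m \<in> borel_measurable borel" by (rule borel_measurable_cont[OF wt_cont])

lemma wt_line:
 fixes z :: "real ^ 'n::finite"
 assumes ij: "i \<noteq> j" and z: "z $ i = z $ j"
 shows "\<exists>R>0. \<forall>t. wt m (z + t *\<^sub>R (axis i 1 - axis j 1))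
  = R * exp (- V (m + centred i z + t) - V (m + centred i z - t))"
proof -
 define v :: "real ^ 'n" where "v = axis i 1 - axis j 1"
 have sv: "(\<Sum>k\<in>UNIV. v $ k) = 0" by (simp add: v_def sum_subtractf axis_def)
 have vk: "v $ i = 1" "v $ j = - 1" "k \<notin> {i, j} ==> v $ k = 0" for k using ij by (auto simp: v_def axis_def)
 have c: "centred k (z + t *\<^sub>R v) = centred k z + t * v $ k" for k t
  using sv by (simp add: centred_def sum.distrib sum_distrib_left[symmetric])
 have cj: "centred j z = centred i z" using z by (simp add: centred_def)
 have e: "(z + t *\<^sub>R v) \<bullet> mean_dir = z \<bullet> mean_dir" for t
  using sv by (simp add: inner_mean_dir sum.distrib sum_distrib_left[symmetric])
 define R where "R = exp (- (\<Sum>k\<in>UNIV - {i, j}. V (m + centred k z)) - \<kappa> / 2 * (z \<bullet> mean_dir)^2)"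
 have "wt m (z + t *\<^sub>R v) = R * exp (- V (m + centred i z + t) - V (m + centred i z - t))" for t
 proof -
  have "(\<Sum>k\<in>UNIV. V (m + centred k (z + t *\<^sub>R v)))
    = (\<Sum>k\<in>UNIV - {i, j}. V (m + centred k (z + t *\<^sub>R v))) + (\<Sum>k\<in>{i, j}. V (m + centred k (z + t *\<^sub>R v)))"
   by (rule sum.subset_diff) auto
  also have "(\<Sum>k\<in>UNIV - {i, j}. V (m + centred k (z + t *\<^sub>R v))) = (\<Sum>k\<in>UNIV - {i, j}. V (m + centred k z))"
   by (intro sum.cong refl) (simp add: c vk)
  also have "(\<Sum>k\<in>{i, j}. V (m + centred k (z + t *\<^sub>R v))) = V (m + centred i z + t) + V (m + centred i z - t)"
   using ij cj by (simp add: c vk algebra_simps)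
  finally show ?thesis by (simp add: wt_def potential_def e R_def exp_add[symmetric])
 qed
 then show ?thesis by (auto simp: v_def R_def)
qed

lemma wt_line_inequality:
 fixes z :: "real ^ 'n::finite" and h D :: "real => real"
 assumes ij: "i \<noteq> j" and z: "z $ i = z $ j"
  and odd: "\<And>t. h (- t) = - h t" and lip: "\<And>s t. \<bar>h s - h t\<bar> \<le> L * \<bar>s - t\<bar>" and bd: "\<And>t. \<bar>h t\<bar> \<le> B"
  and N: "finite N" "\<And>t. t \<notin> N ==> (h has_real_derivative D t) (at t)"
  and Dm [measurable]: "D \<in> borel_measurable borel"
 shows "(NNINT t. ennreal ((h t)^2) * ennreal (wt m (z + t *\<^sub>R (axis i 1 - axis j 1))))
  \<le> ennreal (1 / (2 * (\<alpha> + \<kappa>))) * (NNINT t. ennreal ((D t)^2) * ennreal (wt m (z + t *\<^sub>R (axis i 1 - axis j 1))))"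
proof -
 obtain R where R: "0 < R" "\<And>t. wt m (z + t *\<^sub>R (axis i 1 - axis j 1)) = R * exp (- V (m + centred i z + t) - V (m + centred i z - t))"
  using wt_line[OF ij z] by blast
 have L0: "0 \<le> L" using lip[of 1 0] by simp
 have hc: "continuous_on UNIV h"
  using L0 lip by (intro lipschitz_on_continuous_on[of L]) (auto intro!: lipschitz_onI simp: dist_real_def)
 have hm [measurable]: "h \<in> borel_measurable borel" by (rule borel_measurable_cont[OF hc])
 have Vm [measurable]: "V \<in> borel_measurable borel" by (rule borel_measurable_cont[OF V_cont])
 have w: "(NNINT t. ennreal ((f t)^2) * ennreal (wt m (z + t *\<^sub>R (axis i 1 - axis j 1))))
   = ennreal R * (NNINT t. ennreal ((f t)^2) * ennreal (exp (- V (m + centred i z + t) - V (m + centred i z - t))))"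
  if [measurable]: "f \<in> borel_measurable borel" for f :: "real => real"
 proof -
  have "(NNINT t. ennreal ((f t)^2) * ennreal (wt m (z + t *\<^sub>R (axis i 1 - axis j 1))))
   = (NNINT t. ennreal R * (ennreal ((f t)^2) * ennreal (exp (- V (m + centred i z + t) - V (m + centred i z - t)))))"
   using R(1) by (intro nn_integral_cong) (simp add: R(2) ennreal_mult mult_ac)
  then show ?thesis by (subst (asm) nn_integral_cmult) auto
 qed
 have "(NNINT t. ennreal ((h t)^2) * ennreal (exp (- V (m + centred i z + t) - V (m + centred i z - t))))
  \<le> ennreal ((1 / (\<alpha> + \<kappa>)) / 2) * (NNINT t. ennreal ((D t)^2) * ennreal (exp (- V (m + centred i z + t) - V (m + centred i z - t))))"
  by (rule pair_line_inequality[OF V_cont pair _ odd lip bd N Dm]) (use \<alpha> \<kappa> in auto)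
 then have "ennreal R * (NNINT t. ennreal ((h t)^2) * ennreal (exp (- V (m + centred i z + t) - V (m + centred i z - t))))
  \<le> ennreal R * (ennreal ((1 / (\<alpha> + \<kappa>)) / 2) * (NNINT t. ennreal ((D t)^2) * ennreal (exp (- V (m + centred i z + t) - V (m + centred i z - t)))))"
  by (rule mult_left_mono) simp
 then show ?thesis unfolding w[OF hm] w[OF Dm] by (simp add: mult.left_commute mult.commute[of 2])
qed

lemma wt_odd_inequality:
 fixes F :: "real ^ 'n::finite => real"
 assumes ij: "i \<noteq> j" and F: "Ck 1 F" "bsupp F" and odd: "\<And>x. F (pm (tr i j) x) = - F x"
 shows "(LBINT x. (F x)^2 * wt m x)
  \<le> 1 / (2 * (\<alpha> + \<kappa>)) * (LBINT x. (pd (axis i 1 - axis j 1) F x)^2 * wt m x)"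
proof -
 define v :: "real ^ 'n" where "v = axis i 1 - axis j 1"
 have Fc: "continuous_on UNIV F" "continuous_on UNIV (pd v F)" using Ck_cont[OF F(1)] F(1) by simp_all
 have Fd: "F differentiable at x" for x by (rule Ck_diff[OF F(1)]) simp
 have [measurable]: "F \<in> borel_measurable borel" "pd v F \<in> borel_measurable borel" by (intro borel_measurable_cont Fc)+
 obtain B where B: "\<And>x. \<bar>F x\<bar> \<le> B" using bsupp_bounded[OF Fc(1) F(2)] by blast
 obtain L where L: "\<And>x. \<bar>pd v F x\<bar> \<le> L" using bsupp_bounded[OF Fc(2) bsupp_pd[OF F(2)]] by blast
 have "(NNINT x. ennreal ((F x)^2) * ennreal (wt m x))
   \<le> ennreal (1 / (2 * (\<alpha> + \<kappa>))) * (NNINT x. ennreal ((pd v F x)^2) * ennreal (wt m x))"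
 proof (rule nn_integral_mono_lines[OF _ _ ij], measurable)
  fix z :: "real ^ 'n" assume z: "z $ i = z $ j"
  define h where "h t = F (z + t *\<^sub>R v)" for t
  have hd: "(h has_real_derivative pd v F (z + t *\<^sub>R v)) (at t)" for t
  proof -
   have "((\<lambda>t. z + t *\<^sub>R v) has_derivative (\<lambda>t. t *\<^sub>R v)) (at t)" by (auto intro!: derivative_eq_intros)
   from has_derivative_compose[OF this has_derivative_pd[OF Fd]] show ?thesis
    by (simp add: has_field_derivative_def h_def[abs_def] pd_scaleR[OF Fd] mult_commute_abs)
  qed
  have "(NNINT t. ennreal ((h t)^2) * ennreal (wt m (z + t *\<^sub>R (axis i 1 - axis j 1))))
   \<le> ennreal (1 / (2 * (\<alpha> + \<kappa>))) * (NNINT t. ennreal ((pd v F (z + t *\<^sub>R v))^2) * ennreal (wt m (z + t *\<^sub>R (axis i 1 - axis j 1))))"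
  proof (rule wt_line_inequality[OF ij z, where N = "{}" and L = L and B = B])
   fix t
   have "pm (tr i j) (z + t *\<^sub>R v) = z + (- t) *\<^sub>R v"
    using z ij by (auto simp: vec_eq_iff v_def axis_def Transposition.transpose_def)
   then show "h (- t) = - h t" unfolding h_def by (metis odd)
   show "\<bar>h t\<bar> \<le> B" by (simp add: h_def B)
   show "(h has_real_derivative pd v F (z + t *\<^sub>R v)) (at t)" by (rule hd)
  next
   fix s t show "\<bar>h s - h t\<bar> \<le> L * \<bar>s - t\<bar>"
    using field_differentiable_bound[of UNIV h "\<lambda>t. pd v F (z + t *\<^sub>R v)" L s t] hd L by simp
  qed (simp, measurable)
  then show "(NNINT t. ennreal ((F (z + t *\<^sub>R (axis i 1 - axis j 1)))^2) * ennreal (wt m (z + t *\<^sub>R (axis i 1 - axis j 1))))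
   \<le> ennreal (1 / (2 * (\<alpha> + \<kappa>))) * (NNINT t. ennreal ((pd v F (z + t *\<^sub>R (axis i 1 - axis j 1)))^2) * ennreal (wt m (z + t *\<^sub>R (axis i 1 - axis j 1))))"
   by (simp only: h_def v_def)
 qed
 moreover have eq: "(NNINT x. ennreal ((f x)^2) * ennreal (wt m x)) = ennreal (LBINT x. (f x)^2 * wt m x)"
  if "continuous_on UNIV f" "bsupp f" for f
 proof -
  have "integrable lborel (\<lambda>x. (f x)^2 * wt m x)" unfolding power2_eq_square
   by (intro integrable_bsupp continuous_intros that wt_cont bsupp_mult1)
  then show ?thesis by (subst nn_integral_eq_integral[symmetric]) (auto simp: ennreal_mult)
 qed
 ultimately have "ennreal (LBINT x. (F x)^2 * wt m x) \<le> ennreal (1 / (2 * (\<alpha> + \<kappa>))) * ennreal (LBINT x. (pd v F x)^2 * wt m x)"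
  by (simp only: eq[OF Fc(1) F(2)] eq[OF Fc(2) bsupp_pd[OF F(2)]])
 also have "... = ennreal (1 / (2 * (\<alpha> + \<kappa>)) * (LBINT x. (pd v F x)^2 * wt m x))"
  using \<alpha> \<kappa> by (intro ennreal_mult'[symmetric]) simp
 finally have le: "ennreal (LBINT x. (F x)^2 * wt m x) \<le> ennreal (1 / (2 * (\<alpha> + \<kappa>)) * (LBINT x. (pd v F x)^2 * wt m x))" .
 have "0 \<le> 1 / (2 * (\<alpha> + \<kappa>)) * (LBINT x. (pd v F x)^2 * wt m x)"
  using \<alpha> \<kappa> by (intro mult_nonneg_nonneg integral_nonneg_AE AE_I2) auto
 then show ?thesis using le unfolding v_def by (rule ennreal_le_iff[THEN iffD1])
qed

text \<open>Cylinders around the diagonal. On them the weight is integrable because of the Gaussian factor, before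
integrability on the whole space is known.\<close>

definition tube :: "real => real ^ 'n::finite => ennreal" where
 "tube R = indicator {x. norm (proj 0 x) \<le> R}"

lemma tube_meas [measurable]: "tube R \<in> borel_measurable borel"
 unfolding tube_def by measurable

lemma clamp_facts:
 fixes \<rho> :: real and h :: "real => real"
 assumes "0 \<le> \<rho>" and h_def: "\<And>t. h t = max (- \<rho>) (min t \<rho>)"
 shows "h (- t) = - h t" "\<bar>h s - h t\<bar> \<le> 1 * \<bar>s - t\<bar>" "\<bar>h t\<bar> \<le> \<rho>"
  "t \<notin> {- \<rho>, \<rho>} ==> (h has_real_derivative (if \<bar>t\<bar> < \<rho> then 1 else 0)) (at t)"
proof -
 show "h (- t) = - h t" "\<bar>h s - h t\<bar> \<le> 1 * \<bar>s - t\<bar>" "\<bar>h t\<bar> \<le> \<rho>" using assms by (auto simp: h_def max_def min_def)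
 assume t: "t \<notin> {- \<rho>, \<rho>}"
 show "(h has_real_derivative (if \<bar>t\<bar> < \<rho> then 1 else 0)) (at t)"
 proof (cases "\<bar>t\<bar> < \<rho>")
  case True
  have "(h has_real_derivative 1) (at t)"
   by (rule has_field_derivative_transform_within_open[OF DERIV_ident, where S = "{- \<rho><..<\<rho>}"])
    (use True in \<open>auto simp: h_def\<close>)
  then show ?thesis using True by simp
 next
  case False
  have "(h has_real_derivative 0) (at t)"
  proof (cases "t > 0")
   case True
   show ?thesis
    by (rule has_field_derivative_transform_within_open[OF DERIV_const[of \<rho>], where S = "{\<rho><..}"])
     (use True False t assms(1) in \<open>auto simp: h_def\<close>)
  next
   case neg: False
   show ?thesis
    by (rule has_field_derivative_transform_within_open[OF DERIV_const[of "- \<rho>"], where S = "{..<- \<rho>}"])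
     (use neg False t assms(1) in \<open>auto simp: h_def\<close>)
  qed
  then show ?thesis using False by simp
 qed
qed

text \<open>On a line the tube is an interval \<open>[- \<rho>, \<rho>]\<close>. The linear function \<open>t\<close> truncated at \<open>\<rho>\<close> agrees with \<open>t\<close> there and has
zero derivative outside.\<close>

lemma tube_pair_bound:
 fixes i j :: "'n::finite"
 assumes ij: "i \<noteq> j" and R: "0 \<le> R"
 shows "(NNINT x. tube R x * ennreal (((x $ i - x $ j) / 2)^2) * ennreal (wt m x))
  \<le> ennreal (1 / (2 * (\<alpha> + \<kappa>))) * (NNINT x. tube R x * ennreal (wt m (x :: real ^ 'n)))"
proof (rule nn_integral_mono_lines[OF _ _ ij], measurable)
 fix z :: "real ^ 'n" assume z: "z $ i = z $ j"
 define v :: "real ^ 'n" where "v = axis i 1 - axis j 1"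
 have sv: "(\<Sum>k\<in>UNIV. v $ k) = 0" by (simp add: v_def sum_subtractf axis_def)
 have vk: "v $ i = 1" "v $ j = - 1" using ij by (auto simp: v_def axis_def)
 have vv: "v \<bullet> v = 2" using ij by (simp add: v_def inner_diff_left inner_diff_right inner_axis_axis)
 define r where "r = norm (proj 0 z)"
 have nrm: "(norm (proj 0 (z + t *\<^sub>R v)))^2 = r^2 + 2 * t^2" for t
 proof -
  have p: "proj 0 (z + t *\<^sub>R v) = proj 0 z + t *\<^sub>R v"
   using sv by (simp add: proj_def vec_eq_iff sum.distrib sum_distrib_left[symmetric])
  have "proj 0 z \<bullet> v = proj 0 z $ i - proj 0 z $ j" by (simp add: v_def inner_diff_right inner_axis)
  then have o: "proj 0 z \<bullet> v = 0" using z by (simp add: proj_def)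
  have "(norm (proj 0 (z + t *\<^sub>R v)))^2 = (proj 0 z + t *\<^sub>R v) \<bullet> (proj 0 z + t *\<^sub>R v)"
   by (simp add: power2_norm_eq_inner p)
  also have "... = proj 0 z \<bullet> proj 0 z + 2 * (t * (proj 0 z \<bullet> v)) + t^2 * (v \<bullet> v)"
   by (simp add: inner_add_left inner_add_right inner_commute power2_eq_square algebra_simps)
  also have "... = r^2 + 2 * t^2" unfolding o vv by (simp add: r_def power2_norm_eq_inner)
  finally show ?thesis .
 qed
 have tube: "tube R (z + t *\<^sub>R v) = (if r^2 + 2 * t^2 \<le> R^2 then 1 else 0)" for t
  unfolding nrm[symmetric] tube_def using R by (simp add: indicator_def abs_le_square_iff[symmetric])
 have diff: "((z + t *\<^sub>R v) $ i - (z + t *\<^sub>R v) $ j) / 2 = t" for t using z by (simp add: vk)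
 have "(NNINT t. tube R (z + t *\<^sub>R v) * ennreal (t^2) * ennreal (wt m (z + t *\<^sub>R v)))
   \<le> ennreal (1 / (2 * (\<alpha> + \<kappa>))) * (NNINT t. tube R (z + t *\<^sub>R v) * ennreal (wt m (z + t *\<^sub>R v)))"
 proof (cases "r^2 \<le> R^2")
  case False
  then have "\<not> r^2 + 2 * t^2 \<le> R^2" for t using zero_le_power2[of t] by linarith
  then have "tube R (z + t *\<^sub>R v) = 0" for t unfolding tube by simp
  then show ?thesis by simp
 next
  case True
  define \<rho> where "\<rho> = sqrt ((R^2 - r^2) / 2)"
  have \<rho>: "0 \<le> \<rho>" "\<rho>^2 = (R^2 - r^2) / 2" using True by (simp_all add: \<rho>_def)
  define h where "h t = max (- \<rho>) (min t \<rho>)" for t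
  define D where "D t = (if \<bar>t\<bar> < \<rho> then 1 else 0 :: real)" for t
  have iff: "r^2 + 2 * t^2 \<le> R^2 \<longleftrightarrow> \<bar>t\<bar> \<le> \<rho>" for t
  proof -
   have "r^2 + 2 * t^2 \<le> R^2 \<longleftrightarrow> t^2 \<le> \<rho>^2" by (simp add: \<rho>(2) field_simps)
   also have "... \<longleftrightarrow> \<bar>t\<bar> \<le> \<rho>" using \<rho>(1) by (simp add: abs_le_square_iff[symmetric])
   finally show ?thesis .
  qed
  note cl = clamp_facts[of \<rho> h, OF \<rho>(1) h_def]
  have "(NNINT t. tube R (z + t *\<^sub>R v) * ennreal (t^2) * ennreal (wt m (z + t *\<^sub>R v)))
    \<le> (NNINT t. ennreal ((h t)^2) * ennreal (wt m (z + t *\<^sub>R v)))"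
   by (intro nn_integral_mono mult_right_mono) (auto simp: tube iff h_def)
  also have "... \<le> ennreal (1 / (2 * (\<alpha> + \<kappa>))) * (NNINT t. ennreal ((D t)^2) * ennreal (wt m (z + t *\<^sub>R v)))"
   unfolding v_def
  proof (rule wt_line_inequality[OF ij z cl(1) cl(2) cl(3), of "{- \<rho>, \<rho>}"])
   show "(h has_real_derivative D t) (at t)" if "t \<notin> {- \<rho>, \<rho>}" for t using cl(4)[OF that] by (simp add: D_def)
  qed (simp_all add: D_def[abs_def])
  also have "... \<le> ennreal (1 / (2 * (\<alpha> + \<kappa>))) * (NNINT t. tube R (z + t *\<^sub>R v) * ennreal (wt m (z + t *\<^sub>R v)))"
   by (intro mult_left_mono nn_integral_mono mult_right_mono) (auto simp: tube iff D_def)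
  finally show ?thesis .
 qed
 then show "(NNINT t. tube R (z + t *\<^sub>R (axis i 1 - axis j 1))
    * ennreal ((((z + t *\<^sub>R (axis i 1 - axis j 1)) $ i - (z + t *\<^sub>R (axis i 1 - axis j 1)) $ j) / 2)^2)
    * ennreal (wt m (z + t *\<^sub>R (axis i 1 - axis j 1))))
   \<le> ennreal (1 / (2 * (\<alpha> + \<kappa>))) * (NNINT t. tube R (z + t *\<^sub>R (axis i 1 - axis j 1)) * ennreal (wt m (z + t *\<^sub>R (axis i 1 - axis j 1))))"
  unfolding v_def[symmetric] diff .
qed

lemma norm_proj_sq:
 "(norm (proj 0 x))^2 = (\<Sum>i\<in>UNIV. \<Sum>j\<in>UNIV. ((x $ i - x $ j) / 2)^2) * (2 / real CARD('n))" for x :: "real ^ 'n::finite"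
proof -
 have n: "0 < real CARD('n)" by (rule card_pos)
 have "(norm (proj 0 x))^2 = (\<Sum>i\<in>UNIV. (centred i x)^2)"
  unfolding power2_norm_eq_inner inner_vec_def by (simp add: proj_nth power2_eq_square)
 also have "... = (\<Sum>i\<in>UNIV. (x $ i)^2) - (\<Sum>i\<in>UNIV. x $ i)^2 / real CARD('n)" by (rule sum_centred_sq)
 also have "... = (\<Sum>i\<in>UNIV. \<Sum>j\<in>UNIV. (x $ i - x $ j)^2) / 4 * (2 / real CARD('n))"
  unfolding sum_sq_differences using n by (simp add: field_simps)
 finally show ?thesis by (simp add: power_divide sum_divide_distrib[symmetric])
qed

lemma wt_product:
 "ennreal (wt m x) = ennreal (exp (- (\<kappa> / 2 * (x \<bullet> mean_dir)^2))) * ennreal (exp (- (\<Sum>i\<in>UNIV. V (proj m x $ i))))"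
 for x :: "real ^ 'n::finite"
 by (simp add: wt_def potential_def proj_nth ennreal_mult[symmetric] exp_add[symmetric] add.commute)

lemma tube_finite: "(NNINT x. tube R x * ennreal (wt m (x :: real ^ 'n::finite))) < \<infinity>"
proof -
 define b where "b = (\<chi> i. m :: real ^ 'n)"
 define f where "f y = ennreal (exp (- (\<Sum>i\<in>UNIV. V (y $ i))))" for y :: "real ^ 'n"
 define J :: "real ^ 'n => ennreal" where "J = indicator (cball b R)"
 have [measurable]: "f \<in> borel_measurable borel" unfolding f_def[abs_def] by (rule measurable_cond_weight[OF V_cont])
 have [measurable]: "J \<in> borel_measurable borel" unfolding J_def by (intro borel_measurable_indicator) simp
 have p0: "proj m x = b + proj 0 x" for x by (simp add: b_def vec_eq_iff proj_def)
 have J: "tube R x = J (proj m x)" for x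
  by (simp add: tube_def J_def p0 indicator_def dist_norm)
 have "continuous_on UNIV (\<lambda>y :: real ^ 'n. exp (- (\<Sum>i\<in>UNIV. V (y $ i))))"
  by (intro continuous_intros continuous_on_compose2[OF V_cont]) auto
 then have "compact ((\<lambda>y :: real ^ 'n. exp (- (\<Sum>i\<in>UNIV. V (y $ i)))) ` cball b R)"
  by (rule compact_continuous_image[OF continuous_on_subset[OF _ subset_UNIV] compact_cball])
 then have "bdd_above ((\<lambda>y :: real ^ 'n. exp (- (\<Sum>i\<in>UNIV. V (y $ i)))) ` cball b R)"
  by (intro bounded_imp_bdd_above compact_imp_bounded)
 then obtain M where "\<forall>s\<in>(\<lambda>y :: real ^ 'n. exp (- (\<Sum>i\<in>UNIV. V (y $ i)))) ` cball b R. s \<le> M" unfolding bdd_above_def by blast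
 then have M: "\<And>y. y \<in> cball b R ==> exp (- (\<Sum>i\<in>UNIV. V (y $ i))) \<le> M" by blast
 have "(\<integral>\<^sup>+y. J y \<partial>affine_lborel (mean_hyperplane m)) = (NNINT s. indicator {0..1::real} s) * (\<integral>\<^sup>+y. J y \<partial>affine_lborel (mean_hyperplane m))"
  by simp
 also have "... = (NNINT x. indicator {0..1} (x \<bullet> mean_dir) * J (proj m x))"
  by (rule nn_integral_proj[symmetric]) measurable
 also have "... \<le> (NNINT x. indicator (cball (0 :: real ^ 'n) (R + 1)) x)"
 proof (rule nn_integral_mono)
  fix x :: "real ^ 'n"
  have "norm x \<le> R + 1" if "0 \<le> x \<bullet> mean_dir" "x \<bullet> mean_dir \<le> 1" "norm (proj 0 x) \<le> R"
  proof -
   have "x = proj 0 x + (x \<bullet> mean_dir) *\<^sub>R mean_dir" by (simp add: proj_eq vec_eq_iff)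
   then have "norm x \<le> norm (proj 0 x) + norm ((x \<bullet> mean_dir) *\<^sub>R (mean_dir :: real ^ 'n))" by (metis norm_triangle_ineq)
   also have "norm ((x \<bullet> mean_dir) *\<^sub>R (mean_dir :: real ^ 'n)) \<le> 1" using that by (simp add: norm_mean_dir)
   finally show ?thesis using that by simp
  qed
  then show "indicator {0..1} (x \<bullet> mean_dir) * J (proj m x) \<le> indicator (cball 0 (R + 1)) x"
   by (auto simp: J[symmetric] tube_def indicator_def)
 qed
 also have "... < \<infinity>" using emeasure_lborel_cball_finite[of "0 :: real ^ 'n" "R + 1"] by simp
 finally have Jf: "(\<integral>\<^sup>+y. J y \<partial>affine_lborel (mean_hyperplane m)) < \<infinity>" .
 have "(NNINT x. tube R x * ennreal (wt m (x :: real ^ 'n)))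
   = (NNINT x. ennreal (exp (- (\<kappa> / 2 * (x \<bullet> mean_dir)^2))) * (J (proj m x) * f (proj m x)))"
 proof (rule nn_integral_cong)
  fix x :: "real ^ 'n"
  show "tube R x * ennreal (wt m x) = ennreal (exp (- (\<kappa> / 2 * (x \<bullet> mean_dir)^2))) * (J (proj m x) * f (proj m x))"
   unfolding wt_product f_def J[of x] by (simp only: mult_ac)
 qed
 also have "... = (NNINT s. ennreal (exp (- (\<kappa> / 2 * s^2)))) * (\<integral>\<^sup>+y. J y * f y \<partial>affine_lborel (mean_hyperplane m))"
  by (rule nn_integral_proj) measurable
 also have "(\<integral>\<^sup>+y. J y * f y \<partial>affine_lborel (mean_hyperplane m)) \<le> (\<integral>\<^sup>+y. ennreal M * J y \<partial>affine_lborel (mean_hyperplane m))"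
  by (intro nn_integral_mono) (auto simp: J_def f_def indicator_def intro!: ennreal_leI M)
 also have "... = ennreal M * (\<integral>\<^sup>+y. J y \<partial>affine_lborel (mean_hyperplane m))"
  by (intro nn_integral_cmult measurable_affine_lborel) measurable
 finally have le: "(NNINT x. tube R x * ennreal (wt m (x :: real ^ 'n)))
   \<le> (NNINT s. ennreal (exp (- (\<kappa> / 2 * s^2)))) * (ennreal M * (\<integral>\<^sup>+y. J y \<partial>affine_lborel (mean_hyperplane m)))"
  by (simp add: mult_left_mono)
 also have "... < \<infinity>" using Jf finite_gaussian_integral(1)[OF \<kappa>] by (simp add: ennreal_mult_less_top)
 finally show ?thesis .
qed

text \<open>Summing \<open>tube_pair_bound\<close> over all pairs, the second moment of the tube of radius \<open>R\<close> is at most \<open>n / (\<alpha> + \<kappa>)\<close> times its mass. By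
Chebyshev's inequality at least half of that mass lies in a tube whose radius does not depend on \<open>R\<close>.\<close>

theorem wt_integrable: "integrable lborel (wt m :: real ^ 'n::finite => real)"
proof -
 define I where "I R = (NNINT x. tube R x * ennreal (wt m (x :: real ^ 'n)))" for R
 define n where "n = real CARD('n)"
 define \<Lambda> where "\<Lambda> = \<alpha> + \<kappa>"
 have n: "0 < n" and \<Lambda>: "0 < \<Lambda>" using card_pos[where 'n = 'n] \<alpha> \<kappa> by (auto simp: n_def \<Lambda>_def)
 \<comment> \<open>The square of the radius outside of which Chebyshev's inequality leaves at most half of the mass.\<close>
 define T where "T = 2 * n / \<Lambda>"
 have T: "0 < T" using n \<Lambda> by (simp add: T_def)
 have half: "I R \<le> I (sqrt T) + ennreal (1 / 2) * I R" if R: "0 \<le> R" for R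
 proof -
  define H where "H i j x = tube R x * ennreal (((x $ i - x $ j) / 2)^2) * ennreal (wt m x)" for i j and x :: "real ^ 'n"
  have [measurable]: "H i j \<in> borel_measurable borel" for i j unfolding H_def[abs_def] by measurable
  have H: "(NNINT x. H i j x) \<le> ennreal (1 / (2 * \<Lambda>)) * I R" for i j
  proof (cases "i = j")
   case False then show ?thesis unfolding H_def I_def \<Lambda>_def by (rule tube_pair_bound[OF _ R])
  qed (simp add: H_def)
  have "I R \<le> (NNINT x. tube (sqrt T) x * ennreal (wt m x) + ennreal (2 / (n * T)) * (\<Sum>i\<in>UNIV. \<Sum>j\<in>UNIV. H i j x))"
   unfolding I_def
  proof (rule nn_integral_mono)
   fix x :: "real ^ 'n"
   have "ennreal (2 / (n * T)) * (\<Sum>i\<in>UNIV. \<Sum>j\<in>UNIV. H i j x) = tube R x * ennreal ((norm (proj 0 x))^2 / T) * ennreal (wt m x)"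
   proof -
    have "(\<Sum>i\<in>UNIV. \<Sum>j\<in>UNIV. H i j x) = tube R x * ennreal (\<Sum>i\<in>UNIV. \<Sum>j\<in>UNIV. ((x $ i - x $ j) / 2)^2) * ennreal (wt m x)"
     unfolding H_def sum_distrib_left[symmetric] sum_distrib_right[symmetric] by (simp add: sum_nonneg)
    moreover have "ennreal (2 / (n * T)) * ennreal (\<Sum>i\<in>UNIV. \<Sum>j\<in>UNIV. ((x $ i - x $ j) / 2)^2) = ennreal ((norm (proj 0 x))^2 / T)"
     unfolding norm_proj_sq n_def[symmetric] using n T by (subst ennreal_mult[symmetric]) (auto simp: sum_nonneg field_simps)
    moreover have "a * (b * c * d) = b * (a * c) * d" for a b c d :: ennreal by (simp only: mult_ac)
    ultimately show ?thesis by simp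
   qed
   moreover have "tube R x \<le> tube (sqrt T) x + tube R x * ennreal ((norm (proj 0 x))^2 / T)"
   proof (cases "norm (proj 0 x) \<le> sqrt T")
    case False
    then have "T \<le> (norm (proj 0 x))^2" using T power_mono[of "sqrt T" "norm (proj 0 x)" 2] by simp
    then have "1 \<le> (norm (proj 0 x))^2 / T" using T by simp
    then have "ennreal 1 \<le> ennreal ((norm (proj 0 x))^2 / T)" by (rule ennreal_leI)
    then have "1 \<le> ennreal ((norm (proj 0 x))^2 / T)" by simp
    then have "tube R x * 1 \<le> tube R x * ennreal ((norm (proj 0 x))^2 / T)" by (rule mult_left_mono) simp
    then show ?thesis by (simp add: add_increasing)
   qed (auto simp: tube_def indicator_def)
   then have "tube R x * ennreal (wt m x) \<le> (tube (sqrt T) x + tube R x * ennreal ((norm (proj 0 x))^2 / T)) * ennreal (wt m x)"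
    by (rule mult_right_mono) simp
   ultimately show "tube R x * ennreal (wt m x) \<le> tube (sqrt T) x * ennreal (wt m x) + ennreal (2 / (n * T)) * (\<Sum>i\<in>UNIV. \<Sum>j\<in>UNIV. H i j x)"
    by (simp add: distrib_right)
  qed
  also have "... = I (sqrt T) + ennreal (2 / (n * T)) * (\<Sum>i\<in>UNIV. \<Sum>j\<in>UNIV. (NNINT x. H i j x))"
   by (simp add: nn_integral_add nn_integral_cmult nn_integral_sum I_def)
  also have "... \<le> I (sqrt T) + ennreal (2 / (n * T)) * (\<Sum>i\<in>(UNIV :: 'n set). \<Sum>j\<in>(UNIV :: 'n set). ennreal (1 / (2 * \<Lambda>)) * I R)"
   by (intro add_left_mono mult_left_mono sum_mono H) auto
  also have "(\<Sum>i\<in>(UNIV :: 'n set). \<Sum>j\<in>(UNIV :: 'n set). ennreal (1 / (2 * \<Lambda>)) * I R) = ennreal (n * n * (1 / (2 * \<Lambda>))) * I R"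
  proof -
   have "(\<Sum>i\<in>(UNIV :: 'n set). \<Sum>j\<in>(UNIV :: 'n set). ennreal (1 / (2 * \<Lambda>)) * I R) = ennreal n * (ennreal n * (ennreal (1 / (2 * \<Lambda>)) * I R))"
    by (simp add: n_def ennreal_of_nat_eq_real_of_nat)
   also have "... = ennreal (n * n * (1 / (2 * \<Lambda>))) * I R"
   proof -
    have "ennreal (n * n * c) = ennreal n * ennreal n * ennreal c" if "0 \<le> c" for c using n that by (simp add: ennreal_mult)
    from this[of "1 / (2 * \<Lambda>)"] have key: "ennreal (n * n * (1 / (2 * \<Lambda>))) = ennreal n * ennreal n * ennreal (1 / (2 * \<Lambda>))"
     using \<Lambda> by simp
    show ?thesis unfolding key by (simp only: mult.assoc)
   qed
   finally show ?thesis .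
  qed
  also have "ennreal (2 / (n * T)) * (ennreal (n * n * (1 / (2 * \<Lambda>))) * I R) = ennreal (1 / 2) * I R"
  proof -
   have "2 / (n * T) * (n * n * (1 / (2 * \<Lambda>))) = 1 / 2" using n \<Lambda> by (simp add: T_def field_simps)
   then have "ennreal (2 / (n * T)) * ennreal (n * n * (1 / (2 * \<Lambda>))) = ennreal (1 / 2)"
    using n \<Lambda> T by (subst ennreal_mult[symmetric]) auto
   then show ?thesis by (simp only: mult.assoc[symmetric])
  qed
  finally show ?thesis .
 qed
 have fin: "I R < \<infinity>" for R unfolding I_def by (rule tube_finite)
 have bound: "I R \<le> 2 * I (sqrt T)" if "0 \<le> R" for R
 proof -
  obtain a where a: "I R = ennreal a" "0 \<le> a" using fin[of R] by (cases "I R") auto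
  obtain b where b: "I (sqrt T) = ennreal b" "0 \<le> b" using fin[of "sqrt T"] by (cases "I (sqrt T)") auto
  have "ennreal a \<le> ennreal (b + 1 / 2 * a)"
   using half[OF that] a b by (simp add: ennreal_mult[symmetric] ennreal_plus[symmetric] del: ennreal_plus ennreal_half)
  then have "a \<le> 2 * b" using a b by (subst (asm) ennreal_le_iff) auto
  then have "ennreal a \<le> ennreal (2 * b)" by (rule ennreal_leI)
  then show ?thesis using a b by (simp add: ennreal_mult)
 qed
 have "(\<lambda>k. I (real k)) \<longlonglongrightarrow> (NNINT x. ennreal (wt m (x :: real ^ 'n)))"
  unfolding I_def
 proof (rule nn_integral_LIMSEQ)
  show "incseq (\<lambda>k x. tube (real k) x * ennreal (wt m (x :: real ^ 'n)))"
   by (auto simp: incseq_def le_fun_def tube_def indicator_def)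
  show "(\<lambda>k. tube (real k) x * ennreal (wt m x)) \<longlonglongrightarrow> ennreal (wt m x)" for x :: "real ^ 'n"
  proof -
   obtain K :: nat where K: "norm (proj 0 x) \<le> real K" using real_arch_simple by blast
   have "\<forall>\<^sub>F k in sequentially. tube (real k) x * ennreal (wt m x) = ennreal (wt m x)"
    unfolding eventually_sequentially using K by (intro exI[of _ K]) (auto simp: tube_def indicator_def)
   then show ?thesis by (rule tendsto_eventually)
  qed
 qed measurable
 then have "(NNINT x. ennreal (wt m (x :: real ^ 'n))) \<le> 2 * I (sqrt T)"
  by (rule LIMSEQ_le_const2) (intro exI allI impI bound, simp)
 also have "... < \<infinity>" using fin by (simp add: ennreal_mult_less_top)
 finally show ?thesis by (intro integrableI_nonneg) auto
qed

lemma weight_w: "weight.w (potential m) = wt m"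
proof -
 interpret weight "potential m" by standard (rule potential_C2)
 show ?thesis by (rule ext) (simp add: w_def wt_def)
qed

lemma sym_weight_potential: "sym_weight (potential m :: real ^ 'n::finite => real) \<alpha> \<kappa>"
proof -
 interpret weight "potential m :: real ^ 'n => real" by standard (rule potential_C2)
 show ?thesis
 proof (standard, unfold weight_w)
  show "integrable lborel (wt m :: real ^ 'n => real)" by (rule wt_integrable)
 qed (erule potential_pm, rule \<kappa>, rule \<alpha>, rule potential_hessian, rule wt_odd_inequality)
qed

end

section \<open>Descent to the hyperplane\<close>

lemma (in sym_weight) variance_C1:
 assumes f: "Ck 1 f" "bsupp f"
 shows "(LBINT x. (f x)^2 * w x) - (LBINT x. f x * w x)^2 / integral\<^sup>L lborel w \<le> 2 / \<kappa> * En f"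
proof -
 have c: "continuous_on UNIV f" by (rule Ck_cont[OF f(1)])
 define a where "a = mean f"
 define A where "A = (LBINT x. (f x)^2 * w x)"
 define B where "B = (LBINT x. f x * w x)"
 have W: "0 < W" by (rule W_pos)
 have aB: "a = B / W" by (simp add: a_def mean_def B_def)
 have i: "integrable lborel (\<lambda>x. (f x)^2 * w x)" "integrable lborel (\<lambda>x. f x * w x)"
  unfolding power2_eq_square by (intro integrable_bsupp continuous_intros c w_cont bsupp_mult1 f)+
 have "(LBINT x. (f x - a)^2 * w x) = (LBINT x. ((f x)^2 * w x - 2 * a * (f x * w x)) + a^2 * w x)"
  by (rule Bochner_Integration.integral_cong) (simp_all add: power2_eq_square algebra_simps)
 also have "... = A - 2 * a * B + a^2 * W" using i wi by (simp add: A_def B_def W_def)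
 also have "... = A - B^2 / W" using W by (simp add: aB power2_eq_square)
 finally have "\<kappa> * (A - B^2 / W) \<le> 2 * En f" using poincare_C1[OF f] by (simp add: a_def)
 then have "A - B^2 / W \<le> 2 / \<kappa> * En f" using \<kappa> by (simp add: field_simps)
 then show ?thesis by (simp add: A_def B_def W_def)
qed

lemma proj_shift: "\<exists>s. proj m x = x + s *\<^sub>R (mean_dir :: real ^ 'n::finite)"
proof -
 have "(\<chi> i. m) = (m * sqrt (real CARD('n))) *\<^sub>R (mean_dir :: real ^ 'n)" by (simp add: vec_eq_iff mean_dir_def)
 then have "proj m x = x + (m * sqrt (real CARD('n)) - x \<bullet> mean_dir) *\<^sub>R mean_dir"
  unfolding proj_eq by (simp add: algebra_simps)
 then show ?thesis ..
qed

lemma norm_proj_diff: "norm (proj m x - proj m y) \<le> norm (x - y)" for x y :: "real ^ 'n::finite"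
proof -
 define z where "z = x - y"
 define e where "e = (mean_dir :: real ^ 'n)"
 have e: "e \<bullet> e = 1" using norm_mean_dir[where 'n = 'n] by (simp add: e_def norm_eq_1)
 have p: "proj m x - proj m y = z - (z \<bullet> e) *\<^sub>R e" by (simp add: proj_eq z_def e_def inner_diff_left algebra_simps)
 have "(norm (z - (z \<bullet> e) *\<^sub>R e))^2 = z \<bullet> z - (z \<bullet> e)^2"
  unfolding power2_norm_eq_inner by (simp add: inner_diff_left inner_diff_right e inner_commute[of e z] power2_eq_square)
 also have "... \<le> (norm z)^2" by (simp add: power2_norm_eq_inner)
 finally show ?thesis unfolding p z_def[symmetric] by (rule power2_le_imp_le) simp
qed

lemma closed_mean_hyperplane: "closed (mean_hyperplane m)"
 unfolding mean_hyperplane_eq using closed_hyperplane[of mean_dir] by (simp add: inner_commute)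

lemma locally_lipschitz_on_compact:
 fixes g :: "'a::metric_space => real"
 assumes g: "locally_lipschitz_on S g" and X: "compact X" "X \<subseteq> S"
 shows "\<exists>L. L-lipschitz_on X g"
proof -
 have ll: "local_lipschitz {0::real} X (\<lambda>_. g)"
 proof (rule local_lipschitzI)
  fix t x assume "x \<in> X"
  then obtain e L where e: "0 < e" "L-lipschitz_on (ball x e \<inter> S) g"
   using g X(2) unfolding locally_lipschitz_on_def by blast
  have "cball x (e / 2) \<inter> X \<subseteq> ball x e \<inter> S" using e(1) X(2) by auto
  then have "L-lipschitz_on (cball x (e / 2) \<inter> X) g" by (rule lipschitz_on_subset[OF e(2)])
  then show "\<exists>u>0. \<exists>L. \<forall>t\<in>cball t u \<inter> {0}. L-lipschitz_on (cball x u \<inter> X) g"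
   using e(1) by (intro exI[of _ "e / 2"]) auto
 qed
 obtain L where "\<And>t. t \<in> {0::real} ==> L-lipschitz_on X g"
  by (rule local_lipschitz_compact_implies_lipschitz[OF ll X(1), of]) auto
 then show ?thesis by blast
qed

lemma lip_balls_proj:
 assumes g: "locally_lipschitz_on (mean_hyperplane m) g"
 shows "lip_balls (\<lambda>x :: real ^ 'n::finite. g (proj m x))"
 unfolding lip_balls_def
proof
 fix M
 define X where "X = mean_hyperplane m \<inter> cball (proj m 0 :: real ^ 'n) M"
 have "compact X" unfolding X_def by (intro closed_Int_compact closed_mean_hyperplane compact_cball)
 then obtain L where L: "L-lipschitz_on X g" using locally_lipschitz_on_compact[OF g] X_def by blast
 have X: "proj m x \<in> X" if "norm x \<le> M" for x
  using norm_proj_diff[of m 0 x] that proj_in[of m x] by (simp add: X_def dist_norm)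
 show "\<exists>L\<ge>0. \<forall>x y. norm x \<le> M \<longrightarrow> norm y \<le> M \<longrightarrow> \<bar>g (proj m x) - g (proj m y)\<bar> \<le> L * norm (x - y)"
 proof (intro exI[of _ L] conjI allI impI)
  show L0: "0 \<le> L" by (rule lipschitz_on_nonneg[OF L])
  fix x y :: "real ^ 'n" assume "norm x \<le> M" "norm y \<le> M"
  then have "\<bar>g (proj m x) - g (proj m y)\<bar> \<le> L * norm (proj m x - proj m y)"
   using lipschitz_onD[OF L X X] by (simp add: dist_norm)
  also have "... \<le> L * norm (x - y)" by (intro mult_left_mono norm_proj_diff L0)
  finally show "\<bar>g (proj m x) - g (proj m y)\<bar> \<le> L * norm (x - y)" .
 qed
qed

text \<open>The function composed with the projection is constant in the normal direction, so that its full gradient lies in the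
direction of the hyperplane.\<close>

lemma gradient_on_proj:
 fixes y :: "real ^ 'n::finite"
 assumes y: "y \<in> mean_hyperplane m" and d: "(\<lambda>x. g (proj m x)) differentiable at y"
 shows "(norm (gradient_on (mean_hyperplane m) g y))^2 = (\<Sum>b\<in>Basis. (Dl b (\<lambda>x. g (proj m x)) y)^2)"
proof -
 define G where "G x = g (proj m x)" for x :: "real ^ 'n"
 have dG: "G differentiable at y" using d by (simp add: G_def[abs_def])
 have "(\<lambda>n. dq n mean_dir G y) = (\<lambda>n. 0)" by (simp add: dq_def G_def proj_plus_mean_dir)
 then have "pd mean_dir G y = 0" unfolding Dl_eq_pd[OF dG, symmetric] Dl_def by (simp add: limI)
 then have dir: "grad G y \<in> direction (mean_hyperplane m)"
  using inner_grad[OF dG] by (simp add: direction_mean_hyperplane)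
 have "(G has_derivative (\<lambda>h. grad G y \<bullet> h)) (at y within mean_hyperplane m)"
  using has_derivative_grad[OF dG] by (rule has_derivative_at_withinI)
 then have "(g has_derivative (\<lambda>h. grad G y \<bullet> h)) (at y within mean_hyperplane m)"
  by (rule has_derivative_transform[OF y, rotated]) (simp add: G_def proj_id)
 then have "gradient_on (mean_hyperplane m) g y = grad G y"
  using dir by (intro gradient_on_eq affine_mean_hyperplane y) (simp add: has_gradient_at_def)
 then show ?thesis by (simp add: norm_grad_sq Dl_eq_pd[OF dG] G_def[abs_def, symmetric])
qed

text \<open>Rademacher's theorem holds almost everywhere on space. As the function is constant along normals, one point of
differentiability on a normal line suffices, and almost every normal line has one.\<close>

lemma AE_differentiable_on_hyperplane:
 assumes G: "lip_balls (\<lambda>x :: real ^ 'n::finite. g (proj m x))"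
 shows "AE y in affine_lborel (mean_hyperplane m). (\<lambda>x. g (proj m x)) differentiable at y"
proof -
 obtain N where N: "{x \<in> space lborel. \<not> (\<lambda>x. g (proj m x)) differentiable at x} \<subseteq> N" "emeasure lborel N = 0" "N \<in> sets lborel"
  using rademacher_local[OF G] by (rule AE_E)
 have [measurable]: "N \<in> sets borel" using N(3) by simp
 define H where "H y = (NNINT s. indicator N (y + s *\<^sub>R (mean_dir :: real ^ 'n)))" for y
 have Hm: "H \<in> borel_measurable borel" unfolding H_def[abs_def] by measurable
 have "(\<integral>\<^sup>+y. H y \<partial>affine_lborel (mean_hyperplane m)) = (NNINT x. indicator N x)"
  unfolding H_def mean_hyperplane_eq by (rule nn_integral_hyperplane_slices[OF norm_mean_dir, symmetric]) measurable
 also have "... = 0" using N by simp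
 finally have "AE y in affine_lborel (mean_hyperplane m). H y = 0"
  by (subst (asm) nn_integral_0_iff_AE) (auto intro: measurable_affine_lborel Hm)
 then show ?thesis
 proof eventually_elim
  case (elim y)
  have "\<exists>s. y + s *\<^sub>R mean_dir \<notin> N"
  proof (rule ccontr)
   assume "\<not> (\<exists>s. y + s *\<^sub>R mean_dir \<notin> N)"
   then have "H y = (\<integral>\<^sup>+s. 1 \<partial>(lborel :: real measure))" unfolding H_def by (intro nn_integral_cong) simp
   then show False using elim by simp
  qed
  then obtain s where "y + s *\<^sub>R mean_dir \<notin> N" by blast
  then have "(\<lambda>x. g (proj m x)) differentiable at (s *\<^sub>R mean_dir + y)" using N(1) by (auto simp: add.commute)
  from pd_compose_linear(2)[OF bounded_linear_ident this]
  show ?case by (simp add: add.commute[of "s *\<^sub>R mean_dir"] proj_plus_mean_dir)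
 qed
qed

context pair_gap
begin

lemma smooth_poincare_potential: "smooth_poincare (potential m :: real ^ 'n::finite => real) (2 / \<kappa>)"
proof -
 interpret sym_weight "potential m :: real ^ 'n => real" \<alpha> \<kappa> by (rule sym_weight_potential)
 show ?thesis by standard (use wi \<kappa> variance_C1 in auto)
qed

text \<open>The type argument carries the dimension, which \<open>m\<close> does not determine.\<close>

definition mass :: "'n::finite itself => real => real" where
 "mass _ m = integral\<^sup>L lborel (wt m :: real ^ 'n => real)"

definition upstairs :: "real => (real ^ 'n::finite) measure" where
 "upstairs m = density lborel (\<lambda>x. ennreal (wt m x / mass TYPE('n) m))"

lemma mass_pos: "0 < mass TYPE('n::finite) m"
proof -
 interpret sym_weight "potential m :: real ^ 'n => real" \<alpha> \<kappa> by (rule sym_weight_potential)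
 show ?thesis using W_pos unfolding W_def weight_w mass_def .
qed

lemma nn_integral_wt: "(NNINT x. ennreal (wt m (x :: real ^ 'n::finite))) = ennreal (mass TYPE('n) m)"
 unfolding mass_def by (rule nn_integral_eq_integral[OF wt_integrable]) simp

lemma prob_space_upstairs: "prob_space (upstairs m :: (real ^ 'n::finite) measure)"
proof
 have "emeasure (upstairs m :: (real ^ 'n) measure) (space (upstairs m)) = (NNINT x. ennreal (1 / mass TYPE('n) m) * ennreal (wt m (x :: real ^ 'n)))"
  using mass_pos[where 'n = 'n, of m] by (simp add: upstairs_def emeasure_density ennreal_mult[symmetric])
 also have "... = ennreal (1 / mass TYPE('n) m) * ennreal (mass TYPE('n) m)"
  by (subst nn_integral_cmult) (auto simp: nn_integral_wt)
 also have "... = 1" using mass_pos[where 'n = 'n, of m] by (simp add: ennreal_mult[symmetric])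
 finally show "emeasure (upstairs m :: (real ^ 'n) measure) (space (upstairs m)) = 1" .
qed

lemma measurable_proj_upstairs:
 "proj m \<in> measurable (upstairs m) (restrict_space borel (mean_hyperplane m))"
 unfolding upstairs_def by (rule measurable_restrict_space2) (auto simp: proj_in)

text \<open>The weight is a function of the normal coordinate times the conditioned density at the projected point; the
integral of the former cancels in the normalisation.\<close>

theorem cond_measure_eq_distr:
 "(cond_measure V m :: (real ^ 'n::finite) measure)
  = distr (upstairs m) (restrict_space borel (mean_hyperplane m)) (proj m)"
proof (rule measure_eqI)
 show "sets (cond_measure V m :: (real ^ 'n) measure)
   = sets (distr (upstairs m) (restrict_space borel (mean_hyperplane m)) (proj m))"
  by (simp add: sets_cond_measure)
 fix A :: "(real ^ 'n) set" assume A: "A \<in> sets (cond_measure V m)"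
 define H where "H = (mean_hyperplane m :: (real ^ 'n) set)"
 define f where "f y = ennreal (exp (- (\<Sum>i\<in>UNIV. V (y $ i))))" for y :: "real ^ 'n"
 define p where "p s = ennreal (exp (- (\<kappa> / 2 * s^2)))" for s
 define Z where "Z = (\<integral>\<^sup>+y. f y \<partial>affine_lborel H)"
 define G where "G = (NNINT s. p s)"
 define W where "W = mass TYPE('n) m"
 have W: "0 < W" unfolding W_def by (rule mass_pos)
 have G: "G \<noteq> 0" "G < \<top>" using finite_gaussian_integral[OF \<kappa>] by (auto simp: G_def p_def)
 have fm [measurable]: "f \<in> borel_measurable borel" unfolding f_def[abs_def] by (rule measurable_cond_weight[OF V_cont])
 have pm [measurable]: "p \<in> borel_measurable borel" unfolding p_def[abs_def] by measurable
 have "H \<in> sets borel" unfolding H_def by (intro borel_closed closed_mean_hyperplane)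
 then have Ab [measurable]: "A \<in> sets borel"
  using A by (simp add: sets_cond_measure sets_restrict_space_iff H_def[symmetric])
 have key: "(NNINT x. h (proj m x) * ennreal (wt m x)) = G * (\<integral>\<^sup>+y. h y * f y \<partial>affine_lborel H)"
  if [measurable]: "h \<in> borel_measurable borel" for h :: "real ^ 'n => ennreal"
 proof -
  have "(NNINT x. h (proj m x) * ennreal (wt m x)) = (NNINT x. p (x \<bullet> mean_dir) * (h (proj m x) * f (proj m x)))"
   by (intro nn_integral_cong) (simp only: wt_product p_def f_def mult_ac)
  also have "... = G * (\<integral>\<^sup>+y. h y * f y \<partial>affine_lborel H)"
   unfolding G_def H_def by (rule nn_integral_proj) measurable
  finally show ?thesis .
 qed
 have GZ: "ennreal W = G * Z" using key[of "\<lambda>_. 1"] by (simp add: nn_integral_wt W_def Z_def)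
 have Z: "Z \<noteq> 0" "Z < \<top>"
 proof -
  show "Z \<noteq> 0" using GZ W by auto
  show "Z < \<top>" using GZ G by (metis ennreal_mult_eq_top_iff ennreal_neq_top less_top)
 qed
 have inv: "ennreal (1 / W) = inverse G * inverse Z"
  using W GZ G Z by (simp add: ennreal_inverse_mult[symmetric] inverse_ennreal[symmetric] inverse_eq_divide[symmetric])
 have "emeasure (distr (upstairs m) (restrict_space borel H) (proj m)) A = emeasure (upstairs m) (proj m -` A)"
  using A unfolding H_def by (subst emeasure_distr[OF measurable_proj_upstairs]) (auto simp: sets_cond_measure upstairs_def)
 also have "... = (NNINT x. ennreal (1 / W) * (indicator A (proj m x) * ennreal (wt m x)))"
 proof -
  have "proj m -` A \<in> sets borel" using measurable_sets[OF measurable_proj Ab] by simp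
  then have "emeasure (upstairs m) (proj m -` A) = (NNINT x. ennreal (wt m x / W) * indicator (proj m -` A) x)"
   unfolding upstairs_def W_def by (subst emeasure_density) auto
  also have "... = (NNINT x. ennreal (1 / W) * (indicator A (proj m x) * ennreal (wt m x)))"
   using W by (intro nn_integral_cong) (simp add: indicator_def ennreal_mult[symmetric])
  finally show ?thesis .
 qed
 also have "... = ennreal (1 / W) * (G * (\<integral>\<^sup>+y. indicator A y * f y \<partial>affine_lborel H))"
  by (subst nn_integral_cmult) (measurable, simp add: key)
 also have "... = inverse Z * (\<integral>\<^sup>+y. indicator A y * f y \<partial>affine_lborel H)"
 proof -
  have "inverse G * G = 1" using G by (metis ennreal_divide_self divide_ennreal_def mult.commute)
  moreover have "inverse G * inverse Z * (G * I) = (inverse G * G) * (inverse Z * I)" for I by (simp only: mult_ac)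
  ultimately show ?thesis by (simp add: inv)
 qed
 also have "... = (\<integral>\<^sup>+x. indicator A x \<partial>cond_measure V m)"
  unfolding Z_def H_def f_def by (rule nn_integral_cond_measure[OF V_cont, symmetric]) measurable
 also have "... = emeasure (cond_measure V m) A" using A by simp
 finally show "emeasure (cond_measure V m) A = emeasure (distr (upstairs m) (restrict_space borel (mean_hyperplane m)) (proj m)) A"
  by (simp add: H_def)
qed

text \<open>Both sides are pulled back to space. The squared gradient norm is replaced almost everywhere by the limit of
difference quotients \<open>E\<close>, since the transfer of integrals needs a measurable integrand. If \<open>E\<close> is not
integrable the right-hand side is infinite.\<close>

theorem poincare_const_cond_measure:
 "poincare_const (cond_measure V m :: (real ^ 'n::finite) measure) \<le> ennreal (2 / \<kappa>)"
 unfolding poincare_const_def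
proof (rule Inf_lower, safe)
 define \<nu> where "\<nu> = (cond_measure V m :: (real ^ 'n) measure)"
 define M where "M = (upstairs m :: (real ^ 'n) measure)"
 define H where "H = (mean_hyperplane m :: (real ^ 'n) set)"
 have \<nu>: "\<nu> = distr M (restrict_space borel H) (proj m)"
  unfolding \<nu>_def M_def H_def by (rule cond_measure_eq_distr)
 interpret M: prob_space M unfolding M_def by (rule prob_space_upstairs)
 have pM: "proj m \<in> measurable M (restrict_space borel H)" unfolding M_def H_def by (rule measurable_proj_upstairs)
 show "prob_space (cond_measure V m :: (real ^ 'n) measure)"
  unfolding \<nu>_def[symmetric] \<nu> by (rule M.prob_space_distr[OF pM])
 fix g :: "real ^ 'n => real"
 assume "locally_lipschitz_on (space (cond_measure V m)) g" "integrable (cond_measure V m) (\<lambda>x. (g x)^2)"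
 then have gl: "locally_lipschitz_on H g" and g2: "integrable \<nu> (\<lambda>x. (g x)^2)"
  by (simp_all add: H_def \<nu>_def space_cond_measure)
 interpret S: smooth_poincare "potential m :: real ^ 'n => real" "2 / \<kappa>" by (rule smooth_poincare_potential)
 define W where "W = mass TYPE('n) m"
 have W: "0 < W" unfolding W_def by (rule mass_pos)
 have gm: "g \<in> borel_measurable (restrict_space borel H)"
 proof (rule borel_measurable_continuous_on_restrict, unfold continuous_on_eq_continuous_within, rule ballI)
  fix x assume x: "x \<in> H"
  then obtain e L where e: "0 < e" "L-lipschitz_on (ball x e \<inter> H) g"
   using gl unfolding locally_lipschitz_on_def by blast
  have "continuous (at x within H \<inter> ball x e) g"
   using lipschitz_on_continuous_on[OF e(2)] x e(1) by (simp add: continuous_on_eq_continuous_within Int_commute)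
  moreover have "at x within H \<inter> ball x e = at x within H"
   by (rule at_within_nhd[where S = "ball x e"]) (use e(1) in auto)
  ultimately show "continuous (at x within H) g" by simp
 qed
 define G where "G x = g (proj m x)" for x
 have Gl: "lip_balls G" unfolding G_def using lip_balls_proj gl by (simp add: H_def)
 have Gm [measurable]: "G \<in> borel_measurable borel" by (rule borel_measurable_cont[OF lip_balls_cont[OF Gl]])
 have Mb: "f \<in> borel_measurable borel ==> f \<in> borel_measurable M" for f :: "real ^ 'n => real"
  by (simp add: M_def upstairs_def)
 define E where "E x = (\<Sum>b\<in>Basis. (Dl b G x)^2)" for x
 have Em [measurable]: "E \<in> borel_measurable borel"
  unfolding E_def[abs_def] Dl_def[abs_def] dq_def[abs_def] by measurable
 have E0: "0 \<le> E x" for x unfolding E_def by (intro sum_nonneg) auto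
 have Ep: "E (proj m x) = E x" for x
 proof -
  obtain s where s: "proj m x = x + s *\<^sub>R mean_dir" using proj_shift by blast
  have "proj m (x + s *\<^sub>R mean_dir + h) = proj m (x + h)" for h
   using proj_plus_mean_dir[of m "x + h" s] by (simp add: add_ac)
  from this this[of 0] have "dq n b G (x + s *\<^sub>R mean_dir) = dq n b G x" for n b by (simp add: dq_def G_def)
  then show ?thesis unfolding s E_def Dl_def by simp
 qed
 have iM: "integrable M f \<longleftrightarrow> integrable lborel (\<lambda>x. f x * wt m x)" "(\<integral>x. f x \<partial>M) = (LBINT x. f x * wt m x) / W"
  if [measurable]: "f \<in> borel_measurable borel" for f :: "real ^ 'n => real"
 proof -
  have "integrable M f \<longleftrightarrow> integrable lborel (\<lambda>x. (wt m x / W) *\<^sub>R f x)"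
   unfolding M_def upstairs_def W_def[symmetric] using W by (intro integrable_density) auto
  also have "(\<lambda>x. (wt m x / W) *\<^sub>R f x) = (\<lambda>x. (1 / W) * (f x * wt m x))" by (simp add: fun_eq_iff mult.commute)
  also have "integrable lborel (\<lambda>x. (1 / W) * (f x * wt m x)) \<longleftrightarrow> integrable lborel (\<lambda>x. f x * wt m x)"
   by (subst integrable_mult_left_iff) (use W in simp)
  finally show "integrable M f \<longleftrightarrow> integrable lborel (\<lambda>x. f x * wt m x)" .
  have "(\<integral>x. f x \<partial>M) = (LBINT x. (wt m x / W) *\<^sub>R f x)"
   unfolding M_def upstairs_def W_def[symmetric] using W by (intro integral_density) auto
  also have "... = (LBINT x. (f x * wt m x) / W)" by (simp add: mult.commute)
  finally show "(\<integral>x. f x \<partial>M) = (LBINT x. f x * wt m x) / W" by simp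
 qed
 have G2: "integrable M (\<lambda>x. (G x)^2)"
  using g2 unfolding \<nu> G_def by (subst (asm) integrable_distr_eq[OF pM]) (use gm in measurable)
 have G1: "integrable M G" by (rule M.square_integrable_imp_integrable[OF Mb[OF Gm] G2])
 define a where "a = (\<integral>x. G x \<partial>M)"
 have ag: "(\<integral>y. g y \<partial>\<nu>) = a" unfolding \<nu> a_def G_def by (rule integral_distr[OF pM gm])
 have lhs: "(\<integral>\<^sup>+x. ennreal ((g x - a)^2) \<partial>\<nu>) = ennreal ((\<integral>x. (G x)^2 \<partial>M) - a^2)"
 proof -
  have "(\<integral>\<^sup>+x. ennreal ((g x - a)^2) \<partial>\<nu>) = (\<integral>\<^sup>+x. ennreal ((G x - a)^2) \<partial>M)"
   unfolding \<nu> G_def by (rule nn_integral_distr[OF pM]) (use gm in measurable)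
  also have "... = ennreal (\<integral>x. (G x - a)^2 \<partial>M)"
  proof (rule nn_integral_eq_integral)
   have "integrable M (\<lambda>x. (G x)^2 - 2 * a * G x + a^2)" using G1 G2 by simp
   then show "integrable M (\<lambda>x. (G x - a)^2)" by (simp add: power2_diff algebra_simps)
  qed simp
  also have "(\<integral>x. (G x - a)^2 \<partial>M) = (\<integral>x. (G x)^2 \<partial>M) - a^2"
   unfolding a_def by (rule M.variance_eq[OF G1 G2])
  finally show ?thesis .
 qed
 have "AE y in \<nu>. (norm (gradient_on H g y))^2 = E y"
 proof -
  define L where "L = affine_lborel H"
  define w where "w x = ennreal (exp (- (\<Sum>i\<in>UNIV. V (x $ i))))" for x :: "real ^ 'n"
  have [measurable]: "w \<in> borel_measurable L"
   unfolding w_def L_def by (intro measurable_affine_lborel measurable_cond_weight V_cont)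
  have "AE y in L. G differentiable at y"
   using AE_differentiable_on_hyperplane[OF Gl[unfolded G_def[abs_def]]] unfolding L_def H_def G_def[abs_def] .
  moreover have "AE y in L. y \<in> H" using AE_space[of L] by (simp add: L_def space_affine_lborel)
  ultimately have "AE y in L. (norm (gradient_on H g y))^2 = E y"
  proof eventually_elim
   case (elim y)
   then show ?case using gradient_on_proj[of y m g] by (simp add: H_def G_def[abs_def] E_def)
  qed
  then show ?thesis unfolding \<nu>_def cond_measure_def Let_def w_def[symmetric] H_def[symmetric] L_def[symmetric]
   by (subst AE_density) auto
 qed
 then have "AE y in \<nu>. ennreal ((norm (gradient_on H g y))^2) = ennreal (E y)" by eventually_elim simp
 then have "(\<integral>\<^sup>+x. ennreal ((norm (gradient_on H g x))^2) \<partial>\<nu>) = (\<integral>\<^sup>+x. ennreal (E x) \<partial>\<nu>)"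
  by (rule nn_integral_cong_AE)
 also have "... = (\<integral>\<^sup>+x. ennreal (E (proj m x)) \<partial>M)"
  unfolding \<nu> by (rule nn_integral_distr[OF pM]) (subst measurable_distr_eq1, rule measurable_restrict_space1, measurable)
 finally have rhs: "(\<integral>\<^sup>+x. ennreal ((norm (gradient_on H g x))^2) \<partial>\<nu>) = (\<integral>\<^sup>+x. ennreal (E x) \<partial>M)" by (simp add: Ep)
 have "ennreal ((\<integral>x. (G x)^2 \<partial>M) - a^2) \<le> ennreal (2 / \<kappa>) * (\<integral>\<^sup>+x. ennreal (E x) \<partial>M)"
 proof (cases "integrable M E")
  case True
  have "(LBINT x. (G x)^2 * wt m x) - (LBINT x. G x * wt m x)^2 / W \<le> 2 / \<kappa> * (LBINT x. E x * wt m x)"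
  proof -
   have "integrable lborel (\<lambda>x. (G x)^2 * wt m x)" using G2 by (subst (asm) iM(1)) auto
   moreover have "integrable lborel (\<lambda>x. E x * wt m x)" using True by (simp add: iM(1))
   ultimately show ?thesis
    using S.poincare_locally_lipschitz[OF Gl, unfolded weight_w] unfolding E_def W_def mass_def by blast
  qed
  then have "((LBINT x. (G x)^2 * wt m x) - (LBINT x. G x * wt m x)^2 / W) / W \<le> (2 / \<kappa> * (LBINT x. E x * wt m x)) / W"
   using W by (intro divide_right_mono) auto
  then have "(\<integral>x. (G x)^2 \<partial>M) - a^2 \<le> 2 / \<kappa> * (\<integral>x. E x \<partial>M)"
   by (simp add: iM a_def power2_eq_square diff_divide_distrib)
  then have "ennreal ((\<integral>x. (G x)^2 \<partial>M) - a^2) \<le> ennreal (2 / \<kappa> * (\<integral>x. E x \<partial>M))" by (rule ennreal_leI)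
  also have "... = ennreal (2 / \<kappa>) * ennreal (\<integral>x. E x \<partial>M)" using \<kappa> by (intro ennreal_mult') simp
  also have "ennreal (\<integral>x. E x \<partial>M) = (\<integral>\<^sup>+x. ennreal (E x) \<partial>M)"
   by (rule nn_integral_eq_integral[OF True, symmetric]) (simp add: E0)
  finally show ?thesis .
 next
  case False
  then have "(\<integral>\<^sup>+x. ennreal (E x) \<partial>M) = \<top>"
   using integrableI_nonneg[OF Mb[OF Em]] E0 by (metis AE_I2 infinity_ennreal_def less_top)
  then show ?thesis using \<kappa> by (simp add: ennreal_mult_top)
 qed
 then show "(\<integral>\<^sup>+x. ennreal ((g x - (\<integral>y. g y \<partial>cond_measure V m))^2) \<partial>cond_measure V m)
  \<le> ennreal (2 / \<kappa>) * (\<integral>\<^sup>+x. ennreal ((norm (gradient_on (space (cond_measure V m)) g x))^2) \<partial>cond_measure V m)"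
  unfolding \<nu>_def[symmetric] ag lhs rhs[symmetric] by (simp add: \<nu>_def space_cond_measure H_def)
qed

end

lemma ennreal_less_inverse_gap:
 fixes c :: ennreal
 assumes s: "0 < s" and a: "0 \<le> a" and c: "inverse (inverse c - ennreal a) < ennreal s"
 shows "c < ennreal (1 / (a + 1 / s))"
proof (rule ccontr)
 assume "\<not> c < ennreal (1 / (a + 1 / s))"
 then have le: "ennreal (1 / (a + 1 / s)) \<le> c" by simp
 have p: "0 < a + 1 / s" using s a by (simp add: add_nonneg_pos)
 have anti: "inverse y \<le> inverse x" if xy: "x \<le> y" for x y :: ennreal
 proof (cases "0 < x \<and> y < \<top>")
  case True
  then obtain r q where "x = ennreal r" "0 < r" "y = ennreal q"
   using xy by (cases x; cases y) (auto simp: top_unique)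
  moreover from this xy have "r \<le> q" "0 < q" by (auto simp: ennreal_le_iff2)
  ultimately show ?thesis by (simp add: inverse_ennreal ennreal_leI le_imp_inverse_le)
 qed (use xy in \<open>auto simp: not_less top_unique\<close>)
 have "inverse c \<le> inverse (ennreal (1 / (a + 1 / s)))" by (rule anti[OF le])
 also have "... = ennreal a + ennreal (1 / s)"
  using p s a by (subst inverse_ennreal) (auto simp: ennreal_plus[symmetric] simp del: ennreal_plus)
 finally have "inverse c - ennreal a \<le> ennreal (1 / s)" by (simp add: ennreal_minus_le_iff)
 then have "inverse (ennreal (1 / s)) \<le> inverse (inverse c - ennreal a)" by (rule anti)
 moreover have "inverse (ennreal (1 / s)) = ennreal s" using s by (subst inverse_ennreal) auto
 ultimately show False using c by simp
qed

text \<open>For real \<open>s > \<Sigma>\<close> the bound holds with \<open>\<kappa> = 1 / s\<close>; then \<open>s\<close> decreases to \<open>\<Sigma>\<close>. This includes \<open>\<Sigma> = 0\<close>, and for infinite \<open>\<Sigma>\<close>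
there is nothing to prove.\<close>

theorem proposition18:
  fixes \<mu> :: "real measure" and V :: "real \<Rightarrow> real" and \<alpha> :: real
  assumes \<mu>: "\<mu> = density lborel (\<lambda>t. ennreal (exp (- V t)))" "prob_space \<mu>"
    and C2: "\<And>t. V differentiable at t" "\<And>t. deriv V differentiable at t"
      "continuous_on UNIV (deriv (deriv V))"
    and \<alpha>: "\<alpha> \<ge> 0"
    and V'': "\<And>t. deriv (deriv V) t \<ge> - \<alpha>"
    and gap: "(SUP m. poincare_const (cond_measure V m :: (real ^ 2) measure)) < 1 / ennreal \<alpha>"
    and n: "CARD('n::finite) \<ge> 2"
  shows "(SUP m. poincare_const (cond_measure V m :: (real ^ 'n) measure))
    \<le> 2 * (SUP m. inverse (inverse (poincare_const (cond_measure V m :: (real ^ 2) measure))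
                              - ennreal \<alpha>))"
proof -
 define \<Sigma> where "\<Sigma> = (SUP m. inverse (inverse (poincare_const (cond_measure V m :: (real ^ 2) measure)) - ennreal \<alpha>))"
 have bound: "(SUP m. poincare_const (cond_measure V m :: (real ^ 'n) measure)) \<le> ennreal (2 * s)"
  if s: "0 < s" "\<Sigma> < ennreal s" for s
 proof -
  have "pair_gap V \<alpha> (1 / s)"
  proof
   fix m
   have "inverse (inverse (poincare_const (cond_measure V m :: (real ^ 2) measure)) - ennreal \<alpha>) \<le> \<Sigma>"
    unfolding \<Sigma>_def by (rule SUP_upper) simp
   then have "inverse (inverse (poincare_const (cond_measure V m :: (real ^ 2) measure)) - ennreal \<alpha>) < ennreal s"
    using s(2) by (rule le_less_trans)
   then show "poincare_const (cond_measure V m :: (real ^ 2) measure) < ennreal (1 / (\<alpha> + 1 / s))"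
    by (rule ennreal_less_inverse_gap[OF s(1) \<alpha>])
  qed (use C2 \<alpha> V'' s in auto)
  then have "poincare_const (cond_measure V m :: (real ^ 'n) measure) \<le> ennreal (2 * s)" for m
   using pair_gap.poincare_const_cond_measure[of V \<alpha> "1 / s" m] by simp
  then show ?thesis by (rule SUP_least)
 qed
 have "(SUP m. poincare_const (cond_measure V m :: (real ^ 'n) measure)) \<le> 2 * \<Sigma>"
 proof (rule ennreal_le_epsilon)
  fix e :: real assume e: "2 * \<Sigma> < \<top>" "0 < e"
  then obtain r where r: "\<Sigma> = ennreal r" "0 \<le> r" by (cases \<Sigma>) (auto simp: ennreal_mult_less_top)
  have "\<Sigma> < ennreal (r + e / 2)" using r e(2) by (simp add: ennreal_less_iff)
  then have "(SUP m. poincare_const (cond_measure V m :: (real ^ 'n) measure)) \<le> ennreal (2 * (r + e / 2))"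
   using r e(2) by (intro bound) auto
  also have "... = 2 * \<Sigma> + ennreal e"
   using r e(2) by (simp add: ennreal_mult[symmetric] ennreal_plus[symmetric] numeral_mult_ennreal distrib_left del: ennreal_plus)
  finally show "(SUP m. poincare_const (cond_measure V m :: (real ^ 'n) measure)) \<le> 2 * \<Sigma> + ennreal e" .
 qed
 then show ?thesis by (simp add: \<Sigma>_def)
qed

end
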